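(* Let $Q$ be a commutative Noetherian ring with finite Krull dimension, let $\mathbf{f} = f_1,\ldots,f_c$ be a regular sequence in $Q$, and set $A = Q/(\mathbf{f})$. Let $M$ be a finitely generated $A$-module with $\operatorname{projdim}_Q M$ finite. Let $I$ be an ideal in $A$, let $\mathcal{R}(I) = \bigoplus_{n\geq 0} I^n t^n$ be the Rees algebra of $I$, and let $N = \bigoplus_{n\geq 0} N_n$ be a finitely generated graded $\mathcal{R}(I)$-module. Then $$\mathcal{E}(N) = \bigoplus_{i\geq 0}\bigoplus_{n\geq 0} \operatorname{Ext}^i_A(M, N_n)$$ is a finitely generated bi-graded module over $\mathcal{S} = \mathcal{R}(I)[t_1,\ldots,t_c]$, where $\mathcal{S}$ acts on $\mathcal{E}(N)$ through the Eisenbud operators $t_1,\ldots,t_c$ and the $\mathcal{R}(I)$-action on $N$, as described in the context.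
   Context: Module structure on $\mathcal{E}(N)$. $\mathcal{S} = \mathcal{R}(I)[t_1,\ldots,t_c]$ is a polynomial ring in $c$ variables over $\mathcal{R}(I)$ (the $t_r$ are different from the variable $t$ of the Rees algebra). It is bi-graded so that, for $x\in I^s$, the element $xt^s \in \mathcal{R}(I)$ has degree $(0,s)$ and each $t_r$ has degree $(2,0)$; $\operatorname{Ext}^i_A(M,N_n)$ is the component of degree $(i,n)$ of $\mathcal{E}(N)$. Eisenbud operators: let $\mathbf{F}: \cdots \to F_n \to \cdots \to F_1 \to F_0 \to 0$ be a free resolution of $M$ over $A$ (by finitely generated free modules) with differential $\partial$. Lift it to a sequence of free $Q$-modules $\widetilde{F}_n$ and $Q$-linear maps $\widetilde{\partial}$ with $\widetilde{\partial}\otimes_Q A = \partial$. Since $\widetilde{\partial}^2 \equiv 0$ modulo $(\mathbf{f})$, write $\widetilde{\partial}^2 = \sum_{r=1}^c f_r \widetilde{t}_r$ with $\widetilde{t}_r : \widetilde{F}_{n+2}\to \widetilde{F}_n$, and put $t_r = \widetilde{t}_r\otimes_Q A$. These are chain maps $t_1,\ldots,t_c : \mathbf{F}(+2)\to\mathbf{F}$ that are uniquely determined up to homotopy and commute up to homotopy. Applying $\operatorname{Hom}_A(-,N_n)$ and taking homology, they induce commuting maps $t_r : \operatorname{Ext}^i_A(M,N_n)\to\operatorname{Ext}^{i+2}_A(M,N_n)$. For $u = xt^s\in\mathcal{R}(I)_s$, multiplication $u: N_n\to N_{n+s}$ induces $u : \operatorname{Ext}^i_A(M,N_n)\to \operatorname{Ext}^i_A(M,N_{n+s})$,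 and this commutes with the $t_r$. This makes $\mathcal{E}(N)$ a bi-graded $\mathcal{S}$-module. *)

theory Defs
  imports
    "HOL-Library.Extended_Nat"
    "HOL-Library.Product_Plus"
    "HOL-Algebra.Algebra"
begin

section \<open>Rings\<close>

definition krull_dim :: "('a, 'k) ring_scheme \<Rightarrow> enat" where
  "krull_dim R = Sup {enat n | n. \<exists>P :: nat \<Rightarrow> 'a set.
      (\<forall>i\<le>n. primeideal (P i) R) \<and> (\<forall>i<n. P i \<subset> P (Suc i))}"

text \<open>The middle condition says that \<open>fs ! i\<close> is a nonzerodivisor on the quotient of \<open>R\<close> by the
  ideal generated by the preceding elements.\<close>

definition regular_sequence :: "('a, 'k) ring_scheme \<Rightarrow> 'a list \<Rightarrow> bool" where
  "regular_sequence R fs \<longleftrightarrow>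
     set fs \<subseteq> carrier R \<and>
     (\<forall>i<length fs. \<forall>x\<in>carrier R.
        fs ! i \<otimes>\<^bsub>R\<^esub> x \<in> Idl\<^bsub>R\<^esub> (set (take i fs)) \<longrightarrow> x \<in> Idl\<^bsub>R\<^esub> (set (take i fs))) \<and>
     Idl\<^bsub>R\<^esub> (set fs) \<noteq> carrier R"

primrec ideal_power :: "('a, 'k) ring_scheme \<Rightarrow> 'a set \<Rightarrow> nat \<Rightarrow> 'a set" where
  "ideal_power R I 0 = carrier R"
| "ideal_power R I (Suc n) = ideal_prod R I (ideal_power R I n)"

text \<open>The Rees algebra as a subring of the polynomial ring \<open>R[t]\<close>.\<close>

definition rees :: "('a, 'k) ring_scheme \<Rightarrow> 'a set \<Rightarrow> ('a, nat \<Rightarrow> 'a) up_ring" where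
  "rees R I = (UP R)\<lparr>carrier := {p \<in> carrier (UP R). \<forall>n. coeff (UP R) p n \<in> ideal_power R I n}\<rparr>"

definition rees_part :: "('a, 'k) ring_scheme \<Rightarrow> 'a set \<Rightarrow> nat \<Rightarrow> (nat \<Rightarrow> 'a) set" where
  "rees_part R I n = (\<lambda>x. monom (UP R) x n) ` ideal_power R I n"

text \<open>Polynomials over \<open>R\<close> in variables indexed by \<open>V\<close>, as functions from monomials (multisets of
  variables) to coefficients, as in \<^theory>\<open>HOL-Algebra.Indexed_Polynomials\<close>.\<close>

definition mpoly_ring :: "('a, 'k) ring_scheme \<Rightarrow> 'v set \<Rightarrow> ('v multiset \<Rightarrow> 'a) ring" where
  "mpoly_ring R V = \<lparr>
     carrier = {p. (\<forall>\<alpha>. p \<alpha> \<in> carrier R) \<and> finite {\<alpha>. p \<alpha> \<noteq> \<zero>\<^bsub>R\<^esub>} \<and>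
                   (\<forall>\<alpha>. p \<alpha> \<noteq> \<zero>\<^bsub>R\<^esub> \<longrightarrow> set_mset \<alpha> \<subseteq> V)},
     monoid.mult = (\<lambda>p q \<alpha>. \<Oplus>\<^bsub>R\<^esub>\<beta>\<in>{\<beta>. \<beta> \<subseteq># \<alpha>}. p \<beta> \<otimes>\<^bsub>R\<^esub> q (\<alpha> - \<beta>)),
     one = (\<lambda>\<alpha>. if \<alpha> = {#} then \<one>\<^bsub>R\<^esub> else \<zero>\<^bsub>R\<^esub>),
     ring.zero = (\<lambda>\<alpha>. \<zero>\<^bsub>R\<^esub>),
     add = (\<lambda>p q \<alpha>. p \<alpha> \<oplus>\<^bsub>R\<^esub> q \<alpha>)\<rparr>"

text \<open>The ring \<open>\<S>\<close>; the variables \<open>t\<^sub>1, \<dots>, t\<^sub>c\<close> are numbered from \<open>0\<close>.\<close>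

definition rees_poly ::
    "('a, 'k) ring_scheme \<Rightarrow> 'a set \<Rightarrow> nat \<Rightarrow> (nat multiset \<Rightarrow> nat \<Rightarrow> 'a) ring" where
  "rees_poly R I c = mpoly_ring (rees R I) {..<c}"

definition rees_poly_part ::
    "('a, 'k) ring_scheme \<Rightarrow> 'a set \<Rightarrow> nat \<Rightarrow> nat \<times> nat \<Rightarrow> (nat multiset \<Rightarrow> nat \<Rightarrow> 'a) set" where
  "rees_poly_part R I c = (\<lambda>(i, n). {p \<in> carrier (rees_poly R I c).
     \<forall>\<alpha>. p \<alpha> \<noteq> \<zero>\<^bsub>rees R I\<^esub> \<longrightarrow> 2 * size \<alpha> = i \<and> p \<alpha> \<in> rees_part R I n})"


section \<open>Modules\<close>

text \<open>The record type of modules carries ring fields \<open>mult\<close> and \<open>one\<close> that the locale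
  \<^locale>\<open>module\<close> ignores; they are left undefined in the modules constructed below.\<close>

definition linear_map ::
    "('a, 'k) ring_scheme \<Rightarrow> ('a, 'b, 'm) module_scheme \<Rightarrow> ('a, 'c, 'n) module_scheme \<Rightarrow> ('b \<Rightarrow> 'c) \<Rightarrow> bool"
  where
  "linear_map R M N h \<longleftrightarrow>
     h \<in> carrier M \<rightarrow> carrier N \<and>
     (\<forall>x\<in>carrier M. \<forall>y\<in>carrier M. h (x \<oplus>\<^bsub>M\<^esub> y) = h x \<oplus>\<^bsub>N\<^esub> h y) \<and>
     (\<forall>a\<in>carrier R. \<forall>x\<in>carrier M. h (a \<odot>\<^bsub>M\<^esub> x) = a \<odot>\<^bsub>N\<^esub> h x)"

definition fin_gen_module :: "('a, 'k) ring_scheme \<Rightarrow> ('a, 'b, 'm) module_scheme \<Rightarrow> bool" where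
  "fin_gen_module R M \<longleftrightarrow> (\<exists>B. finite B \<and> B \<subseteq> carrier M \<and>
     (\<forall>x\<in>carrier M. \<exists>a\<in>B \<rightarrow> carrier R. x = (\<Oplus>\<^bsub>M\<^esub>b\<in>B. a b \<odot>\<^bsub>M\<^esub> b)))"

definition fin_free_module :: "('a, 'k) ring_scheme \<Rightarrow> ('a, 'b, 'm) module_scheme \<Rightarrow> bool" where
  "fin_free_module R F \<longleftrightarrow> module R F \<and> (\<exists>B. finite B \<and> B \<subseteq> carrier F \<and>
     (\<forall>x\<in>carrier F. \<exists>!a. a \<in> B \<rightarrow>\<^sub>E carrier R \<and> x = (\<Oplus>\<^bsub>F\<^esub>b\<in>B. a b \<odot>\<^bsub>F\<^esub> b)))"

definition restrict_scalars :: "('r \<Rightarrow> 'a) \<Rightarrow> ('a, 'b, 'm) module_scheme \<Rightarrow> ('r, 'b) module" where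
  "restrict_scalars \<phi> M = \<lparr>carrier = carrier M, monoid.mult = monoid.mult M, one = \<one>\<^bsub>M\<^esub>,
     ring.zero = \<zero>\<^bsub>M\<^esub>, add = add M, smult = (\<lambda>r. smult M (\<phi> r))\<rparr>"

definition quot_module :: "('a, 'b, 'm) module_scheme \<Rightarrow> 'b set \<Rightarrow> ('a, 'b set) module" where
  "quot_module M H = \<lparr>carrier = a_rcosets\<^bsub>M\<^esub> H, monoid.mult = undefined, one = undefined,
     ring.zero = H, add = set_add M, smult = (\<lambda>a C. \<Union>x\<in>C. H +>\<^bsub>M\<^esub> (a \<odot>\<^bsub>M\<^esub> x))\<rparr>"

text \<open>Homomorphisms are normalised to be \<^const>\<open>undefined\<close> outside the carrier of the source.\<close>

definition hom_module ::
    "('a, 'k) ring_scheme \<Rightarrow> ('a, 'b, 'm) module_scheme \<Rightarrow> ('a, 'c, 'n) module_scheme \<Rightarrow> ('a, 'b \<Rightarrow> 'c) module"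
  where
  "hom_module R M N = \<lparr>carrier = {h \<in> extensional (carrier M). linear_map R M N h},
     monoid.mult = undefined, one = undefined,
     ring.zero = (\<lambda>x\<in>carrier M. \<zero>\<^bsub>N\<^esub>),
     add = (\<lambda>g h. \<lambda>x\<in>carrier M. g x \<oplus>\<^bsub>N\<^esub> h x),
     smult = (\<lambda>a h. \<lambda>x\<in>carrier M. a \<odot>\<^bsub>N\<^esub> h x)\<rparr>"


subsection \<open>Graded rings and modules\<close>

definition direct_decomp :: "('b, 'm) ring_scheme \<Rightarrow> ('i \<Rightarrow> 'b set) \<Rightarrow> bool" where
  "direct_decomp M Mg \<longleftrightarrow>
     (\<forall>g. additive_subgroup (Mg g) M) \<and>
     (\<forall>x\<in>carrier M. \<exists>!c. (\<forall>g. c g \<in> Mg g) \<and> finite {g. c g \<noteq> \<zero>\<^bsub>M\<^esub>} \<and>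
        x = (\<Oplus>\<^bsub>M\<^esub>g\<in>{g. c g \<noteq> \<zero>\<^bsub>M\<^esub>}. c g))"

definition graded_ring :: "('a, 'k) ring_scheme \<Rightarrow> ('i::comm_monoid_add \<Rightarrow> 'a set) \<Rightarrow> bool" where
  "graded_ring R Rg \<longleftrightarrow> cring R \<and> direct_decomp R Rg \<and> \<one>\<^bsub>R\<^esub> \<in> Rg 0 \<and>
     (\<forall>g h. \<forall>a\<in>Rg g. \<forall>b\<in>Rg h. a \<otimes>\<^bsub>R\<^esub> b \<in> Rg (g + h))"

definition graded_module ::
    "('a, 'k) ring_scheme \<Rightarrow> ('i::comm_monoid_add \<Rightarrow> 'a set) \<Rightarrow>
     ('a, 'b, 'm) module_scheme \<Rightarrow> ('i \<Rightarrow> 'b set) \<Rightarrow> bool" where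
  "graded_module R Rg M Mg \<longleftrightarrow> graded_ring R Rg \<and> module R M \<and> direct_decomp M Mg \<and>
     (\<forall>g h. \<forall>a\<in>Rg g. \<forall>x\<in>Mg h. a \<odot>\<^bsub>M\<^esub> x \<in> Mg (g + h))"

text \<open>A homogeneous component of a graded module over the Rees algebra of \<open>I \<subseteq> A\<close>, as a module over
  \<open>A\<close> via the embedding of \<open>A\<close> as the degree \<open>0\<close> part.\<close>

definition graded_comp ::
    "('a, 'k) ring_scheme \<Rightarrow> (nat \<Rightarrow> 'a, 'n) module \<Rightarrow> (nat \<Rightarrow> 'n set) \<Rightarrow> nat \<Rightarrow> ('a, 'n) module" where
  "graded_comp A N Ng n = (restrict_scalars (\<lambda>a. monom (UP A) a 0) N)\<lparr>carrier := Ng n\<rparr>"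


section \<open>Resolutions\<close>

text \<open>\<open>\<cdots> \<rightarrow> P 1 \<rightarrow> P 0 \<rightarrow> M \<rightarrow> 0\<close> is exact, where \<open>d n : P (n + 1) \<rightarrow> P n\<close> and \<open>\<epsilon> : P 0 \<rightarrow> M\<close>.\<close>

definition resolution ::
    "('a, 'k) ring_scheme \<Rightarrow> ('a, 'm) module \<Rightarrow> (nat \<Rightarrow> ('a, 'p) module) \<Rightarrow>
     (nat \<Rightarrow> 'p \<Rightarrow> 'p) \<Rightarrow> ('p \<Rightarrow> 'm) \<Rightarrow> bool" where
  "resolution R M P d \<epsilon> \<longleftrightarrow>
     module R M \<and> (\<forall>n. module R (P n)) \<and>
     (\<forall>n. linear_map R (P (Suc n)) (P n) (d n)) \<and> linear_map R (P 0) M \<epsilon> \<and>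
     \<epsilon> ` carrier (P 0) = carrier M \<and>
     d 0 ` carrier (P 1) = {x \<in> carrier (P 0). \<epsilon> x = \<zero>\<^bsub>M\<^esub>} \<and>
     (\<forall>n. d (Suc n) ` carrier (P (Suc (Suc n))) = {x \<in> carrier (P (Suc n)). d n x = \<zero>\<^bsub>P n\<^esub>})"

text \<open>The lifting property is required against surjections \<open>U \<rightarrow> V\<close> with \<open>U\<close> and \<open>V\<close> carried by
  the types \<open>'p \<Rightarrow> 'a\<close> and \<open>'p\<close>. This is no restriction: the free module on the set \<^term>\<open>carrier P\<close>
  is carried by \<open>'p \<Rightarrow> 'a\<close>, and lifting the identity of \<open>P\<close> along its canonical surjection onto \<open>P\<close>
  makes \<open>P\<close> a direct summand of it, which gives the lifting property in general.\<close>

definition projective_module :: "('a, 'k) ring_scheme \<Rightarrow> ('a, 'p) module \<Rightarrow> bool" where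
  "projective_module R P \<longleftrightarrow> module R P \<and>
     (\<forall>(U :: ('a, 'p \<Rightarrow> 'a) module) (V :: ('a, 'p) module) g h.
        module R U \<and> module R V \<and> linear_map R U V g \<and> g ` carrier U = carrier V \<and>
        linear_map R P V h \<longrightarrow>
        (\<exists>k. linear_map R P U k \<and> (\<forall>x\<in>carrier P. g (k x) = h x)))"

text \<open>HOL cannot quantify over types inside a definition, so the modules in the projective
  resolutions are carried by a type \<open>'p\<close> given as an extra argument. A hypothesis
  \<open>proj_dim TYPE('p) R M < \<infinity>\<close> with a type variable \<open>'p\<close> not occurring elsewhere in a theorem is the
  assumption that some finite projective resolution exists, over whatever type.\<close>

definition proj_dim :: "'p itself \<Rightarrow> ('a, 'k) ring_scheme \<Rightarrow> ('a, 'm) module \<Rightarrow> enat" where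
  "proj_dim _ R M = Inf {enat n | n. \<exists>(P :: nat \<Rightarrow> ('a, 'p) module) d \<epsilon>.
      resolution R M P d \<epsilon> \<and> (\<forall>i. projective_module R (P i)) \<and>
      (\<forall>i>n. carrier (P i) = {\<zero>\<^bsub>P i\<^esub>})}"

definition free_resolution ::
    "('a, 'k) ring_scheme \<Rightarrow> ('a, 'm) module \<Rightarrow> (nat \<Rightarrow> ('a, 'f) module) \<Rightarrow>
     (nat \<Rightarrow> 'f \<Rightarrow> 'f) \<Rightarrow> ('f \<Rightarrow> 'm) \<Rightarrow> bool" where
  "free_resolution R M F d \<epsilon> \<longleftrightarrow> resolution R M F d \<epsilon> \<and> (\<forall>n. fin_free_module R (F n))"


section \<open>Eisenbud operators\<close>

definition quot_map :: "('q, 'k) ring_scheme \<Rightarrow> 'q list \<Rightarrow> 'q \<Rightarrow> 'q set" where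
  "quot_map Q fs q = Idl\<^bsub>Q\<^esub> (set fs) +>\<^bsub>Q\<^esub> q"

text \<open>For \<open>A = Q/(fs)\<close>, a module \<open>F\<close> over \<open>A\<close> and a module \<open>L\<close> over \<open>Q\<close>: the map \<open>\<pi>\<close> identifies
  \<open>L \<otimes>\<^sub>Q A = L/(fs)L\<close> with \<open>F\<close>.\<close>

definition reduction ::
    "('q, 'k) ring_scheme \<Rightarrow> 'q list \<Rightarrow> ('q, 'l) module \<Rightarrow> ('q set, 'f) module \<Rightarrow> ('l \<Rightarrow> 'f) \<Rightarrow> bool" where
  "reduction Q fs L F \<pi> \<longleftrightarrow>
     linear_map Q L (restrict_scalars (quot_map Q fs) F) \<pi> \<and>
     \<pi> ` carrier L = carrier F \<and>
     {x \<in> carrier L. \<pi> x = \<zero>\<^bsub>F\<^esub>} =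
       {(\<Oplus>\<^bsub>L\<^esub>r\<in>{..<length fs}. (fs ! r) \<odot>\<^bsub>L\<^esub> g r) | g. g \<in> {..<length fs} \<rightarrow> carrier L}"

text \<open>\<open>t\<close> is a family of Eisenbud operators on the complex \<open>(F, d)\<close> over \<open>A = Q/(fs)\<close>, computed from
  a lift of \<open>(F, d)\<close> to free \<open>Q\<close>-modules \<open>L n\<close> with maps \<open>D n : L (n + 1) \<rightarrow> L n\<close>, and maps
  \<open>T r n : L (n + 2) \<rightarrow> L n\<close> with \<open>D\<^sup>2 = \<Sum>\<^sub>r f\<^sub>r T\<^sub>r\<close>. The last conjunct says \<open>t\<^sub>r = T\<^sub>r \<otimes>\<^sub>Q A\<close>.\<close>

definition eisenbud_operators ::
    "('q, 'k) ring_scheme \<Rightarrow> 'q list \<Rightarrow> (nat \<Rightarrow> ('q set, 'f) module) \<Rightarrow> (nat \<Rightarrow> 'f \<Rightarrow> 'f) \<Rightarrow>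
     (nat \<Rightarrow> ('q, 'l) module) \<Rightarrow> (nat \<Rightarrow> 'l \<Rightarrow> 'f) \<Rightarrow> (nat \<Rightarrow> 'l \<Rightarrow> 'l) \<Rightarrow>
     (nat \<Rightarrow> nat \<Rightarrow> 'l \<Rightarrow> 'l) \<Rightarrow> (nat \<Rightarrow> nat \<Rightarrow> 'f \<Rightarrow> 'f) \<Rightarrow> bool" where
  "eisenbud_operators Q fs F d L \<pi> D T t \<longleftrightarrow>
     (\<forall>n. fin_free_module Q (L n) \<and> reduction Q fs (L n) (F n) (\<pi> n)) \<and>
     (\<forall>n. linear_map Q (L (Suc n)) (L n) (D n) \<and>
          (\<forall>x\<in>carrier (L (Suc n)). \<pi> n (D n x) = d n (\<pi> (Suc n) x))) \<and>
     (\<forall>r<length fs. \<forall>n. linear_map Q (L (n + 2)) (L n) (T r n)) \<and>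
     (\<forall>n. \<forall>x\<in>carrier (L (n + 2)).
          D n (D (Suc n) x) = (\<Oplus>\<^bsub>L n\<^esub>r\<in>{..<length fs}. (fs ! r) \<odot>\<^bsub>L n\<^esub> T r n x)) \<and>
     (\<forall>r<length fs. \<forall>n. \<forall>x\<in>carrier (L (n + 2)). t r n (\<pi> (n + 2) x) = \<pi> n (T r n x))"


section \<open>Ext\<close>

definition cocycles ::
    "('a, 'k) ring_scheme \<Rightarrow> (nat \<Rightarrow> ('a, 'f) module) \<Rightarrow> (nat \<Rightarrow> 'f \<Rightarrow> 'f) \<Rightarrow>
     ('a, 'n) module \<Rightarrow> nat \<Rightarrow> ('f \<Rightarrow> 'n) set" where
  "cocycles R F d N i =
     {h \<in> carrier (hom_module R (F i) N). \<forall>x\<in>carrier (F (Suc i)). h (d i x) = \<zero>\<^bsub>N\<^esub>}"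

primrec coboundaries ::
    "('a, 'k) ring_scheme \<Rightarrow> (nat \<Rightarrow> ('a, 'f) module) \<Rightarrow> (nat \<Rightarrow> 'f \<Rightarrow> 'f) \<Rightarrow>
     ('a, 'n) module \<Rightarrow> nat \<Rightarrow> ('f \<Rightarrow> 'n) set" where
  "coboundaries R F d N 0 = {\<zero>\<^bsub>hom_module R (F 0) N\<^esub>}"
| "coboundaries R F d N (Suc i) =
     (\<lambda>h. \<lambda>x\<in>carrier (F (Suc i)). h (d i x)) ` carrier (hom_module R (F i) N)"

text \<open>\<open>Ext\<^sup>i(M, N)\<close> computed from the free resolution \<open>(F, d)\<close> of \<open>M\<close>.\<close>

definition Ext_module ::
    "('a, 'k) ring_scheme \<Rightarrow> (nat \<Rightarrow> ('a, 'f) module) \<Rightarrow> (nat \<Rightarrow> 'f \<Rightarrow> 'f) \<Rightarrow>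
     ('a, 'n) module \<Rightarrow> nat \<Rightarrow> ('a, ('f \<Rightarrow> 'n) set) module" where
  "Ext_module R F d N i =
     quot_module ((hom_module R (F i) N)\<lparr>carrier := cocycles R F d N i\<rparr>) (coboundaries R F d N i)"

text \<open>The map from \<open>Ext\<^sup>i\<close> to \<open>Ext\<^sup>j(M, N)\<close> induced by a map \<open>\<phi>\<close> on cochains; \<open>C\<close> is a cohomology
  class in \<open>Ext\<^sup>i\<close>.\<close>

definition Ext_induced ::
    "('a, 'k) ring_scheme \<Rightarrow> (nat \<Rightarrow> ('a, 'f) module) \<Rightarrow> (nat \<Rightarrow> 'f \<Rightarrow> 'f) \<Rightarrow>
     ('a, 'n) module \<Rightarrow> nat \<Rightarrow> (('f \<Rightarrow> 'n) \<Rightarrow> ('f \<Rightarrow> 'n)) \<Rightarrow> ('f \<Rightarrow> 'n) set \<Rightarrow> ('f \<Rightarrow> 'n) set" where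
  "Ext_induced R F d N j \<phi> C =
     (\<Union>h\<in>C. coboundaries R F d N j +>\<^bsub>hom_module R (F j) N\<^esub> \<phi> h)"


subsection \<open>The bigraded module\<close>

text \<open>\<open>\<E>(N) = \<Oplus>\<^sub>i \<Oplus>\<^sub>n Ext\<^sup>i(M, N\<^sub>n)\<close> as an abelian group.\<close>

definition total_Ext_group ::
    "('a, 'k) ring_scheme \<Rightarrow> (nat \<Rightarrow> ('a, 'f) module) \<Rightarrow> (nat \<Rightarrow> 'f \<Rightarrow> 'f) \<Rightarrow>
     (nat \<Rightarrow> 'a, 'n) module \<Rightarrow> (nat \<Rightarrow> 'n set) \<Rightarrow> (nat \<times> nat \<Rightarrow> ('f \<Rightarrow> 'n) set) ring" where
  "total_Ext_group A F d N Ng = (let E = (\<lambda>(i, n). Ext_module A F d (graded_comp A N Ng n) i) in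
     \<lparr>carrier = {e. (\<forall>p. e p \<in> carrier (E p)) \<and> finite {p. e p \<noteq> \<zero>\<^bsub>E p\<^esub>}},
      monoid.mult = undefined, one = undefined,
      ring.zero = (\<lambda>p. \<zero>\<^bsub>E p\<^esub>),
      add = (\<lambda>e e' p. e p \<oplus>\<^bsub>E p\<^esub> e' p)\<rparr>)"

text \<open>The action of \<open>t\<^sub>r\<close>, given by \<open>Ext\<^sup>i(M, N\<^sub>n) \<rightarrow> Ext\<^sup>i\<^sup>+\<^sup>2(M, N\<^sub>n)\<close>.\<close>

definition eisenbud_act ::
    "('a, 'k) ring_scheme \<Rightarrow> (nat \<Rightarrow> ('a, 'f) module) \<Rightarrow> (nat \<Rightarrow> 'f \<Rightarrow> 'f) \<Rightarrow> (nat \<Rightarrow> nat \<Rightarrow> 'f \<Rightarrow> 'f) \<Rightarrow>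
     (nat \<Rightarrow> 'a, 'n) module \<Rightarrow> (nat \<Rightarrow> 'n set) \<Rightarrow>
     nat \<Rightarrow> (nat \<times> nat \<Rightarrow> ('f \<Rightarrow> 'n) set) \<Rightarrow> (nat \<times> nat \<Rightarrow> ('f \<Rightarrow> 'n) set)" where
  "eisenbud_act A F d t N Ng r e = (\<lambda>(i, n).
     if 2 \<le> i
     then Ext_induced A F d (graded_comp A N Ng n) i
            (\<lambda>h. \<lambda>x\<in>carrier (F i). h (t r (i - 2) x)) (e (i - 2, n))
     else \<zero>\<^bsub>Ext_module A F d (graded_comp A N Ng n) i\<^esub>)"

text \<open>The action of \<open>x t\<^sup>s\<close> for \<open>x \<in> I\<^sup>s\<close>, given by \<open>Ext\<^sup>i(M, N\<^sub>n) \<rightarrow> Ext\<^sup>i(M, N\<^sub>n\<^sub>+\<^sub>s)\<close>.\<close>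

definition rees_monom_act ::
    "('a, 'k) ring_scheme \<Rightarrow> (nat \<Rightarrow> ('a, 'f) module) \<Rightarrow> (nat \<Rightarrow> 'f \<Rightarrow> 'f) \<Rightarrow>
     (nat \<Rightarrow> 'a, 'n) module \<Rightarrow> (nat \<Rightarrow> 'n set) \<Rightarrow>
     'a \<Rightarrow> nat \<Rightarrow> (nat \<times> nat \<Rightarrow> ('f \<Rightarrow> 'n) set) \<Rightarrow> (nat \<times> nat \<Rightarrow> ('f \<Rightarrow> 'n) set)" where
  "rees_monom_act A F d N Ng x s e = (\<lambda>(i, n).
     if s \<le> n
     then Ext_induced A F d (graded_comp A N Ng n) i
            (\<lambda>h. \<lambda>y\<in>carrier (F i). monom (UP A) x s \<odot>\<^bsub>N\<^esub> h y) (e (i, n - s))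
     else \<zero>\<^bsub>Ext_module A F d (graded_comp A N Ng n) i\<^esub>)"

text \<open>\<open>\<E>(N)\<close> with its scalar multiplication by elements of \<open>\<S>\<close>: the coefficient \<open>p \<alpha>\<close> of the monomial
  \<open>\<alpha>\<close> is a polynomial in \<open>A[t]\<close>, and \<open>p \<alpha> s\<close> is its coefficient at \<open>t\<^sup>s\<close>.\<close>

definition total_Ext ::
    "('a, 'k) ring_scheme \<Rightarrow> (nat \<Rightarrow> ('a, 'f) module) \<Rightarrow> (nat \<Rightarrow> 'f \<Rightarrow> 'f) \<Rightarrow> (nat \<Rightarrow> nat \<Rightarrow> 'f \<Rightarrow> 'f) \<Rightarrow>
     (nat \<Rightarrow> 'a, 'n) module \<Rightarrow> (nat \<Rightarrow> 'n set) \<Rightarrow>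
     (nat multiset \<Rightarrow> nat \<Rightarrow> 'a, nat \<times> nat \<Rightarrow> ('f \<Rightarrow> 'n) set) module" where
  "total_Ext A F d t N Ng = (let E = total_Ext_group A F d N Ng in
     \<lparr>carrier = carrier E, monoid.mult = monoid.mult E, one = \<one>\<^bsub>E\<^esub>, ring.zero = \<zero>\<^bsub>E\<^esub>, add = add E,
      smult = (\<lambda>p e.
        \<Oplus>\<^bsub>E\<^esub>\<alpha>\<in>{\<alpha>. p \<alpha> \<noteq> \<zero>\<^bsub>UP A\<^esub>}. \<Oplus>\<^bsub>E\<^esub>s\<in>{s. coeff (UP A) (p \<alpha>) s \<noteq> \<zero>\<^bsub>A\<^esub>}.
          rees_monom_act A F d N Ng (coeff (UP A) (p \<alpha>) s) s
            (foldr (eisenbud_act A F d t N Ng) (sorted_list_of_multiset \<alpha>) e))\<rparr>)"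

definition total_Ext_part ::
    "('a, 'k) ring_scheme \<Rightarrow> (nat \<Rightarrow> ('a, 'f) module) \<Rightarrow> (nat \<Rightarrow> 'f \<Rightarrow> 'f) \<Rightarrow>
     (nat \<Rightarrow> 'a, 'n) module \<Rightarrow> (nat \<Rightarrow> 'n set) \<Rightarrow>
     nat \<times> nat \<Rightarrow> (nat \<times> nat \<Rightarrow> ('f \<Rightarrow> 'n) set) set" where
  "total_Ext_part A F d N Ng p =
     {e \<in> carrier (total_Ext_group A F d N Ng).
        \<forall>p'. p' \<noteq> p \<longrightarrow> e p' = \<zero>\<^bsub>total_Ext_group A F d N Ng\<^esub> p'}"

end

theory Submission
	imports Defs
begin

text \<open>The proof works over \<open>Q\<close> with the lifted resolution. There \<open>D \<circ> D = f\<^sub>1 T\<^sub>1 + \<dots> + f\<^sub>c T\<^sub>c\<close>, and since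
the \<open>f\<^sub>r\<close> annihilate every \<open>N\<^sub>n\<close>, the cochains \<open>Hom(L\<^sub>i, N\<^sub>n)\<close> over \<open>Q\<close> form a complex that is isomorphic to
\<open>Hom(F\<^sub>i, N\<^sub>n)\<close> over \<open>A\<close>, on which \<open>T\<^sub>r\<close> acts as \<open>t\<^sub>r\<close>. The claim is that its cohomology is finitely
generated under the operators \<open>T\<^sub>1, \<dots>, T\<^sub>c\<close> and multiplication by finitely many generators of \<open>I\<close>.

The induction is on the number \<open>k\<close> of operators, for systems in which \<open>D \<circ> D = f\<^sub>1 T\<^sub>1 + \<dots> + f\<^sub>k T\<^sub>k\<close> and which
resolve \<open>M\<close> modulo \<open>f\<^sub>1, \<dots>, f\<^sub>k\<close> (\<open>ci_system\<close>). For \<open>k = 0\<close> the system is a resolution of \<open>M\<close> over \<open>Q\<close>.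
Comparison with a finite projective resolution shows that the cohomology vanishes in high degrees
(\<open>bounded_cohomology\<close>); in each remaining degree it is a subquotient of \<open>Hom(L\<^sub>i, N)\<close>, hence of a finite
direct sum of copies of \<open>N\<close>, which is noetherian (\<open>fin_gen_bounded\<close>).

For the step, the sum \<open>C\<^sub>n = L\<^sub>n + L\<^sub>n\<^sub>-\<^sub>1\<close> with differential \<open>(x, y) \<mapsto> (D x + f y, - T x - D y)\<close>, where \<open>f\<close>
and \<open>T\<close> belong to the last operator, resolves the same \<open>M\<close> modulo one element fewer (\<open>cone_system\<close>).
This uses regularity: the commutator of \<open>D\<close> and \<open>T\<close> lies in the span of the earlier elements, and its coefficients
correct the remaining operators. By induction the cohomology of \<open>C\<close> is finitely generated under \<open>k\<close>
operators. These commute on cohomology, so the operator form of the Hilbert basis theorem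
(\<open>fin_gen_imp_noetherian\<close>) makes it noetherian. Projecting \<open>C\<close> to \<open>L\<close> pulls cohomology of \<open>L\<close> back to
cohomology of \<open>C\<close>, and the kernel is the image of \<open>T\<close> (\<open>incl_coboundary\<close>). Hence the cokernel of \<open>T\<close> on the
cohomology of \<open>L\<close> embeds in a noetherian module and is finitely generated. Because \<open>T\<close> raises the degree and
nothing lives in negative degrees, generators of the cokernel generate everything once \<open>T\<close> is allowed
(\<open>graded_nakayama\<close>).

It remains to turn operators into a module structure. The operators on the total Ext group commute, so monomials in the
\<open>t\<^sub>r\<close> with coefficients in the Rees algebra act on it (\<open>rees_action\<close>), the bigrading is visible on monomials,
and generators for the operators are generators for the polynomial ring (\<open>TE_fin_gen\<close>).\<close>

text \<open>Nearly every operation below carries a structure as its index; a one-symbol subscript keeps the formulas readable.\<close>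

syntax "_index" :: "logic => index"  ("\<^sub>_" [1000] 1000)

abbreviation lincomb where
  "lincomb P K a b == (\<Oplus>\<^bsub>P\<^esub>j\<in>K. a j \<odot>\<^bsub>P\<^esub> b j)"

section \<open>Linear maps and Hom modules\<close>

lemma linear_closed: "linear_map R M N h ==> x : carrier M ==> h x : carrier N"
	by (auto simp: linear_map_def)

lemma linear_add:
	"linear_map R M N h ==> x : carrier M ==> y : carrier M ==> h (x \<oplus>\<^sub>M y) = h x \<oplus>\<^sub>N h y"
	by (auto simp: linear_map_def)

lemma linear_smult:
	"linear_map R M N h ==> a : carrier R ==> x : carrier M ==> h (a \<odot>\<^sub>M x) = a \<odot>\<^sub>N h x"
	by (auto simp: linear_map_def)

lemma linear_mapI:
	assumes "!!x. x : carrier M ==> h x : carrier N"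
		and "!!x y. x : carrier M ==> y : carrier M ==> h (x \<oplus>\<^sub>M y) = h x \<oplus>\<^sub>N h y"
		and "!!a x. a : carrier R ==> x : carrier M ==> h (a \<odot>\<^sub>M x) = a \<odot>\<^sub>N h x"
	shows "linear_map R M N h"
	using assms by (auto simp: linear_map_def)

lemma linear_zero:
	assumes "module R M" "module R N" "linear_map R M N h"
	shows "h \<zero>\<^sub>M = \<zero>\<^sub>N"
proof -
	interpret M: module R M by fact
	interpret N: module R N by fact
	have "h \<zero>\<^sub>M = h (\<zero>\<^sub>R \<odot>\<^sub>M \<zero>\<^sub>M)" by simp
	also have "... = \<zero>\<^sub>N"
		using assms(3) by (simp add: linear_smult linear_closed del: M.smult_l_null M.smult_r_null)
	finally show ?thesis .
qed

lemma linear_minus: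
	assumes "module R M" "module R N" "linear_map R M N h" "x : carrier M"
	shows "h (\<ominus>\<^sub>M x) = \<ominus>\<^sub>N h x"
proof -
	interpret M: module R M by fact
	interpret N: module R N by fact
	have "h (\<ominus>\<^sub>M x) = h ((\<ominus>\<^sub>R \<one>\<^sub>R) \<odot>\<^sub>M x)"
		using assms(4) by (simp add: M.smult_l_minus)
	also have "... = (\<ominus>\<^sub>R \<one>\<^sub>R) \<odot>\<^sub>N h x"
		using assms(3,4) by (simp add: linear_smult)
	also have "... = \<ominus>\<^sub>N h x"
		using assms(3,4) by (simp add: N.smult_l_minus linear_closed)
	finally show ?thesis .
qed

lemma linear_diff:
	assumes "module R M" "module R N" "linear_map R M N h" "x : carrier M" "y : carrier M"
	shows "h (x \<ominus>\<^sub>M y) = h x \<ominus>\<^sub>N h y"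
proof -
	interpret M: module R M by fact
	show ?thesis unfolding a_minus_def
		using assms by (simp add: linear_add linear_minus)
qed

lemma linear_finsum:
	assumes "module R M" "module R N" "linear_map R M N h" "finite A" "g : A \<rightarrow> carrier M"
	shows "h (\<Oplus>\<^sub>M i\<in>A. g i) = (\<Oplus>\<^sub>N i\<in>A. h (g i))"
proof -
	interpret M: module R M by fact
	interpret N: module R N by fact
	show ?thesis using assms(4,5)
	proof (induct A rule: finite_induct)
		case empty
		thus ?case using assms by (simp add: linear_zero)
	next
		case (insert a A)
		hence "h (g a \<oplus>\<^sub>M (\<Oplus>\<^sub>M i\<in>A. g i)) = h (g a) \<oplus>\<^sub>N h (\<Oplus>\<^sub>M i\<in>A. g i)"
			using assms(3) by (intro linear_add) auto
		thus ?case using insert assms(3)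
			by (simp add: M.finsum_insert N.finsum_insert Pi_def linear_closed)
	qed
qed

lemma linear_comp:
	"linear_map R M N g ==> linear_map R N P h ==> linear_map R M P (%x. h (g x))"
	by (auto simp: linear_map_def Pi_iff)

lemma linear_cong:
	assumes "linear_map R M N g" "module R M" "!!x. x : carrier M ==> h x = g x"
	shows "linear_map R M N h"
proof -
	interpret M: module R M by fact
	show ?thesis using assms(1,3) by (auto simp: linear_map_def Pi_iff)
qed

lemma linear_restrict:
	"module R M ==> linear_map R M N g ==> linear_map R M N (\<lambda>x\<in>carrier M. g x)"
	by (rule linear_cong) auto

lemma linear_plus:
	assumes "module R N" "linear_map R M N g" "linear_map R M N h"
	shows "linear_map R M N (%x. g x \<oplus>\<^sub>N h x)"
proof -
	interpret N: module R N by fact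
	show ?thesis
		by (rule linear_mapI)
			(use assms in "auto simp: linear_closed linear_add linear_smult N.a_ac N.smult_r_distr")
qed

lemma linear_uminus:
	assumes "module R N" "linear_map R M N g"
	shows "linear_map R M N (%x. \<ominus>\<^sub>N g x)"
proof -
	interpret N: module R N by fact
	show ?thesis
		by (rule linear_mapI)
			(use assms in "auto simp: linear_closed linear_add linear_smult N.minus_add N.smult_r_minus")
qed

lemma linear_minus_map:
	assumes "module R N" "linear_map R M N g" "linear_map R M N h"
	shows "linear_map R M N (%x. g x \<ominus>\<^sub>N h x)"
	unfolding a_minus_def by (intro linear_plus linear_uminus assms)

lemma linear_scale:
	assumes "module R N" "linear_map R M N g" "a : carrier R"
	shows "linear_map R M N (%x. a \<odot>\<^sub>N g x)"
proof -
	interpret N: module R N by fact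
	show ?thesis
		by (rule linear_mapI)
			(use assms in "auto simp: linear_closed linear_add linear_smult N.smult_r_distr
			N.smult_assoc1[symmetric] N.R.m_comm")
qed

lemma linear_const_zero:
	assumes "module R N"
	shows "linear_map R M N (%x. \<zero>\<^sub>N)"
proof -
	interpret N: module R N by fact
	show ?thesis by (rule linear_mapI) auto
qed

lemma linear_id: "linear_map R M M (%x. x)"
	by (auto simp: linear_map_def)

lemma hom_module_simps:
	"carrier (hom_module R M N) = {h : extensional (carrier M). linear_map R M N h}"
	"\<zero>\<^sub>(hom_module R M N) = (\<lambda>x\<in>carrier M. \<zero>\<^sub>N)"
	"g \<oplus>\<^sub>(hom_module R M N) h = (\<lambda>x\<in>carrier M. g x \<oplus>\<^sub>N h x)"
	"a \<odot>\<^sub>(hom_module R M N) h = (\<lambda>x\<in>carrier M. a \<odot>\<^sub>N h x)"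
	by (auto simp: hom_module_def)

lemma hom_module_is_module:
	assumes "module R M" "module R N"
	shows "module R (hom_module R M N)"
proof -
	interpret M: module R M by fact
	interpret N: module R N by fact
	let ?H = "hom_module R M N"
	note s = hom_module_simps
	have ext: "g = h" if "g : extensional (carrier M)" "h : extensional (carrier M)"
			"!!x. x : carrier M ==> g x = h x" for g h :: "'c => 'e"
		using that by (rule extensionalityI)
	show ?thesis
	proof (rule moduleI)
		show "cring R" by (rule M.R.is_cring)
		show "abelian_group ?H"
		proof (rule abelian_groupI)
			fix g h assume "g : carrier ?H" "h : carrier ?H"
			thus "g \<oplus>\<^sub>?H h : carrier ?H"
			using assms by (auto simp: s intro!: linear_restrict linear_plus)
		next
			show "\<zero>\<^sub>?H : carrier ?H"
			using assms by (auto simp: s intro!: linear_restrict linear_const_zero)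
		next
			fix g assume g: "g : carrier ?H"
			show "EX h:carrier ?H. h \<oplus>\<^sub>?H g = \<zero>\<^sub>?H"
			by (rule bexI[of _ "\<lambda>x\<in>carrier M. \<ominus>\<^sub>N g x"])
			(use g assms in "auto simp: s linear_closed N.l_neg
			intro!: linear_restrict linear_uminus restrict_ext")
		qed (auto simp: s linear_closed N.a_ac intro!: ext)
	next
		fix a g assume "a : carrier R" "g : carrier ?H"
		thus "a \<odot>\<^sub>?H g : carrier ?H"
			using assms by (auto simp: s intro!: linear_restrict linear_scale)
	qed (auto simp: s linear_closed N.smult_l_distr N.smult_r_distr N.smult_assoc1 intro!: ext)
qed

lemma hom_module_uminus:
	assumes "module R M" "module R N" "h : carrier (hom_module R M N)"
	shows "\<ominus>\<^sub>(hom_module R M N) h = (\<lambda>x\<in>carrier M. \<ominus>\<^sub>N h x)"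
proof -
	interpret N: module R N by fact
	interpret H: module R "hom_module R M N" by (rule hom_module_is_module) fact+
	show ?thesis
		by (rule H.minus_equality[OF _ assms(3)])
			(use assms in "auto simp: hom_module_simps linear_closed N.l_neg
			intro!: linear_restrict linear_uminus restrict_ext")
qed

lemma hom_module_diff:
	assumes "module R M" "module R N" "g : carrier (hom_module R M N)" "h : carrier (hom_module R M N)"
	shows "g \<ominus>\<^sub>(hom_module R M N) h = (\<lambda>x\<in>carrier M. g x \<ominus>\<^sub>N h x)"
	unfolding a_minus_def hom_module_uminus[OF assms(1,2,4)]
	by (auto simp: hom_module_simps intro!: restrict_ext)

section \<open>Families of modules with operators\<close>

text \<open>A graded module with operators is kept as a family of modules \<open>G g\<close> indexed by degrees, together with
pairs \<open>(s, \<phi>)\<close> of a degree and a family of maps raising degrees by \<open>s\<close>. The direct sum is never formed, and a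
closed family is a homogeneous submodule.\<close>

definition closed_family ::
		"('q, 'k) ring_scheme => ('g::cancel_comm_monoid_add => ('q, 'x) module) =>
		('g \<times> ('g => 'x => 'x)) set => ('g => 'x set) => bool" where
	"closed_family Q G ops U \<longleftrightarrow>
		(ALL g. submodule (U g) Q (G g)) & (ALL (s, \<phi>):ops. ALL g. ALL x:U g. \<phi> g x : U (g + s))"

text \<open>This says that \<open>Z / B\<close> is finitely generated by homogeneous elements. Representatives in \<open>Z\<close> and
subfamilies between \<open>B\<close> and \<open>Z\<close> take the place of cosets and submodules of the quotient.\<close>

definition fin_gen_family ::
		"('q, 'k) ring_scheme => ('g::cancel_comm_monoid_add => ('q, 'x) module) =>
		('g \<times> ('g => 'x => 'x)) set => ('g => 'x set) => ('g => 'x set) => bool" where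
	"fin_gen_family Q G ops Z B \<longleftrightarrow> (EX S. finite S & S <= Sigma UNIV Z &
		(ALL U. closed_family Q G ops U & B <= U & S <= Sigma UNIV U --> Z <= U))"

definition noetherian_family ::
		"('q, 'k) ring_scheme => ('g::cancel_comm_monoid_add => ('q, 'x) module) =>
		('g \<times> ('g => 'x => 'x)) set => ('g => 'x set) => ('g => 'x set) => bool" where
	"noetherian_family Q G ops Z B \<longleftrightarrow>
		(ALL U. closed_family Q G ops U & B <= U & U <= Z --> fin_gen_family Q G ops U B)"

definition family_sum ::
		"('g => ('q, 'x) module) => ('g => 'x set) => ('g => 'x set) => 'g => 'x set" where
	"family_sum G U V g = {x \<oplus>\<^sub>(G g) y | x y. x : U g & y : V g}"

lemma closed_familyD:
	assumes "closed_family Q G ops U" "!!g. module Q (G g)"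
	shows "!!g x. x : U g ==> x : carrier (G g)"
		and "!!g. \<zero>\<^sub>(G g) : U g"
		and "!!g x y. x : U g ==> y : U g ==> x \<oplus>\<^sub>(G g) y : U g"
		and "!!g x y. x : U g ==> y : U g ==> x \<ominus>\<^sub>(G g) y : U g"
		and "!!g a x. a : carrier Q ==> x : U g ==> a \<odot>\<^sub>(G g) x : U g"
		and "!!g s \<phi> x. (s, \<phi>) : ops ==> x : U g ==> \<phi> g x : U (g + s)"
proof -
	have sub: "submodule (U g) Q (G g)" for g using assms(1) by (simp add: closed_family_def)
	note m = module.submoduleE[OF assms(2) sub]
	show "!!g x. x : U g ==> x : carrier (G g)" using m(1) by blast
	show "\<zero>\<^sub>(G g) : U g" for g using subgroup.one_closed[OF submodule.axioms(1)[OF sub[of g]]] by simp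
	show "!!g x y. x : U g ==> y : U g ==> x \<oplus>\<^sub>(G g) y : U g" using m(5) by blast
	show "!!g x y. x : U g ==> y : U g ==> x \<ominus>\<^sub>(G g) y : U g"
		unfolding a_minus_def using m(3,5) by blast
	show "!!g a x. a : carrier Q ==> x : U g ==> a \<odot>\<^sub>(G g) x : U g" using m(4) by blast
	show "!!g s \<phi> x. (s, \<phi>) : ops ==> x : U g ==> \<phi> g x : U (g + s)"
		using assms(1) by (fastforce simp: closed_family_def)
qed

lemma closed_familyI:
	assumes "!!g. module Q (G g)"
		and "!!g x. x : U g ==> x : carrier (G g)"
		and "!!g. \<zero>\<^sub>(G g) : U g"
		and "!!g x y. x : U g ==> y : U g ==> x \<oplus>\<^sub>(G g) y : U g"
		and "!!g a x. a : carrier Q ==> x : U g ==> a \<odot>\<^sub>(G g) x : U g"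
		and "!!g s \<phi> x. (s, \<phi>) : ops ==> x : U g ==> \<phi> g x : U (g + s)"
	shows "closed_family Q G ops U"
proof -
	have "submodule (U g) Q (G g)" for g
	proof (rule module.submoduleI[OF assms(1)])
		interpret module Q "G g" by (rule assms(1))
		fix x assume x: "x : U g"
		have "\<ominus>\<^sub>(G g) x = (\<ominus>\<^sub>Q \<one>\<^sub>Q) \<odot>\<^sub>(G g) x" using assms(2)[OF x] by (simp add: smult_l_minus)
		thus "\<ominus>\<^sub>(G g) x : U g" using assms(5)[OF _ x] by simp
	qed (use assms in auto)
	thus ?thesis using assms(6) by (auto simp: closed_family_def)
qed

lemma closed_family_mono: "closed_family Q G ops' U ==> ops <= ops' ==> closed_family Q G ops U"
	unfolding closed_family_def by blast

lemma closed_family_inf: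
	assumes "!!g. module Q (G g)" "closed_family Q G ops U" "closed_family Q G ops V"
	shows "closed_family Q G ops (%g. U g Int V g)"
	by (rule closed_familyI[OF assms(1)])
		(use closed_familyD[OF assms(2,1)] closed_familyD[OF assms(3,1)] in auto)

lemma fin_gen_family_mono_ops:
	assumes "fin_gen_family Q G ops Z B" "ops <= ops'"
	shows "fin_gen_family Q G ops' Z B"
	using assms closed_family_mono[of Q G ops' _ ops] unfolding fin_gen_family_def by meson

lemma fin_gen_family_mono_base:
	assumes "fin_gen_family Q G ops Z B" "B <= B'"
	shows "fin_gen_family Q G ops Z B'"
	using assms unfolding fin_gen_family_def by (meson order_trans)

lemma noetherian_familyD:
	"noetherian_family Q G ops Z B ==> closed_family Q G ops U ==> B <= U ==> U <= Z ==> fin_gen_family Q G ops U B"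
	by (auto simp: noetherian_family_def)

lemma noetherian_family_mono:
	assumes "noetherian_family Q G ops Z B" "B <= B'" "Z' <= Z" "ops <= ops'"
	shows "noetherian_family Q G ops' Z' B'"
	using assms unfolding noetherian_family_def
	by (meson closed_family_mono fin_gen_family_mono_base fin_gen_family_mono_ops order_trans)

lemma noetherian_family_refl: "noetherian_family Q G ops Z Z"
	unfolding noetherian_family_def fin_gen_family_def
	by (metis antisym empty_subsetI finite.emptyI)

locale module_family =
	fixes Q :: "('q, 'k) ring_scheme" and G :: "'g::cancel_comm_monoid_add => ('q, 'x) module"
	assumes G_module: "!!g. module Q (G g)"
begin

abbreviation "linear_ops ops == ALL (s, \<phi>):ops. ALL g. linear_map Q (G g) (G (g + s)) (\<phi> g)"

lemmas closedD = closed_familyD[OF _ G_module]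
lemmas closedI = closed_familyI[where G = G, OF G_module]

lemma linear_opsD: "linear_ops ops ==> (s, \<phi>) : ops ==> linear_map Q (G g) (G (g + s)) (\<phi> g)"
	by blast

lemma family_sum_I:
	"x : U g ==> y : V g ==> x \<oplus>\<^sub>(G g) y : family_sum G U V g"
	by (auto simp: family_sum_def)

lemma family_sum_closed:
	assumes ol: "linear_ops ops" and U: "closed_family Q G ops U" and V: "closed_family Q G ops V"
	shows "closed_family Q G ops (family_sum G U V)" "U <= family_sum G U V" "V <= family_sum G U V"
proof -
	note Ud = closedD[OF U] and Vd = closedD[OF V]
	show "closed_family Q G ops (family_sum G U V)"
	proof (rule closedI)
		fix g x y assume "x : family_sum G U V g" "y : family_sum G U V g"
		then obtain a b c e where e: "x = a \<oplus>\<^sub>(G g) b" "y = c \<oplus>\<^sub>(G g) e" "a : U g" "b : V g" "c : U g" "e : V g"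
			by (auto simp: family_sum_def)
		interpret module Q "G g" by (rule G_module)
		have "x \<oplus>\<^sub>(G g) y = (a \<oplus>\<^sub>(G g) c) \<oplus>\<^sub>(G g) (b \<oplus>\<^sub>(G g) e)"
			using Ud(1) Vd(1) e by (simp add: M.a_ac)
		thus "x \<oplus>\<^sub>(G g) y : family_sum G U V g" using e Ud(3) Vd(3) by (auto intro: family_sum_I)
	next
		fix g x assume x: "x : family_sum G U V g"
		interpret module Q "G g" by (rule G_module)
		show "x : carrier (G g)" using x Ud(1) Vd(1) by (auto simp: family_sum_def)
		obtain u v where uv: "x = u \<oplus>\<^sub>(G g) v" "u : U g" "v : V g" using x by (auto simp: family_sum_def)
		{ fix a assume a: "a : carrier Q"
			hence "a \<odot>\<^sub>(G g) x = a \<odot>\<^sub>(G g) u \<oplus>\<^sub>(G g) a \<odot>\<^sub>(G g) v"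
			using uv Ud(1) Vd(1) by (simp add: smult_r_distr)
			thus "a \<odot>\<^sub>(G g) x : family_sum G U V g"
			using family_sum_I[where U = U and V = V, OF Ud(5)[OF a uv(2)] Vd(5)[OF a uv(3)]] by simp }
		{ fix s \<phi> assume s: "(s, \<phi>) : ops"
			hence "\<phi> g x = \<phi> g u \<oplus>\<^sub>(G (g + s)) \<phi> g v"
			using uv Ud(1) Vd(1) linear_add[OF linear_opsD[OF ol s]] by simp
			thus "\<phi> g x : family_sum G U V (g + s)"
			using family_sum_I[where U = U and V = V, OF Ud(6)[OF s uv(2)] Vd(6)[OF s uv(3)]] by simp }
	next
		fix g
		interpret module Q "G g" by (rule G_module)
		show "\<zero>\<^sub>(G g) : family_sum G U V g"
			using family_sum_I[where U = U and V = V, OF Ud(2)[of g] Vd(2)] by simp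
	qed
	show "U <= family_sum G U V"
	proof (intro le_funI subsetI)
		fix g x assume x: "x : U g"
		interpret module Q "G g" by (rule G_module)
		show "x : family_sum G U V g"
			using family_sum_I[where U = U and V = V, OF x Vd(2)] Ud(1)[OF x] by simp
	qed
	show "V <= family_sum G U V"
	proof (intro le_funI subsetI)
		fix g x assume x: "x : V g"
		interpret module Q "G g" by (rule G_module)
		show "x : family_sum G U V g"
			using family_sum_I[where U = U and V = V, OF Ud(2) x] Vd(1)[OF x] by simp
	qed
qed

lemma family_sum_lift:
	assumes "finite S" "S <= Sigma UNIV (family_sum G U V)"
	shows "EX S'. finite S' & S' <= Sigma UNIV U &
			(ALL g x. (g, x) : S --> (EX u v. (g, u) : S' & v : V g & x = u \<oplus>\<^sub>(G g) v))"
proof -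
	have "ALL p:S. EX u. u : U (fst p) & (EX v : V (fst p). snd p = u \<oplus>\<^sub>(G (fst p)) v)"
		using assms(2) by (fastforce simp: family_sum_def)
	then obtain w where w: "ALL p:S. w p : U (fst p) & (EX v : V (fst p). snd p = w p \<oplus>\<^sub>(G (fst p)) v)"
		by metis
	show ?thesis
	proof (rule exI[of _ "(%p. (fst p, w p)) ` S"], intro conjI allI impI)
		show "finite ((%p. (fst p, w p)) ` S)" using assms(1) by simp
		show "(%p. (fst p, w p)) ` S <= Sigma UNIV U" using w by auto
		fix g x assume "(g, x) : S"
		thus "EX u v. (g, u) : (%p. (fst p, w p)) ` S & v : V g & x = u \<oplus>\<^sub>(G g) v"
			using w by force
	qed
qed

lemma diff_of_sum:
	assumes "w : carrier (G g)" "b : carrier (G g)"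
	shows "(w \<oplus>\<^sub>(G g) b) \<ominus>\<^sub>(G g) w = b"
proof -
	interpret module Q "G g" by (rule G_module)
	show ?thesis using assms by (simp add: a_minus_def M.a_ac M.r_neg M.r_neg1 M.r_neg2)
qed

text \<open>A subfamily \<open>U\<close> is controlled by \<open>U \<inter> B1\<close>, which lies in the submodule, and by \<open>U + B1\<close>, which gives its
image in the quotient. A closed family that contains generators of the first and lifts to \<open>U\<close> of generators of the
second contains \<open>U\<close>.\<close>

lemma noetherian_extension:
	assumes ol: "linear_ops ops" and B1: "closed_family Q G ops B1"
		and n1: "noetherian_family Q G ops Z B1" and n2: "noetherian_family Q G ops B1 B2"
		and sub: "B2 <= B1" "B1 <= Z" and Z: "closed_family Q G ops Z"
	shows "noetherian_family Q G ops Z B2"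
	unfolding noetherian_family_def
proof (intro allI impI)
	fix U assume "closed_family Q G ops U & B2 <= U & U <= Z"
	hence U: "closed_family Q G ops U" and BU: "B2 <= U" and UZ: "U <= Z" by auto
	note Ud = closedD[OF U] and Bd = closedD[OF B1] and Zd = closedD[OF Z]
	note UB = family_sum_closed[OF ol U B1]
	have "fin_gen_family Q G ops (%g. U g Int B1 g) B2"
		by (rule noetherian_familyD[OF n2]) (use BU sub closed_family_inf[OF G_module U B1] in "auto simp: le_fun_def")
	then obtain S2 where S2: "finite S2" "S2 <= Sigma UNIV (%g. U g Int B1 g)"
		"!!W. closed_family Q G ops W ==> B2 <= W ==> S2 <= Sigma UNIV W ==> (%g. U g Int B1 g) <= W"
		unfolding fin_gen_family_def by blast
	have "fin_gen_family Q G ops (family_sum G U B1) B1"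
		by (rule noetherian_familyD[OF n1])
			(use UB UZ sub Zd(3) in "auto simp: le_fun_def family_sum_def subset_iff")
	then obtain S1 where S1: "finite S1" "S1 <= Sigma UNIV (family_sum G U B1)"
		"!!W. closed_family Q G ops W ==> B1 <= W ==> S1 <= Sigma UNIV W ==> family_sum G U B1 <= W"
		unfolding fin_gen_family_def by blast
	obtain S1' where S1': "finite S1'" "S1' <= Sigma UNIV U"
		"!!g x. (g, x) : S1 ==> EX u v. (g, u) : S1' & v : B1 g & x = u \<oplus>\<^sub>(G g) v"
		using family_sum_lift[OF S1(1,2)] by blast
	show "fin_gen_family Q G ops U B2"
		unfolding fin_gen_family_def
	proof (intro exI[of _ "S1' Un S2"] conjI allI impI)
		show "finite (S1' Un S2)" "S1' Un S2 <= Sigma UNIV U" using S1'(1,2) S2(1,2) by auto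
		fix W assume "closed_family Q G ops W & B2 <= W & S1' Un S2 <= Sigma UNIV W"
		hence W: "closed_family Q G ops W" and BW: "B2 <= W" and SW: "S1' <= Sigma UNIV W" "S2 <= Sigma UNIV W"
			by auto
		note WU = closed_family_inf[OF G_module W U]
		note C = family_sum_closed[OF ol WU B1]
		have "S1 <= Sigma UNIV (family_sum G (%g. W g Int U g) B1)"
			using S1'(2,3) SW(1) by (fastforce simp: family_sum_def)
		from order_trans[OF UB(2) S1(3)[OF C(1) C(3) this]]
		have UW: "U <= family_sum G (%g. W g Int U g) B1" .
		have IW: "U g Int B1 g <= W g" for g using S2(3)[OF W BW SW(2)] by (auto simp: le_fun_def)
		show "U <= W"
		proof (intro le_funI subsetI)
			fix g u assume u: "u : U g"
			then obtain w b where wb: "u = w \<oplus>\<^sub>(G g) b" "w : W g" "w : U g" "b : B1 g"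
			using UW by (fastforce simp: le_fun_def family_sum_def)
			have "b = u \<ominus>\<^sub>(G g) w" unfolding wb(1) using Ud(1) Bd(1) wb by (simp add: diff_of_sum)
			hence "b : W g" using Ud(4)[OF u wb(3)] wb(4) IW by auto
			thus "u : W g" using wb closedD(3)[OF W] by simp
		qed
	qed
qed

end

text \<open>The quotient of \<open>Z\<close> by the preimage of \<open>B'\<close> embeds in \<open>Z' / B'\<close> through \<open>j\<close>, and a submodule of a
noetherian module is noetherian. The operators upstairs need only be compatible with \<open>j\<close>: every operator
downstairs has to be induced by some operator upstairs.\<close>

lemma noetherian_pullback:
	assumes "module_family Q G" "module_family Q Y"
		and linY: "ALL (s, \<phi>):ops'. ALL g. linear_map Q (Y g) (Y (g + s)) (\<phi> g)"
		and j: "!!g. linear_map Q (G g) (Y g) (j g)"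
		and Z: "closed_family Q G ops Z"
		and B': "closed_family Q Y ops' B'"
		and jZ: "!!g x. x : Z g ==> j g x : Z' g" and BZ: "B' <= Z'" and Z': "closed_family Q Y ops' Z'"
		and equi: "!!s \<psi>. (s, \<psi>) : ops' ==> EX \<phi>. (s, \<phi>) : ops &
			(ALL g. ALL x:Z g. j (g + s) (\<phi> g x) = \<psi> g (j g x))"
		and n: "noetherian_family Q Y ops' Z' B'"
	shows "noetherian_family Q G ops Z (%g. {x : Z g. j g x : B' g})"
	unfolding noetherian_family_def
proof (intro allI impI)
	interpret G: module_family Q G by fact
	interpret Y: module_family Q Y by fact
	let ?B = "%g. {x : Z g. j g x : B' g}"
	fix U assume "closed_family Q G ops U & ?B <= U & U <= Z"
	hence U: "closed_family Q G ops U" and BU: "!!g. ?B g <= U g" and UZ: "!!g. U g <= Z g"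
		by (auto simp: le_fun_def)
	note Bd = Y.closedD[OF B']
	let ?jU = "%U g. j g ` U g"
	have jU: "closed_family Q Y ops' (?jU V)" if V: "closed_family Q G ops V" "!!g. V g <= Z g" for V
	proof (rule Y.closedI)
		note Vd = G.closedD[OF V(1)]
		fix g x assume x: "x : j g ` V g"
		show "x : carrier (Y g)" using x Vd(1) linear_closed[OF j] by blast
		{ fix y assume "y : j g ` V g"
			with x obtain a b where ab: "x = j g a" "y = j g b" "a : V g" "b : V g" by blast
			hence "x \<oplus>\<^sub>(Y g) y = j g (a \<oplus>\<^sub>(G g) b)" using Vd(1) linear_add[OF j] by simp
			thus "x \<oplus>\<^sub>(Y g) y : j g ` V g" using Vd(3)[OF ab(3,4)] by blast }
		{ fix a assume a: "a : carrier Q"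
			obtain u where u: "x = j g u" "u : V g" using x by blast
			hence "a \<odot>\<^sub>(Y g) x = j g (a \<odot>\<^sub>(G g) u)" using a Vd(1) linear_smult[OF j] by simp
			thus "a \<odot>\<^sub>(Y g) x : j g ` V g" using Vd(5)[OF a u(2)] by blast }
		{ fix s \<psi> assume "(s, \<psi>) : ops'"
			then obtain \<phi> where p: "(s, \<phi>) : ops" "!!g x. x : Z g ==> j (g + s) (\<phi> g x) = \<psi> g (j g x)"
			using equi by blast
			obtain u where u: "x = j g u" "u : V g" using x by blast
			hence "u : Z g" using V(2) by blast
			hence "\<psi> g x = j (g + s) (\<phi> g u)" using p(2) u(1) by simp
			thus "\<psi> g x : j (g + s) ` V (g + s)" using Vd(6)[OF p(1) u(2)] by blast }
	next
		fix g show "\<zero>\<^sub>(Y g) : j g ` V g"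
			using G.closedD(2)[OF V(1)] linear_zero[OF G.G_module Y.G_module j] by (metis imageI)
	qed
	note UB = Y.family_sum_closed[OF linY jU[OF U UZ] B']
	have "fin_gen_family Q Y ops' (family_sum Y (?jU U) B') B'"
	proof (rule noetherian_familyD[OF n UB(1) UB(3)])
		show "family_sum Y (?jU U) B' <= Z'"
			using UZ jZ BZ Y.closedD(3)[OF Z'] by (fastforce simp: le_fun_def family_sum_def)
	qed
	then obtain S1 where S1: "finite S1" "S1 <= Sigma UNIV (family_sum Y (?jU U) B')"
		"!!W. closed_family Q Y ops' W ==> B' <= W ==> S1 <= Sigma UNIV W ==> family_sum Y (?jU U) B' <= W"
		unfolding fin_gen_family_def by blast
	obtain S2 where S2: "finite S2" "S2 <= Sigma UNIV (?jU U)"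
		"!!g x. (g, x) : S1 ==> EX u v. (g, u) : S2 & v : B' g & x = u \<oplus>\<^sub>(Y g) v"
		using Y.family_sum_lift[OF S1(1,2)] by blast
	have "ALL p:S2. EX u. u : U (fst p) & snd p = j (fst p) u" using S2(2) by force
	then obtain w where w: "!!p. p : S2 ==> w p : U (fst p) & snd p = j (fst p) (w p)" by metis
	show "fin_gen_family Q G ops U ?B"
		unfolding fin_gen_family_def
	proof (intro exI[of _ "(%p. (fst p, w p)) ` S2"] conjI allI impI)
		show "finite ((%p. (fst p, w p)) ` S2)" "(%p. (fst p, w p)) ` S2 <= Sigma UNIV U"
			using S2(1) w by auto
		fix W assume W': "closed_family Q G ops W & ?B <= W & (%p. (fst p, w p)) ` S2 <= Sigma UNIV W"
		hence W: "closed_family Q G ops W" and BW: "!!g. ?B g <= W g"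
			and SW: "!!p. p : S2 ==> w p : W (fst p)"
			by (auto simp: le_fun_def)
		note WU = closed_family_inf[OF G.G_module W U]
		have jWU: "closed_family Q Y ops' (?jU (%g. W g Int U g))" using jU[OF WU] UZ by blast
		note C = Y.family_sum_closed[OF linY jWU B']
		have "S1 <= Sigma UNIV (family_sum Y (?jU (%g. W g Int U g)) B')"
		proof (clarsimp)
			fix g x assume "(g, x) : S1"
			then obtain u v where uv: "(g, u) : S2" "v : B' g" "x = u \<oplus>\<^sub>(Y g) v" using S2(3) by blast
			have "u : j g ` (W g Int U g)" using w[OF uv(1)] SW[OF uv(1)] by auto
			thus "x : family_sum Y (?jU (%g. W g Int U g)) B' g" using uv by (auto simp: family_sum_def)
		qed
		from order_trans[OF UB(2) S1(3)[OF C(1) C(3) this]]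
		have UW: "?jU U <= family_sum Y (?jU (%g. W g Int U g)) B'" .
		show "U <= W"
		proof (intro le_funI subsetI)
			fix g u assume u: "u : U g"
			hence "j g u : family_sum Y (?jU (%g. W g Int U g)) B' g" using UW by (auto simp: le_fun_def)
			then obtain v b where vb: "j g u = j g v \<oplus>\<^sub>(Y g) b" "v : W g" "v : U g" "b : B' g"
			by (auto simp: family_sum_def)
			interpret Gg: module Q "G g" by (rule G.G_module)
			have uc: "u : carrier (G g)" and vc: "v : carrier (G g)" using G.closedD(1)[OF U] u vb(3) by auto
			have "j g (u \<ominus>\<^sub>(G g) v) = j g u \<ominus>\<^sub>(Y g) j g v"
			by (rule linear_diff[OF G.G_module Y.G_module j uc vc])
			also have "... = b" unfolding vb(1)
			by (rule Y.diff_of_sum) (use linear_closed[OF j vc] Bd(1)[OF vb(4)] in auto)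
			finally have "u \<ominus>\<^sub>(G g) v : ?B g" using vb(4) UZ G.closedD(4)[OF U u vb(3)] by auto
			hence "v \<oplus>\<^sub>(G g) (u \<ominus>\<^sub>(G g) v) : W g" using BW vb(2) G.closedD(3)[OF W] by blast
			also have "v \<oplus>\<^sub>(G g) (u \<ominus>\<^sub>(G g) v) = u"
			using uc vc by (simp add: a_minus_def Gg.M.a_ac Gg.M.r_neg2 Gg.M.r_neg1 Gg.M.r_neg)
			finally show "u : W g" .
		qed
	qed
qed

context module_family begin

text \<open>The quotient \<open>Y / B\<close> is cyclic and concentrated in the degree of \<open>s\<close>, so its submodules are given by
ideals of coefficients, and these are finitely generated. This is where the ring being noetherian enters.\<close>

lemma noetherian_cyclic_extension:
	assumes noeth: "noetherian_ring Q" and B: "closed_family Q G {} B" and s: "s : carrier (G g0)"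
	defines "Y == %g. if g = g0 then {b \<oplus>\<^sub>(G g) a \<odot>\<^sub>(G g) s | a b. a : carrier Q & b : B g} else B g"
	shows "noetherian_family Q G {} Y B" "closed_family Q G {} Y" "B <= Y" "s : Y g0"
proof -
	interpret g0: module Q "G g0" by (rule G_module)
	note Bd = closedD[OF B]
	have mem: "b \<oplus>\<^sub>(G g0) a \<odot>\<^sub>(G g0) s : Y g0" if "a : carrier Q" "b : B g0" for a b
		using that by (auto simp: Y_def)
	have Yother: "Y g = B g" if "g ~= g0" for g using that by (simp add: Y_def)
	have Yg0: "EX a b. x = b \<oplus>\<^sub>(G g0) a \<odot>\<^sub>(G g0) s & a : carrier Q & b : B g0" if "x : Y g0" for x
		using that by (auto simp: Y_def)
	show BY: "B <= Y"
	proof (intro le_funI subsetI)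
		fix g b assume b: "b : B g"
		show "b : Y g"
		proof (cases "g = g0")
			case True
			thus ?thesis using mem[of "\<zero>\<^sub>Q" b] b s Bd(1)[of b g0] by simp
		qed (use b Yother in simp)
	qed
	show "s : Y g0" using mem[of "\<one>\<^sub>Q" "\<zero>\<^sub>(G g0)"] Bd(2) s by simp
	show "closed_family Q G {} Y"
	proof (rule closedI)
		fix g x assume x: "x : Y g"
		show "x : carrier (G g)"
			using x Bd(1) Yother[of g] s by (cases "g = g0") (auto dest!: Yg0)
		{ fix y assume y: "y : Y g"
			show "x \<oplus>\<^sub>(G g) y : Y g"
			proof (cases "g = g0")
			case True
			obtain a b c e where e: "x = b \<oplus>\<^sub>(G g0) a \<odot>\<^sub>(G g0) s" "y = e \<oplus>\<^sub>(G g0) c \<odot>\<^sub>(G g0) s"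
			"a : carrier Q" "c : carrier Q" "b : B g0" "e : B g0"
			using Yg0[of x] Yg0[of y] x y True by auto
			have "x \<oplus>\<^sub>(G g0) y = (b \<oplus>\<^sub>(G g0) e) \<oplus>\<^sub>(G g0) (a \<oplus>\<^sub>Q c) \<odot>\<^sub>(G g0) s"
			using e Bd(1) s by (simp add: g0.M.a_ac g0.smult_l_distr)
			thus ?thesis using mem[of "a \<oplus>\<^sub>Q c" "b \<oplus>\<^sub>(G g0) e"] e Bd(3) True by simp
			qed (use x y Yother Bd(3) in simp) }
		{ fix r assume r: "r : carrier Q"
			show "r \<odot>\<^sub>(G g) x : Y g"
			proof (cases "g = g0")
			case True
			obtain a b where e: "x = b \<oplus>\<^sub>(G g0) a \<odot>\<^sub>(G g0) s" "a : carrier Q" "b : B g0"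
			using Yg0[of x] x True by auto
			have "r \<odot>\<^sub>(G g0) x = r \<odot>\<^sub>(G g0) b \<oplus>\<^sub>(G g0) (r \<otimes>\<^sub>Q a) \<odot>\<^sub>(G g0) s"
			using e Bd(1) s r by (simp add: g0.smult_r_distr g0.smult_assoc1)
			thus ?thesis using mem[of "r \<otimes>\<^sub>Q a" "r \<odot>\<^sub>(G g0) b"] e r Bd(5) True by simp
			qed (use x r Yother Bd(5) in simp) }
	next
		fix g show "\<zero>\<^sub>(G g) : Y g" using BY Bd(2) by (auto simp: le_fun_def)
	qed simp
	show "noetherian_family Q G {} Y B"
		unfolding noetherian_family_def
	proof (intro allI impI)
		fix U assume "closed_family Q G {} U & B <= U & U <= Y"
		hence U: "closed_family Q G {} U" and BU: "!!g. B g <= U g" and UY: "!!g. U g <= Y g"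
			by (auto simp: le_fun_def)
		have id: "ideal {a : carrier Q. a \<odot>\<^sub>(G g0) s : W g0} Q" if W: "closed_family Q G {} W" for W
		proof (rule idealI)
			note Wd = closedD[OF W]
			show "ring Q" by (rule g0.R.ring_axioms)
			show "subgroup {a : carrier Q. a \<odot>\<^sub>(G g0) s : W g0} (add_monoid Q)"
			proof (rule g0.R.add.subgroupI)
			show "{a : carrier Q. a \<odot>\<^sub>(G g0) s : W g0} ~= {}" using Wd(2)[of g0] s by (auto intro!: exI[of _ "\<zero>\<^sub>Q"])
			fix a assume a: "a : {a : carrier Q. a \<odot>\<^sub>(G g0) s : W g0}"
			hence "(\<ominus>\<^sub>Q \<one>\<^sub>Q) \<odot>\<^sub>(G g0) (a \<odot>\<^sub>(G g0) s) : W g0" using Wd(5) by simp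
			thus "\<ominus>\<^sub>Q a : {a : carrier Q. a \<odot>\<^sub>(G g0) s : W g0}"
			using a s by (simp add: g0.smult_l_minus)
			qed (use Wd(3) s in "auto simp: g0.smult_l_distr")
			fix a x assume "a : {a : carrier Q. a \<odot>\<^sub>(G g0) s : W g0}" "x : carrier Q"
			thus "x \<otimes>\<^sub>Q a : {a : carrier Q. a \<odot>\<^sub>(G g0) s : W g0}"
			"a \<otimes>\<^sub>Q x : {a : carrier Q. a \<odot>\<^sub>(G g0) s : W g0}"
			using Wd(5)[of x "a \<odot>\<^sub>(G g0) s" g0] s
			by (auto simp: g0.smult_assoc1 g0.R.m_comm[of a x])
		qed
		obtain A0 where A0: "A0 <= carrier Q" "finite A0" "{a : carrier Q. a \<odot>\<^sub>(G g0) s : U g0} = Idl\<^bsub>Q\<^esub> A0"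
			using noetherian_ring.finetely_gen[OF noeth id[OF U]] by blast
		have A0U: "a \<odot>\<^sub>(G g0) s : U g0" if "a : A0" for a
			using g0.R.genideal_self[OF A0(1)] that A0(3) by auto
		show "fin_gen_family Q G {} U B"
			unfolding fin_gen_family_def
		proof (intro exI[of _ "(%a. (g0, a \<odot>\<^sub>(G g0) s)) ` A0"] conjI allI impI)
			show "finite ((%a. (g0, a \<odot>\<^sub>(G g0) s)) ` A0)" "(%a. (g0, a \<odot>\<^sub>(G g0) s)) ` A0 <= Sigma UNIV U"
			using A0 A0U by auto
			fix W assume "closed_family Q G {} W & B <= W & (%a. (g0, a \<odot>\<^sub>(G g0) s)) ` A0 <= Sigma UNIV W"
			hence W: "closed_family Q G {} W" and BW: "!!g. B g <= W g" and SW: "!!a. a : A0 ==> a \<odot>\<^sub>(G g0) s : W g0"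
			by (auto simp: le_fun_def)
			have "Idl\<^bsub>Q\<^esub> A0 <= {a : carrier Q. a \<odot>\<^sub>(G g0) s : W g0}"
			by (rule g0.R.genideal_minimal[OF id[OF W]]) (use SW A0(1) in auto)
			hence key: "a \<odot>\<^sub>(G g0) s : W g0" if "a : carrier Q" "a \<odot>\<^sub>(G g0) s : U g0" for a
			using that A0(3) by auto
			show "U <= W"
			proof (intro le_funI subsetI)
			fix g x assume x: "x : U g"
			show "x : W g"
			proof (cases "g = g0")
			case True
			obtain a b where e: "x = b \<oplus>\<^sub>(G g0) a \<odot>\<^sub>(G g0) s" "a : carrier Q" "b : B g0"
			using Yg0[of x] x UY[of g] True by auto
			have "a \<odot>\<^sub>(G g0) s = x \<ominus>\<^sub>(G g0) b" unfolding e(1) using diff_of_sum[of b g0] Bd(1) e s by simp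
			hence "a \<odot>\<^sub>(G g0) s : U g0" using closedD(4)[OF U, of x g0 b] x e BU True by auto
			hence "a \<odot>\<^sub>(G g0) s : W g0" using key e by simp
			thus ?thesis using e BW closedD(3)[OF W] True by blast
			next
			case False
			thus ?thesis using x UY[of g] BW[of g] Yother by auto
			qed
			qed
		qed
	qed
qed

lemma noetherian_span:
	assumes noeth: "noetherian_ring Q" and B: "closed_family Q G {} B"
		and S: "finite S" "!!g x. (g, x) : S ==> x : carrier (G g)"
	shows "EX Y. closed_family Q G {} Y & B <= Y & S <= Sigma UNIV Y & noetherian_family Q G {} Y B &
		(ALL W. closed_family Q G {} W & B <= W & S <= Sigma UNIV W --> Y <= W)"
	using S
proof (induct S rule: finite_induct)
	case empty
	show ?case by (rule exI[of _ B]) (use B noetherian_family_refl in auto)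
next
	case (insert p S)
	then obtain Y where Y: "closed_family Q G {} Y" "B <= Y" "S <= Sigma UNIV Y" "noetherian_family Q G {} Y B"
		"!!W. closed_family Q G {} W ==> B <= W ==> S <= Sigma UNIV W ==> Y <= W"
		by (metis insertI2)
	obtain g0 s where p: "p = (g0, s)" by (cases p)
	have s: "s : carrier (G g0)" using insert(4)[of g0 s] p by simp
	define Y' where "Y' = (%g. if g = g0 then {b \<oplus>\<^sub>(G g) a \<odot>\<^sub>(G g) s | a b. a : carrier Q & b : Y g} else Y g)"
	note N = noetherian_cyclic_extension[OF noeth Y(1) s, folded Y'_def]
	show ?case
	proof (intro exI[of _ Y'] conjI allI impI)
		show "closed_family Q G {} Y'" by (rule N)
		show "B <= Y'" using Y(2) N(3) by (rule order_trans)
		have "s : Y' g0" using N(4) by (simp add: Y'_def)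
		thus "insert p S <= Sigma UNIV Y'" using N(3) Y(3) p by (auto simp: le_fun_def)
		show "noetherian_family Q G {} Y' B"
			by (rule noetherian_extension[OF _ Y(1) N(1) Y(4) Y(2) N(3) N(2)]) simp
		fix W assume "closed_family Q G {} W & B <= W & insert p S <= Sigma UNIV W"
		hence W: "closed_family Q G {} W" "s : W g0" "!!g. Y g <= W g" using Y(5)[of W] p by (auto simp: le_fun_def)
		have "b \<oplus>\<^sub>(G g0) a \<odot>\<^sub>(G g0) s : W g0" if "a : carrier Q" "b : Y g0" for a b
			using closedD(3)[OF W(1)] closedD(5)[OF W(1) that(1) W(2)] that(2) W(3) by blast
		thus "Y' <= W" using W(3) by (auto simp: Y'_def le_fun_def)
	qed
qed

end

section \<open>The Hilbert basis theorem for commuting operators\<close>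

context module_family begin

lemma add_diff_regroup:
	assumes "u : carrier (G g)" "a : carrier (G g)" "w : carrier (G g)"
	shows "u \<oplus>\<^sub>(G g) a = (u \<oplus>\<^sub>(G g) (a \<ominus>\<^sub>(G g) w)) \<oplus>\<^sub>(G g) w"
proof -
	interpret module Q "G g" by (rule G_module)
	show ?thesis using assms by (simp add: a_minus_def M.a_assoc M.l_neg)
qed

definition cong_mod :: "('g => 'x set) => 'g => 'x => 'x => bool" where
	"cong_mod B g x y \<longleftrightarrow> x : carrier (G g) & y : carrier (G g) & x \<ominus>\<^sub>(G g) y : B g"

lemma cong_mod_trans:
	assumes B: "closed_family Q G ops B" and "cong_mod B g x y" "cong_mod B g y z"
	shows "cong_mod B g x z"
proof -
	interpret module Q "G g" by (rule G_module)
	have "x \<ominus>\<^sub>(G g) z = (x \<ominus>\<^sub>(G g) y) \<oplus>\<^sub>(G g) (y \<ominus>\<^sub>(G g) z)"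
		using assms(2,3) unfolding cong_mod_def
		by (simp add: a_minus_def M.a_ac M.r_neg M.r_neg1 M.r_neg2)
	thus ?thesis using assms(2,3) closedD(3)[OF B] by (simp add: cong_mod_def)
qed

lemma cong_mod_sym:
	assumes B: "closed_family Q G ops B" and "cong_mod B g x y"
	shows "cong_mod B g y x"
proof -
	interpret module Q "G g" by (rule G_module)
	have "y \<ominus>\<^sub>(G g) x = \<zero>\<^sub>(G g) \<ominus>\<^sub>(G g) (x \<ominus>\<^sub>(G g) y)"
		using assms(2) unfolding cong_mod_def
		by (simp add: a_minus_def M.a_ac M.minus_add)
	thus ?thesis using assms(2) closedD(2,4)[OF B] by (simp add: cong_mod_def)
qed

lemma cong_mod_refl:
	assumes B: "closed_family Q G ops B" and "x : carrier (G g)"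
	shows "cong_mod B g x x"
proof -
	interpret module Q "G g" by (rule G_module)
	show ?thesis using assms(2) closedD(2)[OF B] by (simp add: cong_mod_def a_minus_def M.r_neg)
qed

lemma cong_mod_linear:
	assumes "linear_map Q (G g) (G h) \<zeta>" "!!b. b : B g ==> \<zeta> b : B h" "cong_mod B g x y"
	shows "cong_mod B h (\<zeta> x) (\<zeta> y)"
	using assms(2)[of "x \<ominus>\<^sub>(G g) y"] assms(1,3) linear_diff[OF G_module G_module assms(1), of x y]
	unfolding cong_mod_def by (auto simp: linear_closed)

text \<open>Eisenbud operators commute on cohomology but not on cochains, so commutation is required on \<open>Z\<close> and only
up to \<open>B\<close>.\<close>

definition commutes_mod :: "('g => 'x set) => ('g => 'x set) => 'g \<times> ('g => 'x => 'x) => 'g \<times> ('g => 'x => 'x) => bool"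
	where "commutes_mod Z B = (%(s, \<zeta>) (r, \<phi>). ALL g. ALL x:Z g.
		cong_mod B (g + r + s) (\<zeta> (g + r) (\<phi> g x)) (\<phi> (g + s) (\<zeta> g x)))"

end

primrec multiple_shift :: "'g::cancel_comm_monoid_add => nat => 'g" where
	"multiple_shift s 0 = 0"
| "multiple_shift s (Suc k) = multiple_shift s k + s"

primrec op_power :: "'g::cancel_comm_monoid_add => ('g => 'x => 'x) => nat => 'g => 'x => 'x" where
	"op_power s \<zeta> 0 g x = x"
| "op_power s \<zeta> (Suc k) g x = \<zeta> (g + multiple_shift s k) (op_power s \<zeta> k g x)"

text \<open>One new operator \<open>\<zeta>\<close> is adjoined. As in the passage from a module \<open>H\<close> to \<open>H[X]\<close>, the family generated
by \<open>H\<close> under \<open>\<zeta>\<close> consists of the sums of \<open>\<zeta>\<^sup>k y\<^sub>k\<close> with \<open>y\<^sub>k\<close> in \<open>H\<close>. Unlike for polynomials, the coefficients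
\<open>y\<^sub>k\<close> of such a sum need not be unique.\<close>

locale hilbert_step = module_family Q G
	for Q :: "('q, 'k) ring_scheme" and G :: "'g::cancel_comm_monoid_add => ('q, 'x) module" +
	fixes ops :: "('g \<times> ('g => 'x => 'x)) set" and s :: 'g and \<zeta> :: "'g => 'x => 'x"
		and H B Z :: "'g => 'x set"
	assumes linear_ops: "linear_ops ops" and linear: "!!g. linear_map Q (G g) (G (g + s)) (\<zeta> g)"
		and H: "closed_family Q G ops H" and B: "closed_family Q G (insert (s, \<zeta>) ops) B"
		and Z: "closed_family Q G (insert (s, \<zeta>) ops) Z"
		and B_H: "!!g. B g <= H g" and H_Z: "!!g. H g <= Z g"
		and commutes: "!!p. p : ops ==> commutes_mod Z B (s, \<zeta>) p"
begin

abbreviation "sh == multiple_shift s"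
abbreviation "pw == op_power s \<zeta>"

lemmas Bd = closedD[OF B] and Hd = closedD[OF H] and Zd = closedD[OF Z]

lemma B_Z: "B g <= Z g" using B_H H_Z by blast

lemma linear_pw: "linear_map Q (G g) (G (g + sh k)) (pw k g)"
proof (induct k)
	case 0
	thus ?case by (simp add: linear_id[unfolded id_def])
next
	case (Suc k)
	from linear_comp[OF this linear[of "g + sh k"]] show ?case by (simp add: add.assoc)
qed

lemma pw_closed:
	assumes "closed_family Q G (insert (s, \<zeta>) ops) W" "x : W g"
	shows "pw k g x : W (g + sh k)"
proof (induct k)
	case (Suc k)
	thus ?case using closedD(6)[OF assms(1), of s \<zeta> "pw k g x" "g + sh k"] by (simp add: add.assoc)
qed (use assms in simp)

lemma pw_commutes:
	assumes "(r, \<phi>) : ops" "x : Z g"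
	shows "cong_mod B (g + r + sh k) (\<phi> (g + sh k) (pw k g x)) (pw k (g + r) (\<phi> g x))"
proof (induct k)
	case 0
	thus ?case using assms Zd(6)[of r \<phi> x g] Zd(1) cong_mod_refl[OF B] by simp
next
	case (Suc k)
	let ?w = "pw k g x"
	have w: "?w : Z (g + sh k)" by (rule pw_closed[OF Z assms(2)])
	have e: "g + sh k + r = g + r + sh k" "g + sh k + r + s = g + r + sh (Suc k)" "g + r + sh k + s = g + r + sh (Suc k)"
		"g + sh k + s = g + sh (Suc k)"
		by (simp_all add: ac_simps)
	have 1: "cong_mod B (g + r + sh (Suc k)) (\<phi> (g + sh (Suc k)) (\<zeta> (g + sh k) ?w)) (\<zeta> (g + r + sh k) (\<phi> (g + sh k) ?w))"
		using commutes[OF assms(1)] w cong_mod_sym[OF B] unfolding commutes_mod_def prod.case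
		by (metis e)
	have 2: "cong_mod B (g + r + sh (Suc k)) (\<zeta> (g + r + sh k) (\<phi> (g + sh k) ?w)) (\<zeta> (g + r + sh k) (pw k (g + r) (\<phi> g x)))"
		by (rule cong_mod_linear[OF _ _ Suc])
			(use linear[of "g + r + sh k"] Bd(6)[of s \<zeta> _ "g + r + sh k"] e in auto)
	show ?case using cong_mod_trans[OF B 1 2] by simp
qed

text \<open>Step \<open>k\<close> of the ladder plays the part of the polynomials of degree less than \<open>k\<close>, modulo \<open>B\<close>.\<close>

primrec ladder :: "nat => 'g => 'x set" where
	"ladder 0 g = B g"
| "ladder (Suc k) g = ladder k g Un {u \<oplus>\<^sub>(G g) pw k g' y | u g' y. g = g' + sh k & u : ladder k g & y : H g'}"

lemma ladder_mono: "k <= l ==> ladder k g <= ladder l g"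
	by (rule lift_Suc_mono_le[of "%k. ladder k g"]) auto

lemma ladder_I: "u : ladder k (g + sh k) ==> y : H g ==> u \<oplus>\<^sub>(G (g + sh k)) pw k g y : ladder (Suc k) (g + sh k)"
	by auto

lemma pw_linear_simps:
	assumes "y : carrier (G g)"
	shows "pw k g y : carrier (G (g + sh k))"
		"!!x. x : carrier (G g) ==> pw k g (y \<oplus>\<^sub>(G g) x) = pw k g y \<oplus>\<^sub>(G (g + sh k)) pw k g x"
		"!!a. a : carrier Q ==> pw k g (a \<odot>\<^sub>(G g) y) = a \<odot>\<^sub>(G (g + sh k)) pw k g y"
	using assms linear_pw[of g k] by (auto simp: linear_closed linear_add linear_smult)

lemma ladder_closed: "closed_family Q G ops (ladder k)"
proof (induct k)
	case 0
	have "ladder 0 = B" by (rule ext) simp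
	thus ?case using closed_family_mono[OF B] by auto
next
	case (Suc k)
	note Ld = closedD[OF Suc]
	show ?case
	proof (rule closedI)
		fix g x assume x: "x : ladder (Suc k) g"
		interpret module Q "G g" by (rule G_module)
		have "u \<oplus>\<^sub>(G g) pw k g' y : carrier (G g)" if "g = g' + sh k" "u : ladder k g" "y : H g'" for u g' y
			using that Ld(1)[OF that(2)] pw_linear_simps(1)[OF Hd(1)[OF that(3)], of k] by (intro M.a_closed) auto
		thus "x : carrier (G g)"
			using x Ld(1) by auto
		consider "x : ladder k g" "\<not> (EX g'. g = g' + sh k)" | u g' y where "g = g' + sh k" "u : ladder k g" "y : H g'"
			"x = u \<oplus>\<^sub>(G g) pw k g' y"
		proof -
			{ fix g' assume g': "g = g' + sh k" and x': "x : ladder k g"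
			have "pw k g' \<zero>\<^sub>(G g') = \<zero>\<^sub>(G g)"
			using linear_zero[OF G_module G_module linear_pw[of g' k]] g' by simp
			hence "x = x \<oplus>\<^sub>(G g) pw k g' \<zero>\<^sub>(G g')"
			using M.r_zero[OF Ld(1)[OF x']] by simp
			hence "EX u g' y. g = g' + sh k & u : ladder k g & y : H g' & x = u \<oplus>\<^sub>(G g) pw k g' y"
			using g' x' Hd(2) by metis }
			thus thesis using x that by (cases "x : ladder k g") auto
		qed note cs = this
		{ fix z assume z: "z : ladder (Suc k) g"
			show "x \<oplus>\<^sub>(G g) z : ladder (Suc k) g"
			proof (cases rule: cs)
			case 1
			thus ?thesis using z Ld(3) by auto
			next
			case (2 u g' y)
			hence g: "g = g' + sh k" by simp
			have uc: "u : carrier (G g)" and yc: "y : carrier (G g')" using 2 Ld(1) Hd(1) by auto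
			have pc: "pw k g' y : carrier (G g)" using pw_linear_simps(1)[OF yc] g by simp
			consider "z : ladder k g" | v y' where "v : ladder k g" "y' : H g'" "z = v \<oplus>\<^sub>(G g) pw k g' y'"
			using z g by (auto dest!: add_right_imp_eq)
			thus ?thesis
			proof cases
			case 1
			have "x \<oplus>\<^sub>(G g) z = (u \<oplus>\<^sub>(G g) z) \<oplus>\<^sub>(G g) pw k g' y"
			unfolding 2(4) using uc Ld(1)[OF 1] pc by (simp add: M.a_ac)
			thus ?thesis using ladder_I[of "u \<oplus>\<^sub>(G g) z" k g' y] Ld(3)[OF 2(2) 1] 2 g by simp
			next
			case (2 v y')
			note two = \<open>u : ladder k g\<close> \<open>y : H g'\<close> \<open>x = u \<oplus>\<^sub>(G g) pw k g' y\<close>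
			have c: "v : carrier (G g)" "y' : carrier (G g')" using 2 Ld(1) Hd(1) by auto
			have pc': "pw k g' y' : carrier (G g)" using pw_linear_simps(1)[OF c(2)] g by simp
			have "pw k g' (y \<oplus>\<^sub>(G g') y') = pw k g' y \<oplus>\<^sub>(G g) pw k g' y'"
			using pw_linear_simps(2)[OF yc c(2)] g by simp
			hence "x \<oplus>\<^sub>(G g) z = (u \<oplus>\<^sub>(G g) v) \<oplus>\<^sub>(G g) pw k g' (y \<oplus>\<^sub>(G g') y')"
			unfolding two(3) 2(3) using uc c pc pc' by (simp add: M.a_ac)
			thus ?thesis
			using ladder_I[of "u \<oplus>\<^sub>(G g) v" k g' "y \<oplus>\<^sub>(G g') y'"] Ld(3) Hd(3) two 2 g by simp
			qed
			qed }
		{ fix a assume a: "a : carrier Q"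
			show "a \<odot>\<^sub>(G g) x : ladder (Suc k) g"
			proof (cases rule: cs)
			case 1
			thus ?thesis using a Ld(5) by auto
			next
			case (2 u g' y)
			hence g: "g = g' + sh k" by simp
			have uc: "u : carrier (G g)" and yc: "y : carrier (G g')" using 2 Ld(1) Hd(1) by auto
			have "a \<odot>\<^sub>(G g) x = a \<odot>\<^sub>(G g) u \<oplus>\<^sub>(G g) pw k g' (a \<odot>\<^sub>(G g') y)"
			unfolding 2(4) using uc a pw_linear_simps(1)[OF yc, of k, folded g] pw_linear_simps(3)[OF yc a, of k, folded g]
			by (simp add: smult_r_distr)
			thus ?thesis
			using ladder_I[of "a \<odot>\<^sub>(G g) u" k g' "a \<odot>\<^sub>(G g') y"] Ld(5)[OF a 2(2)] Hd(5)[OF a 2(3)] g by simp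
			qed }
		{ fix r \<phi> assume p: "(r, \<phi>) : ops"
			show "\<phi> g x : ladder (Suc k) (g + r)"
			proof (cases rule: cs)
			case 1
			thus ?thesis using p Ld(6) by auto
			next
			case (2 u g' y)
			hence g: "g = g' + sh k" by simp
			have e: "g + r = g' + r + sh k" using g by (simp add: ac_simps)
			have uc: "u : carrier (G g)" and yc: "y : carrier (G g')" using 2 Ld(1) Hd(1) by auto
			interpret r: module Q "G (g + r)" by (rule G_module)
			have l: "linear_map Q (G g) (G (g + r)) (\<phi> g)" by (rule linear_opsD[OF linear_ops p])
			have py: "\<phi> g' y : H (g' + r)" by (rule Hd(6)[OF p 2(3)])
			have "cong_mod B (g + r) (\<phi> g (pw k g' y)) (pw k (g' + r) (\<phi> g' y))"
			using pw_commutes[OF p, of y g' k] 2(3) H_Z e g by auto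
			hence b: "\<phi> g (pw k g' y) \<ominus>\<^sub>(G (g + r)) pw k (g' + r) (\<phi> g' y) : B (g + r)"
			by (simp add: cong_mod_def)
			have c: "pw k (g' + r) (\<phi> g' y) : carrier (G (g + r))"
			using pw_linear_simps(1)[OF Hd(1)[OF py], of k] e by simp
			have "\<phi> g x = \<phi> g u \<oplus>\<^sub>(G (g + r)) \<phi> g (pw k g' y)"
			unfolding 2(4) using linear_add[OF l uc] pw_linear_simps(1)[OF yc] g by simp
			also have "... = (\<phi> g u \<oplus>\<^sub>(G (g + r)) (\<phi> g (pw k g' y) \<ominus>\<^sub>(G (g + r)) pw k (g' + r) (\<phi> g' y)))
			\<oplus>\<^sub>(G (g + r)) pw k (g' + r) (\<phi> g' y)"
			using c linear_closed[OF l uc] linear_closed[OF l, of "pw k g' y"] pw_linear_simps(1)[OF yc, of k] g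
			by (intro add_diff_regroup) auto
			finally have x': "\<phi> g x = (\<phi> g u \<oplus>\<^sub>(G (g + r)) (\<phi> g (pw k g' y) \<ominus>\<^sub>(G (g + r)) pw k (g' + r) (\<phi> g' y)))
			\<oplus>\<^sub>(G (g + r)) pw k (g' + r) (\<phi> g' y)" .
			have "B (g + r) <= ladder k (g + r)" using ladder_mono[of 0 k "g + r"] by simp
			hence "\<phi> g u \<oplus>\<^sub>(G (g + r)) (\<phi> g (pw k g' y) \<ominus>\<^sub>(G (g + r)) pw k (g' + r) (\<phi> g' y)) : ladder k (g + r)"
			using b Ld(3) Ld(6)[OF p 2(2)] by blast
			thus ?thesis unfolding x' e by (rule ladder_I[OF _ py])
			qed }
	next
		fix g show "\<zero>\<^sub>(G g) : ladder (Suc k) g" using Ld(2) by auto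
	qed
qed

lemmas Ld = closedD[OF ladder_closed]

lemma ladder_\<zeta>: "x : ladder k g ==> \<zeta> g x : ladder (Suc k) (g + s)"
proof (induct k arbitrary: x)
	case 0
	thus ?case using Bd(6)[of s \<zeta> x g] by simp
next
	case (Suc k)
	then consider "x : ladder k g" | u g' y where "g = g' + sh k" "u : ladder k g" "y : H g'" "x = u \<oplus>\<^sub>(G g) pw k g' y"
		by auto
	thus ?case
	proof cases
		case 1
		thus ?thesis using Suc(1)[OF 1] ladder_mono[of "Suc k" "Suc (Suc k)" "g + s"] by (meson le_SucI order_refl subsetD)
	next
		case 2
		have e: "g + s = g' + sh (Suc k)" using 2 by (simp add: ac_simps)
		have "\<zeta> g x = \<zeta> g u \<oplus>\<^sub>(G (g + s)) pw (Suc k) g' y"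
			unfolding 2(4) using linear_add[OF linear] 2 Ld(1) pw_linear_simps(1)[OF Hd(1)[OF 2(3)], of k] by simp
		thus ?thesis using ladder_I[of "\<zeta> g u" "Suc k" g' y] Suc(1)[OF 2(2)] 2(3) e by simp
	qed
qed

definition tower :: "'g => 'x set" where "tower g = (\<Union>k. ladder k g)"

lemma tower_closed: "closed_family Q G (insert (s, \<zeta>) ops) tower"
proof (rule closedI)
	fix g x assume "x : tower g"
	then obtain k where k: "x : ladder k g" by (auto simp: tower_def)
	show "x : carrier (G g)" using k Ld(1) by blast
	show "!!a. a : carrier Q ==> a \<odot>\<^sub>(G g) x : tower g" using Ld(5)[OF _ k] by (auto simp: tower_def)
	{ fix y assume "y : tower g"
		then obtain l where l: "y : ladder l g" by (auto simp: tower_def)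
		have "x : ladder (max k l) g" "y : ladder (max k l) g"
			using k l ladder_mono[of k "max k l" g] ladder_mono[of l "max k l" g] by auto
		from Ld(3)[OF this] show "x \<oplus>\<^sub>(G g) y : tower g" by (auto simp: tower_def) }
	{ fix r \<phi> assume "(r, \<phi>) : insert (s, \<zeta>) ops"
		thus "\<phi> g x : tower (g + r)" using ladder_\<zeta>[OF k] Ld(6)[OF _ k] by (auto simp: tower_def simp del: ladder.simps) }
next
	fix g show "\<zero>\<^sub>(G g) : tower g" using Ld(2) by (auto simp: tower_def)
qed

lemma H_tower: "H g <= tower g"
proof
	fix y assume y: "y : H g"
	interpret module Q "G g" by (rule G_module)
	have "\<zero>\<^sub>(G g) \<oplus>\<^sub>(G g) y : ladder (Suc 0) g" using ladder_I[of "\<zero>\<^sub>(G g)" 0 g y] Bd(2) y by simp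
	thus "y : tower g" unfolding tower_def using Hd(1)[OF y] by (auto simp del: ladder.simps)
qed

lemma tower_Z: "tower g <= Z g"
proof -
	have "x : Z g" if "x : ladder k g" for k x
		using that
	proof (induct k arbitrary: x)
		case (Suc k)
		then consider "x : ladder k g" | u g' y where "g = g' + sh k" "u : ladder k g" "y : H g'" "x = u \<oplus>\<^sub>(G g) pw k g' y"
			by auto
		thus ?case
		proof cases
			case 2
			thus ?thesis using Suc(1) Zd(3) pw_closed[OF Z, of y g' k] H_Z by blast
		qed (rule Suc(1))
	qed (use B_Z in auto)
	thus ?thesis by (auto simp: tower_def)
qed

text \<open>The possible leading coefficients of elements of \<open>U\<close> of formal degree \<open>k\<close>. Applying \<open>\<zeta>\<close> shows that they
increase with \<open>k\<close>.\<close>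

definition lead :: "('g => 'x set) => nat => 'g => 'x set" where
	"lead U k g = {y : H g. EX u:ladder k (g + sh k). u \<oplus>\<^sub>(G (g + sh k)) pw k g y : U (g + sh k)}"

context
	fixes U assumes U: "closed_family Q G (insert (s, \<zeta>) ops) U" and BU: "!!g. B g <= U g"
begin

lemmas Ud = closedD[OF U]

lemma lead_closed: "closed_family Q G ops (lead U k)"
proof (rule closedI)
	fix g x assume x: "x : lead U k g"
	let ?h = "g + sh k"
	interpret module Q "G ?h" by (rule G_module)
	obtain u where u: "x : H g" "u : ladder k ?h" "u \<oplus>\<^sub>(G ?h) pw k g x : U ?h" using x by (auto simp: lead_def)
	have xc: "x : carrier (G g)" and uc: "u : carrier (G ?h)" using u Hd(1) Ld(1) by auto
	show "x : carrier (G g)" by fact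
	{ fix y assume "y : lead U k g"
		then obtain v where v: "y : H g" "v : ladder k ?h" "v \<oplus>\<^sub>(G ?h) pw k g y : U ?h" by (auto simp: lead_def)
		have yc: "y : carrier (G g)" and vc: "v : carrier (G ?h)" using v Hd(1) Ld(1) by auto
		have "(u \<oplus>\<^sub>(G ?h) v) \<oplus>\<^sub>(G ?h) pw k g (x \<oplus>\<^sub>(G g) y) = (u \<oplus>\<^sub>(G ?h) pw k g x) \<oplus>\<^sub>(G ?h) (v \<oplus>\<^sub>(G ?h) pw k g y)"
			using xc uc yc vc by (simp add: pw_linear_simps M.a_ac)
		hence "(u \<oplus>\<^sub>(G ?h) v) \<oplus>\<^sub>(G ?h) pw k g (x \<oplus>\<^sub>(G g) y) : U ?h" using Ud(3) u v by simp
		thus "x \<oplus>\<^sub>(G g) y : lead U k g" using Hd(3) Ld(3) u v by (auto simp: lead_def) }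
	{ fix a assume a: "a : carrier Q"
		have "a \<odot>\<^sub>(G ?h) u \<oplus>\<^sub>(G ?h) pw k g (a \<odot>\<^sub>(G g) x) = a \<odot>\<^sub>(G ?h) (u \<oplus>\<^sub>(G ?h) pw k g x)"
			using xc uc a by (simp add: pw_linear_simps smult_r_distr)
		hence "a \<odot>\<^sub>(G ?h) u \<oplus>\<^sub>(G ?h) pw k g (a \<odot>\<^sub>(G g) x) : U ?h" using Ud(5) u a by simp
		thus "a \<odot>\<^sub>(G g) x : lead U k g" using Hd(5) Ld(5) u a by (auto simp: lead_def) }
	{ fix r \<phi> assume p: "(r, \<phi>) : ops"
		have e: "?h + r = g + r + sh k" by (simp add: ac_simps)
		let ?w = "pw k (g + r) (\<phi> g x)"
		interpret r: module Q "G (?h + r)" by (rule G_module)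
		have l: "linear_map Q (G ?h) (G (?h + r)) (\<phi> ?h)" by (rule linear_opsD[OF linear_ops p])
		have px: "\<phi> g x : H (g + r)" by (rule Hd(6)[OF p u(1)])
		have "cong_mod B (?h + r) (\<phi> ?h (pw k g x)) ?w"
			using pw_commutes[OF p, of x g k] u(1) H_Z e by auto
		hence b: "\<phi> ?h (pw k g x) \<ominus>\<^sub>(G (?h + r)) ?w : B (?h + r)"
			by (simp add: cong_mod_def)
		have c: "?w : carrier (G (?h + r))"
			using pw_linear_simps(1)[OF Hd(1)[OF px], of k] e by simp
		have "\<phi> ?h (u \<oplus>\<^sub>(G ?h) pw k g x) = \<phi> ?h u \<oplus>\<^sub>(G (?h + r)) \<phi> ?h (pw k g x)"
			using linear_add[OF l uc] pw_linear_simps(1)[OF xc] by simp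
		also have "... = (\<phi> ?h u \<oplus>\<^sub>(G (?h + r)) (\<phi> ?h (pw k g x) \<ominus>\<^sub>(G (?h + r)) ?w)) \<oplus>\<^sub>(G (?h + r)) ?w"
			using c linear_closed[OF l uc] linear_closed[OF l, of "pw k g x"] pw_linear_simps(1)[OF xc, of k]
			by (intro add_diff_regroup) auto
		finally have "(\<phi> ?h u \<oplus>\<^sub>(G (?h + r)) (\<phi> ?h (pw k g x) \<ominus>\<^sub>(G (?h + r)) ?w)) \<oplus>\<^sub>(G (?h + r)) ?w : U (?h + r)"
			using Ud(6)[of r \<phi>, OF _ u(3)] p by simp
		moreover have "B (?h + r) <= ladder k (?h + r)" using ladder_mono[of 0 k "?h + r"] by simp
		hence "\<phi> ?h u \<oplus>\<^sub>(G (?h + r)) (\<phi> ?h (pw k g x) \<ominus>\<^sub>(G (?h + r)) ?w) : ladder k (?h + r)"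
			using b Ld(3) Ld(6)[OF p u(2)] by blast
		ultimately show "\<phi> g x : lead U k (g + r)" using px unfolding lead_def e by blast }
next
	fix g
	let ?h = "g + sh k"
	interpret module Q "G ?h" by (rule G_module)
	have "pw k g \<zero>\<^sub>(G g) = \<zero>\<^sub>(G ?h)" by (rule linear_zero[OF G_module G_module linear_pw])
	thus "\<zero>\<^sub>(G g) : lead U k g" using Hd(2) Ld(2) Ud(2) by (auto simp: lead_def intro!: bexI[of _ "\<zero>\<^sub>(G ?h)"])
qed

lemma lead_Suc: "lead U k g <= lead U (Suc k) g"
proof
	fix x assume x: "x : lead U k g"
	let ?h = "g + sh k"
	have e: "?h + s = g + sh (Suc k)" by (simp add: ac_simps)
	obtain u where u: "x : H g" "u : ladder k ?h" "u \<oplus>\<^sub>(G ?h) pw k g x : U ?h" using x by (auto simp: lead_def)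
	have "\<zeta> ?h (u \<oplus>\<^sub>(G ?h) pw k g x) = \<zeta> ?h u \<oplus>\<^sub>(G (?h + s)) pw (Suc k) g x"
		using linear_add[OF linear] Ld(1)[OF u(2)] pw_linear_simps(1)[OF Hd(1)[OF u(1)], of k] by simp
	hence "\<zeta> ?h u \<oplus>\<^sub>(G (?h + s)) pw (Suc k) g x : U (?h + s)" using Ud(6)[of s \<zeta>, OF _ u(3)] by simp
	thus "x : lead U (Suc k) g" using u(1) ladder_\<zeta>[OF u(2)] unfolding lead_def e by blast
qed

lemma lead_mono: "k <= l ==> lead U k g <= lead U l g"
	by (rule lift_Suc_mono_le[of "%k. lead U k g"]) (rule lead_Suc)

lemma B_lead: "B g <= lead U k g"
proof -
	have "B g <= lead U 0 g"
	proof
		fix b assume b: "b : B g"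
		interpret module Q "G g" by (rule G_module)
		show "b : lead U 0 g"
			using b Bd(2)[of g] BU[of g] B_H[of g] Bd(1)[OF b] by (auto simp: lead_def intro!: bexI[of _ "\<zero>\<^sub>(G g)"])
	qed
	thus ?thesis using lead_mono[of 0 k g] by blast
qed

end

text \<open>The classical argument with leading coefficients. The families \<open>lead U k\<close> increase in the noetherian
family \<open>H\<close>, hence become stationary at some \<open>K\<close>. Elements of \<open>U\<close> whose leading coefficients generate \<open>lead U k\<close>
for \<open>k \<le> K\<close> generate \<open>U\<close>: if \<open>W\<close> contains them, then \<open>U\<close> and \<open>U \<inter> W\<close> have the same leading
coefficients, and an element of \<open>U\<close> is moved down the ladder by subtracting elements of \<open>U \<inter> W\<close>.\<close>

theorem noetherian_step:
	assumes n: "noetherian_family Q G ops H B"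
	shows "noetherian_family Q G (insert (s, \<zeta>) ops) tower B"
	unfolding noetherian_family_def
proof (intro allI impI)
	fix U assume "closed_family Q G (insert (s, \<zeta>) ops) U & B <= U & U <= tower"
	hence U: "closed_family Q G (insert (s, \<zeta>) ops) U" and BU: "!!g. B g <= U g" and UT: "!!g. U g <= tower g"
		by (auto simp: le_fun_def)
	note Vc = lead_closed[OF U BU] and Vm = lead_mono[OF U BU] and BV = B_lead[OF U BU]
	define V where "V g = (\<Union>k. lead U k g)" for g
	have "closed_family Q G ops V"
	proof (rule closedI)
		fix g x assume "x : V g"
		then obtain k where k: "x : lead U k g" by (auto simp: V_def)
		show "x : carrier (G g)" using k closedD(1)[OF Vc] by blast
		show "!!a. a : carrier Q ==> a \<odot>\<^sub>(G g) x : V g" using closedD(5)[OF Vc _ k] by (auto simp: V_def)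
		show "!!r \<phi>. (r, \<phi>) : ops ==> \<phi> g x : V (g + r)" using closedD(6)[OF Vc _ k] by (auto simp: V_def)
		{ fix y assume "y : V g"
			then obtain l where l: "y : lead U l g" by (auto simp: V_def)
			have "x : lead U (max k l) g" "y : lead U (max k l) g"
			using k l Vm[of k "max k l" g] Vm[of l "max k l" g] by auto
			from closedD(3)[OF Vc this] show "x \<oplus>\<^sub>(G g) y : V g" by (auto simp: V_def) }
	next
		fix g show "\<zero>\<^sub>(G g) : V g" using closedD(2)[OF Vc] by (auto simp: V_def)
	qed
	moreover have "B <= V" using BV by (auto simp: V_def le_fun_def)
	moreover have "V <= H" by (auto simp: V_def le_fun_def lead_def)
	ultimately have "fin_gen_family Q G ops V B" by (rule noetherian_familyD[OF n])
	then obtain S0 where S0: "finite S0" "S0 <= Sigma UNIV V"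
		"!!W. closed_family Q G ops W ==> B <= W ==> S0 <= Sigma UNIV W ==> V <= W"
		unfolding fin_gen_family_def by blast
	have "EX K. S0 <= Sigma UNIV (lead U K)"
		using S0(1,2)
	proof (induct S0 rule: finite_induct)
		case (insert p S)
		then obtain K where K: "S <= Sigma UNIV (lead U K)" by auto
		from insert obtain l where l: "snd p : lead U l (fst p)" by (auto simp: V_def)
		have "insert p S <= Sigma UNIV (lead U (max K l))"
			using K l Vm[of K "max K l"] Vm[of l "max K l"] by (cases p) fastforce
		thus ?case by blast
	qed simp
	then obtain K where K: "S0 <= Sigma UNIV (lead U K)" by blast
	have "V <= lead U K" by (rule S0(3)[OF Vc _ K]) (use BV in "auto simp: le_fun_def")
	hence VK: "lead U k g <= lead U K g" for k g by (auto simp: V_def le_fun_def)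
	have "ALL k. EX S. finite S & S <= Sigma UNIV (lead U k) &
			(ALL W. closed_family Q G ops W & B <= W & S <= Sigma UNIV W --> lead U k <= W)"
	proof
		fix k
		have "fin_gen_family Q G ops (lead U k) B"
			by (rule noetherian_familyD[OF n Vc]) (use BV in "auto simp: le_fun_def lead_def")
		thus "EX S. finite S & S <= Sigma UNIV (lead U k) &
			(ALL W. closed_family Q G ops W & B <= W & S <= Sigma UNIV W --> lead U k <= W)"
			unfolding fin_gen_family_def .
	qed
	then obtain S where S: "!!k. finite (S k)" "!!k. S k <= Sigma UNIV (lead U k)"
		"!!k W. closed_family Q G ops W ==> B <= W ==> S k <= Sigma UNIV W ==> lead U k <= W"
		by metis
	have "ALL k. ALL p:S k. EX u. u : ladder k (fst p + sh k) &
			u \<oplus>\<^sub>(G (fst p + sh k)) pw k (fst p) (snd p) : U (fst p + sh k)"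
		using S(2) by (fastforce simp: lead_def)
	then obtain u where u: "!!k p. p : S k ==> u k p : ladder k (fst p + sh k)"
			"!!k p. p : S k ==> u k p \<oplus>\<^sub>(G (fst p + sh k)) pw k (fst p) (snd p) : U (fst p + sh k)"
		by metis
	let ?gen = "%k p. (fst p + sh k, u k p \<oplus>\<^sub>(G (fst p + sh k)) pw k (fst p) (snd p))"
	let ?S = "\<Union>k\<in>{..K}. ?gen k ` S k"
	show "fin_gen_family Q G (insert (s, \<zeta>) ops) U B"
		unfolding fin_gen_family_def
	proof (intro exI[of _ ?S] conjI allI impI)
		show "finite ?S" using S(1) by auto
		show "?S <= Sigma UNIV U" using u(2) by auto
		fix W assume "closed_family Q G (insert (s, \<zeta>) ops) W & B <= W & ?S <= Sigma UNIV W"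
		hence W: "closed_family Q G (insert (s, \<zeta>) ops) W" and BW: "!!g. B g <= W g" and SW: "?S <= Sigma UNIV W"
			by (auto simp: le_fun_def)
		let ?UW = "%g. U g Int W g"
		have UW: "closed_family Q G (insert (s, \<zeta>) ops) ?UW" by (rule closed_family_inf[OF G_module U W])
		have BUW: "B g <= ?UW g" for g using BU BW by auto
		have small: "lead U k <= lead ?UW k" if "k <= K" for k
		proof (rule S(3)[OF lead_closed[OF UW BUW]])
			show "B <= lead ?UW k" using B_lead[OF UW BUW] by (auto simp: le_fun_def)
			show "S k <= Sigma UNIV (lead ?UW k)"
			proof
			fix p assume p: "p : S k"
			have "snd p : H (fst p)" using S(2)[of k] p by (auto simp: lead_def)
			moreover have "?gen k p : Sigma UNIV W" using SW p that by blast
			hence "u k p \<oplus>\<^sub>(G (fst p + sh k)) pw k (fst p) (snd p) : ?UW (fst p + sh k)" using u(2)[OF p] by simp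
			ultimately show "p : Sigma UNIV (lead ?UW k)" using u(1)[OF p] by (cases p) (auto simp: lead_def)
			qed
		qed
		have all: "lead U k g <= lead ?UW k g" for k g
		proof (cases "k <= K")
			case True
			thus ?thesis using small by (auto simp: le_fun_def)
		next
			case False
			thus ?thesis using VK[of k g] small[of K] lead_mono[OF UW BUW, of K k g] by (fastforce simp: le_fun_def)
		qed
		have "x : W g" if "x : ladder k g" "x : U g" for k g x
			using that
		proof (induct k arbitrary: x)
			case 0
			thus ?case using BW by auto
		next
			case (Suc k)
			interpret module Q "G g" by (rule G_module)
			from Suc(2) consider "x : ladder k g" | v g' y where "g = g' + sh k" "v : ladder k g" "y : H g'" "x = v \<oplus>\<^sub>(G g) pw k g' y"
			by auto
			thus ?case
			proof cases
			case 1
			thus ?thesis using Suc by simp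
			next
			case 2
			hence "y : lead U k g'" using Suc(3) by (auto simp: lead_def)
			hence "y : lead ?UW k g'" using all by blast
			then obtain v' where v': "v' : ladder k g" "v' \<oplus>\<^sub>(G g) pw k g' y : U g" "v' \<oplus>\<^sub>(G g) pw k g' y : W g"
			using 2(1) by (auto simp: lead_def)
			have c: "v : carrier (G g)" "v' : carrier (G g)" "pw k g' y : carrier (G g)"
			using 2 v' Ld(1) pw_linear_simps(1)[OF Hd(1)[OF 2(3)], of k] by auto
			have "x \<ominus>\<^sub>(G g) (v' \<oplus>\<^sub>(G g) pw k g' y) = v \<ominus>\<^sub>(G g) v'"
			unfolding 2(4) using c by (simp add: a_minus_def M.minus_add M.a_ac M.r_neg M.r_neg1 M.r_neg2)
			hence "x \<ominus>\<^sub>(G g) (v' \<oplus>\<^sub>(G g) pw k g' y) : W g"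
			using Suc(1)[OF Ld(4)[OF 2(2) v'(1)]] closedD(4)[OF U Suc(3) v'(2)] by simp
			hence "(v' \<oplus>\<^sub>(G g) pw k g' y) \<oplus>\<^sub>(G g) (x \<ominus>\<^sub>(G g) (v' \<oplus>\<^sub>(G g) pw k g' y)) : W g"
			using closedD(3)[OF W v'(3)] by blast
			also have "(v' \<oplus>\<^sub>(G g) pw k g' y) \<oplus>\<^sub>(G g) (x \<ominus>\<^sub>(G g) (v' \<oplus>\<^sub>(G g) pw k g' y)) = x"
			proof -
			have "a \<oplus>\<^sub>(G g) (x \<ominus>\<^sub>(G g) a) = x" if "a : carrier (G g)" "x : carrier (G g)" for a
			using that by (simp add: a_minus_def M.a_comm[of a] M.a_assoc M.l_neg)
			thus ?thesis using c 2(4) by simp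
			qed
			finally show ?thesis .
			qed
		qed
		thus "U <= W" using UT by (fastforce simp: le_fun_def tower_def)
	qed
qed

end

context module_family begin

text \<open>Start with the span of the generators over the ring, which is noetherian, and adjoin the operators one by one. The
resulting family is closed under all operators and contains the generators, so it is all of \<open>Z\<close>.\<close>

theorem fin_gen_imp_noetherian:
	assumes noeth: "noetherian_ring Q" and fin: "finite ops" and lops: "linear_ops ops"
		and Z: "closed_family Q G ops Z" and B: "closed_family Q G ops B" and BZ: "B <= Z"
		and com: "!!p q. p : ops ==> q : ops ==> commutes_mod Z B p q"
		and fg: "fin_gen_family Q G ops Z B"
	shows "noetherian_family Q G ops Z B"
proof -
	obtain S where S: "finite S" "S <= Sigma UNIV Z"
		"!!U. closed_family Q G ops U ==> B <= U ==> S <= Sigma UNIV U ==> Z <= U"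
		using fg unfolding fin_gen_family_def by blast
	have "EX Y. closed_family Q G ops' Y & B <= Y & Y <= Z & S <= Sigma UNIV Y & noetherian_family Q G ops' Y B"
		if "finite ops'" "ops' <= ops" for ops'
		using that
	proof (induct ops' rule: finite_induct)
		case empty
		have B0: "closed_family Q G {} B" by (rule closed_family_mono[OF B]) simp
		have Z0: "closed_family Q G {} Z" by (rule closed_family_mono[OF Z]) simp
		have "!!g x. (g, x) : S ==> x : carrier (G g)" using S(2) closedD(1)[OF Z] by blast
		from noetherian_span[OF noeth B0 S(1) this] obtain Y where Y: "closed_family Q G {} Y" "B <= Y"
			"S <= Sigma UNIV Y" "noetherian_family Q G {} Y B"
			"!!W. closed_family Q G {} W ==> B <= W ==> S <= Sigma UNIV W ==> Y <= W"
			by blast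
		thus ?case using Y(5)[OF Z0 BZ S(2)] by blast
	next
		case (insert p ops')
		obtain s \<zeta> where p: "p = (s, \<zeta>)" by (cases p)
		from insert obtain Y where Y: "closed_family Q G ops' Y" "B <= Y" "Y <= Z" "S <= Sigma UNIV Y"
			"noetherian_family Q G ops' Y B" by auto
		have sub: "insert (s, \<zeta>) ops' <= ops" using insert p by auto
		interpret hilbert_step Q G ops' s \<zeta> Y B Z
		proof (unfold_locales)
			show "linear_ops ops'" using lops sub by blast
			show "!!g. linear_map Q (G g) (G (g + s)) (\<zeta> g)" using lops sub by blast
			show "closed_family Q G (insert (s, \<zeta>) ops') B" by (rule closed_family_mono[OF B sub])
			show "closed_family Q G (insert (s, \<zeta>) ops') Z" by (rule closed_family_mono[OF Z sub])
			show "!!p. p : ops' ==> commutes_mod Z B (s, \<zeta>) p" using com sub by blast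
		qed (use Y in "auto simp: le_fun_def")
		show ?case
		proof (intro exI[of _ tower] conjI)
			show "S <= Sigma UNIV tower" using Y(4) H_tower by blast
			show "B <= tower" using H_tower B_H by (fastforce simp: le_fun_def)
			show "tower <= Z" using tower_Z by (auto simp: le_fun_def)
		qed (use tower_closed noetherian_step[OF Y(5)] p in auto)
	qed
	from this[OF fin order_refl] obtain Y where Y: "closed_family Q G ops Y" "B <= Y" "Y <= Z" "S <= Sigma UNIV Y"
		"noetherian_family Q G ops Y B" by blast
	have "Y = Z" using Y(3) S(3)[OF Y(1,2,4)] by (rule antisym)
	thus ?thesis using Y(5) by simp
qed

end

text \<open>If \<open>S\<close> generates \<open>Z\<close> modulo the image \<open>D\<close> of \<open>\<zeta>\<close>, it generates \<open>Z\<close> when \<open>\<zeta>\<close> is an operator: by induction on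
the first degree, the element that \<open>\<zeta>\<close> is applied to has smaller degree, and negative degrees are trivial.\<close>

lemma graded_nakayama:
	fixes G :: "int \<times> nat => ('q, 'x) module"
	assumes "module_family Q G"
		and lops: "ALL (s, \<phi>):ops. ALL g. linear_map Q (G g) (G (g + s)) (\<phi> g)"
		and lin: "!!g. linear_map Q (G g) (G (g + (2, 0))) (\<zeta> g)"
		and Z: "closed_family Q G (insert ((2, 0), \<zeta>) ops) Z"
		and B: "closed_family Q G (insert ((2, 0), \<zeta>) ops) B"
		and com: "!!p. p : ops ==> module_family.commutes_mod G Z B ((2, 0), \<zeta>) p"
		and neg: "!!i n. i < 0 ==> Z (i, n) <= B (i, n)"
		and D: "!!i n. D (i, n) = {b \<oplus>\<^sub>(G (i, n)) \<zeta> (i - 2, n) y | b y. b : B (i, n) & y : Z (i - 2, n)}"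
		and fg: "fin_gen_family Q G ops Z D"
	shows "fin_gen_family Q G (insert ((2, 0), \<zeta>) ops) Z B"
proof -
	interpret module_family Q G by fact
	note Zd = closedD[OF Z] and Bd = closedD[OF B]
	have l2: "linear_map Q (G (i - 2, n)) (G (i, n)) (\<zeta> (i - 2, n))" for i n using lin[of "(i - 2, n)"] by simp
	have BD: "B <= D"
	proof (intro le_funI subsetI)
		fix g b assume b: "b : B g"
		obtain i n where g: "g = (i, n)" by (cases g)
		interpret module Q "G (i, n)" by (rule G_module)
		have "b \<oplus>\<^sub>(G g) \<zeta> (i - 2, n) \<zero>\<^sub>(G (i - 2, n)) : D g" unfolding g D using b Zd(2) g by blast
		thus "b : D g" using linear_zero[OF G_module G_module l2] b Bd(1)[OF b] g by simp
	qed
	have Dc: "closed_family Q G ops D"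
	proof (rule closedI)
		fix g x assume x: "x : D g"
		obtain i n where g: "g = (i, n)" by (cases g)
		interpret module Q "G g" by (rule G_module)
		obtain b y where xy: "x = b \<oplus>\<^sub>(G g) \<zeta> (i - 2, n) y" "b : B g" "y : Z (i - 2, n)" using x unfolding g D by blast
		note l = l2[of i n, folded g]
		have c: "b : carrier (G g)" "y : carrier (G (i - 2, n))" "\<zeta> (i - 2, n) y : carrier (G g)"
			using xy Bd(1) Zd(1) linear_closed[OF l] by auto
		show "x : carrier (G g)" using xy(1) c by simp
		{ fix a assume a: "a : carrier Q"
			have "a \<odot>\<^sub>(G g) x = a \<odot>\<^sub>(G g) b \<oplus>\<^sub>(G g) \<zeta> (i - 2, n) (a \<odot>\<^sub>(G (i - 2, n)) y)"
			unfolding xy(1) using c a linear_smult[OF l] by (simp add: smult_r_distr)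
			thus "a \<odot>\<^sub>(G g) x : D g" using Bd(5)[OF a xy(2)] Zd(5)[OF a xy(3)] unfolding g D by blast }
		{ fix x' assume "x' : D g"
			then obtain b' y' where xy': "x' = b' \<oplus>\<^sub>(G g) \<zeta> (i - 2, n) y'" "b' : B g" "y' : Z (i - 2, n)" unfolding g D by blast
			have c': "b' : carrier (G g)" "y' : carrier (G (i - 2, n))" "\<zeta> (i - 2, n) y' : carrier (G g)"
			using xy' Bd(1) Zd(1) linear_closed[OF l] by auto
			have "x \<oplus>\<^sub>(G g) x' = (b \<oplus>\<^sub>(G g) b') \<oplus>\<^sub>(G g) \<zeta> (i - 2, n) (y \<oplus>\<^sub>(G (i - 2, n)) y')"
			unfolding xy(1) xy'(1) using c c' linear_add[OF l] by (simp add: M.a_ac)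
			thus "x \<oplus>\<^sub>(G g) x' : D g" using Bd(3)[OF xy(2) xy'(2)] Zd(3)[OF xy(3) xy'(3)] unfolding g D by blast }
		{ fix s \<phi> assume p: "(s, \<phi>) : ops"
			obtain i' n' where gs: "g + s = (i', n')" by (cases "g + s")
			have e: "(i - 2, n) + s = (i' - 2, n')" "(i - 2, n) + s + (2, 0) = g + s" "(i - 2, n) + (2, 0) = g"
			using gs g by (cases s; auto)+
			have lp: "linear_map Q (G g) (G (g + s)) (\<phi> g)" using lops p by blast
			have "cong_mod B (g + s) (\<zeta> (i' - 2, n') (\<phi> (i - 2, n) y)) (\<phi> g (\<zeta> (i - 2, n) y))"
			using com[OF p] xy(3) unfolding commutes_mod_def prod.case by (metis e)
			from cong_mod_sym[OF B this]
			have m: "\<phi> g (\<zeta> (i - 2, n) y) \<ominus>\<^sub>(G (g + s)) \<zeta> (i' - 2, n') (\<phi> (i - 2, n) y) : B (g + s)"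
			"\<zeta> (i' - 2, n') (\<phi> (i - 2, n) y) : carrier (G (g + s))"
			by (auto simp: cong_mod_def)
			have "\<phi> g x = \<phi> g b \<oplus>\<^sub>(G (g + s)) \<phi> g (\<zeta> (i - 2, n) y)"
			unfolding xy(1) by (rule linear_add[OF lp c(1,3)])
			also have "... = (\<phi> g b \<oplus>\<^sub>(G (g + s)) (\<phi> g (\<zeta> (i - 2, n) y) \<ominus>\<^sub>(G (g + s)) \<zeta> (i' - 2, n') (\<phi> (i - 2, n) y)))
			\<oplus>\<^sub>(G (g + s)) \<zeta> (i' - 2, n') (\<phi> (i - 2, n) y)"
			by (rule add_diff_regroup) (use linear_closed[OF lp] c m(2) in auto)
			finally have *: "\<phi> g x = ..." .
			have "\<phi> g b \<oplus>\<^sub>(G (g + s)) (\<phi> g (\<zeta> (i - 2, n) y) \<ominus>\<^sub>(G (g + s)) \<zeta> (i' - 2, n') (\<phi> (i - 2, n) y)) : B (g + s)"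
			using Bd(3)[OF Bd(6)[OF _ xy(2)] m(1)] p by blast
			moreover have "\<phi> (i - 2, n) y : Z (i' - 2, n')" using Zd(6)[OF _ xy(3), of s \<phi>] p e by auto
			ultimately show "\<phi> g x : D (g + s)" unfolding * unfolding gs D by blast }
	next
		fix g show "\<zero>\<^sub>(G g) : D g" using BD Bd(2)[of g] unfolding le_fun_def by blast
	qed
	obtain S where S: "finite S" "S <= Sigma UNIV Z"
		"!!U. closed_family Q G ops U ==> D <= U ==> S <= Sigma UNIV U ==> Z <= U"
		using fg unfolding fin_gen_family_def by blast
	show ?thesis
		unfolding fin_gen_family_def
	proof (intro exI[of _ S] conjI allI impI)
		show "finite S" "S <= Sigma UNIV Z" by fact+
		fix W assume "closed_family Q G (insert ((2, 0), \<zeta>) ops) W & B <= W & S <= Sigma UNIV W"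
		hence W: "closed_family Q G (insert ((2, 0), \<zeta>) ops) W" and BW: "!!g. B g <= W g" and SW: "S <= Sigma UNIV W"
			by (auto simp: le_fun_def)
		have W0: "closed_family Q G ops W" by (rule closed_family_mono[OF W]) auto
		note F = family_sum_closed[OF lops W0 Dc]
		have "Z <= family_sum G W D"
			by (rule S(3)[OF F(1) F(3)]) (use SW F(2) in "fastforce simp: le_fun_def")
		hence ZW: "Z g <= family_sum G W D g" for g unfolding le_fun_def by blast
		have "i < int k --> Z (i, n) <= W (i, n)" for k i n
		proof (induct k arbitrary: i)
			case 0
			thus ?case using neg[of i n] BW[of "(i, n)"] by auto
		next
			case (Suc k)
			show ?case
			proof (intro impI subsetI)
			fix z assume i: "i < int (Suc k)" and z: "z : Z (i, n)"
			have "z : family_sum G W D (i, n)" using ZW z by blast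
			then obtain w b y where w: "w : W (i, n)" "b : B (i, n)" "y : Z (i - 2, n)"
			"z = w \<oplus>\<^sub>(G (i, n)) (b \<oplus>\<^sub>(G (i, n)) \<zeta> (i - 2, n) y)"
			unfolding family_sum_def D by blast
			have "y : W (i - 2, n)" using Suc[of "i - 2"] i w(3) by auto
			hence "\<zeta> (i - 2, n) y : W (i, n)" using closedD(6)[OF W, of "(2, 0)" \<zeta> y "(i - 2, n)"] by simp
			thus "z : W (i, n)" unfolding w(4) using closedD(3)[OF W] w BW by blast
			qed
		qed
		hence "Z (i, n) <= W (i, n)" for i n
			using reals_Archimedean2[of "real_of_int i"] by (metis of_int_less_iff of_int_of_nat_eq)
		thus "Z <= W" by (auto simp: le_fun_def)
	qed
qed

section \<open>Dual bases and spans of regular sequences\<close>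

text \<open>Projectivity in the form of the dual basis lemma. Free modules of finite rank, their direct sums and arbitrary
projective modules then share one notion, and lifting along surjections becomes a formula.\<close>

definition dual_basis ::
		"('q, 'k) ring_scheme => ('q, 'p) module => 'j set => ('j => 'p) => ('p => 'j => 'q) => bool" where
	"dual_basis Q P J b lam \<longleftrightarrow> b : J \<rightarrow> carrier P &
		(ALL x:carrier P. lam x : J \<rightarrow> carrier Q & finite {j : J. lam x j ~= \<zero>\<^sub>Q} &
			x = (\<Oplus>\<^sub>P j\<in>{j : J. lam x j ~= \<zero>\<^sub>Q}. lam x j \<odot>\<^sub>P b j)) &
		(ALL x:carrier P. ALL y:carrier P. ALL j:J. lam (x \<oplus>\<^sub>P y) j = lam x j \<oplus>\<^sub>Q lam y j) &
		(ALL a:carrier Q. ALL x:carrier P. ALL j:J. lam (a \<odot>\<^sub>P x) j = a \<otimes>\<^sub>Q lam x j)"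

lemma (in module) finsum_support:
	assumes "finite K" "K <= J" "{j : J. l j ~= \<zero>\<^sub>R} <= K" "l : J \<rightarrow> carrier R" "v : J \<rightarrow> carrier M"
	shows "(\<Oplus>\<^sub>M j\<in>{j : J. l j ~= \<zero>\<^sub>R}. l j \<odot>\<^sub>M v j) = (lincomb M K l v)"
proof (rule M.add.finprod_mono_neutral_cong_left)
	fix i assume "i : K - {j : J. l j ~= \<zero>\<^sub>R}"
	hence "l i = \<zero>\<^sub>R" "i : J" using assms(2) by auto
	thus "l i \<odot>\<^sub>M v i = \<zero>\<^sub>M" using funcset_mem[OF assms(5), of i] by simp
qed (use assms in "auto simp: Pi_iff subset_iff")

lemma coordinate_sum_linear:
	assumes "module Q P" "module Q U" "u : J \<rightarrow> carrier U"
		and lam: "!!x j. x : carrier P ==> j : J ==> lam x j : carrier Q"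
		and fin: "!!x. x : carrier P ==> finite {j : J. lam x j ~= \<zero>\<^sub>Q}"
		and lam_add: "!!x y j. x : carrier P ==> y : carrier P ==> j : J ==> lam (x \<oplus>\<^sub>P y) j = lam x j \<oplus>\<^sub>Q lam y j"
		and lam_smult: "!!a x j. a : carrier Q ==> x : carrier P ==> j : J ==> lam (a \<odot>\<^sub>P x) j = a \<otimes>\<^sub>Q lam x j"
	defines "k == %x. \<Oplus>\<^sub>U j\<in>{j : J. lam x j ~= \<zero>\<^sub>Q}. lam x j \<odot>\<^sub>U u j"
	shows "linear_map Q P U k"
proof -
	interpret P: module Q P by fact
	interpret U: module Q U by fact
	have u: "u j : carrier U" if "j : J" for j using assms(3) that by auto
	have k: "k x = (lincomb U K (lam x) u)"
		if "x : carrier P" "finite K" "K <= J" "{j : J. lam x j ~= \<zero>\<^sub>Q} <= K" for x K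
		unfolding k_def by (rule U.finsum_support) (use that lam u in auto)
	show ?thesis
	proof (rule linear_mapI)
		fix x assume x: "x : carrier P"
		show "k x : carrier U" unfolding k_def using x lam u by (intro U.M.finsum_closed) auto
		{ fix a assume a: "a : carrier Q"
			let ?K = "{j : J. lam x j ~= \<zero>\<^sub>Q}"
			have l: "lam (a \<odot>\<^sub>P x) j = a \<otimes>\<^sub>Q lam x j" if "j : J" for j using lam_smult a x that by auto
			have "k (a \<odot>\<^sub>P x) = (lincomb U ?K (lam (a \<odot>\<^sub>P x)) u)"
			by (rule k) (use a x fin l in auto)
			also have "... = (\<Oplus>\<^sub>U j\<in>?K. a \<odot>\<^sub>U (lam x j \<odot>\<^sub>U u j))"
			by (rule U.M.finsum_cong') (use a x lam u l in "auto simp: U.smult_assoc1")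
			also have "... = a \<odot>\<^sub>U k x"
			unfolding k_def by (rule U.finsum_smult_ldistr[symmetric]) (use a x lam u fin in auto)
			finally show "k (a \<odot>\<^sub>P x) = a \<odot>\<^sub>U k x" . }
		{ fix y assume y: "y : carrier P"
			let ?K = "{j : J. lam x j ~= \<zero>\<^sub>Q} Un {j : J. lam y j ~= \<zero>\<^sub>Q}"
			have l: "lam (x \<oplus>\<^sub>P y) j = lam x j \<oplus>\<^sub>Q lam y j" if "j : J" for j using lam_add x y that by auto
			have f: "finite ?K" using fin x y by auto
			have "k (x \<oplus>\<^sub>P y) = (lincomb U ?K (lam (x \<oplus>\<^sub>P y)) u)"
			by (rule k) (use x y f l in auto)
			also have "... = (\<Oplus>\<^sub>U j\<in>?K. lam x j \<odot>\<^sub>U u j \<oplus>\<^sub>U lam y j \<odot>\<^sub>U u j)"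
			by (rule U.M.finsum_cong') (use x y lam u l in "auto simp: U.smult_l_distr")
			also have "... = (lincomb U ?K (lam x) u) \<oplus>\<^sub>U (lincomb U ?K (lam y) u)"
			by (rule U.M.finsum_addf) (use x y lam u in auto)
			also have "(lincomb U ?K (lam x) u) = k x" by (rule k[symmetric]) (use x f in auto)
			also have "(lincomb U ?K (lam y) u) = k y" by (rule k[symmetric]) (use y f in auto)
			finally show "k (x \<oplus>\<^sub>P y) = k x \<oplus>\<^sub>U k y" . }
	qed
qed

lemma dual_basis_extend:
	assumes "module Q P" "module Q U" "dual_basis Q P J b lam" "u : J \<rightarrow> carrier U"
	shows "linear_map Q P U (%x. \<Oplus>\<^sub>U j\<in>{j : J. lam x j ~= \<zero>\<^sub>Q}. lam x j \<odot>\<^sub>U u j)"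
	by (rule coordinate_sum_linear) (use assms in "auto simp: dual_basis_def")

lemma dual_basis_expand:
	assumes "module Q P" "module Q V" "dual_basis Q P J b lam" "linear_map Q P V h" "x : carrier P"
	shows "h x = (\<Oplus>\<^sub>V j\<in>{j : J. lam x j ~= \<zero>\<^sub>Q}. lam x j \<odot>\<^sub>V h (b j))"
proof -
	interpret P: module Q P by fact
	interpret V: module Q V by fact
	note db = assms(3)[unfolded dual_basis_def]
	let ?K = "{j : J. lam x j ~= \<zero>\<^sub>Q}"
	have lam: "lam x j : carrier Q" if "j : J" for j using db assms(5) that by auto
	have b: "b j : carrier P" if "j : J" for j using db that by auto
	have fin: "finite ?K" and x: "x = (lincomb P ?K (lam x) b)" using db assms(5) by auto
	have "h x = h (lincomb P ?K (lam x) b)" using x by simp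
	also have "... = (\<Oplus>\<^sub>V j\<in>?K. h (lam x j \<odot>\<^sub>P b j))"
		by (rule linear_finsum[OF assms(1,2,4) fin]) (use lam b in auto)
	also have "... = (lincomb V ?K (lam x) (%j. h (b j)))"
		by (rule V.M.finsum_cong') (use lam b linear_smult[OF assms(4)] linear_closed[OF assms(4)] in auto)
	finally show ?thesis .
qed

text \<open>Lift the images of the basis elements and extend by the coordinates.\<close>

lemma dual_basis_lift:
	assumes "module Q P" "module Q U" "module Q V" "dual_basis Q P J b lam"
		and g: "linear_map Q U V g" and h: "linear_map Q P V h"
		and im: "!!x. x : carrier P ==> h x : g ` carrier U"
	shows "EX k. linear_map Q P U k & (ALL x:carrier P. g (k x) = h x)"
proof -
	interpret U: module Q U by fact
	interpret V: module Q V by fact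
	note db = assms(4)[unfolded dual_basis_def]
	have b: "b j : carrier P" if "j : J" for j using db that by auto
	have "ALL j:J. EX v. v : carrier U & g v = h (b j)"
	proof
		fix j assume "j : J"
		from im[OF b[OF this]] show "EX v. v : carrier U & g v = h (b j)" by force
	qed
	then obtain u where u: "!!j. j : J ==> u j : carrier U" "!!j. j : J ==> g (u j) = h (b j)" by metis
	let ?k = "%x. \<Oplus>\<^sub>U j\<in>{j : J. lam x j ~= \<zero>\<^sub>Q}. lam x j \<odot>\<^sub>U u j"
	have "g (?k x) = h x" if x: "x : carrier P" for x
	proof -
		let ?K = "{j : J. lam x j ~= \<zero>\<^sub>Q}"
		have lam: "lam x j : carrier Q" if "j : J" for j using db x that by auto
		have fin: "finite ?K" using db x by auto
		have gj: "g (lam x j \<odot>\<^sub>U u j) = lam x j \<odot>\<^sub>V h (b j)" if "j : J" for j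
			using linear_smult[OF g lam[OF that] u(1)[OF that]] u(2)[OF that] by simp
		have hb: "lam x j \<odot>\<^sub>V h (b j) : carrier V" if "j : J" for j
			using lam[OF that] linear_closed[OF h b[OF that]] by simp
		have "g (?k x) = (\<Oplus>\<^sub>V j\<in>?K. g (lam x j \<odot>\<^sub>U u j))"
			by (rule linear_finsum[OF assms(2,3) g fin]) (use lam u in auto)
		also have "... = (lincomb V ?K (lam x) (%j. h (b j)))"
			by (rule V.M.finsum_cong') (use gj hb in auto)
		also have "... = h x" by (rule dual_basis_expand[OF assms(1,3,4) h x, symmetric])
		finally show ?thesis .
	qed
	thus ?thesis using dual_basis_extend[OF assms(1,2,4), of u] u(1) by blast
qed

text \<open>The submodule \<open>(f\<^sub>1, \<dots>, f\<^sub>k) P\<close> of \<open>P\<close>.\<close>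

definition fspan :: "(nat => 'q) => nat => ('q, 'p, 'm) module_scheme => 'p set" where
	"fspan f k P = {(lincomb P {..<k} f g) | g. g : {..<k} \<rightarrow> carrier P}"

lemma (in abelian_group) finsum_lessThan_Suc:
	assumes "!!r. r < Suc k ==> g r : carrier G"
	shows "(\<Oplus>r\<in>{..<Suc k}. g r) = g k \<oplus> (\<Oplus>r\<in>{..<k}. g r)"
	unfolding lessThan_Suc using assms by (subst finsum_insert) auto

lemma (in module) fspan_submodule:
	assumes f: "!!r. r < k ==> f r : carrier R"
	shows "submodule (fspan f k M) R M"
proof (rule submoduleI)
	have c: "(lincomb M {..<k} f g) : carrier M" if "g : {..<k} \<rightarrow> carrier M" for g
		using that f by (intro M.finsum_closed) auto
	show "fspan f k M <= carrier M" using c by (auto simp: fspan_def)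
	have "(\<Oplus>\<^sub>M r\<in>{..<k}. f r \<odot>\<^sub>M \<zero>\<^sub>M) = \<zero>\<^sub>M"
		using f by (intro M.add.finprod_one_eqI) auto
	thus "\<zero>\<^sub>M : fspan f k M" unfolding fspan_def by (auto intro!: exI[of _ "%_. \<zero>\<^sub>M"])
	have sm: "a \<odot>\<^sub>M x : fspan f k M" if a: "a : carrier R" and x: "x : fspan f k M" for a x
	proof -
		obtain g where g: "g : {..<k} \<rightarrow> carrier M" "x = (lincomb M {..<k} f g)" using x by (auto simp: fspan_def)
		have "a \<odot>\<^sub>M x = (\<Oplus>\<^sub>M r\<in>{..<k}. a \<odot>\<^sub>M (f r \<odot>\<^sub>M g r))"
			unfolding g(2) by (rule finsum_smult_ldistr) (use a f g in auto)
		also have "... = (lincomb M {..<k} f (%r. (a \<odot>\<^sub>M g r)))"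
			by (rule M.finsum_cong') (use a f g in "auto simp: Pi_iff smult_assoc1[symmetric] m_comm")
		finally show ?thesis unfolding fspan_def using g(1) a by (auto simp: Pi_iff intro!: exI[of _ "%r. a \<odot>\<^sub>M g r"])
	qed
	show "a \<odot>\<^sub>M x : fspan f k M" if "a : carrier R" "x : fspan f k M" for a x by (rule sm) fact+
	show "\<ominus>\<^sub>M x : fspan f k M" if x: "x : fspan f k M" for x
		using sm[of "\<ominus>\<^sub>R \<one>\<^sub>R" x] x \<open>fspan f k M <= carrier M\<close> by (auto simp: smult_l_minus)
	show "x \<oplus>\<^sub>M y : fspan f k M" if x: "x : fspan f k M" and y: "y : fspan f k M" for x y
	proof -
		obtain g where g: "g : {..<k} \<rightarrow> carrier M" "x = (lincomb M {..<k} f g)" using x by (auto simp: fspan_def)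
		obtain h where h: "h : {..<k} \<rightarrow> carrier M" "y = (lincomb M {..<k} f h)" using y by (auto simp: fspan_def)
		have "x \<oplus>\<^sub>M y = (\<Oplus>\<^sub>M r\<in>{..<k}. f r \<odot>\<^sub>M g r \<oplus>\<^sub>M f r \<odot>\<^sub>M h r)"
			unfolding g(2) h(2) by (rule M.finsum_addf[symmetric]) (use f g h in auto)
		also have "... = (lincomb M {..<k} f (%r. (g r \<oplus>\<^sub>M h r)))"
			by (rule M.finsum_cong') (use f g h in "auto simp: Pi_iff smult_r_distr")
		finally show ?thesis unfolding fspan_def using g(1) h(1) by (auto simp: Pi_iff intro!: exI[of _ "%r. g r \<oplus>\<^sub>M h r"])
	qed
qed

lemma (in module) fspan_generator:
	assumes f: "!!r. r < k ==> f r : carrier R" and r: "r < k" and x: "x : carrier M"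
	shows "f r \<odot>\<^sub>M x : fspan f k M"
proof -
	have "(lincomb M {..<k} f (%i. (if r = i then x else \<zero>\<^sub>M))) = (\<Oplus>\<^sub>M i\<in>{..<k}. if r = i then f i \<odot>\<^sub>M x else \<zero>\<^sub>M)"
		by (rule M.finsum_cong') (use f x in auto)
	also have "... = f r \<odot>\<^sub>M x"
		by (rule M.finsum_singleton) (use f x r in auto)
	finally show ?thesis unfolding fspan_def using x
		by (auto intro!: exI[of _ "%i. if r = i then x else \<zero>\<^sub>M"])
qed

lemma (in module) fspan_Suc:
	assumes f: "!!r. r < Suc k ==> f r : carrier R"
	shows "x : fspan f (Suc k) M \<longleftrightarrow> (EX u:carrier M. EX v:fspan f k M. x = f k \<odot>\<^sub>M u \<oplus>\<^sub>M v)"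
proof
	assume "x : fspan f (Suc k) M"
	then obtain g where g: "g : {..<Suc k} \<rightarrow> carrier M" "x = (lincomb M {..<Suc k} f g)" by (auto simp: fspan_def)
	have "x = f k \<odot>\<^sub>M g k \<oplus>\<^sub>M (lincomb M {..<k} f g)"
		unfolding g(2) by (rule M.finsum_lessThan_Suc) (use f g in auto)
	moreover have "(lincomb M {..<k} f g) : fspan f k M"
		unfolding fspan_def using g(1) by (auto intro!: exI[of _ g])
	ultimately show "EX u:carrier M. EX v:fspan f k M. x = f k \<odot>\<^sub>M u \<oplus>\<^sub>M v" using g(1) by blast
next
	assume "EX u:carrier M. EX v:fspan f k M. x = f k \<odot>\<^sub>M u \<oplus>\<^sub>M v"
	then obtain u g where u: "u : carrier M" and g: "g : {..<k} \<rightarrow> carrier M"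
			"x = f k \<odot>\<^sub>M u \<oplus>\<^sub>M (lincomb M {..<k} f g)"
		unfolding fspan_def by blast
	let ?g = "%r. if r = k then u else g r"
	have "(lincomb M {..<Suc k} f ?g) = f k \<odot>\<^sub>M ?g k \<oplus>\<^sub>M (lincomb M {..<k} f ?g)"
		by (rule M.finsum_lessThan_Suc) (use f g u in "auto simp: Pi_iff less_Suc_eq")
	also have "(lincomb M {..<k} f ?g) = (lincomb M {..<k} f g)"
		by (rule M.finsum_cong') (use f g u in "auto simp: Pi_iff less_Suc_eq")
	finally have "x = (lincomb M {..<Suc k} f ?g)" using g by simp
	moreover have "?g : {..<Suc k} \<rightarrow> carrier M" using u g by (auto simp: Pi_iff less_Suc_eq)
	ultimately show "x : fspan f (Suc k) M" unfolding fspan_def mem_Collect_eq by (intro exI[of _ ?g]) simp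
qed

lemma linear_fspan:
	assumes "module Q P" "module Q V" "linear_map Q P V h" "!!r. r < k ==> f r : carrier Q" "x : fspan f k P"
	shows "h x : fspan f k V"
proof -
	interpret P: module Q P by fact
	interpret V: module Q V by fact
	obtain g where g: "g : {..<k} \<rightarrow> carrier P" "x = (lincomb P {..<k} f g)" using assms(5) by (auto simp: fspan_def)
	have "h x = (\<Oplus>\<^sub>V r\<in>{..<k}. h (f r \<odot>\<^sub>P g r))"
		unfolding g(2) by (rule linear_finsum[OF assms(1-3)]) (use g assms(4) in auto)
	also have "... = (lincomb V {..<k} f (%r. h (g r)))"
		by (rule V.M.finsum_cong') (use g assms(4) linear_smult[OF assms(3)] linear_closed[OF assms(3)] in "auto simp: Pi_iff")
	finally show ?thesis unfolding fspan_def using g(1) linear_closed[OF assms(3)] by (auto simp: Pi_iff)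
qed

locale regular_seq = cring Q for Q :: "('q, 'k) ring_scheme" (structure) +
	fixes f :: "nat => 'q" and c :: nat
	assumes f_closed [simp]: "r < c ==> f r : carrier Q"
		and regular: "k < c ==> x : carrier Q ==> f k \<otimes> x : Idl (f ` {..<k}) ==> x : Idl (f ` {..<k})"
begin

lemma ideal_Idl: "k <= c ==> ideal (Idl (f ` {..<k})) Q"
	by (rule genideal_ideal) auto

text \<open>Membership can be tested on coordinates, so regularity passes from the ring to projective modules.\<close>

lemma fspan_iff_coordinates:
	assumes P: "module Q P" and db: "dual_basis Q P J b lam" and J: "finite J" and k: "k <= c" and x: "x : carrier P"
	shows "x : fspan f k P \<longleftrightarrow> (ALL j:J. lam x j : Idl (f ` {..<k}))"
proof -
	interpret P: module Q P by (rule P)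
	interpret I: ideal "Idl (f ` {..<k})" Q by (rule ideal_Idl[OF k])
	have fI: "f r : Idl (f ` {..<k})" if "r < k" for r
	proof -
		have "f ` {..<k} <= carrier Q" using k by auto
		from genideal_self[OF this] show ?thesis using that by auto
	qed
	note d = db[unfolded dual_basis_def]
	have fk: "!!r. r < k ==> f r : carrier Q" using k by auto
	interpret S: submodule "fspan f k P" Q P by (rule P.fspan_submodule[OF fk])
	show ?thesis
	proof
		assume "x : fspan f k P"
		then obtain g where g: "g : {..<k} \<rightarrow> carrier P" "x = (lincomb P {..<k} f g)" by (auto simp: fspan_def)
		show "ALL j:J. lam x j : Idl (f ` {..<k})"
		proof
			fix j assume j: "j : J"
			have zero: "lam \<zero>\<^sub>P j = \<zero>"
			proof -
			have "lam (\<zero> \<odot>\<^sub>P \<zero>\<^sub>P) j = \<zero> \<otimes> lam \<zero>\<^sub>P j" using d j by blast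
			thus ?thesis using d j by (simp add: Pi_iff)
			qed
			have "lam (lincomb P K f g) j : Idl (f ` {..<k})" if "finite K" "K <= {..<k}" for K
			using that
			proof (induct K rule: finite_induct)
			case empty
			thus ?case using zero I.zero_closed by simp
			next
			case (insert r K)
			hence r: "r < k" "g r : carrier P" "f r : carrier Q" using g k by auto
			have fg: "f i \<odot>\<^sub>P g i : carrier P" if "i < k" for i using g k that by (auto simp: Pi_iff)
			have Kk: "i < k" if "i : K" for i using insert that by auto
			have s: "(lincomb P K f g) : carrier P" using fg Kk by (intro P.M.finsum_closed) auto
			have "(lincomb P (insert r K) f g) = f r \<odot>\<^sub>P g r \<oplus>\<^sub>P (lincomb P K f g)"
			using insert fg Kk r by (intro P.M.finsum_insert) auto
			hence "lam (lincomb P (insert r K) f g) j = f r \<otimes> lam (g r) j \<oplus> lam (lincomb P K f g) j"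
			using d j r s by simp
			moreover have "f r \<otimes> lam (g r) j : Idl (f ` {..<k})"
			using I.I_r_closed[OF fI[OF r(1)]] d j r by auto
			ultimately show ?case using insert I.a_closed by simp
			qed
			thus "lam x j : Idl (f ` {..<k})" using g by simp
		qed
	next
		assume l: "ALL j:J. lam x j : Idl (f ` {..<k})"
		have sm: "a \<odot>\<^sub>P y : fspan f k P" if a: "a : Idl (f ` {..<k})" and y: "y : carrier P" for a y
		proof -
			have "ideal {a : carrier Q. a \<odot>\<^sub>P y : fspan f k P} Q"
			proof (rule idealI)
			show "ring Q" by (rule ring_axioms)
			show "subgroup {a : carrier Q. a \<odot>\<^sub>P y : fspan f k P} (add_monoid Q)"
			proof (rule add.subgroupI)
			show "{a : carrier Q. a \<odot>\<^sub>P y : fspan f k P} ~= {}"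
			using S.one_closed y by (auto intro!: exI[of _ \<zero>])
			next
			fix a assume "a : {a : carrier Q. a \<odot>\<^sub>P y : fspan f k P}"
			thus "\<ominus> a : {a : carrier Q. a \<odot>\<^sub>P y : fspan f k P}"
			using y P.submoduleE(3)[OF S.submodule_axioms] by (auto simp: P.smult_l_minus)
			qed (use y P.submoduleE(5)[OF S.submodule_axioms] in "auto simp: P.smult_l_distr")
			fix a z assume "a : {a : carrier Q. a \<odot>\<^sub>P y : fspan f k P}" "z : carrier Q"
			thus "z \<otimes> a : {a : carrier Q. a \<odot>\<^sub>P y : fspan f k P}"
			"a \<otimes> z : {a : carrier Q. a \<odot>\<^sub>P y : fspan f k P}"
			using y by (auto simp: P.smult_assoc1 m_comm[of a z])
			qed
			hence "Idl (f ` {..<k}) <= {a : carrier Q. a \<odot>\<^sub>P y : fspan f k P}"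
			by (rule genideal_minimal) (use P.fspan_generator[OF fk _ y] fk in auto)
			thus ?thesis using a by auto
		qed
		let ?K = "{j : J. lam x j ~= \<zero>}"
		have "(lincomb P K (lam x) b) : fspan f k P" if "finite K" "K <= J" for K
			using that
		proof (induct K rule: finite_induct)
			case empty
			thus ?case using S.one_closed by simp
		next
			case (insert j K)
			hence "(lincomb P (insert j K) (lam x) b) = lam x j \<odot>\<^sub>P b j \<oplus>\<^sub>P (lincomb P K (lam x) b)"
			using d x by (intro P.M.finsum_insert) (auto simp: Pi_iff subset_iff)
			moreover have "lam x j \<odot>\<^sub>P b j : fspan f k P" using sm l d insert by auto
			ultimately show ?case using insert P.submoduleE(5)[OF S.submodule_axioms] by auto
		qed
		from this[of ?K] show "x : fspan f k P" using d x by auto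
	qed
qed

lemma fspan_regular:
	assumes P: "module Q P" and db: "dual_basis Q P J b lam" and J: "finite J" and k: "k < c" and x: "x : carrier P"
		and fx: "f k \<odot>\<^sub>P x : fspan f k P"
	shows "x : fspan f k P"
proof -
	interpret P: module Q P by (rule P)
	note d = db[unfolded dual_basis_def]
	have "ALL j:J. lam (f k \<odot>\<^sub>P x) j : Idl (f ` {..<k})"
		using fspan_iff_coordinates[OF P db J _ P.smult_closed[OF f_closed[OF k] x], of k] fx k by simp
	hence fl: "ALL j:J. f k \<otimes> lam x j : Idl (f ` {..<k})" using d x k by simp
	have "lam x j : carrier Q" if "j : J" for j using d x that by auto
	hence "ALL j:J. lam x j : Idl (f ` {..<k})" using regular[OF k] fl by blast
	thus ?thesis using fspan_iff_coordinates[OF P db J _ x, of k] k by simp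
qed

text \<open>A trace of the vanishing of Koszul homology. In the induction, regularity puts the last coefficient in the span
of the earlier elements, and substituting it shortens the relation.\<close>

lemma relation_in_fspan:
	assumes P: "module Q P" and db: "dual_basis Q P J b lam" and J: "finite J" and k: "k <= c"
		and g: "!!r. r < k ==> g r : carrier P" and z: "(lincomb P {..<k} f g) = \<zero>\<^sub>P" and r: "r < k"
	shows "g r : fspan f k P"
	using k g z r
proof (induct k arbitrary: g r)
	case (Suc k)
	interpret P: module Q P by (rule P)
	have kc: "k < c" using Suc(2) by simp
	have fk: "!!r. r < Suc k ==> f r : carrier Q" using Suc(2) by auto
	interpret S: submodule "fspan f k P" Q P by (rule P.fspan_submodule) (use fk in auto)
	have gk: "g k : carrier P" and g: "!!r. r < k ==> g r : carrier P" using Suc(3) by auto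
	let ?s = "\<Oplus>\<^sub>P r\<in>{..<k}. f r \<odot>\<^sub>P g r"
	have s: "?s : fspan f k P" unfolding fspan_def using g by auto
	have Sc: "x : carrier P" if "x : fspan f k P" for x
		using P.submoduleE(1)[OF S.submodule_axioms] that by blast
	have sc: "?s : carrier P" using s by (rule Sc)
	have "f k \<odot>\<^sub>P g k \<oplus>\<^sub>P ?s = \<zero>\<^sub>P"
		using Suc(4) by (subst (asm) P.M.finsum_lessThan_Suc) (use fk Suc(3) in auto)
	hence e: "f k \<odot>\<^sub>P g k = \<ominus>\<^sub>P ?s" using P.M.minus_equality[of "f k \<odot>\<^sub>P g k" ?s] gk sc kc by simp
	hence "f k \<odot>\<^sub>P g k : fspan f k P" using s P.submoduleE(3)[OF S.submodule_axioms] by simp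
	hence gk': "g k : fspan f k P" by (rule fspan_regular[OF P db J kc gk])
	then obtain y where y: "y : {..<k} \<rightarrow> carrier P" "g k = (lincomb P {..<k} f y)" by (auto simp: fspan_def)
	have mono: "x : fspan f (Suc k) P" if "x : fspan f k P" for x
		using P.fspan_Suc[of k f x, OF fk] that kc Sc[OF that] P.M.zero_closed by (metis P.M.l_zero P.smult_r_null f_closed)
	show ?case
	proof (cases "r = k")
		case True
		thus ?thesis using mono[OF gk'] by simp
	next
		case False
		hence r: "r < k" using Suc(5) by simp
		let ?h = "%r. f k \<odot>\<^sub>P y r \<oplus>\<^sub>P g r"
		have yc: "y r : carrier P" if "r < k" for r using y that by auto
		have "(lincomb P {..<k} f ?h) = (\<Oplus>\<^sub>P r\<in>{..<k}. f k \<odot>\<^sub>P (f r \<odot>\<^sub>P y r) \<oplus>\<^sub>P f r \<odot>\<^sub>P g r)"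
			by (rule P.M.finsum_cong')
			(use yc g fk kc in "auto simp: P.smult_r_distr P.smult_assoc1[symmetric] m_comm")
		also have "... = (\<Oplus>\<^sub>P r\<in>{..<k}. f k \<odot>\<^sub>P (f r \<odot>\<^sub>P y r)) \<oplus>\<^sub>P ?s"
			by (rule P.M.finsum_addf) (use yc g fk kc in auto)
		also have "(\<Oplus>\<^sub>P r\<in>{..<k}. f k \<odot>\<^sub>P (f r \<odot>\<^sub>P y r)) = f k \<odot>\<^sub>P g k"
			unfolding y(2) by (rule P.finsum_smult_ldistr[symmetric]) (use yc fk kc in auto)
		also have "f k \<odot>\<^sub>P g k \<oplus>\<^sub>P ?s = \<zero>\<^sub>P" unfolding e using sc by (rule P.M.l_neg)
		finally have "?h r : fspan f k P"
			using Suc(1)[of ?h r] yc g kc r by simp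
		hence h: "?h r : fspan f (Suc k) P" by (rule mono)
		interpret S': submodule "fspan f (Suc k) P" Q P by (rule P.fspan_submodule) (use fk in auto)
		have fy: "f k \<odot>\<^sub>P y r : fspan f (Suc k) P" by (rule P.fspan_generator) (use fk yc r in auto)
		have "g r = \<ominus>\<^sub>P (f k \<odot>\<^sub>P y r) \<oplus>\<^sub>P ?h r"
			using yc[OF r] g[OF r] kc by (simp add: P.M.r_neg1)
		thus ?thesis using P.submoduleE(3,5)[OF S'.submodule_axioms] fy h by metis
	qed
qed simp

text \<open>The coefficients can be chosen linearly in the argument because they can be chosen freely on a dual basis.\<close>

lemma lift_to_fspan:
	assumes P: "module Q P" and V: "module Q V" and db: "dual_basis Q P J b lam" and k: "k <= c"
		and h: "linear_map Q P V h" and im: "!!x. x : carrier P ==> h x : fspan f k V"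
	shows "EX H. (ALL r<k. linear_map Q P V (H r)) & (ALL x:carrier P. h x = (lincomb V {..<k} f (%r. H r x)))"
proof -
	interpret V: module Q V by (rule V)
	note d = db[unfolded dual_basis_def]
	have b: "b j : carrier P" if "j : J" for j using d that by auto
	have "ALL j:J. EX g. g : {..<k} \<rightarrow> carrier V & h (b j) = (lincomb V {..<k} f g)"
		using im b unfolding fspan_def by blast
	then obtain g where g: "!!j. j : J ==> g j : {..<k} \<rightarrow> carrier V"
		"!!j. j : J ==> h (b j) = (lincomb V {..<k} f (g j))" by metis
	have gc: "g j r : carrier V" if "j : J" "r < k" for j r using g(1)[OF that(1)] that(2) by auto
	let ?H = "%r x. \<Oplus>\<^sub>V j\<in>{j : J. lam x j ~= \<zero>}. lam x j \<odot>\<^sub>V g j r"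
	have fk: "!!r. r < k ==> f r : carrier Q" using k by auto
	show ?thesis
	proof (intro exI[of _ ?H] conjI allI impI ballI)
		fix r assume "r < k"
		thus "linear_map Q P V (?H r)" by (intro dual_basis_extend[OF P V db]) (use gc in auto)
	next
		fix x assume x: "x : carrier P"
		let ?K = "{j : J. lam x j ~= \<zero>}"
		have K: "finite ?K" and l: "!!j. j : J ==> lam x j : carrier Q" using d x by auto
		have "(lincomb V {..<m} f (%r. (\<Oplus>\<^sub>V j\<in>?K. lam x j \<odot>\<^sub>V g j r))) = (lincomb V ?K (lam x) (%j. (\<Oplus>\<^sub>V r\<in>{..<m}. f r \<odot>\<^sub>V g j r)))"
			if "m <= k" for m
			using that
		proof (induct m)
			case 0
			have "(\<Oplus>\<^sub>V j\<in>?K. lam x j \<odot>\<^sub>V \<zero>\<^sub>V) = \<zero>\<^sub>V" by (rule V.M.add.finprod_one_eqI) (use l in auto)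
			thus ?case by simp
		next
			case (Suc m)
			hence m: "m < k" by simp
			have Hc: "(lincomb V ?K (lam x) (%j. g j r)) : carrier V" if "r < k" for r
			using that l gc by (intro V.M.finsum_closed) auto
			have ic: "(lincomb V {..<m} f (g j)) : carrier V" if "j : J" for j
			using that gc fk m by (intro V.M.finsum_closed) auto
			have "(lincomb V {..<Suc m} f (%r. (\<Oplus>\<^sub>V j\<in>?K. lam x j \<odot>\<^sub>V g j r))) =
			f m \<odot>\<^sub>V (lincomb V ?K (lam x) (%j. g j m)) \<oplus>\<^sub>V (lincomb V {..<m} f (%r. (\<Oplus>\<^sub>V j\<in>?K. lam x j \<odot>\<^sub>V g j r)))"
			by (rule V.M.finsum_lessThan_Suc) (use Hc fk m in auto)
			also have "f m \<odot>\<^sub>V (lincomb V ?K (lam x) (%j. g j m)) = (\<Oplus>\<^sub>V j\<in>?K. f m \<odot>\<^sub>V (lam x j \<odot>\<^sub>V g j m))"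
			by (rule V.finsum_smult_ldistr) (use K l gc fk m in auto)
			also have "... = (lincomb V ?K (lam x) (%j. (f m \<odot>\<^sub>V g j m)))"
			by (rule V.M.finsum_cong') (use l gc fk m in "auto simp: V.smult_assoc1[symmetric] m_comm")
			also have "(lincomb V {..<m} f (%r. (\<Oplus>\<^sub>V j\<in>?K. lam x j \<odot>\<^sub>V g j r))) = (lincomb V ?K (lam x) (%j. (\<Oplus>\<^sub>V r\<in>{..<m}. f r \<odot>\<^sub>V g j r)))"
			using Suc by simp
			also have "(lincomb V ?K (lam x) (%j. (f m \<odot>\<^sub>V g j m))) \<oplus>\<^sub>V (lincomb V ?K (lam x) (%j. (\<Oplus>\<^sub>V r\<in>{..<m}. f r \<odot>\<^sub>V g j r)))
			= (\<Oplus>\<^sub>V j\<in>?K. lam x j \<odot>\<^sub>V (f m \<odot>\<^sub>V g j m) \<oplus>\<^sub>V lam x j \<odot>\<^sub>V (lincomb V {..<m} f (g j)))"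
			by (rule V.M.finsum_addf[symmetric]) (use l gc fk m ic in auto)
			also have "... = (lincomb V ?K (lam x) (%j. (\<Oplus>\<^sub>V r\<in>{..<Suc m}. f r \<odot>\<^sub>V g j r)))"
			proof (rule V.M.finsum_cong')
			fix j assume j: "j : ?K"
			have "(lincomb V {..<Suc m} f (g j)) = f m \<odot>\<^sub>V g j m \<oplus>\<^sub>V (lincomb V {..<m} f (g j))"
			by (rule V.M.finsum_lessThan_Suc) (use j gc fk m in auto)
			thus "lam x j \<odot>\<^sub>V (f m \<odot>\<^sub>V g j m) \<oplus>\<^sub>V lam x j \<odot>\<^sub>V (lincomb V {..<m} f (g j))
			= lam x j \<odot>\<^sub>V (lincomb V {..<Suc m} f (g j))"
			using j l gc fk m ic by (simp add: V.smult_r_distr)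
			next
			have "(lincomb V {..<Suc m} f (g j)) : carrier V" if "j : J" for j
			using that gc fk m by (intro V.M.finsum_closed) auto
			thus "(%j. lam x j \<odot>\<^sub>V (lincomb V {..<Suc m} f (g j))) : ?K \<rightarrow> carrier V" using l by auto
			qed simp
			finally show ?case .
		qed
		from this[OF order_refl] have "(lincomb V {..<k} f (%r. ?H r x)) = (lincomb V ?K (lam x) (%j. (\<Oplus>\<^sub>V r\<in>{..<k}. f r \<odot>\<^sub>V g j r)))" .
		also have "... = (lincomb V ?K (lam x) (%j. h (b j)))"
			by (rule V.M.finsum_cong') (use l g(2) linear_closed[OF h b] in auto)
		also have "... = h x" by (rule dual_basis_expand[OF P V db h x, symmetric])
		finally show "h x = (lincomb V {..<k} f (%r. ?H r x))" by simp
	qed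
qed

end

section \<open>Lifted resolutions with Eisenbud operators\<close>

text \<open>Direct sums are formed inside the type of sequences, as even and odd parts. This keeps the type of the modules
unchanged when sums are iterated, as the induction on the number of operators requires.\<close>

definition evens :: "(nat => 'l) => nat => 'l" where "evens u k = u (2 * k)"
definition odds :: "(nat => 'l) => nat => 'l" where "odds u k = u (2 * k + 1)"
definition interleave :: "(nat => 'l) => (nat => 'l) => nat => 'l" where
	"interleave x y k = (if even k then x (k div 2) else y (k div 2))"

lemma interleave_simps [simp]:
	"evens (interleave x y) = x" "odds (interleave x y) = y" "interleave (evens u) (odds u) = u"
	by (auto simp: evens_def odds_def interleave_def fun_eq_iff elim!: oddE)

lemma interleave_eqI: "evens u = evens v ==> odds u = odds v ==> u = v"
	by (metis interleave_simps(3))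

definition pair_module ::
		"('q, nat => 'l) module => ('q, nat => 'l) module => ('q, nat => 'l) module" where
	"pair_module A B = (|carrier = {u. evens u : carrier A & odds u : carrier B},
		monoid.mult = undefined, one = undefined,
		ring.zero = interleave \<zero>\<^sub>A \<zero>\<^sub>B,
		add = (%u v. interleave (evens u \<oplus>\<^sub>A evens v) (odds u \<oplus>\<^sub>B odds v)),
		smult = (%a u. interleave (a \<odot>\<^sub>A evens u) (a \<odot>\<^sub>B odds u))|)"

lemma pair_module_simps [simp]:
	"u : carrier (pair_module A B) \<longleftrightarrow> evens u : carrier A & odds u : carrier B"
	"evens (\<zero>\<^sub>(pair_module A B)) = \<zero>\<^sub>A" "odds (\<zero>\<^sub>(pair_module A B)) = \<zero>\<^sub>B"
	"evens (u \<oplus>\<^sub>(pair_module A B) v) = evens u \<oplus>\<^sub>A evens v" "odds (u \<oplus>\<^sub>(pair_module A B) v) = odds u \<oplus>\<^sub>B odds v"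
	"evens (a \<odot>\<^sub>(pair_module A B) u) = a \<odot>\<^sub>A evens u" "odds (a \<odot>\<^sub>(pair_module A B) u) = a \<odot>\<^sub>B odds u"
	by (auto simp: pair_module_def)

lemma pair_module_is_module:
	assumes "module Q A" "module Q B"
	shows "module Q (pair_module A B)"
proof -
	interpret A: module Q A by fact
	interpret B: module Q B by fact
	show ?thesis
	proof (rule moduleI)
		show "abelian_group (pair_module A B)"
		proof (rule abelian_groupI)
			fix x assume "x : carrier (pair_module A B)"
			thus "EX y:carrier (pair_module A B). y \<oplus>\<^sub>(pair_module A B) x = \<zero>\<^sub>(pair_module A B)"
			by (intro bexI[of _ "interleave (\<ominus>\<^sub>A evens x) (\<ominus>\<^sub>B odds x)"])
			(rule interleave_eqI, simp_all add: A.l_neg B.l_neg)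
		qed ((((rule interleave_eqI)?); simp add: A.a_ac B.a_ac)+)
	qed ((((rule interleave_eqI)?); simp add: A.smult_l_distr B.smult_l_distr A.R.is_cring
			A.smult_r_distr B.smult_r_distr A.smult_assoc1 B.smult_assoc1)+)
qed

lemma linear_evens: "linear_map Q (pair_module A B) A evens"
	and linear_odds: "linear_map Q (pair_module A B) B odds"
	by (auto simp: linear_map_def)

lemma linear_interleave:
	assumes "linear_map Q P A g" "linear_map Q P B h"
	shows "linear_map Q P (pair_module A B) (%x. interleave (g x) (h x))"
	by (rule linear_mapI)
		((((rule interleave_eqI)?); simp add: linear_add[OF assms(1)] linear_smult[OF assms(1)]
			linear_closed[OF assms(1)] linear_add[OF assms(2)] linear_smult[OF assms(2)]
			linear_closed[OF assms(2)])+)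

lemma evens_diff:
	assumes "module Q A" "module Q B" "u : carrier (pair_module A B)" "v : carrier (pair_module A B)"
	shows "evens (u \<ominus>\<^sub>(pair_module A B) v) = evens u \<ominus>\<^sub>A evens v"
		"odds (u \<ominus>\<^sub>(pair_module A B) v) = odds u \<ominus>\<^sub>B odds v"
	using linear_diff[OF pair_module_is_module[OF assms(1,2)] assms(1) linear_evens assms(3,4)]
		linear_diff[OF pair_module_is_module[OF assms(1,2)] assms(2) linear_odds assms(3,4)] by auto

lemma pair_fspan:
	assumes "module Q A" "module Q B" "!!r. r < k ==> f r : carrier Q"
		"evens u : fspan f k A" "odds u : fspan f k B"
	shows "u : fspan f k (pair_module A B)"
proof -
	interpret P: module Q "pair_module A B" by (rule pair_module_is_module) fact+
	interpret A: module Q A by fact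
	interpret B: module Q B by fact
	obtain g where g: "g : {..<k} \<rightarrow> carrier A" "evens u = (lincomb A {..<k} f g)"
		using assms(4) by (auto simp: fspan_def)
	obtain h where h: "h : {..<k} \<rightarrow> carrier B" "odds u = (lincomb B {..<k} f h)"
		using assms(5) by (auto simp: fspan_def)
	let ?w = "%r. interleave (g r) (h r)"
	have w: "?w : {..<k} \<rightarrow> carrier (pair_module A B)" using g h by auto
	have fw: "(%r. f r \<odot>\<^sub>(pair_module A B) ?w r) : {..<k} \<rightarrow> carrier (pair_module A B)"
		using g h assms(3) by (auto simp: Pi_iff)
	have "u = (lincomb (pair_module A B) {..<k} f ?w)"
		by (rule interleave_eqI)
			(simp_all add: linear_finsum[OF P.module_axioms assms(1) linear_evens _ fw]
			linear_finsum[OF P.module_axioms assms(2) linear_odds _ fw] g h)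
	thus ?thesis unfolding fspan_def using w by (intro CollectI exI conjI)
qed

lemma dual_basis_finite:
	assumes "module Q P" "dual_basis Q P J b lam" "finite J" "x : carrier P"
	shows "x = (lincomb P J (lam x) b)"
proof -
	interpret P: module Q P by fact
	note d = assms(2)[unfolded dual_basis_def]
	have "x = (\<Oplus>\<^sub>P j\<in>{j : J. lam x j ~= \<zero>\<^sub>Q}. lam x j \<odot>\<^sub>P b j)" using d assms(4) by blast
	also have "... = (lincomb P J (lam x) b)"
		by (rule P.finsum_support) (use d assms in auto)
	finally show ?thesis .
qed

lemma dual_basis_finiteI:
	assumes "module Q P" "finite J" "b : J \<rightarrow> carrier P"
		and "!!x j. x : carrier P ==> j : J ==> lam x j : carrier Q"
		and "!!x. x : carrier P ==> x = (lincomb P J (lam x) b)"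
		and "!!x y j. x : carrier P ==> y : carrier P ==> j : J ==> lam (x \<oplus>\<^sub>P y) j = lam x j \<oplus>\<^sub>Q lam y j"
		and "!!a x j. a : carrier Q ==> x : carrier P ==> j : J ==> lam (a \<odot>\<^sub>P x) j = a \<otimes>\<^sub>Q lam x j"
	shows "dual_basis Q P J b lam"
proof -
	interpret P: module Q P by fact
	have "x = (\<Oplus>\<^sub>P j\<in>{j : J. lam x j ~= \<zero>\<^sub>Q}. lam x j \<odot>\<^sub>P b j)" if "x : carrier P" for x
		using assms(5)[OF that] P.finsum_support[of J J "lam x" b] assms(2,3,4) that by auto
	thus ?thesis unfolding dual_basis_def using assms by auto
qed

definition fin_dual_basis :: "('q, 'k) ring_scheme => ('q, 'p) module => bool" where
	"fin_dual_basis Q P \<longleftrightarrow> (EX (J :: nat set) b lam. finite J & dual_basis Q P J b lam)"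

lemma fin_dual_basis_pair:
	assumes "module Q A" "module Q B" "fin_dual_basis Q A" "fin_dual_basis Q B"
	shows "fin_dual_basis Q (pair_module A B)"
proof -
	interpret A: module Q A by fact
	interpret B: module Q B by fact
	let ?P = "pair_module A B"
	interpret P: module Q ?P by (rule pair_module_is_module) fact+
	obtain J :: "nat set" and b lam where J: "finite J" "dual_basis Q A J b lam"
		using assms(3) by (auto simp: fin_dual_basis_def)
	obtain K :: "nat set" and c mu where K: "finite K" "dual_basis Q B K c mu"
		using assms(4) by (auto simp: fin_dual_basis_def)
	note dJ = J(2)[unfolded dual_basis_def] and dK = K(2)[unfolded dual_basis_def]
	let ?J = "(%j. 2 * j) ` J" and ?K = "(%j. 2 * j + 1) ` K"
	let ?b = "interleave (%j. interleave (b j) \<zero>\<^sub>B) (%j. interleave \<zero>\<^sub>A (c j))"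
	let ?l = "%u. interleave (lam (evens u)) (mu (odds u))"
	have i: "interleave p q (2 * j) = p j" "interleave p q (Suc (2 * j)) = q j" for p q :: "nat => 'd" and j
		by (auto simp: interleave_def)
	have i': "interleave p q (2 * j) = p j" "interleave p q (Suc (2 * j)) = q j" for p q :: "nat => 'a" and j
		by (auto simp: interleave_def)
	have i'': "interleave p q (2 * j) = p j" "interleave p q (Suc (2 * j)) = q j" for p q :: "nat => nat => 'c" and j
		by (auto simp: interleave_def)
	have bc: "b j : carrier A" if "j : J" for j using dJ that by auto
	have cc: "c j : carrier B" if "j : K" for j using dK that by auto
	have lc: "lam x j : carrier Q" if "j : J" "x : carrier A" for x j using dJ that by auto
	have mc: "mu x j : carrier Q" if "j : K" "x : carrier B" for x j using dK that by auto
	have "dual_basis Q ?P (?J Un ?K) ?b ?l"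
	proof (rule dual_basis_finiteI)
		show "module Q ?P" by (rule P.module_axioms)
		show "finite (?J Un ?K)" using J K by simp
		show "?b : ?J Un ?K \<rightarrow> carrier ?P" using bc cc by (auto simp: i'')
		show "?l x j : carrier Q" if "x : carrier ?P" "j : ?J Un ?K" for x j
			using that lc mc by (auto simp: i')
		show "?l (x \<oplus>\<^sub>?P y) j = ?l x j \<oplus>\<^sub>Q ?l y j"
			if "x : carrier ?P" "y : carrier ?P" "j : ?J Un ?K" for x y j
			using that dJ dK by (auto simp: i')
		show "?l (a \<odot>\<^sub>?P x) j = a \<otimes>\<^sub>Q ?l x j"
			if "a : carrier Q" "x : carrier ?P" "j : ?J Un ?K" for x a j
			using that dJ dK by (auto simp: i')
		show "u = (lincomb ?P (?J Un ?K) (?l u) ?b)" if u: "u : carrier ?P" for u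
		proof -
			have l1: "linear_map Q A ?P (%x. interleave x \<zero>\<^sub>B)"
			by (intro linear_interleave linear_id linear_const_zero) fact
			have l2: "linear_map Q B ?P (%x. interleave \<zero>\<^sub>A x)"
			by (intro linear_interleave linear_id linear_const_zero) fact
			have c1: "?l u j \<odot>\<^sub>?P ?b j : carrier ?P" if "j : ?J Un ?K" for j
			using that u lc mc bc cc by (auto simp: i' i'')
			have e1: "(lincomb ?P ?J (?l u) ?b) = interleave (evens u) \<zero>\<^sub>B"
			proof -
			have "(lincomb ?P ?J (?l u) ?b) = (lincomb ?P J (%j. ?l u (2 * j)) (%j. ?b (2 * j)))"
			by (rule P.M.finsum_reindex) (use c1 in "auto simp: inj_on_def")
			also have "... = (\<Oplus>\<^sub>?P j\<in>J. interleave (lam (evens u) j \<odot>\<^sub>A b j) \<zero>\<^sub>B)"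
			by (rule P.M.finsum_cong') (use u lc bc B.smult_r_null in "auto simp: i' i'' intro: interleave_eqI")
			also have "... = interleave (lincomb A J (lam (evens u)) b) \<zero>\<^sub>B"
			by (rule linear_finsum[OF assms(1) P.module_axioms l1 J(1), symmetric]) (use u lc bc in auto)
			also have "(lincomb A J (lam (evens u)) b) = evens u"
			by (rule dual_basis_finite[OF assms(1) J(2,1), symmetric]) (use u in auto)
			finally show ?thesis .
			qed
			have e2: "(lincomb ?P ?K (?l u) ?b) = interleave \<zero>\<^sub>A (odds u)"
			proof -
			have "(lincomb ?P ?K (?l u) ?b) = (lincomb ?P K (%j. ?l u (2 * j + 1)) (%j. ?b (2 * j + 1)))"
			by (rule P.M.finsum_reindex) (use c1 in "auto simp: inj_on_def")
			also have "... = (\<Oplus>\<^sub>?P j\<in>K. interleave \<zero>\<^sub>A (mu (odds u) j \<odot>\<^sub>B c j))"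
			by (rule P.M.finsum_cong') (use u mc cc in "auto simp: i' i'' intro: interleave_eqI")
			also have "... = interleave \<zero>\<^sub>A (lincomb B K (mu (odds u)) c)"
			by (rule linear_finsum[OF assms(2) P.module_axioms l2 K(1), symmetric]) (use u mc cc in auto)
			also have "(lincomb B K (mu (odds u)) c) = odds u"
			by (rule dual_basis_finite[OF assms(2) K(2,1), symmetric]) (use u in auto)
			finally show ?thesis .
			qed
			have "(lincomb ?P (?J Un ?K) (?l u) ?b) =
			(lincomb ?P ?J (?l u) ?b) \<oplus>\<^sub>?P (lincomb ?P ?K (?l u) ?b)"
			proof (rule P.M.finsum_Un_disjoint)
			show "?J Int ?K = {}" by (auto; presburger)
			qed (use J K c1 in auto)
			also have "... = u" unfolding e1 e2 by (rule interleave_eqI) (use u in auto)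
			finally show ?thesis by simp
		qed
	qed
	moreover have "finite (?J Un ?K)" using J K by simp
	ultimately show ?thesis unfolding fin_dual_basis_def by (intro exI conjI)
qed

text \<open>A resolution of \<open>M\<close> over the quotient by \<open>f\<^sub>1, \<dots>, f\<^sub>k\<close>, lifted to \<open>Q\<close>. All exactness is stated modulo
\<open>fspan f k\<close>. Degrees are integers and negative components are zero, so that \<open>n - 1\<close> and \<open>n - 2\<close> need no case
distinction.\<close>

definition ci_system ::
		"('q, 'k) ring_scheme => (nat => 'q) => nat => (int => ('q, nat => 'l) module) =>
		(int => (nat => 'l) => nat => 'l) => (nat => int => (nat => 'l) => nat => 'l) =>
		('q, 'm) module => ((nat => 'l) => 'm) => bool" where
	"ci_system Q f k L D T M aug \<longleftrightarrow>
		(ALL n. module Q (L n)) & (ALL n. fin_dual_basis Q (L n)) &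
		(ALL n. linear_map Q (L n) (L (n - 1)) (D n)) &
		(ALL r<k. ALL n. linear_map Q (L n) (L (n - 2)) (T r n)) &
		(ALL n. ALL x:carrier (L n). D (n - 1) (D n x) = (lincomb (L (n - 2)) {..<k} f (%r. T r n x))) &
		(ALL n<0. carrier (L n) = {\<zero>\<^sub>(L n)}) &
		(ALL n>0. ALL x:carrier (L n). D n x : fspan f k (L (n - 1)) -->
			(EX y:carrier (L (n + 1)). x \<ominus>\<^sub>(L n) D (n + 1) y : fspan f k (L n))) &
		module Q M & (ALL r<k. ALL y:carrier M. f r \<odot>\<^sub>M y = \<zero>\<^sub>M) & linear_map Q (L 0) M aug & aug ` carrier (L 0) = carrier M &
		(ALL y:carrier (L 1). aug (D 1 y) = \<zero>\<^sub>M) &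
		(ALL x:carrier (L 0). aug x = \<zero>\<^sub>M --> (EX y:carrier (L 1). x \<ominus>\<^sub>(L 0) D 1 y : fspan f k (L 0)))"

locale ci_sys = regular_seq Q f c for Q :: "('q, 'k) ring_scheme" (structure) and f c +
	fixes k :: nat and L :: "int => ('q, nat => 'l) module" and D T and M :: "('q, 'm) module" and aug
	assumes sys: "ci_system Q f k L D T M aug" and k_le: "k <= c"
begin

abbreviation "commutator r n x == D (n - 2) (T r n x) \<ominus>\<^sub>(L (n - 3)) T r (n - 1) (D n x)"

lemma L_module: "module Q (L n)" and L_dual: "fin_dual_basis Q (L n)"
	and D_linear: "linear_map Q (L n) (L (n - 1)) (D n)"
	and T_linear: "r < k ==> linear_map Q (L n) (L (n - 2)) (T r n)"
	and D_D: "x : carrier (L n) ==> D (n - 1) (D n x) = (lincomb (L (n - 2)) {..<k} f (%r. T r n x))"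
	and L_neg: "n < 0 ==> carrier (L n) = {\<zero>\<^sub>(L n)}"
	and exact: "n > 0 ==> x : carrier (L n) ==> D n x : fspan f k (L (n - 1)) ==>
			EX y:carrier (L (n + 1)). x \<ominus>\<^sub>(L n) D (n + 1) y : fspan f k (L n)"
	and M_module: "module Q M" and f_M: "r < k ==> z : carrier M ==> f r \<odot>\<^sub>M z = \<zero>\<^sub>M" and aug_linear: "linear_map Q (L 0) M aug" and aug_surj: "aug ` carrier (L 0) = carrier M"
	and aug_D: "y : carrier (L 1) ==> aug (D 1 y) = \<zero>\<^sub>M"
	and aug_exact: "x : carrier (L 0) ==> aug x = \<zero>\<^sub>M ==> EX y:carrier (L 1). x \<ominus>\<^sub>(L 0) D 1 y : fspan f k (L 0)"
	using sys unfolding ci_system_def by blast+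

lemma D_linear': "m = n - 1 ==> linear_map Q (L n) (L m) (D n)" using D_linear by simp
lemma T_linear': "r < k ==> m = n - 2 ==> linear_map Q (L n) (L m) (T r n)" using T_linear by simp
lemma D_closed: "x : carrier (L n) ==> m = n - 1 ==> D n x : carrier (L m)"
	using linear_closed[OF D_linear] by simp
lemma T_closed: "r < k ==> x : carrier (L n) ==> m = n - 2 ==> T r n x : carrier (L m)"
	using linear_closed[OF T_linear] by simp

lemma f_k: "r < k ==> f r : carrier Q" using k_le by simp

lemma fsum_diff:
	assumes "j <= k" "!!r. r < j ==> g r : carrier (L n)" "!!r. r < j ==> h r : carrier (L n)"
	shows "(lincomb (L n) {..<j} f (%r. (g r \<ominus>\<^sub>(L n) h r))) =
		(lincomb (L n) {..<j} f g) \<ominus>\<^sub>(L n) (lincomb (L n) {..<j} f h)"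
proof -
	interpret n: module Q "L n" by (rule L_module)
	have fj: "f r : carrier Q" if "r < j" for r using f_k that assms(1) by auto
	show ?thesis
		using assms(2,3) fj
	proof (induct j)
		case 0
		thus ?case by (simp add: a_minus_def) (metis n.M.minus_equality n.M.zero_closed n.M.l_zero)
	next
		case (Suc j)
		have s: "(lincomb (L n) {..<j} f g) : carrier (L n)" "(lincomb (L n) {..<j} f h) : carrier (L n)"
			using Suc by (auto intro!: n.M.finsum_closed)
		show ?case
			using Suc s
			by (simp add: n.M.finsum_lessThan_Suc a_minus_def n.smult_r_distr n.smult_r_minus n.M.minus_add n.M.a_ac)
	qed
qed

lemma fsum_map:
	assumes "linear_map Q (L m) (L n) h" "j <= k" "!!r. r < j ==> g r : carrier (L m)"
	shows "h (lincomb (L m) {..<j} f g) = (lincomb (L n) {..<j} f (%r. h (g r)))"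
proof -
	interpret m: module Q "L m" by (rule L_module)
	interpret n: module Q "L n" by (rule L_module)
	have fj: "f r : carrier Q" if "r < j" for r using f_k that assms(2) by auto
	have "h (lincomb (L m) {..<j} f g) = (\<Oplus>\<^sub>(L n)r\<in>{..<j}. h (f r \<odot>\<^sub>(L m) g r))"
		by (rule linear_finsum[OF L_module L_module assms(1)]) (use assms(3) fj in auto)
	also have "... = (lincomb (L n) {..<j} f (%r. h (g r)))"
		by (rule n.M.finsum_cong') (use assms(3) fj linear_smult[OF assms(1)] linear_closed[OF assms(1)] in auto)
	finally show ?thesis .
qed

lemma fsum_closed:
	assumes "j <= k" "!!r. r < j ==> g r : carrier (L n)"
	shows "(lincomb (L n) {..<j} f g) : carrier (L n)"
proof -
	interpret n: module Q "L n" by (rule L_module)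
	show ?thesis using assms f_k by (intro n.M.finsum_closed) auto
qed

lemma relation:
	assumes "j <= k" "!!r. r < j ==> g r : carrier (L n)" "(lincomb (L n) {..<j} f g) = \<zero>\<^sub>(L n)" "r < j"
	shows "g r : fspan f j (L n)"
proof -
	obtain J :: "nat set" and b lam where J: "finite J" "dual_basis Q (L n) J b lam"
		using L_dual[of n] by (auto simp: fin_dual_basis_def)
	show ?thesis by (rule relation_in_fspan[OF L_module J(2,1)]) (use assms k_le in auto)
qed

text \<open>Both \<open>(D \<circ> D) \<circ> D\<close> and \<open>D \<circ> (D \<circ> D)\<close> are expanded; their difference is the sum of the commutators weighted by
the \<open>f\<^sub>r\<close>, a relation between these.\<close>

lemma commutator_sum:
	assumes x: "x : carrier (L n)"
	shows "(lincomb (L (n - 3)) {..<k} f (%r. (commutator r n x))) = \<zero>\<^sub>(L (n - 3))"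
proof -
	interpret m: module Q "L (n - 3)" by (rule L_module)
	have 1: "D (n - 2) (D (n - 1) (D n x)) = (lincomb (L (n - 3)) {..<k} f (%r. D (n - 2) (T r n x)))"
		unfolding D_D[OF x] by (rule fsum_map[OF D_linear']) (use x in "auto intro!: T_closed")
	have 2: "D (n - 2) (D (n - 1) (D n x)) = (lincomb (L (n - 3)) {..<k} f (%r. T r (n - 1) (D n x)))"
		using D_D[OF D_closed[OF x refl]] by simp
	have "(lincomb (L (n - 3)) {..<k} f (%r. (commutator r n x)))
		= (lincomb (L (n - 3)) {..<k} f (%r. D (n - 2) (T r n x))) \<ominus>\<^sub>(L (n - 3))
			(lincomb (L (n - 3)) {..<k} f (%r. T r (n - 1) (D n x)))"
		by (rule fsum_diff) (use x in "auto intro!: D_closed T_closed")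
	also have "... = \<zero>\<^sub>(L (n - 3))"
		unfolding 1[symmetric] 2[symmetric] a_minus_def
		by (rule m.M.r_neg) (use x in "auto intro!: D_closed")
	finally show ?thesis .
qed

lemma commutator_linear:
	"r < k ==> linear_map Q (L n) (L (n - 3)) (%x. commutator r n x)"
	by (intro linear_minus_map L_module linear_comp[OF T_linear'[OF _ refl] D_linear']
			linear_comp[OF D_linear'[OF refl] T_linear']) auto

lemma commutator_lift:
	assumes "j <= k" "r < k"
		and "!!x. x : carrier (L n) ==> commutator r n x : fspan f j (L (n - 3))"
	shows "EX H. (ALL s<j. linear_map Q (L n) (L (n - 3)) (H s)) & (ALL x:carrier (L n).
		commutator r n x = (lincomb (L (n - 3)) {..<j} f (%s. H s x)))"
proof -
	obtain J :: "nat set" and b lam where J: "finite J" "dual_basis Q (L n) J b lam"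
		using L_dual[of n] by (auto simp: fin_dual_basis_def)
	show ?thesis
		by (rule lift_to_fspan[OF L_module L_module J(2) _ commutator_linear]) (use assms k_le in auto)
qed

lemma commutator_in_fspan:
	assumes "x : carrier (L n)" "r < k"
	shows "commutator r n x : fspan f k (L (n - 3))"
	by (rule relation[OF order_refl _ commutator_sum])
		(use assms linear_closed[OF commutator_linear] in auto)

text \<open>The operators commute up to homotopy modulo \<open>f\<^sub>1, \<dots>, f\<^sub>k\<close>. Write the commutator of \<open>D\<close> and \<open>T\<^sub>r\<close> as the sum of
the \<open>f\<^sub>s H\<^sub>s\<close>. Expanding the commutator of \<open>D \<circ> D\<close> and \<open>T\<^sub>r\<close> in two ways gives a relation whose coefficient at \<open>f\<^sub>s\<close>
is \<open>T\<^sub>s T\<^sub>r - T\<^sub>r T\<^sub>s - D H\<^sub>s - H\<^sub>s D\<close>.\<close>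

lemma operators_homotopy:
	assumes r: "r < k"
	shows "EX H. (ALL s<k. ALL n. linear_map Q (L n) (L (n - 3)) (H s n)) & (ALL s<k. ALL n. ALL x:carrier (L n).
		T s (n - 2) (T r n x) \<ominus>\<^sub>(L (n - 4)) T r (n - 2) (T s n x) \<ominus>\<^sub>(L (n - 4)) D (n - 3) (H s n x)
			\<ominus>\<^sub>(L (n - 4)) H s (n - 1) (D n x) : fspan f k (L (n - 4)))"
proof -
	have "ALL n. EX H. (ALL s<k. linear_map Q (L n) (L (n - 3)) (H s)) & (ALL x:carrier (L n).
		commutator r n x = (lincomb (L (n - 3)) {..<k} f (%s. H s x)))"
		using commutator_lift[OF order_refl r] commutator_in_fspan[OF _ r] by blast
	from choice[OF this] obtain H where "ALL n. (ALL s<k. linear_map Q (L n) (L (n - 3)) (H n s)) & (ALL x:carrier (L n).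
		commutator r n x = (lincomb (L (n - 3)) {..<k} f (%s. H n s x)))"
		by blast
	hence H: "!!n s. s < k ==> linear_map Q (L n) (L (n - 3)) (H n s)"
		"!!n x. x : carrier (L n) ==> commutator r n x
			= (lincomb (L (n - 3)) {..<k} f (%s. H n s x))"
		by blast+
	have Hc: "H n s x : carrier (L m)" if "s < k" "x : carrier (L n)" "m = n - 3" for n s x m
		using linear_closed[OF H(1)] that by blast
	have "T s (n - 2) (T r n x) \<ominus>\<^sub>(L (n - 4)) T r (n - 2) (T s n x) \<ominus>\<^sub>(L (n - 4)) D (n - 3) (H n s x)
			\<ominus>\<^sub>(L (n - 4)) H (n - 1) s (D n x) : fspan f k (L (n - 4))"
		if s: "s < k" and x: "x : carrier (L n)" for s n x
	proof -
		interpret m: module Q "L (n - 4)" by (rule L_module)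
		have P: "T s (n - 2) (T r n x) : carrier (L (n - 4))" and R: "T r (n - 2) (T s n x) : carrier (L (n - 4))"
			and U: "D (n - 3) (H n s x) : carrier (L (n - 4))" and W: "H (n - 1) s (D n x) : carrier (L (n - 4))"
			if "s < k" for s
			using that r x by (auto intro!: D_closed T_closed Hc)
		have A1: "D (n - 3) (D (n - 2) (T r n x)) = (lincomb (L (n - 4)) {..<k} f (%s. T s (n - 2) (T r n x)))"
			using D_D[OF T_closed[OF r x refl]] by simp
		have A2: "T r (n - 2) (D (n - 1) (D n x)) = (lincomb (L (n - 4)) {..<k} f (%s. T r (n - 2) (T s n x)))"
			unfolding D_D[OF x] by (rule fsum_map[OF T_linear'[OF r]]) (use x in "auto intro!: T_closed")
		have A3: "D (n - 3) (D (n - 2) (T r n x)) \<ominus>\<^sub>(L (n - 4)) D (n - 3) (T r (n - 1) (D n x))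
			= (lincomb (L (n - 4)) {..<k} f (%s. D (n - 3) (H n s x)))"
		proof -
			have "(lincomb (L (n - 4)) {..<k} f (%s. D (n - 3) (H n s x))) =
			D (n - 3) (lincomb (L (n - 3)) {..<k} f (%s. H n s x))"
			by (rule fsum_map[OF D_linear', symmetric]) (use Hc x in auto)
			also have "... = D (n - 3) (D (n - 2) (T r n x)) \<ominus>\<^sub>(L (n - 4)) D (n - 3) (T r (n - 1) (D n x))"
			unfolding H(2)[OF x, symmetric]
			by (rule linear_diff[OF L_module L_module D_linear']) (use x r in "auto intro!: D_closed T_closed")
			finally show ?thesis by simp
		qed
		have A4: "D (n - 3) (T r (n - 1) (D n x)) \<ominus>\<^sub>(L (n - 4)) T r (n - 2) (D (n - 1) (D n x))
			= (lincomb (L (n - 4)) {..<k} f (%s. H (n - 1) s (D n x)))"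
			using H(2)[OF D_closed[OF x refl]] by simp
		have c: "D (n - 3) (D (n - 2) (T r n x)) : carrier (L (n - 4))" "T r (n - 2) (D (n - 1) (D n x)) : carrier (L (n - 4))"
			"D (n - 3) (T r (n - 1) (D n x)) : carrier (L (n - 4))"
			using r x by (auto intro!: D_closed T_closed)
		have "(lincomb (L (n - 4)) {..<k} f (%s. (T s (n - 2) (T r n x) \<ominus>\<^sub>(L (n - 4)) T r (n - 2) (T s n x)
			\<ominus>\<^sub>(L (n - 4)) D (n - 3) (H n s x) \<ominus>\<^sub>(L (n - 4)) H (n - 1) s (D n x)))) =
			D (n - 3) (D (n - 2) (T r n x)) \<ominus>\<^sub>(L (n - 4)) T r (n - 2) (D (n - 1) (D n x))
			\<ominus>\<^sub>(L (n - 4)) (D (n - 3) (D (n - 2) (T r n x)) \<ominus>\<^sub>(L (n - 4)) D (n - 3) (T r (n - 1) (D n x)))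
			\<ominus>\<^sub>(L (n - 4)) (D (n - 3) (T r (n - 1) (D n x)) \<ominus>\<^sub>(L (n - 4)) T r (n - 2) (D (n - 1) (D n x)))"
			unfolding A1 A2 A3[unfolded A1] A4[unfolded A2]
			using P R U W by (simp add: fsum_diff)
		also have "... = \<zero>\<^sub>(L (n - 4))"
		proof -
			have "a \<ominus>\<^sub>(L (n - 4)) b \<ominus>\<^sub>(L (n - 4)) (a \<ominus>\<^sub>(L (n - 4)) e) \<ominus>\<^sub>(L (n - 4)) (e \<ominus>\<^sub>(L (n - 4)) b) = \<zero>\<^sub>(L (n - 4))"
			if "a : carrier (L (n - 4))" "b : carrier (L (n - 4))" "e : carrier (L (n - 4))" for a b e
			using that by (simp add: a_minus_def m.M.minus_add m.M.a_ac m.M.r_neg m.M.r_neg1 m.M.r_neg2 m.M.l_neg)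
			thus ?thesis using c by simp
		qed
		finally show ?thesis using P R U W s by (intro relation) auto
	qed
	thus ?thesis using H(1) by (intro exI[of _ "%s n. H n s"]) auto
qed

end

section \<open>The complex of cochains and its operators\<close>

lemma (in abelian_group) diff_eq_zero_iff:
	assumes "a : carrier G" "b : carrier G"
	shows "a \<ominus> b = \<zero> \<longleftrightarrow> a = b"
proof
	assume "a \<ominus> b = \<zero>"
	hence "\<ominus> (\<ominus> b) = a" using assms by (intro minus_equality) (simp_all add: a_minus_def)
	thus "a = b" using assms by simp
qed (use assms in "simp add: a_minus_def r_neg")

lemma (in abelian_group) diff_zero:
	assumes "a : carrier G"
	shows "a \<ominus> \<zero> = a"
proof -
	have "\<ominus> \<zero> = \<zero>" by (rule minus_equality) simp_all
	thus ?thesis using assms by (simp add: a_minus_def)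
qed

lemma fspanI: "(!!r. r < k ==> g r : carrier P) ==> (lincomb P {..<k} f g) : fspan f k P"
	by (auto simp: fspan_def intro!: exI[of _ g])

text \<open>The coefficients: a graded module, noetherian under commuting operators \<open>nops\<close>, that the regular sequence
annihilates.\<close>

locale ci_coeff = regular_seq Q f c for Q :: "('q, 'k) ring_scheme" (structure) and f c +
	fixes NN :: "nat => ('q, 'n) module" and nops :: "(nat \<times> (nat => 'n => 'n)) set"
	assumes Q_noetherian: "noetherian_ring Q"
		and NN_module: "module Q (NN n)"
		and f_NN: "r < c ==> y : carrier (NN n) ==> f r \<odot>\<^sub>(NN n) y = \<zero>\<^sub>(NN n)"
		and nops_finite: "finite nops"
		and nops_linear: "(s, \<phi>) : nops ==> linear_map Q (NN n) (NN (n + s)) (\<phi> n)"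
		and nops_commute: "(s, \<phi>) : nops ==> (r, \<psi>) : nops ==> y : carrier (NN n) ==>
			\<phi> (n + r) (\<psi> n y) = \<psi> (n + s) (\<phi> n y)"
		and NN_noetherian: "noetherian_family Q NN nops (%n. carrier (NN n)) (%n. {\<zero>\<^sub>(NN n)})"
begin

definition cochain :: "(int => ('q, 'l) module) => int \<times> nat => ('q, 'l => 'n) module" where
	"cochain L = (%(i, n). hom_module Q (L i) (NN n))"

definition coeff_op :: "(int => ('q, 'l) module) => nat \<times> (nat => 'n => 'n) =>
		(int \<times> nat) \<times> (int \<times> nat => ('l => 'n) => 'l => 'n)" where
	"coeff_op L = (%(s, \<phi>). ((0, s), %(i, n) h. \<lambda>x\<in>carrier (L i). \<phi> n (h x)))"

definition shift_op :: "(int => ('q, 'l) module) => (int => 'l => 'l) =>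
		(int \<times> nat) \<times> (int \<times> nat => ('l => 'n) => 'l => 'n)" where
	"shift_op L t = ((2, 0), %(i, n) h. \<lambda>x\<in>carrier (L (i + 2)). h (t (i + 2) x))"

definition all_ops :: "nat => (int => ('q, 'l) module) => (nat => int => 'l => 'l) =>
		((int \<times> nat) \<times> (int \<times> nat => ('l => 'n) => 'l => 'n)) set" where
	"all_ops k L T = coeff_op L ` nops Un (%r. shift_op L (T r)) ` {..<k}"

definition cocycle :: "(int => ('q, 'l) module) => (int => 'l => 'l) => int \<times> nat => ('l => 'n) set" where
	"cocycle L D = (%(i, n). {h : carrier (cochain L (i, n)). ALL x:carrier (L (i + 1)). h (D (i + 1) x) = \<zero>\<^sub>(NN n)})"

definition coboundary :: "(int => ('q, 'l) module) => (int => 'l => 'l) => int \<times> nat => ('l => 'n) set" where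
	"coboundary L D = (%(i, n). {(\<lambda>x\<in>carrier (L i). a (D i x)) | a. linear_map Q (L (i - 1)) (NN n) a})"

lemma all_ops_mono: "k <= l ==> all_ops k L T <= all_ops l L T"
	by (auto simp: all_ops_def)

lemma all_ops_Suc: "all_ops (Suc k) L T = insert (shift_op L (T k)) (all_ops k L T)"
	by (auto simp: all_ops_def lessThan_Suc)

lemma all_ops_cases:
	assumes "(s, \<phi>) : all_ops k L T"
	obtains (coeff) s0 \<phi>0 where "(s0, \<phi>0) : nops" "s = (0, s0)" "\<phi> = (%(i, n) h. \<lambda>x\<in>carrier (L i). \<phi>0 n (h x))"
	| (shift) r where "r < k" "s = (2, 0)" "\<phi> = (%(i, n) h. \<lambda>x\<in>carrier (L (i + 2)). h (T r (i + 2) x))"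
	using assms by (auto simp: all_ops_def coeff_op_def shift_op_def)

lemma finite_all_ops: "finite (all_ops k L T)"
	using nops_finite by (auto simp: all_ops_def)

lemma cochain_carrier: "h : carrier (cochain L (i, n)) \<longleftrightarrow> h : extensional (carrier (L i)) & linear_map Q (L i) (NN n) h"
	by (auto simp: cochain_def hom_module_simps)

lemma coboundaryI:
	assumes "linear_map Q (L (i - 1)) (NN n) a" "g : extensional (carrier (L i))" "!!x. x : carrier (L i) ==> g x = a (D i x)"
	shows "g : coboundary L D (i, n)"
proof -
	have "g = (\<lambda>x\<in>carrier (L i). a (D i x))"
		by (rule extensionalityI[OF assms(2)]) (use assms(3) in auto)
	thus ?thesis using assms(1) by (auto simp: coboundary_def)
qed

text \<open>This is why everything that holds on the lifted resolution only modulo the sequence holds exactly on cochains.\<close>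

lemma linear_kills_fspan:
	assumes "module Q P" "linear_map Q P (NN n) h" "k <= c" "x : fspan f k P"
	shows "h x = \<zero>\<^sub>(NN n)"
proof -
	interpret P: module Q P by fact
	interpret N: module Q "NN n" by (rule NN_module)
	obtain g where g: "g : {..<k} \<rightarrow> carrier P" "x = (lincomb P {..<k} f g)" using assms(4) by (auto simp: fspan_def)
	have "h x = (\<Oplus>\<^sub>(NN n)r\<in>{..<k}. h (f r \<odot>\<^sub>P g r))"
		unfolding g(2) by (rule linear_finsum[OF assms(1) NN_module assms(2)]) (use g assms(3) in auto)
	also have "... = \<zero>\<^sub>(NN n)"
	proof (rule N.M.add.finprod_one_eqI)
		fix r assume "r : {..<k}"
		hence "r < c" "g r : carrier P" using g assms(3) by auto
		thus "h (f r \<odot>\<^sub>P g r) = \<zero>\<^sub>(NN n)"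
			using linear_smult[OF assms(2)] linear_closed[OF assms(2)] f_NN by simp
	qed
	finally show ?thesis .
qed

lemma cochain_family:
	assumes "!!i. module Q (L i)"
	shows "module_family Q (cochain L)"
	by (rule module_family.intro) (auto simp: cochain_def split: prod.split intro!: hom_module_is_module assms NN_module)

lemma cochain_simps:
	"\<zero>\<^sub>(cochain L (i, n)) = (\<lambda>x\<in>carrier (L i). \<zero>\<^sub>(NN n))"
	"g \<oplus>\<^sub>(cochain L (i, n)) h = (\<lambda>x\<in>carrier (L i). g x \<oplus>\<^sub>(NN n) h x)"
	"a \<odot>\<^sub>(cochain L (i, n)) h = (\<lambda>x\<in>carrier (L i). a \<odot>\<^sub>(NN n) h x)"
	by (auto simp: cochain_def hom_module_simps)

lemma cochain_diff:
	assumes "!!i. module Q (L i)" "g : carrier (cochain L (i, n))" "h : carrier (cochain L (i, n))"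
	shows "g \<ominus>\<^sub>(cochain L (i, n)) h = (\<lambda>x\<in>carrier (L i). g x \<ominus>\<^sub>(NN n) h x)"
	using hom_module_diff[OF assms(1) NN_module, of g i n h] assms(2,3) by (auto simp: cochain_def)

end

locale ci_cochain = ci_coeff Q f c NN nops + ci_sys Q f c k L D T M aug
	for Q :: "('q, 'k) ring_scheme" (structure) and f c and NN :: "nat => ('q, 'n) module" and nops k
		and L :: "int => ('q, nat => 'l) module" and D T and M :: "('q, 'm) module" and aug
begin

abbreviation "K == cochain L"
abbreviation "Z == cocycle L D"
abbreviation "B == coboundary L D"

sublocale K: module_family Q "cochain L" by (rule cochain_family[OF L_module])

lemma ops_linear: "(s, \<phi>) : all_ops k L T ==> linear_map Q (K g) (K (g + s)) (\<phi> g)"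
proof (cases g)
	case (Pair i n)
	assume "(s, \<phi>) : all_ops k L T"
	thus ?thesis
	proof (cases rule: all_ops_cases)
		case (coeff s0 \<phi>0)
		note l = nops_linear[OF coeff(1), of n]
		show ?thesis unfolding Pair coeff add_Pair prod.case
		proof (rule linear_mapI)
			fix h assume h: "h : carrier (K (i, n))"
			hence hl: "linear_map Q (L i) (NN n) h" by (simp add: cochain_carrier)
			show "(\<lambda>x\<in>carrier (L i). \<phi>0 n (h x)) : carrier (K (i + 0, n + s0))"
			using linear_restrict[OF L_module linear_comp[OF hl l]] by (simp add: cochain_carrier)
			{ fix h' assume "h' : carrier (K (i, n))"
			hence hl': "linear_map Q (L i) (NN n) h'" by (simp add: cochain_carrier)
			show "(\<lambda>x\<in>carrier (L i). \<phi>0 n ((h \<oplus>\<^sub>(K (i, n)) h') x)) =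
			(\<lambda>x\<in>carrier (L i). \<phi>0 n (h x)) \<oplus>\<^sub>(K (i + 0, n + s0)) (\<lambda>x\<in>carrier (L i). \<phi>0 n (h' x))"
			using linear_closed[OF hl] linear_closed[OF hl'] linear_add[OF l]
			by (auto simp: cochain_simps intro!: restrict_ext) }
			{ fix a assume a: "a : carrier Q"
			thus "(\<lambda>x\<in>carrier (L i). \<phi>0 n ((a \<odot>\<^sub>(K (i, n)) h) x)) =
			a \<odot>\<^sub>(K (i + 0, n + s0)) (\<lambda>x\<in>carrier (L i). \<phi>0 n (h x))"
			using linear_closed[OF hl] linear_smult[OF l]
			by (auto simp: cochain_simps intro!: restrict_ext) }
		qed
	next
		case (shift r)
		note l = T_linear'[OF shift(1), of i "i + 2", simplified]
		show ?thesis unfolding Pair shift add_Pair prod.case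
		proof (rule linear_mapI)
			fix h assume h: "h : carrier (K (i, n))"
			hence hl: "linear_map Q (L i) (NN n) h" by (simp add: cochain_carrier)
			show "(\<lambda>x\<in>carrier (L (i + 2)). h (T r (i + 2) x)) : carrier (K (i + 2, n + 0))"
			using linear_restrict[OF L_module linear_comp[OF l hl]] by (simp add: cochain_carrier)
		qed (unfold cochain_simps, (rule restrict_ext, simp add: linear_closed[OF l])+)
	qed
qed

lemma ops_linear_all: "ALL (s, \<phi>):all_ops k L T. ALL g. linear_map Q (K g) (K (g + s)) (\<phi> g)"
	using ops_linear by auto

lemma D_D_killed:
	assumes "linear_map Q (L m) (NN n) a" "x : carrier (L i)" "m = i - 2"
	shows "a (D (i - 1) (D i x)) = \<zero>\<^sub>(NN n)"
proof (rule linear_kills_fspan[OF L_module assms(1) k_le])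
	show "D (i - 1) (D i x) : fspan f k (L m)"
		unfolding D_D[OF assms(2)] assms(3) by (rule fspanI) (rule T_closed[OF _ assms(2) refl])
qed

lemma D_T_killed:
	assumes "linear_map Q (L m) (NN n) a" "x : carrier (L i)" "r < k" "m = i - 3" "p = i - 2" "q = i - 1"
	shows "a (D p (T r i x)) = a (T r q (D i x))"
	unfolding assms(5,6)
proof -
	interpret N: module Q "NN n" by (rule NN_module)
	have c: "D (i - 2) (T r i x) : carrier (L m)" "T r (i - 1) (D i x) : carrier (L m)"
		using assms by (auto intro!: D_closed T_closed)
	have "a (D (i - 2) (T r i x) \<ominus>\<^sub>(L m) T r (i - 1) (D i x)) = \<zero>\<^sub>(NN n)"
		by (rule linear_kills_fspan[OF L_module assms(1) k_le])
			(use commutator_in_fspan[OF assms(2,3)] assms(4) in simp)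
	hence "a (D (i - 2) (T r i x)) \<ominus>\<^sub>(NN n) a (T r (i - 1) (D i x)) = \<zero>\<^sub>(NN n)"
		using linear_diff[OF L_module NN_module assms(1) c] by simp
	thus "a (D (i - 2) (T r i x)) = a (T r (i - 1) (D i x))"
		using linear_closed[OF assms(1)] c by (simp add: N.M.diff_eq_zero_iff)
qed

lemma Z_iff: "h : Z (i, n) \<longleftrightarrow> h : extensional (carrier (L i)) & linear_map Q (L i) (NN n) h &
		(ALL x:carrier (L (i + 1)). h (D (i + 1) x) = \<zero>\<^sub>(NN n))"
	by (auto simp: cocycle_def cochain_carrier)

lemma B_le_Z: "B <= Z"
proof (intro le_funI subsetI)
	fix g h assume h: "h : B g"
	obtain i n where g: "g = (i, n)" by (cases g)
	obtain a where a: "linear_map Q (L (i - 1)) (NN n) a" "h = (\<lambda>x\<in>carrier (L i). a (D i x))"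
		using h by (auto simp: coboundary_def g)
	have "linear_map Q (L i) (NN n) h" unfolding a(2)
		by (intro linear_restrict L_module linear_comp[OF D_linear a(1)])
	moreover have "h (D (i + 1) x) = \<zero>\<^sub>(NN n)" if "x : carrier (L (i + 1))" for x
		using D_D_killed[OF a(1) that] D_closed[OF that, of i] by (simp add: a(2))
	ultimately show "h : Z g" using a(2) by (auto simp: g Z_iff)
qed

lemma Z_closed: "closed_family Q K (all_ops k L T) Z"
proof (rule K.closedI)
	fix g h assume h: "h : Z g"
	obtain i n where g: "g = (i, n)" by (cases g)
	interpret N: module Q "NN n" by (rule NN_module)
	note hz = h[unfolded g Z_iff]
	have Dc: "D (i + 1) x : carrier (L i)" if "x : carrier (L (i + 1))" for x using D_closed[OF that] by simp
	show hK: "h : carrier (K g)" using hz by (simp add: g cochain_carrier)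
	interpret Kg: module Q "K g" by (rule K.G_module)
	{ fix h' assume h': "h' : Z g"
		hence "h' : carrier (K g)" by (simp add: g Z_iff cochain_carrier)
		hence "h \<oplus>\<^sub>(K g) h' : carrier (K g)" using hK by simp
		thus "h \<oplus>\<^sub>(K g) h' : Z g"
			using hz h' Dc by (simp add: g Z_iff cochain_carrier cochain_simps) }
	{ fix a assume a: "a : carrier Q"
		hence "a \<odot>\<^sub>(K g) h : carrier (K g)" using hK by simp
		thus "a \<odot>\<^sub>(K g) h : Z g"
			using hz Dc a by (simp add: g Z_iff cochain_carrier cochain_simps) }
	{ fix s \<phi> assume p: "(s, \<phi>) : all_ops k L T"
		have c: "\<phi> g h : carrier (K (g + s))" by (rule linear_closed[OF ops_linear[OF p] hK])
		from p show "\<phi> g h : Z (g + s)"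
		proof (cases rule: all_ops_cases)
			case (coeff s0 \<phi>0)
			show ?thesis
			using c hz Dc linear_zero[OF NN_module NN_module nops_linear[OF coeff(1)]]
			unfolding g coeff by (auto simp: Z_iff cochain_carrier)
		next
			case (shift r)
			have "h (T r (i + 2) (D (i + 3) x)) = \<zero>\<^sub>(NN n)" if x: "x : carrier (L (i + 3))" for x
			using D_T_killed[of i n h x "i + 3" r "i + 1" "i + 2"] hz x shift(1) T_closed[OF shift(1) x, of "i + 1"] by simp
			moreover have "D (i + 3) x : carrier (L (i + 2))" if "x : carrier (L (i + 3))" for x
			using D_closed[OF that, of "i + 2"] by simp
			ultimately show ?thesis
			using c unfolding g shift by (auto simp: Z_iff cochain_carrier add.commute[of 3])
		qed }
next
	fix g :: "int \<times> nat"
	obtain i n where g: "g = (i, n)" by (cases g)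
	interpret N: module Q "NN n" by (rule NN_module)
	have Dc: "D (i + 1) x : carrier (L i)" if "x : carrier (L (i + 1))" for x using D_closed[OF that] by simp
	show "\<zero>\<^sub>(K g) : Z g"
		using linear_restrict[OF L_module linear_const_zero[OF NN_module]] Dc by (simp add: g Z_iff cochain_simps)
qed

lemma B_closed: "closed_family Q K (all_ops k L T) B"
proof (rule K.closedI)
	fix g h assume h: "h : B g"
	obtain i n where g: "g = (i, n)" by (cases g)
	interpret N: module Q "NN n" by (rule NN_module)
	obtain a where a: "linear_map Q (L (i - 1)) (NN n) a" "h = (\<lambda>x\<in>carrier (L i). a (D i x))"
		using h by (auto simp: coboundary_def g)
	show hK: "h : carrier (K g)" using K.closedD(1)[OF Z_closed] B_le_Z h unfolding le_fun_def by blast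
	interpret Kg: module Q "K g" by (rule K.G_module)
	{ fix h' assume h': "h' : B g"
		then obtain a' where a': "linear_map Q (L (i - 1)) (NN n) a'" "h' = (\<lambda>x\<in>carrier (L i). a' (D i x))"
			by (auto simp: coboundary_def g)
		show "h \<oplus>\<^sub>(K g) h' : B g" unfolding g
			by (rule coboundaryI[where a = "%x. a x \<oplus>\<^sub>(NN n) a' x"])
			(use linear_plus[OF NN_module a(1) a'(1)] in "auto simp: cochain_simps a(2) a'(2)") }
	{ fix b assume b: "b : carrier Q"
		show "b \<odot>\<^sub>(K g) h : B g" unfolding g
			by (rule coboundaryI[where a = "%x. b \<odot>\<^sub>(NN n) a x"])
			(use linear_scale[OF NN_module a(1) b] in "auto simp: cochain_simps a(2)") }
	{ fix s \<phi> assume p: "(s, \<phi>) : all_ops k L T"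
		have c: "\<phi> g h : carrier (K (g + s))" by (rule linear_closed[OF ops_linear[OF p] hK])
		from p show "\<phi> g h : B (g + s)"
		proof (cases rule: all_ops_cases)
			case (coeff s0 \<phi>0)
			have "\<phi> g h : B (i + 0, n + s0)"
			by (rule coboundaryI[where a = "%x. \<phi>0 n (a x)"])
			(use linear_comp[OF a(1) nops_linear[OF coeff(1)]] in "auto simp: a(2) coeff g")
			thus ?thesis by (simp add: g coeff)
		next
			case (shift r)
			have "\<phi> g h : B (i + 2, n + 0)"
			proof (rule coboundaryI[where a = "%x. a (T r (i + 1) x)"])
			show "linear_map Q (L (i + 2 - 1)) (NN (n + 0)) (%x. a (T r (i + 1) x))"
			using linear_comp[OF T_linear'[OF shift(1), of "i - 1" "i + 1"] a(1)] by (simp add: add.commute[of 1])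
			show "\<phi> g h : extensional (carrier (L (i + 2)))" by (simp add: shift g)
			fix x assume x: "x : carrier (L (i + 2))"
			show "\<phi> g h x = a (T r (i + 1) (D (i + 2) x))"
			proof -
			have 1: "a (D i (T r (i + 2) x)) = a (T r (i + 1) (D (i + 2) x))"
			by (rule D_T_killed[OF a(1) x shift(1)]) auto
			have 2: "T r (i + 2) x : carrier (L i)" by (rule T_closed[OF shift(1) x]) simp
			show ?thesis unfolding shift g a(2) prod.case using x 1 2 by simp
			qed
			qed
			thus ?thesis by (simp add: g shift)
		qed }
next
	fix g :: "int \<times> nat"
	obtain i n where g: "g = (i, n)" by (cases g)
	show "\<zero>\<^sub>(K g) : B g" unfolding g
		by (rule coboundaryI[where a = "%x. \<zero>\<^sub>(NN n)"])
			(use linear_const_zero[OF NN_module] in "auto simp: cochain_simps")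
qed

text \<open>Two Eisenbud operators commute on cocycles up to a coboundary, by the homotopy; all other pairs commute exactly.\<close>

lemma operators_commute:
	assumes p: "p : all_ops k L T" and q: "q : all_ops k L T"
	shows "K.commutes_mod Z B p q"
proof -
	obtain s \<zeta> where ps: "p = (s, \<zeta>)" by (cases p)
	obtain r \<phi> where qs: "q = (r, \<phi>)" by (cases q)
	have p': "(s, \<zeta>) : all_ops k L T" and q': "(r, \<phi>) : all_ops k L T" using p q ps qs by auto
	show ?thesis unfolding ps qs K.commutes_mod_def prod.case
	proof (intro allI ballI)
		fix g h assume h: "h : Z g"
		obtain i n where g: "g = (i, n)" by (cases g)
		note hz = h[unfolded g Z_iff]
		note Zd = K.closedD[OF Z_closed]
		have c1: "\<zeta> (g + r) (\<phi> g h) : carrier (K (g + r + s))" using Zd(1)[OF Zd(6)[OF p' Zd(6)[OF q' h]]] .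
		have c2: "\<phi> (g + s) (\<zeta> g h) : carrier (K (g + r + s))"
			using Zd(1)[OF Zd(6)[OF q' Zd(6)[OF p' h]]] by (simp add: ac_simps)
		have strict: "K.cong_mod B (g + r + s) (\<zeta> (g + r) (\<phi> g h)) (\<phi> (g + s) (\<zeta> g h))"
			if "\<zeta> (g + r) (\<phi> g h) = \<phi> (g + s) (\<zeta> g h)"
			unfolding that by (rule K.cong_mod_refl[OF B_closed c2])
		show "K.cong_mod B (g + r + s) (\<zeta> (g + r) (\<phi> g h)) (\<phi> (g + s) (\<zeta> g h))"
			using p'
		proof (cases rule: all_ops_cases)
			case p: (coeff s0 \<zeta>0)
			from q' show ?thesis
			proof (cases rule: all_ops_cases)
			case q: (coeff r0 \<phi>0)
			show ?thesis
			by (rule strict) (use nops_commute[OF p(1) q(1)] linear_closed[OF hz[THEN conjunct2, THEN conjunct1]] in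
			\<open>auto simp: g p q intro!: restrict_ext\<close>)
			next
			case q: (shift r')
			have "T r' (i + 2) x : carrier (L i)" if "x : carrier (L (i + 2))" for x using T_closed[OF q(1) that] by simp
			thus ?thesis
			by (intro strict) (auto simp: g p q intro!: restrict_ext)
			qed
		next
			case p: (shift s')
			from q' show ?thesis
			proof (cases rule: all_ops_cases)
			case q: (coeff r0 \<phi>0)
			have "T s' (i + 2) x : carrier (L i)" if "x : carrier (L (i + 2))" for x using T_closed[OF p(1) that] by simp
			thus ?thesis
			by (intro strict) (auto simp: g p q intro!: restrict_ext)
			next
			case q: (shift r')
			interpret N: module Q "NN n" by (rule NN_module)
			obtain H where H: "!!s n. s < k ==> linear_map Q (L n) (L (n - 3)) (H s n)"
			"!!s n x. s < k ==> x : carrier (L n) ==>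
			T s (n - 2) (T s' n x) \<ominus>\<^sub>(L (n - 4)) T s' (n - 2) (T s n x) \<ominus>\<^sub>(L (n - 4)) D (n - 3) (H s n x)
			\<ominus>\<^sub>(L (n - 4)) H s (n - 1) (D n x) : fspan f k (L (n - 4))"
			using operators_homotopy[OF p(1)] by metis
			have hl: "linear_map Q (L i) (NN n) h" and hD: "!!x. x : carrier (L (i + 1)) ==> h (D (i + 1) x) = \<zero>\<^sub>(NN n)"
			using hz by auto
			have Hl: "linear_map Q (L (i + 3)) (L i) (H r' (i + 3))" using H(1)[OF q(1), of "i + 3"] by simp
			have H4: "linear_map Q (L (i + 4)) (L (i + 1)) (H r' (i + 4))"
			using H(1)[OF q(1), of "i + 4"] by (simp add: add.commute)
			have main: "h (T r' (i + 2) (T s' (i + 4) x)) \<ominus>\<^sub>(NN n) h (T s' (i + 2) (T r' (i + 4) x)) = h (H r' (i + 3) (D (i + 4) x))"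
			if x: "x : carrier (L (i + 4))" for x
			proof -
			have c: "T r' (i + 2) (T s' (i + 4) x) : carrier (L i)" "T s' (i + 2) (T r' (i + 4) x) : carrier (L i)"
			"D (i + 1) (H r' (i + 4) x) : carrier (L i)" "H r' (i + 3) (D (i + 4) x) : carrier (L i)"
			using x p(1) q(1) linear_closed[OF H4]
			by (auto intro!: T_closed D_closed linear_closed[OF Hl])
			have hH: "h (D (i + 1) (H r' (i + 4) x)) = \<zero>\<^sub>(NN n)"
			by (rule hD) (rule linear_closed[OF H4 x])
			interpret Li: module Q "L i" by (rule L_module)
			have "h (T r' (i + 2) (T s' (i + 4) x) \<ominus>\<^sub>(L i) T s' (i + 2) (T r' (i + 4) x) \<ominus>\<^sub>(L i) D (i + 1) (H r' (i + 4) x)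
			\<ominus>\<^sub>(L i) H r' (i + 3) (D (i + 4) x)) = \<zero>\<^sub>(NN n)"
			by (rule linear_kills_fspan[OF L_module hl k_le]) (use H(2)[OF q(1) x] in "simp add: add.commute")
			hence "h (T r' (i + 2) (T s' (i + 4) x)) \<ominus>\<^sub>(NN n) h (T s' (i + 2) (T r' (i + 4) x)) \<ominus>\<^sub>(NN n) \<zero>\<^sub>(NN n)
			\<ominus>\<^sub>(NN n) h (H r' (i + 3) (D (i + 4) x)) = \<zero>\<^sub>(NN n)"
			using c hH by (simp add: linear_diff[OF L_module NN_module hl])
			thus ?thesis
			using linear_closed[OF hl c(1)] linear_closed[OF hl c(2)] linear_closed[OF hl c(4)]
			by (simp add: N.M.diff_eq_zero_iff N.M.diff_zero)
			qed
			have e: "g + r + s = (i + 4, n)" "g + r = (i + 2, n)" "g + s = (i + 2, n)" by (simp_all add: g p q)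
			have Tc: "T s' (i + 4) x : carrier (L (i + 2))" "T r' (i + 4) x : carrier (L (i + 2))"
			if "x : carrier (L (i + 4))" for x using that p(1) q(1) by (auto intro!: T_closed)
			have "\<zeta> (g + r) (\<phi> g h) \<ominus>\<^sub>(K (i + 4, n)) \<phi> (g + s) (\<zeta> g h) =
			(\<lambda>x\<in>carrier (L (i + 4)). \<zeta> (g + r) (\<phi> g h) x \<ominus>\<^sub>(NN n) \<phi> (g + s) (\<zeta> g h) x)"
			by (rule cochain_diff[OF L_module]) (use c1 c2 e in auto)
			also have "... = (\<lambda>x\<in>carrier (L (i + 4)). h (H r' (i + 3) (D (i + 4) x)))"
			proof (rule restrict_ext)
			fix x assume x: "x : carrier (L (i + 4))"
			have 1: "\<zeta> (g + r) (\<phi> g h) x = h (T r' (i + 2) (T s' (i + 4) x))"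
			using x Tc[OF x] by (simp add: g p q add.commute[of 4])
			have 2: "\<phi> (g + s) (\<zeta> g h) x = h (T s' (i + 2) (T r' (i + 4) x))"
			using x Tc[OF x] by (simp add: g p q add.commute[of 4])
			show "\<zeta> (g + r) (\<phi> g h) x \<ominus>\<^sub>(NN n) \<phi> (g + s) (\<zeta> g h) x = h (H r' (i + 3) (D (i + 4) x))"
			unfolding 1 2 by (rule main[OF x])
			qed
			also have "... : B (i + 4, n)"
			by (rule coboundaryI[where a = "%x. h (H r' (i + 3) x)"])
			(use linear_comp[OF Hl hl] in "auto simp: add.commute[of 3]")
			finally show ?thesis unfolding K.cong_mod_def e(1) using c1[unfolded e(1)] c2[unfolded e(1)] by blast
			qed
		qed
	qed
qed

end

section \<open>Removing one operator by a cone\<close>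

definition cone :: "(int => ('q, nat => 'l) module) => int => ('q, nat => 'l) module" where
	"cone L n = pair_module (L n) (L (n - 1))"

text \<open>The signs make the square of the differential equal to \<open>D\<^sup>2 - f\<^sub>k T\<^sub>k\<close> on both components, except that the commutator of
\<open>D\<close> and \<open>T\<^sub>k\<close> maps the first to the second.\<close>

definition cone_diff ::
		"(nat => 'q) => nat => (int => ('q, nat => 'l) module) => (int => (nat => 'l) => nat => 'l) =>
		(nat => int => (nat => 'l) => nat => 'l) => int => (nat => 'l) => nat => 'l" where
	"cone_diff f k L D T n u = interleave
		(D n (evens u) \<oplus>\<^sub>(L (n - 1)) f k \<odot>\<^sub>(L (n - 1)) odds u)
		(\<ominus>\<^sub>(L (n - 2)) (T k n (evens u) \<oplus>\<^sub>(L (n - 2)) D (n - 1) (odds u)))"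

text \<open>The off-diagonal term \<open>H\<close> absorbs the commutator of \<open>D\<close> and \<open>T\<^sub>k\<close>.\<close>

definition cone_op ::
		"(int => ('q, nat => 'l) module) => (nat => int => (nat => 'l) => nat => 'l) =>
		(nat => int => (nat => 'l) => nat => 'l) => nat => int => (nat => 'l) => nat => 'l" where
	"cone_op L T H s n u = interleave (T s n (evens u)) (H s n (evens u) \<oplus>\<^sub>(L (n - 3)) T s (n - 1) (odds u))"

locale ci_sys_Suc = ci_sys Q f c "Suc k" L D T M aug
	for Q :: "('q, 'k) ring_scheme" (structure) and f c k and L :: "int => ('q, nat => 'l) module"
		and D T and M :: "('q, 'm) module" and aug
begin

lemma k_lt: "k < c" using k_le by simp

lemma fk_closed: "f k : carrier Q" using k_lt by simp

text \<open>By the relation between the commutators, \<open>f\<^sub>k\<close> times the last one lies in the span of the earlier elements, so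
regularity applies.\<close>

lemma top_commutator:
	assumes x: "x : carrier (L n)"
	shows "commutator k n x : fspan f k (L (n - 3))"
proof -
	interpret m: module Q "L (n - 3)" by (rule L_module)
	let ?g = "%r. commutator r n x"
	have g: "?g r : carrier (L (n - 3))" if "r < Suc k" for r
		using that linear_closed[OF commutator_linear x] by simp
	have s: "(lincomb (L (n - 3)) {..<k} f ?g) : fspan f k (L (n - 3))"
		by (rule fspanI) (use g in auto)
	have sc: "(lincomb (L (n - 3)) {..<k} f ?g) : carrier (L (n - 3))"
		by (rule fsum_closed) (use g in auto)
	have "f k \<odot>\<^sub>(L (n - 3)) ?g k \<oplus>\<^sub>(L (n - 3)) (lincomb (L (n - 3)) {..<k} f ?g) = (lincomb (L (n - 3)) {..<Suc k} f ?g)"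
		by (rule m.M.finsum_lessThan_Suc[symmetric]) (rule m.smult_closed[OF f_k g])
	also have "... = \<zero>\<^sub>(L (n - 3))" by (rule commutator_sum[OF x])
	finally have "f k \<odot>\<^sub>(L (n - 3)) ?g k \<oplus>\<^sub>(L (n - 3)) (lincomb (L (n - 3)) {..<k} f ?g) = \<zero>\<^sub>(L (n - 3))" .
	hence eq: "f k \<odot>\<^sub>(L (n - 3)) ?g k = \<ominus>\<^sub>(L (n - 3)) (lincomb (L (n - 3)) {..<k} f ?g)"
		using m.M.minus_equality[of "f k \<odot>\<^sub>(L (n - 3)) ?g k"] sc g[of k] fk_closed by simp
	have sub: "submodule (fspan f k (L (n - 3))) Q (L (n - 3))"
		by (rule m.fspan_submodule) (use f_k in auto)
	have fg: "f k \<odot>\<^sub>(L (n - 3)) ?g k : fspan f k (L (n - 3))"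
		unfolding eq by (rule m.submoduleE(3)[OF sub s])
	obtain J :: "nat set" and b lam where J: "finite J" "dual_basis Q (L (n - 3)) J b lam"
		using L_dual[of "n - 3"] by (auto simp: fin_dual_basis_def)
	show ?thesis by (rule fspan_regular[OF L_module J(2,1) k_lt g[of k] fg]) simp
qed

definition H :: "nat => int => (nat => 'l) => nat => 'l" where
	"H = (SOME H. (ALL s<k. ALL n. linear_map Q (L n) (L (n - 3)) (H s n)) & (ALL n. ALL x:carrier (L n).
		commutator k n x = (lincomb (L (n - 3)) {..<k} f (%s. H s n x))))"

lemma H_linear: "s < k ==> linear_map Q (L n) (L (n - 3)) (H s n)"
	and H_eq: "x : carrier (L n) ==> commutator k n x
		= (lincomb (L (n - 3)) {..<k} f (%s. H s n x))"
proof -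
	have "ALL n. EX H. (ALL s<k. linear_map Q (L n) (L (n - 3)) (H s)) & (ALL x:carrier (L n).
		commutator k n x = (lincomb (L (n - 3)) {..<k} f (%s. H s x)))"
		using commutator_lift[of k k] top_commutator by simp
	from choice[OF this] obtain H' where "ALL n. (ALL s<k. linear_map Q (L n) (L (n - 3)) (H' n s)) & (ALL x:carrier (L n).
		commutator k n x = (lincomb (L (n - 3)) {..<k} f (%s. H' n s x)))"
		by blast
	hence "EX H. (ALL s<k. ALL n. linear_map Q (L n) (L (n - 3)) (H s n)) & (ALL n. ALL x:carrier (L n).
		commutator k n x = (lincomb (L (n - 3)) {..<k} f (%s. H s n x)))"
		by (intro exI[of _ "%s n. H' n s"]) simp
	from someI_ex[OF this, folded H_def]
	show "s < k ==> linear_map Q (L n) (L (n - 3)) (H s n)"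
		"x : carrier (L n) ==> commutator k n x
		= (lincomb (L (n - 3)) {..<k} f (%s. H s n x))"
		by blast+
qed

abbreviation "C == cone L"
abbreviation "\<delta> == cone_diff f k L D T"
abbreviation "S == cone_op L T H"

lemma cone_carrier: "u : carrier (C n) \<longleftrightarrow> evens u : carrier (L n) & odds u : carrier (L (n - 1))"
	by (simp add: cone_def)

lemma cone_module: "module Q (C n)"
	unfolding cone_def by (rule pair_module_is_module[OF L_module L_module])

lemma cone_diff_simps [simp]:
	"evens (\<delta> n u) = D n (evens u) \<oplus>\<^sub>(L (n - 1)) f k \<odot>\<^sub>(L (n - 1)) odds u"
	"odds (\<delta> n u) = \<ominus>\<^sub>(L (n - 2)) (T k n (evens u) \<oplus>\<^sub>(L (n - 2)) D (n - 1) (odds u))"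
	by (simp_all add: cone_diff_def)

lemma cone_op_simps [simp]:
	"evens (S s n u) = T s n (evens u)"
	"odds (S s n u) = H s n (evens u) \<oplus>\<^sub>(L (n - 3)) T s (n - 1) (odds u)"
	by (simp_all add: cone_op_def)

lemma linear_map_evens: "linear_map Q (C n) (L n) evens"
	and linear_map_odds: "m = n - 1 ==> linear_map Q (C n) (L m) odds"
	unfolding cone_def by (simp_all add: linear_evens linear_odds)

lemma cone_diff_linear: "linear_map Q (C n) (C (n - 1)) (\<delta> n)"
	unfolding cone_diff_def cone_def[of L "n - 1"]
proof (rule linear_interleave)
	show "linear_map Q (C n) (L (n - 1)) (%u. D n (evens u) \<oplus>\<^sub>(L (n - 1)) f k \<odot>\<^sub>(L (n - 1)) odds u)"
		by (intro linear_plus linear_scale L_module fk_closed linear_map_odds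
			linear_comp[OF linear_map_evens D_linear]) simp
	have "linear_map Q (C n) (L (n - 2)) (%u. \<ominus>\<^sub>(L (n - 2)) (T k n (evens u) \<oplus>\<^sub>(L (n - 2)) D (n - 1) (odds u)))"
		by (intro linear_plus linear_uminus L_module
			linear_comp[OF linear_map_evens T_linear] linear_comp[OF linear_map_odds[OF refl] D_linear']) auto
	thus "linear_map Q (C n) (L (n - 1 - 1)) (%u. \<ominus>\<^sub>(L (n - 2)) (T k n (evens u) \<oplus>\<^sub>(L (n - 2)) D (n - 1) (odds u)))"
		by simp
qed

lemma cone_op_linear: "s < k ==> linear_map Q (C n) (C (n - 2)) (S s n)"
	unfolding cone_op_def cone_def[of L "n - 2"]
proof (rule linear_interleave)
	assume s: "s < k"
	show "linear_map Q (C n) (L (n - 2)) (%u. T s n (evens u))"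
		using s by (intro linear_comp[OF linear_map_evens T_linear]) simp
	have "linear_map Q (C n) (L (n - 3)) (%u. H s n (evens u) \<oplus>\<^sub>(L (n - 3)) T s (n - 1) (odds u))"
		using s by (intro linear_plus L_module linear_comp[OF linear_map_evens H_linear]
			linear_comp[OF linear_map_odds[OF refl] T_linear']) auto
	thus "linear_map Q (C n) (L (n - 2 - 1)) (%u. H s n (evens u) \<oplus>\<^sub>(L (n - 3)) T s (n - 1) (odds u))"
		by simp
qed

lemma cone_finsum:
	assumes "!!s. s < k ==> g s : carrier (C n)"
	shows "evens (lincomb (C n) {..<k} f g) = (lincomb (L n) {..<k} f (%s. evens (g s)))"
		"odds (lincomb (C n) {..<k} f g) = (lincomb (L (n - 1)) {..<k} f (%s. odds (g s)))"
proof -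
	interpret C: module Q "C n" by (rule cone_module)
	have c: "(%s. f s \<odot>\<^sub>(C n) g s) : {..<k} \<rightarrow> carrier (C n)" using assms f_k by auto
	show "evens (lincomb (C n) {..<k} f g) = (lincomb (L n) {..<k} f (%s. evens (g s)))"
		using linear_finsum[OF cone_module L_module linear_map_evens _ c] by (simp add: cone_def)
	show "odds (lincomb (C n) {..<k} f g) = (lincomb (L (n - 1)) {..<k} f (%s. odds (g s)))"
		using linear_finsum[OF cone_module L_module linear_map_odds[OF refl] _ c] by (simp add: cone_def)
qed

lemma D_D_Suc:
	assumes x: "x : carrier (L n)"
	shows "D (n - 1) (D n x) = f k \<odot>\<^sub>(L (n - 2)) T k n x \<oplus>\<^sub>(L (n - 2)) (lincomb (L (n - 2)) {..<k} f (%r. T r n x))"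
proof -
	interpret m: module Q "L (n - 2)" by (rule L_module)
	show ?thesis unfolding D_D[OF x]
		by (rule m.M.finsum_lessThan_Suc) (use f_k T_closed[OF _ x refl] in auto)
qed

lemma cone_diff_diff:
	assumes u: "u : carrier (C n)"
	shows "\<delta> (n - 1) (\<delta> n u) = (lincomb (C (n - 2)) {..<k} f (%s. S s n u))"
proof (rule interleave_eqI)
	define x y where "x = evens u" and "y = odds u"
	have x: "x : carrier (L n)" and y: "y : carrier (L (n - 1))" using u by (auto simp: cone_carrier x_def y_def)
	interpret L1: module Q "L (n - 1)" by (rule L_module)
	interpret L2: module Q "L (n - 2)" by (rule L_module)
	interpret L3: module Q "L (n - 3)" by (rule L_module)
	have Sc: "!!s. s < k ==> S s n u : carrier (C (n - 2))" using linear_closed[OF cone_op_linear u] by simp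
	have c2: "T k n x : carrier (L (n - 2))" "D (n - 1) y : carrier (L (n - 2))"
		"D n x : carrier (L (n - 1))" "D (n - 1) (D n x) : carrier (L (n - 2))"
		using x y by (auto intro!: T_closed D_closed)
	let ?s = "\<Oplus>\<^sub>(L (n - 2))r\<in>{..<k}. f r \<odot>\<^sub>(L (n - 2)) T r n x"
	have sc: "?s : carrier (L (n - 2))" by (rule fsum_closed) (use x T_closed in auto)
	have "evens (\<delta> (n - 1) (\<delta> n u)) = D (n - 1) (D n x \<oplus>\<^sub>(L (n - 1)) f k \<odot>\<^sub>(L (n - 1)) y)
			\<oplus>\<^sub>(L (n - 2)) f k \<odot>\<^sub>(L (n - 2)) (\<ominus>\<^sub>(L (n - 2)) (T k n x \<oplus>\<^sub>(L (n - 2)) D (n - 1) y))"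
		by (simp add: x_def y_def)
	also have "D (n - 1) (D n x \<oplus>\<^sub>(L (n - 1)) f k \<odot>\<^sub>(L (n - 1)) y) = D (n - 1) (D n x) \<oplus>\<^sub>(L (n - 2)) f k \<odot>\<^sub>(L (n - 2)) D (n - 1) y"
		using D_linear'[of "n - 2" "n - 1"] y c2 fk_closed by (simp add: linear_add linear_smult)
	also have "D (n - 1) (D n x) = f k \<odot>\<^sub>(L (n - 2)) T k n x \<oplus>\<^sub>(L (n - 2)) ?s" by (rule D_D_Suc[OF x])
	also have "(f k \<odot>\<^sub>(L (n - 2)) T k n x \<oplus>\<^sub>(L (n - 2)) ?s) \<oplus>\<^sub>(L (n - 2)) f k \<odot>\<^sub>(L (n - 2)) D (n - 1) y
			\<oplus>\<^sub>(L (n - 2)) f k \<odot>\<^sub>(L (n - 2)) (\<ominus>\<^sub>(L (n - 2)) (T k n x \<oplus>\<^sub>(L (n - 2)) D (n - 1) y)) = ?s"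
	proof -
		have gen: "(a \<oplus>\<^sub>(L (n - 2)) z) \<oplus>\<^sub>(L (n - 2)) b \<oplus>\<^sub>(L (n - 2)) (\<ominus>\<^sub>(L (n - 2)) (a \<oplus>\<^sub>(L (n - 2)) b)) = z"
			if "a : carrier (L (n - 2))" "b : carrier (L (n - 2))" "z : carrier (L (n - 2))" for a b z
		proof -
			have "(a \<oplus>\<^sub>(L (n - 2)) z) \<oplus>\<^sub>(L (n - 2)) b = z \<oplus>\<^sub>(L (n - 2)) (a \<oplus>\<^sub>(L (n - 2)) b)"
			using that by (simp add: L2.M.a_ac)
			thus ?thesis using that by (simp add: L2.M.a_assoc L2.M.r_neg)
		qed
		show ?thesis
			using gen[of "f k \<odot>\<^sub>(L (n - 2)) T k n x" "f k \<odot>\<^sub>(L (n - 2)) D (n - 1) y" ?s] c2 sc fk_closed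
			by (simp add: L2.smult_r_minus L2.smult_r_distr)
	qed
	finally show "evens (\<delta> (n - 1) (\<delta> n u)) = evens (lincomb (C (n - 2)) {..<k} f (%s. S s n u))"
		by (simp add: cone_finsum[OF Sc] x_def)
	have c3: "T k (n - 1) (D n x) : carrier (L (n - 3))" "D (n - 2) (T k n x) : carrier (L (n - 3))"
		"T k (n - 1) y : carrier (L (n - 3))" "D (n - 2) (D (n - 1) y) : carrier (L (n - 3))"
		using x y by (auto intro!: T_closed D_closed)
	let ?h = "\<Oplus>\<^sub>(L (n - 3))s\<in>{..<k}. f s \<odot>\<^sub>(L (n - 3)) H s n x"
	let ?t = "\<Oplus>\<^sub>(L (n - 3))s\<in>{..<k}. f s \<odot>\<^sub>(L (n - 3)) T s (n - 1) y"
	have Hc: "H s n x : carrier (L (n - 3))" if "s < k" for s using linear_closed[OF H_linear x] that by simp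
	have Tc: "T s (n - 1) y : carrier (L (n - 3))" if "s < k" for s using that y by (auto intro!: T_closed)
	have hc: "?h : carrier (L (n - 3))" by (rule fsum_closed) (use Hc in auto)
	have tc: "?t : carrier (L (n - 3))" by (rule fsum_closed) (use Tc in auto)
	have DDy: "D (n - 2) (D (n - 1) y) = f k \<odot>\<^sub>(L (n - 3)) T k (n - 1) y \<oplus>\<^sub>(L (n - 3)) ?t"
		using D_D_Suc[OF y] by simp
	have "odds (\<delta> (n - 1) (\<delta> n u)) = \<ominus>\<^sub>(L (n - 3)) (T k (n - 1) (D n x \<oplus>\<^sub>(L (n - 1)) f k \<odot>\<^sub>(L (n - 1)) y)
			\<oplus>\<^sub>(L (n - 3)) D (n - 2) (\<ominus>\<^sub>(L (n - 2)) (T k n x \<oplus>\<^sub>(L (n - 2)) D (n - 1) y)))"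
		by (simp add: x_def y_def)
	also have "T k (n - 1) (D n x \<oplus>\<^sub>(L (n - 1)) f k \<odot>\<^sub>(L (n - 1)) y) = T k (n - 1) (D n x) \<oplus>\<^sub>(L (n - 3)) f k \<odot>\<^sub>(L (n - 3)) T k (n - 1) y"
		using T_linear'[of k "n - 3" "n - 1"] y c2 fk_closed by (simp add: linear_add linear_smult)
	also have "D (n - 2) (\<ominus>\<^sub>(L (n - 2)) (T k n x \<oplus>\<^sub>(L (n - 2)) D (n - 1) y)) =
			\<ominus>\<^sub>(L (n - 3)) (D (n - 2) (T k n x) \<oplus>\<^sub>(L (n - 3)) D (n - 2) (D (n - 1) y))"
		using linear_minus[OF L_module L_module D_linear'[of "n - 3" "n - 2"]] D_linear'[of "n - 3" "n - 2"] c2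
		by (simp add: linear_add)
	also have "\<ominus>\<^sub>(L (n - 3)) ((T k (n - 1) (D n x) \<oplus>\<^sub>(L (n - 3)) f k \<odot>\<^sub>(L (n - 3)) T k (n - 1) y) \<oplus>\<^sub>(L (n - 3))
			\<ominus>\<^sub>(L (n - 3)) (D (n - 2) (T k n x) \<oplus>\<^sub>(L (n - 3)) D (n - 2) (D (n - 1) y))) = ?h \<oplus>\<^sub>(L (n - 3)) ?t"
	proof -
		have gen: "\<ominus>\<^sub>(L (n - 3)) ((a \<oplus>\<^sub>(L (n - 3)) b) \<oplus>\<^sub>(L (n - 3)) \<ominus>\<^sub>(L (n - 3)) (e \<oplus>\<^sub>(L (n - 3)) (b \<oplus>\<^sub>(L (n - 3)) z)))
			= (e \<ominus>\<^sub>(L (n - 3)) a) \<oplus>\<^sub>(L (n - 3)) z"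
			if "a : carrier (L (n - 3))" "b : carrier (L (n - 3))" "e : carrier (L (n - 3))" "z : carrier (L (n - 3))" for a b e z
		proof -
			have "\<ominus>\<^sub>(L (n - 3)) ((a \<oplus>\<^sub>(L (n - 3)) b) \<oplus>\<^sub>(L (n - 3)) \<ominus>\<^sub>(L (n - 3)) (e \<oplus>\<^sub>(L (n - 3)) (b \<oplus>\<^sub>(L (n - 3)) z)))
			= \<ominus>\<^sub>(L (n - 3)) b \<oplus>\<^sub>(L (n - 3)) (b \<oplus>\<^sub>(L (n - 3)) (e \<oplus>\<^sub>(L (n - 3)) (\<ominus>\<^sub>(L (n - 3)) a \<oplus>\<^sub>(L (n - 3)) z)))"
			using that by (simp add: L3.M.minus_add L3.M.a_ac)
			also have "... = e \<oplus>\<^sub>(L (n - 3)) (\<ominus>\<^sub>(L (n - 3)) a \<oplus>\<^sub>(L (n - 3)) z)" using that by (simp add: L3.M.r_neg1)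
			finally show ?thesis using that by (simp add: a_minus_def L3.M.a_assoc)
		qed
		show ?thesis unfolding DDy H_eq[OF x, symmetric] by (rule gen) (use c3 tc fk_closed in auto)
	qed
	also have "?h \<oplus>\<^sub>(L (n - 3)) ?t = (\<Oplus>\<^sub>(L (n - 3))s\<in>{..<k}. f s \<odot>\<^sub>(L (n - 3)) H s n x \<oplus>\<^sub>(L (n - 3)) f s \<odot>\<^sub>(L (n - 3)) T s (n - 1) y)"
		by (rule L3.M.finsum_addf[symmetric]) (use Hc Tc f_k in auto)
	also have "... = (lincomb (L (n - 3)) {..<k} f (%s. (H s n x \<oplus>\<^sub>(L (n - 3)) T s (n - 1) y)))"
		by (rule L3.M.finsum_cong') (use Hc Tc f_k in "auto simp: L3.smult_r_distr")
	finally show "odds (\<delta> (n - 1) (\<delta> n u)) = odds (lincomb (C (n - 2)) {..<k} f (%s. S s n u))"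
		by (simp add: cone_finsum[OF Sc] x_def y_def)
qed

lemma fspan_Suc_L: "x : fspan f (Suc k) (L n) \<longleftrightarrow> (EX u:carrier (L n). EX v:fspan f k (L n). x = f k \<odot>\<^sub>(L n) u \<oplus>\<^sub>(L n) v)"
	by (rule module.fspan_Suc[OF L_module]) (use f_k in auto)

lemma fspan_k_submodule: "submodule (fspan f k (L n)) Q (L n)"
	by (rule module.fspan_submodule[OF L_module]) (use f_k in auto)

lemma cone_fspanI: "evens u : fspan f k (L n) ==> odds u : fspan f k (L (n - 1)) ==> u : fspan f k (C n)"
	unfolding cone_def by (rule pair_fspan[OF L_module L_module]) (use f_k in auto)

lemma cone_fspanD:
	assumes "u : fspan f k (C n)"
	shows "evens u : fspan f k (L n)" "odds u : fspan f k (L (n - 1))"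
	using linear_fspan[OF cone_module L_module linear_map_evens _ assms]
		linear_fspan[OF cone_module L_module linear_map_odds[OF refl] _ assms] f_k by auto

text \<open>The boundary of \<open>(y, w)\<close> agrees with \<open>u\<close> in the first component modulo the earlier elements. The difference has
its differential in their span, hence also \<open>f\<^sub>k\<close> times its second component, and regularity applies.\<close>

lemma cone_exact_step:
	assumes u: "u : carrier (C n)" and du: "\<delta> n u : fspan f k (C (n - 1))"
		and y: "y : carrier (L (n + 1))" and w: "w : carrier (L n)" and v: "v : fspan f k (L n)"
		and eq: "evens u = (D (n + 1) y \<oplus>\<^sub>(L n) f k \<odot>\<^sub>(L n) w) \<oplus>\<^sub>(L n) v"
	shows "u \<ominus>\<^sub>(C n) \<delta> (n + 1) (interleave y w) : fspan f k (C n)"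
proof -
	let ?z = "interleave y w"
	interpret Cn: module Q "C n" by (rule cone_module)
	interpret C1: module Q "C (n - 1)" by (rule cone_module)
	interpret L0: module Q "L n" by (rule L_module)
	interpret L1: module Q "L (n - 1)" by (rule L_module)
	have z: "?z : carrier (C (n + 1))" using y w by (simp add: cone_carrier)
	have dz: "\<delta> (n + 1) ?z : carrier (C n)" using linear_closed[OF cone_diff_linear z] by simp
	let ?u = "u \<ominus>\<^sub>(C n) \<delta> (n + 1) ?z"
	have uc: "?u : carrier (C n)" using u dz by simp
	have vc: "v : carrier (L n)" using v L0.submoduleE(1)[OF fspan_k_submodule] by blast
	have Dy: "D (n + 1) y : carrier (L n)" using D_closed[OF y] by simp
	have dzd: "evens (\<delta> (n + 1) ?z) = D (n + 1) y \<oplus>\<^sub>(L n) f k \<odot>\<^sub>(L n) w" by simp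
	have "evens ?u = evens u \<ominus>\<^sub>(L n) evens (\<delta> (n + 1) ?z)"
		using evens_diff(1)[OF L_module L_module] u dz unfolding cone_def by blast
	also have "... = v"
	proof -
		have "(a \<oplus>\<^sub>(L n) v) \<ominus>\<^sub>(L n) a = v" if "a : carrier (L n)" for a
			using that vc by (simp add: a_minus_def L0.M.a_comm[of a] L0.M.a_assoc L0.M.r_neg)
		thus ?thesis unfolding dzd eq using Dy w fk_closed by simp
	qed
	finally have eu: "evens ?u = v" .
	have ddz: "\<delta> n (\<delta> (n + 1) ?z) : fspan f k (C (n - 1))"
	proof -
		have "\<delta> n (\<delta> (n + 1) ?z) = (lincomb (C (n - 1)) {..<k} f (%s. S s (n + 1) ?z))"
			using cone_diff_diff[OF z] by simp
		thus ?thesis using linear_closed[OF cone_op_linear z] by (auto intro: fspanI)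
	qed
	have subC: "submodule (fspan f k (C (n - 1))) Q (C (n - 1))"
		by (rule C1.fspan_submodule) (use f_k in auto)
	have "\<delta> n ?u = \<delta> n u \<ominus>\<^sub>(C (n - 1)) \<delta> n (\<delta> (n + 1) ?z)"
		by (rule linear_diff[OF cone_module cone_module cone_diff_linear u dz])
	hence "\<delta> n ?u : fspan f k (C (n - 1))"
		unfolding a_minus_def using C1.submoduleE(3,5)[OF subC] du ddz by simp
	hence "evens (\<delta> n ?u) : fspan f k (L (n - 1))" by (rule cone_fspanD)
	hence 1: "D n v \<oplus>\<^sub>(L (n - 1)) f k \<odot>\<^sub>(L (n - 1)) odds ?u : fspan f k (L (n - 1))" by (simp add: eu)
	have 2: "D n v : fspan f k (L (n - 1))"
		by (rule linear_fspan[OF L_module L_module D_linear _ v]) (use f_k in auto)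
	have oc: "odds ?u : carrier (L (n - 1))" using uc by (simp add: cone_carrier)
	have Dv: "D n v : carrier (L (n - 1))" by (rule D_closed[OF vc refl])
	have "\<ominus>\<^sub>(L (n - 1)) D n v \<oplus>\<^sub>(L (n - 1)) (D n v \<oplus>\<^sub>(L (n - 1)) f k \<odot>\<^sub>(L (n - 1)) odds ?u) : fspan f k (L (n - 1))"
		using 1 2 L1.submoduleE(3,5)[OF fspan_k_submodule] by blast
	hence "f k \<odot>\<^sub>(L (n - 1)) odds ?u : fspan f k (L (n - 1))"
		using Dv oc fk_closed by (simp add: L1.M.r_neg1)
	moreover obtain J :: "nat set" and b lam where J: "finite J" "dual_basis Q (L (n - 1)) J b lam"
		using L_dual[of "n - 1"] by (auto simp: fin_dual_basis_def)
	ultimately have "odds ?u : fspan f k (L (n - 1))"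
		using fspan_regular[OF L_module J(2,1) k_lt oc] by simp
	thus ?thesis using cone_fspanI eu v by simp
qed

lemma fspan_Suc_regroup:
	assumes "x : carrier (L n)" "y : carrier (L n)" "x \<ominus>\<^sub>(L n) y : fspan f (Suc k) (L n)"
	shows "EX w:carrier (L n). EX v:fspan f k (L n). x = (y \<oplus>\<^sub>(L n) f k \<odot>\<^sub>(L n) w) \<oplus>\<^sub>(L n) v"
proof -
	interpret L0: module Q "L n" by (rule L_module)
	obtain w v where wv: "w : carrier (L n)" "v : fspan f k (L n)" "x \<ominus>\<^sub>(L n) y = f k \<odot>\<^sub>(L n) w \<oplus>\<^sub>(L n) v"
		using assms(3) fspan_Suc_L by blast
	have vc: "v : carrier (L n)" using wv(2) L0.submoduleE(1)[OF fspan_k_submodule] by blast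
	have "x = y \<oplus>\<^sub>(L n) (x \<ominus>\<^sub>(L n) y)"
		using assms(1,2) by (simp add: a_minus_def L0.M.a_comm[of y] L0.M.a_assoc L0.M.l_neg)
	hence "x = (y \<oplus>\<^sub>(L n) f k \<odot>\<^sub>(L n) w) \<oplus>\<^sub>(L n) v"
		unfolding wv(3) using assms(2) wv(1) vc fk_closed by (simp add: L0.M.a_assoc)
	thus ?thesis using wv by blast
qed

lemma cone_neg:
	assumes that: "n < 0"
	shows "carrier (C n) = {\<zero>\<^sub>(C n)}"
proof -
	have z: "carrier (L n) = {\<zero>\<^sub>(L n)}" "carrier (L (n - 1)) = {\<zero>\<^sub>(L (n - 1))}" using L_neg that by auto
	show ?thesis
	proof (rule Set.set_eqI)
		fix u
		show "u : carrier (C n) \<longleftrightarrow> u : {\<zero>\<^sub>(C n)}"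
			using z by (auto simp: cone_def) (rule interleave_eqI; simp)
	qed
qed

lemma cone_system: "ci_system Q f k C \<delta> S M (%u. aug (evens u))"
	unfolding ci_system_def
proof (intro conjI allI impI ballI)
	fix n
	show "module Q (C n)" by (rule cone_module)
	show "fin_dual_basis Q (C n)" unfolding cone_def by (rule fin_dual_basis_pair[OF L_module L_module L_dual L_dual])
	show "linear_map Q (C n) (C (n - 1)) (\<delta> n)" by (rule cone_diff_linear)
	show "linear_map Q (C n) (C (n - 2)) (S s n)" if "s < k" for s by (rule cone_op_linear[OF that])
	show "\<delta> (n - 1) (\<delta> n u) = (lincomb (C (n - 2)) {..<k} f (%s. S s n u))" if "u : carrier (C n)" for u
		by (rule cone_diff_diff[OF that])
	show "carrier (C n) = {\<zero>\<^sub>(C n)}" if "n < 0" by (rule cone_neg[OF that])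
	show "f r \<odot>\<^sub>M z = \<zero>\<^sub>M" if "r < k" "z : carrier M" for r z using f_M that by simp
	show "EX y:carrier (C (n + 1)). u \<ominus>\<^sub>(C n) \<delta> (n + 1) y : fspan f k (C n)"
		if n: "n > 0" and u: "u : carrier (C n)" and du: "\<delta> n u : fspan f k (C (n - 1))" for u
	proof -
		interpret L1: module Q "L (n - 1)" by (rule L_module)
		have uc: "evens u : carrier (L n)" "odds u : carrier (L (n - 1))" using u by (auto simp: cone_carrier)
		have Du: "D n (evens u) : carrier (L (n - 1))" by (rule D_closed[OF uc(1) refl])
		have "D n (evens u) \<oplus>\<^sub>(L (n - 1)) f k \<odot>\<^sub>(L (n - 1)) odds u : fspan f k (L (n - 1))"
			using cone_fspanD(1)[OF du] by simp
		then obtain v where v: "v : fspan f k (L (n - 1))" "v = D n (evens u) \<oplus>\<^sub>(L (n - 1)) f k \<odot>\<^sub>(L (n - 1)) odds u" by blast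
		have vc: "v : carrier (L (n - 1))" using v L1.submoduleE(1)[OF fspan_k_submodule] by blast
		have "D n (evens u) = f k \<odot>\<^sub>(L (n - 1)) (\<ominus>\<^sub>(L (n - 1)) odds u) \<oplus>\<^sub>(L (n - 1)) v"
			unfolding v(2) using Du uc fk_closed
			by (simp add: L1.smult_r_minus L1.M.a_comm[of "D n (evens u)"] L1.M.r_neg1)
		hence "D n (evens u) : fspan f (Suc k) (L (n - 1))"
			using v(1) uc unfolding fspan_Suc_L by blast
		then obtain y where y: "y : carrier (L (n + 1))" "evens u \<ominus>\<^sub>(L n) D (n + 1) y : fspan f (Suc k) (L n)"
			using exact[OF n uc(1)] by blast
		have "D (n + 1) y : carrier (L n)" using D_closed[OF y(1)] by simp
		from fspan_Suc_regroup[OF uc(1) this y(2)] obtain w v where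
			"w : carrier (L n)" "v : fspan f k (L n)" "evens u = (D (n + 1) y \<oplus>\<^sub>(L n) f k \<odot>\<^sub>(L n) w) \<oplus>\<^sub>(L n) v" by blast
		from cone_exact_step[OF u du y(1) this] show ?thesis
			using y(1) \<open>w : carrier (L n)\<close> by (intro bexI[of _ "interleave y w"]) (auto simp: cone_carrier)
	qed
next
	show "module Q M" by (rule M_module)
	show "linear_map Q (C 0) M (%u. aug (evens u))" by (rule linear_comp[OF linear_map_evens aug_linear])
	have z1: "carrier (L (- 1)) = {\<zero>\<^sub>(L (- 1))}" using L_neg by simp
	show "(%u. aug (evens u)) ` carrier (C 0) = carrier M"
	proof -
		have "evens ` carrier (C 0) = carrier (L 0)"
		proof
			show "carrier (L 0) <= evens ` carrier (C 0)"
			proof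
			fix x assume "x : carrier (L 0)"
			hence "interleave x \<zero>\<^sub>(L (- 1)) : carrier (C 0)" using z1 by (simp add: cone_carrier)
			thus "x : evens ` carrier (C 0)" by (metis imageI interleave_simps(1))
			qed
		qed (auto simp: cone_carrier)
		thus ?thesis using aug_surj by (metis image_image)
	qed
	interpret Mm: module Q M by (rule M_module)
	interpret L0: module Q "L 0" by (rule L_module)
	interpret Lm: module Q "L (- 1)" by (rule L_module)
	have e_fspan: "aug (f k \<odot>\<^sub>(L 0) w) = \<zero>\<^sub>M" if "w : carrier (L 0)" for w
		using f_M[of k] linear_closed[OF aug_linear that] linear_smult[OF aug_linear fk_closed that] by simp
	show "aug (evens (\<delta> 1 u)) = \<zero>\<^sub>M" if "u : carrier (C 1)" for u
		using that aug_D e_fspan D_closed[of "evens u" 1 0] fk_closed by (simp add: cone_carrier linear_add[OF aug_linear])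
	show "EX y:carrier (C 1). u \<ominus>\<^sub>(C 0) \<delta> 1 y : fspan f k (C 0)"
		if u: "u : carrier (C 0)" and eu: "aug (evens u) = \<zero>\<^sub>M" for u
	proof -
		have uc: "evens u : carrier (L 0)" using u by (simp add: cone_carrier)
		obtain y where y: "y : carrier (L 1)" "evens u \<ominus>\<^sub>(L 0) D 1 y : fspan f (Suc k) (L 0)"
			using aug_exact[OF uc eu] by blast
		have "D 1 y : carrier (L 0)" using D_closed[OF y(1)] by simp
		from fspan_Suc_regroup[OF uc this y(2)] obtain w v where
			w: "w : carrier (L 0)" "v : fspan f k (L 0)" "evens u = (D 1 y \<oplus>\<^sub>(L 0) f k \<odot>\<^sub>(L 0) w) \<oplus>\<^sub>(L 0) v" by blast
		have "\<delta> 0 u : fspan f k (C (0 - 1))"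
		proof -
			interpret Cm: module Q "C (- 1)" by (rule cone_module)
			have "\<delta> 0 u : carrier (C (- 1))" using linear_closed[OF cone_diff_linear u] by simp
			moreover have "carrier (C (- 1)) = {\<zero>\<^sub>(C (- 1))}"
by (rule cone_neg) simp
			moreover have "submodule (fspan f k (C (- 1))) Q (C (- 1))" by (rule Cm.fspan_submodule) (use f_k in auto)
			hence "\<zero>\<^sub>(C (- 1)) : fspan f k (C (- 1))" using subgroup.one_closed[OF submodule.axioms(1)] by force
			ultimately show ?thesis by simp
		qed
		from cone_exact_step[OF u this, of y w v] y(1) w show ?thesis
			by (intro bexI[of _ "interleave y w"]) (auto simp: cone_carrier)
	qed
qed

end

section \<open>The induction step and the bounded case\<close>

lemma (in ci_cochain) Z_neg: "i < 0 ==> Z (i, n) <= B (i, n)"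
proof
	fix h assume i: "i < 0" and h: "h : Z (i, n)"
	have "h \<zero>\<^sub>(L i) = \<zero>\<^sub>(NN n)" by (rule linear_zero[OF L_module NN_module]) (use h Z_iff in blast)
	thus "h : B (i, n)"
		using h L_neg[OF i] by (intro coboundaryI[where a = "%x. \<zero>\<^sub>(NN n)"]) (auto simp: Z_iff linear_const_zero[OF NN_module])
qed

locale ci_step = ci_coeff Q f c NN nops + ci_sys_Suc Q f c k L D T M aug
	for Q :: "('q, 'k) ring_scheme" (structure) and f c and NN :: "nat => ('q, 'n) module" and nops k
		and L :: "int => ('q, nat => 'l) module" and D T and M :: "('q, 'm) module" and aug
begin

sublocale ci_cochain Q f c NN nops "Suc k" L D T M aug ..

sublocale cone: ci_cochain Q f c NN nops k C \<delta> S M "%u. aug (evens u)"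
proof unfold_locales
	show "ci_system Q f k C \<delta> S M (%u. aug (evens u))" by (rule cone_system)
	show "k <= c" using k_lt by simp
qed

text \<open>Cochains pulled back along the projection of the cone to its first summand.\<close>

definition incl :: "int \<times> nat => ((nat => 'l) => 'n) => (nat => 'l) => 'n" where
	"incl = (%(i, n) g. \<lambda>u\<in>carrier (C i). g (evens u))"

lemma evens_closed: "u : carrier (C i) ==> evens u : carrier (L i)"
	by (simp add: cone_carrier)

lemma incl_linear: "linear_map Q (K g) (cochain C g) (incl g)"
proof (cases g)
	case (Pair i n)
	show ?thesis unfolding Pair
	proof (rule linear_mapI)
		fix h assume "h : carrier (K (i, n))"
		hence "linear_map Q (L i) (NN n) h" by (simp add: cochain_carrier)
		thus "incl (i, n) h : carrier (cochain C (i, n))"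
			using linear_restrict[OF cone_module linear_comp[OF linear_map_evens]]
			by (simp add: incl_def cochain_carrier)
	qed (unfold incl_def cochain_simps prod.case, (rule restrict_ext, simp add: evens_closed)+)
qed

lemma incl_Z:
	assumes "h : Z g"
	shows "incl g h : cocycle C \<delta> g"
proof (cases g)
	case (Pair i n)
	interpret N: module Q "NN n" by (rule NN_module)
	note h = assms[unfolded Pair Z_iff]
	have hl: "linear_map Q (L i) (NN n) h" using h by blast
	have c: "incl (i, n) h : carrier (cochain C (i, n))"
		using linear_closed[OF incl_linear, of h "(i, n)"] h by (simp add: cochain_carrier)
	have "incl (i, n) h (\<delta> (i + 1) u) = \<zero>\<^sub>(NN n)" if u: "u : carrier (C (i + 1))" for u
	proof -
		have uc: "evens u : carrier (L (i + 1))" "odds u : carrier (L i)" using u by (auto simp: cone_carrier)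
		interpret Li: module Q "L i" by (rule L_module)
		have Du: "D (i + 1) (evens u) : carrier (L i)" using D_closed[OF uc(1)] by simp
		have dc: "\<delta> (i + 1) u : carrier (C i)" using linear_closed[OF cone_diff_linear u] by simp
		have "incl (i, n) h (\<delta> (i + 1) u) = h (D (i + 1) (evens u) \<oplus>\<^sub>(L i) f k \<odot>\<^sub>(L i) odds u)"
			using dc by (simp add: incl_def)
		also have "... = h (D (i + 1) (evens u)) \<oplus>\<^sub>(NN n) f k \<odot>\<^sub>(NN n) h (odds u)"
			using Du uc fk_closed by (simp add: linear_add[OF hl] linear_smult[OF hl])
		also have "... = \<zero>\<^sub>(NN n)"
			using h uc f_NN[OF k_lt] linear_closed[OF hl] by simp
		finally show ?thesis .
	qed
	thus ?thesis using c unfolding Pair cone.Z_iff cochain_carrier by blast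
qed

definition tower_base :: "int \<times> nat => ((nat => 'l) => 'n) set" where
	"tower_base = (%(i, n). {b \<oplus>\<^sub>(K (i, n)) snd (shift_op L (T k)) (i - 2, n) y | b y. b : B (i, n) & y : Z (i - 2, n)})"

text \<open>Part of the long exact sequence of the cone. A cochain \<open>\<Psi>\<close> of the cone with coboundary \<open>incl g\<close> splits into \<open>a\<close> and
\<open>e\<close> on the two summands. Evaluating on the second summand shows that \<open>e\<close> is a cocycle, and on the first that \<open>g\<close> is
\<open>a \<circ> D - e \<circ> T\<^sub>k\<close>.\<close>

lemma incl_coboundary:
	assumes g: "g : Z (i, n)" and b: "incl (i, n) g : coboundary C \<delta> (i, n)"
	shows "g : tower_base (i, n)"
proof -
	interpret N: module Q "NN n" by (rule NN_module)
	interpret Li: module Q "L i" by (rule L_module)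
	interpret L1: module Q "L (i - 1)" by (rule L_module)
	interpret L2: module Q "L (i - 2)" by (rule L_module)
	note gz = g[unfolded Z_iff]
	obtain \<Psi> where \<Psi>: "linear_map Q (C (i - 1)) (NN n) \<Psi>" "incl (i, n) g = (\<lambda>u\<in>carrier (C i). \<Psi> (\<delta> i u))"
		using b by (auto simp: coboundary_def)
	have val: "g (evens u) = \<Psi> (\<delta> i u)" if "u : carrier (C i)" for u
		using fun_cong[OF \<Psi>(2), of u] that by (simp add: incl_def)
	define a where "a x = \<Psi> (interleave x \<zero>\<^sub>(L (i - 2)))" for x
	define e where "e y = \<Psi> (interleave \<zero>\<^sub>(L (i - 1)) y)" for y
	have C1: "C (i - 1) = pair_module (L (i - 1)) (L (i - 2))" by (simp add: cone_def)
	have al: "linear_map Q (L (i - 1)) (NN n) a" unfolding a_def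
		by (rule linear_comp[OF _ \<Psi>(1)[unfolded C1]])
			(intro linear_interleave linear_id linear_const_zero L_module)
	have el: "linear_map Q (L (i - 2)) (NN n) e" unfolding e_def
		by (rule linear_comp[OF _ \<Psi>(1)[unfolded C1]])
			(intro linear_interleave linear_id linear_const_zero L_module)
	have split: "\<Psi> (interleave x y) = a x \<oplus>\<^sub>(NN n) e y" if "x : carrier (L (i - 1))" "y : carrier (L (i - 2))" for x y
	proof -
		have "interleave x y = interleave x \<zero>\<^sub>(L (i - 2)) \<oplus>\<^sub>(C (i - 1)) interleave \<zero>\<^sub>(L (i - 1)) y"
			unfolding C1 by (rule interleave_eqI) (use that in auto)
		thus ?thesis using linear_add[OF \<Psi>(1)] that by (simp add: C1 a_def e_def)
	qed
	have zD: "D m \<zero>\<^sub>(L m) = \<zero>\<^sub>(L (m - 1))" for m by (rule linear_zero[OF L_module L_module D_linear])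
	have zT: "T k i \<zero>\<^sub>(L i) = \<zero>\<^sub>(L (i - 2))" by (rule linear_zero[OF L_module L_module T_linear]) simp
	have g0: "g \<zero>\<^sub>(L i) = \<zero>\<^sub>(NN n)" by (rule linear_zero[OF L_module NN_module]) (use gz in blast)
	have gx: "g x = a (D i x) \<oplus>\<^sub>(NN n) \<ominus>\<^sub>(NN n) e (T k i x)" if x: "x : carrier (L i)" for x
	proof -
		let ?u = "interleave x \<zero>\<^sub>(L (i - 1))"
		have c: "D i x : carrier (L (i - 1))" "T k i x : carrier (L (i - 2))" using x by (auto intro!: D_closed T_closed)
		have "\<delta> i ?u = interleave (D i x) (\<ominus>\<^sub>(L (i - 2)) T k i x)"
			by (rule interleave_eqI) (use c fk_closed zD[of "i - 1"] in simp_all)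
		hence "g x = a (D i x) \<oplus>\<^sub>(NN n) e (\<ominus>\<^sub>(L (i - 2)) T k i x)"
			using val[of ?u] x c by (simp add: cone_carrier split)
		also have "e (\<ominus>\<^sub>(L (i - 2)) T k i x) = \<ominus>\<^sub>(NN n) e (T k i x)"
			by (rule linear_minus[OF L_module NN_module el c(2)])
		finally show ?thesis .
	qed
	have eD: "e (D (i - 1) y) = \<zero>\<^sub>(NN n)" if y: "y : carrier (L (i - 1))" for y
	proof -
		let ?u = "interleave \<zero>\<^sub>(L i) y"
		have c: "D (i - 1) y : carrier (L (i - 2))" using y by (auto intro!: D_closed)
		have "\<delta> i ?u = interleave (f k \<odot>\<^sub>(L (i - 1)) y) (\<ominus>\<^sub>(L (i - 2)) D (i - 1) y)"
			by (rule interleave_eqI) (use c y fk_closed zD[of i] zT in simp_all)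
		hence "\<zero>\<^sub>(NN n) = a (f k \<odot>\<^sub>(L (i - 1)) y) \<oplus>\<^sub>(NN n) e (\<ominus>\<^sub>(L (i - 2)) D (i - 1) y)"
			using val[of ?u] y c g0 fk_closed by (simp add: cone_carrier split)
		also have "a (f k \<odot>\<^sub>(L (i - 1)) y) = \<zero>\<^sub>(NN n)"
			using linear_smult[OF al fk_closed y] f_NN[OF k_lt linear_closed[OF al y]] by simp
		also have "e (\<ominus>\<^sub>(L (i - 2)) D (i - 1) y) = \<ominus>\<^sub>(NN n) e (D (i - 1) y)"
			by (rule linear_minus[OF L_module NN_module el c])
		finally have "\<ominus>\<^sub>(NN n) e (D (i - 1) y) = \<zero>\<^sub>(NN n)" using linear_closed[OF el c] by simp
		hence "e (D (i - 1) y) \<oplus>\<^sub>(NN n) \<zero>\<^sub>(NN n) = \<zero>\<^sub>(NN n)"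
			using N.M.r_neg[OF linear_closed[OF el c]] by simp
		thus ?thesis using linear_closed[OF el c] by simp
	qed
	define y where "y = (\<lambda>x\<in>carrier (L (i - 2)). \<ominus>\<^sub>(NN n) e x)"
	have nz: "\<ominus>\<^sub>(NN n) \<zero>\<^sub>(NN n) = \<zero>\<^sub>(NN n)" by (rule N.M.minus_equality) simp_all
	have y: "y : Z (i - 2, n)"
		unfolding Z_iff y_def
	proof (intro conjI ballI)
		show "linear_map Q (L (i - 2)) (NN n) (\<lambda>x\<in>carrier (L (i - 2)). \<ominus>\<^sub>(NN n) e x)"
			by (intro linear_restrict L_module linear_uminus NN_module el)
		fix x assume "x : carrier (L (i - 2 + 1))"
		hence x: "x : carrier (L (i - 1))" by simp
		show "(\<lambda>x\<in>carrier (L (i - 2)). \<ominus>\<^sub>(NN n) e x) (D (i - 2 + 1) x) = \<zero>\<^sub>(NN n)"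
			using eD[OF x] D_closed[OF x, of "i - 2"] nz by simp
	qed simp
	define b where "b = (\<lambda>x\<in>carrier (L i). a (D i x))"
	have b: "b : B (i, n)" by (rule coboundaryI[where a = a]) (use al in "auto simp: b_def")
	have "g = b \<oplus>\<^sub>(K (i, n)) snd (shift_op L (T k)) (i - 2, n) y"
	proof (rule extensionalityI)
		show "g : extensional (carrier (L i))" using gz by blast
		show "b \<oplus>\<^sub>(K (i, n)) snd (shift_op L (T k)) (i - 2, n) y : extensional (carrier (L i))" by (simp add: cochain_simps)
		fix x assume x: "x : carrier (L i)"
		have "T k i x : carrier (L (i - 2))" using x by (auto intro!: T_closed)
		thus "g x = (b \<oplus>\<^sub>(K (i, n)) snd (shift_op L (T k)) (i - 2, n) y) x"
			using x gx by (simp add: cochain_simps shift_op_def b_def y_def)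
	qed
	thus ?thesis using b y unfolding tower_base_def prod.case by blast
qed

text \<open>Noetherianity, and not only finite generation, of the cohomology of the cone is needed here, because the
cokernel of the last operator is a submodule of it.\<close>

lemma fin_gen_step:
	assumes "fin_gen_family Q (cochain C) (all_ops k C S) (cocycle C \<delta>) (coboundary C \<delta>)"
	shows "fin_gen_family Q K (all_ops (Suc k) L T) Z B"
proof -
	have n: "noetherian_family Q (cochain C) (all_ops k C S) (cocycle C \<delta>) (coboundary C \<delta>)"
		by (rule cone.K.fin_gen_imp_noetherian[OF Q_noetherian finite_all_ops cone.ops_linear_all cone.Z_closed
			cone.B_closed cone.B_le_Z cone.operators_commute assms])
	have sub: "all_ops k L T <= all_ops (Suc k) L T" by (rule all_ops_mono) simp
	have Zk: "closed_family Q K (all_ops k L T) Z" by (rule closed_family_mono[OF Z_closed sub])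
	have "noetherian_family Q K (all_ops k L T) Z (%g. {x : Z g. incl g x : coboundary C \<delta> g})"
	proof (rule noetherian_pullback[OF K.module_family_axioms cone.K.module_family_axioms cone.ops_linear_all
			incl_linear Zk cone.B_closed incl_Z cone.B_le_Z cone.Z_closed _ n])
		fix s \<psi> assume "(s, \<psi>) : all_ops k C S"
		thus "EX \<phi>. (s, \<phi>) : all_ops k L T & (ALL g. ALL x:Z g. incl (g + s) (\<phi> g x) = \<psi> g (incl g x))"
		proof (cases rule: all_ops_cases)
			case (coeff s0 \<phi>0)
			let ?\<phi> = "%(i, n) h. \<lambda>x\<in>carrier (L i). \<phi>0 n (h x)"
			have "(s, ?\<phi>) = coeff_op L (s0, \<phi>0)" by (simp add: coeff_op_def coeff)
			hence "(s, ?\<phi>) : all_ops k L T" using coeff(1) by (auto simp: all_ops_def)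
			moreover have "incl (g + s) (?\<phi> g x) = \<psi> g (incl g x)" for g x
			by (cases g) (auto simp: incl_def coeff evens_closed intro!: restrict_ext)
			ultimately show ?thesis by blast
		next
			case (shift r)
			let ?\<phi> = "%(i, n) h. \<lambda>x\<in>carrier (L (i + 2)). h (T r (i + 2) x)"
			have "(s, ?\<phi>) = shift_op L (T r)" by (simp add: shift_op_def shift)
			hence "(s, ?\<phi>) : all_ops k L T" using shift(1) by (auto simp: all_ops_def)
			moreover have "incl (g + s) (?\<phi> g x) = \<psi> g (incl g x)" for g x
			proof (cases g)
			case (Pair i n)
			have "S r (i + 2) u : carrier (C i)" if "u : carrier (C (i + 2))" for u
			using cone.T_closed[OF shift(1) that, of i] by simp
			thus ?thesis by (auto simp: Pair incl_def shift evens_closed intro!: restrict_ext)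
			qed
			ultimately show ?thesis by blast
		qed
	qed
	hence "fin_gen_family Q K (all_ops k L T) Z (%g. {x : Z g. incl g x : coboundary C \<delta> g})"
		by (rule noetherian_familyD) (use Zk in "auto simp: le_fun_def")
	hence fg: "fin_gen_family Q K (all_ops k L T) Z tower_base"
		by (rule fin_gen_family_mono_base) (use incl_coboundary in "auto simp: le_fun_def")
	obtain \<zeta> where z: "shift_op L (T k) = ((2, 0), \<zeta>)" by (simp add: shift_op_def)
	have mem: "((2, 0), \<zeta>) : all_ops (Suc k) L T" using z by (simp add: all_ops_Suc)
	show ?thesis
		unfolding all_ops_Suc z
	proof (rule graded_nakayama[OF K.module_family_axioms _ ops_linear[OF mem] _ _ _ Z_neg _ fg])
		show "ALL (s, \<phi>):all_ops k L T. ALL g. linear_map Q (K g) (K (g + s)) (\<phi> g)" using ops_linear sub by auto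
		show "closed_family Q K (insert ((2, 0), \<zeta>) (all_ops k L T)) Z" using Z_closed by (simp add: all_ops_Suc z)
		show "closed_family Q K (insert ((2, 0), \<zeta>) (all_ops k L T)) B" using B_closed by (simp add: all_ops_Suc z)
		show "K.commutes_mod Z B ((2, 0), \<zeta>) p" if "p : all_ops k L T" for p
			using operators_commute[OF mem, of p] that sub by blast
		show "tower_base (i, n) = {b \<oplus>\<^sub>(K (i, n)) \<zeta> (i - 2, n) y |b y. b : B (i, n) & y : Z (i - 2, n)}" for i n
			by (simp add: tower_base_def z)
	qed
qed

end

lemma fin_gen_slices:
	fixes G :: "int \<times> nat => ('q, 'x) module"
	assumes fin: "finite I"
		and slice: "!!i. i : I ==> fin_gen_family Q (%n. G (i, n)) (ops' i) (%n. Z (i, n)) (%n. B (i, n))"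
		and triv: "!!i n. i ~: I ==> Z (i, n) <= B (i, n)"
		and ops: "!!i s \<psi>. (s, \<psi>) : ops' i ==> EX \<phi>. ((0, s), \<phi>) : ops & (ALL n. \<phi> (i, n) = \<psi> n)"
	shows "fin_gen_family Q G ops Z B"
proof -
	have "ALL i:I. EX S. finite S & S <= Sigma UNIV (%n. Z (i, n)) &
		(ALL U. closed_family Q (%n. G (i, n)) (ops' i) U & (%n. B (i, n)) <= U & S <= Sigma UNIV U --> (%n. Z (i, n)) <= U)"
		using slice unfolding fin_gen_family_def by blast
	then obtain S where S: "!!i. i : I ==> finite (S i)" "!!i. i : I ==> S i <= Sigma UNIV (%n. Z (i, n))"
		"!!i U. i : I ==> closed_family Q (%n. G (i, n)) (ops' i) U ==> (%n. B (i, n)) <= U ==> S i <= Sigma UNIV U ==> (%n. Z (i, n)) <= U"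
		by metis
	let ?S = "\<Union>i\<in>I. (%(n, x). ((i, n), x)) ` S i"
	show ?thesis unfolding fin_gen_family_def
	proof (intro exI[of _ ?S] conjI allI impI)
		show "finite ?S" using S(1) fin by auto
		show "?S <= Sigma UNIV Z" using S(2) by fastforce
		fix W assume "closed_family Q G ops W & B <= W & ?S <= Sigma UNIV W"
		hence W: "closed_family Q G ops W" and BW: "!!g. B g <= W g" and SW: "?S <= Sigma UNIV W"
			by (auto simp: le_fun_def)
		have "Z (i, n) <= W (i, n)" for i n
		proof (cases "i : I")
			case True
			have "(%n. Z (i, n)) <= (%n. W (i, n))"
			proof (rule S(3)[OF True])
			show "closed_family Q (%n. G (i, n)) (ops' i) (%n. W (i, n))"
			unfolding closed_family_def
			proof (intro conjI allI ballI, goal_cases)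
			case 1
			thus ?case using W by (simp add: closed_family_def)
			next
			case (2 p)
			obtain s \<psi> where p: "p = (s, \<psi>)" by (cases p)
			with 2 ops obtain \<phi> where "((0, s), \<phi>) : ops" "!!n. \<phi> (i, n) = \<psi> n" by blast
			thus ?case using W unfolding closed_family_def p by fastforce
			qed
			show "S i <= Sigma UNIV (%n. W (i, n))" using SW True by fastforce
			qed (use BW in "auto simp: le_fun_def")
			thus ?thesis by (auto simp: le_fun_def)
		qed (use triv BW in blast)
		thus "Z <= W" by (auto simp: le_fun_def)
	qed
qed

context ci_coeff begin

definition slice_ops :: "('q, 'l) module => (nat \<times> (nat => ('l => 'n) => 'l => 'n)) set" where
	"slice_ops P = (%(s, \<phi>). (s, %n h. \<lambda>x\<in>carrier P. \<phi> n (h x))) ` nops"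

lemma slice_opsE:
	assumes "(s, \<psi>) : slice_ops P"
	obtains \<phi> where "(s, \<phi>) : nops" "\<psi> = (%n h. \<lambda>x\<in>carrier P. \<phi> n (h x))"
proof -
	obtain p where p: "p : nops" "(s, \<psi>) = (%(s, \<phi>). (s, %n h. \<lambda>x\<in>carrier P. \<phi> n (h x))) p"
		using assms unfolding slice_ops_def by (rule imageE)
	thus ?thesis using that by (cases p) simp
qed

text \<open>Evaluation at a finite dual basis embeds the Hom module in a finite power of the coefficients. The basis is
used one element at a time: homomorphisms killing the first elements form a filtration.\<close>

lemma hom_noetherian:
	assumes P: "module Q P" and dual: "fin_dual_basis Q P"
	shows "noetherian_family Q (%n. hom_module Q P (NN n)) (slice_ops P)
		(%n. carrier (hom_module Q P (NN n))) (%n. {\<zero>\<^sub>(hom_module Q P (NN n))})"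
proof -
	let ?G = "%n. hom_module Q P (NN n)"
	interpret P: module Q P by (rule P)
	interpret G: module_family Q ?G by (rule module_family.intro) (intro hom_module_is_module P NN_module)
	interpret NF: module_family Q NN by (rule module_family.intro) (rule NN_module)
	obtain J :: "nat set" and b lam where J: "finite J" "dual_basis Q P J b lam"
		using dual by (auto simp: fin_dual_basis_def)
	have bc: "b j : carrier P" if "j : J" for j using J(2) that by (auto simp: dual_basis_def)
	define W where "W S n = {h : carrier (?G n). ALL j:S. h (b j) = \<zero>\<^sub>(NN n)}" for S n
	have mem: "h : carrier (?G n) \<longleftrightarrow> h : extensional (carrier P) & linear_map Q P (NN n) h" for h n
		by (auto simp: hom_module_simps)
	have lin: "linear_map Q (?G n) (?G (n + s)) (\<phi> n)" if sl: "(s, \<phi>) : slice_ops P" for s \<phi> n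
	proof -
		obtain \<phi>0 where p: "(s, \<phi>0) : nops" "\<phi> = (%n h. \<lambda>x\<in>carrier P. \<phi>0 n (h x))"
			using slice_opsE[OF sl] by blast
		note l = nops_linear[OF p(1), of n]
		show ?thesis unfolding p
		proof (rule linear_mapI)
			fix h assume h: "h : carrier (?G n)"
			hence hl: "linear_map Q P (NN n) h" by (simp add: mem)
			show "(\<lambda>x\<in>carrier P. \<phi>0 n (h x)) : carrier (?G (n + s))"
			using linear_restrict[OF P linear_comp[OF hl l]] by (simp add: mem)
			{ fix h' assume "h' : carrier (?G n)"
			hence hl': "linear_map Q P (NN n) h'" by (simp add: mem)
			show "(\<lambda>x\<in>carrier P. \<phi>0 n ((h \<oplus>\<^sub>(?G n) h') x)) =
			(\<lambda>x\<in>carrier P. \<phi>0 n (h x)) \<oplus>\<^sub>(?G (n + s)) (\<lambda>x\<in>carrier P. \<phi>0 n (h' x))"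
			using linear_closed[OF hl] linear_closed[OF hl'] linear_add[OF l]
			by (auto simp: hom_module_simps intro!: restrict_ext) }
			{ fix a assume a: "a : carrier Q"
			thus "(\<lambda>x\<in>carrier P. \<phi>0 n ((a \<odot>\<^sub>(?G n) h) x)) =
			a \<odot>\<^sub>(?G (n + s)) (\<lambda>x\<in>carrier P. \<phi>0 n (h x))"
			using linear_closed[OF hl] linear_smult[OF l]
			by (auto simp: hom_module_simps intro!: restrict_ext) }
		qed
	qed
	have lin_all: "ALL (s, \<phi>):slice_ops P. ALL n. linear_map Q (?G n) (?G (n + s)) (\<phi> n)" using lin by auto
	have Wc: "closed_family Q ?G (slice_ops P) (W S)" if S: "S <= J" for S
	proof (rule G.closedI)
		fix n h assume h: "h : W S n"
		interpret Gn: module Q "?G n" by (rule G.G_module)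
		interpret Nn: module Q "NN n" by (rule NN_module)
		have bS: "b j : carrier P" if "j : S" for j using that S bc by auto
		show hc: "h : carrier (?G n)" using h by (simp add: W_def)
		{ fix h' assume "h' : W S n"
			thus "h \<oplus>\<^sub>(?G n) h' : W S n" using h bS Gn.M.a_closed unfolding W_def by (auto simp: hom_module_simps(3)) }
		{ fix a assume "a : carrier Q"
			thus "a \<odot>\<^sub>(?G n) h : W S n" using h bS Gn.smult_closed unfolding W_def by (auto simp: hom_module_simps(4)) }
		{ fix s \<phi> assume p: "(s, \<phi>) : slice_ops P"
			obtain \<phi>0 where p0: "(s, \<phi>0) : nops" "\<phi> = (%n h. \<lambda>x\<in>carrier P. \<phi>0 n (h x))"
			using slice_opsE[OF p] by blast
			show "\<phi> n h : W S (n + s)"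
			using linear_closed[OF lin[OF p] hc] h bS linear_zero[OF NN_module NN_module nops_linear[OF p0(1)]]
			unfolding W_def p0(2) by auto }
	next
		fix n
		interpret Gn: module Q "?G n" by (rule G.G_module)
		show "\<zero>\<^sub>(?G n) : W S n" using S bc Gn.M.zero_closed unfolding W_def by (auto simp: hom_module_simps(2))
	qed
	have N0: "closed_family Q NN nops (%n. {\<zero>\<^sub>(NN n)})"
	proof (rule NF.closedI)
		fix n x assume "x : {\<zero>\<^sub>(NN n)}"
		hence x: "x = \<zero>\<^sub>(NN n)" by simp
		interpret Nn: module Q "NN n" by (rule NN_module)
		show "x : carrier (NN n)" "!!y. y : {\<zero>\<^sub>(NN n)} ==> x \<oplus>\<^sub>(NN n) y : {\<zero>\<^sub>(NN n)}"
			"!!a. a : carrier Q ==> a \<odot>\<^sub>(NN n) x : {\<zero>\<^sub>(NN n)}" using x by auto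
		show "\<phi> n x : {\<zero>\<^sub>(NN (n + s))}" if "(s, \<phi>) : nops" for s \<phi>
			unfolding x using linear_zero[OF NN_module NN_module nops_linear[OF that]] by simp
	qed simp
	have NC: "closed_family Q NN nops (%n. carrier (NN n))"
	proof (rule NF.closedI)
		fix n x assume x: "x : carrier (NN n)"
		interpret Nn: module Q "NN n" by (rule NN_module)
		show "!!y. y : carrier (NN n) ==> x \<oplus>\<^sub>(NN n) y : carrier (NN n)"
			"!!a. a : carrier Q ==> a \<odot>\<^sub>(NN n) x : carrier (NN n)" using x by auto
		show "\<phi> n x : carrier (NN (n + s))" if "(s, \<phi>) : nops" for s \<phi>
			by (rule linear_closed[OF nops_linear[OF that] x])
	next
		fix n
		interpret Nn: module Q "NN n" by (rule NN_module)
		show "\<zero>\<^sub>(NN n) : carrier (NN n)" by simp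
	qed
	have "noetherian_family Q ?G (slice_ops P) (W {}) (W S)" if "S <= J" for S
		using finite_subset[OF that J(1)] that
	proof (induct S rule: finite_induct)
		case empty
		show ?case by (rule noetherian_family_refl)
	next
		case (insert j S)
		hence SJ: "S <= J" and j: "j : J" by auto
		have "noetherian_family Q ?G (slice_ops P) (W S) (%n. {h : W S n. h (b j) : {\<zero>\<^sub>(NN n)}})"
		proof (rule noetherian_pullback[OF G.module_family_axioms NF.module_family_axioms _ _ Wc[OF SJ] N0 _ _ NC _ NN_noetherian])
			show "ALL (s, \<phi>):nops. ALL n. linear_map Q (NN n) (NN (n + s)) (\<phi> n)" using nops_linear by auto
			show "linear_map Q (?G n) (NN n) (%h. h (b j))" for n
			by (rule linear_mapI) (use bc[OF j] in "auto simp: hom_module_simps linear_closed")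
			show "h (b j) : carrier (NN n)" if "h : W S n" for n h
			using that bc[OF j] by (auto simp: W_def mem linear_closed)
			show "(%n. {\<zero>\<^sub>(NN n)}) <= (%n. carrier (NN n))" using NF.closedD(1)[OF N0] unfolding le_fun_def by blast
			fix s \<psi> assume p: "(s, \<psi>) : nops"
			show "EX \<phi>. (s, \<phi>) : slice_ops P & (ALL n. ALL h:W S n. (\<phi> n h) (b j) = \<psi> n (h (b j)))"
			by (rule exI[of _ "%n h. \<lambda>x\<in>carrier P. \<psi> n (h x)"]) (use p bc[OF j] in "force simp: slice_ops_def")
		qed
		moreover have "(%n. {h : W S n. h (b j) : {\<zero>\<^sub>(NN n)}}) = W (insert j S)"
			by (rule ext) (auto simp: W_def)
		ultimately have n: "noetherian_family Q ?G (slice_ops P) (W S) (W (insert j S))" by simp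
		show ?case
			by (rule G.noetherian_extension[OF lin_all Wc[OF SJ] insert(3)[OF SJ] n _ _ Wc[of "{}"]])
			(auto simp: le_fun_def W_def)
	qed
	from this[OF order_refl] have n: "noetherian_family Q ?G (slice_ops P) (W {}) (W J)" .
	have WJ: "W J n <= {\<zero>\<^sub>(?G n)}" for n
	proof
		fix h assume h: "h : W J n"
		interpret Nn: module Q "NN n" by (rule NN_module)
		have hl: "linear_map Q P (NN n) h" using h by (simp add: W_def mem)
		have "h x = \<zero>\<^sub>(NN n)" if x: "x : carrier P" for x
		proof -
			have "h x = (\<Oplus>\<^sub>(NN n)j\<in>{j : J. lam x j ~= \<zero>}. lam x j \<odot>\<^sub>(NN n) h (b j))"
			by (rule dual_basis_expand[OF P NN_module J(2) hl x])
			also have "... = \<zero>\<^sub>(NN n)"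
			proof (rule Nn.M.add.finprod_one_eqI)
			fix j assume j: "j : {j : J. lam x j ~= \<zero>}"
			have "lam x j : carrier Q" using J(2) x j by (auto simp: dual_basis_def)
			thus "lam x j \<odot>\<^sub>(NN n) h (b j) = \<zero>\<^sub>(NN n)" using h j by (simp add: W_def)
			qed
			finally show ?thesis .
		qed
		thus "h : {\<zero>\<^sub>(?G n)}" using h by (auto simp: W_def mem hom_module_simps(2) intro!: extensionalityI)
	qed
	show ?thesis
		by (rule noetherian_family_mono[OF n]) (use WJ in "auto simp: le_fun_def W_def")
qed

end

lemma (in ci_cochain) fin_gen_bounded:
	assumes bound: "!!i n. i > p ==> Z (i, n) <= B (i, n)"
	shows "fin_gen_family Q K (all_ops k L T) Z B"
proof (rule fin_gen_slices[of "{0..p}" _ _ "%i. slice_ops (L i)"])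
	fix i assume "i : {0..p}"
	let ?G = "%n. hom_module Q (L i) (NN n)"
	have slice: "closed_family Q ?G (slice_ops (L i)) (%n. U (i, n))" if U: "closed_family Q K (all_ops k L T) U" for U
		unfolding closed_family_def
	proof (intro conjI allI ballI, goal_cases)
		case (1 n)
		have "submodule (U (i, n)) Q (K (i, n))" using U by (simp add: closed_family_def)
		thus ?case by (simp add: cochain_def)
	next
		case (2 p)
		then obtain s \<phi> where p: "(s, \<phi>) : nops" "p = (s, %n h. \<lambda>x\<in>carrier (L i). \<phi> n (h x))"
	proof -
		obtain s \<psi> where "p = (s, \<psi>)" by (cases p)
		thus thesis using 2 that slice_opsE[of s \<psi> "L i"] by blast
	qed
		have "coeff_op L (s, \<phi>) : all_ops k L T" using p by (auto simp: all_ops_def)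
		hence m: "((0, s), %(i, n) h. \<lambda>x\<in>carrier (L i). \<phi> n (h x)) : all_ops k L T" by (simp add: coeff_op_def)
		show ?case unfolding p prod.case using K.closedD(6)[OF U m, of _ "(i, _)"] by simp
	qed
	have "closed_family Q ?G (slice_ops (L i)) (%n. Z (i, n))" by (rule slice[OF Z_closed])
	moreover have "(%n. {\<zero>\<^sub>(?G n)}) <= (%n. Z (i, n))"
		using K.closedD(2)[OF Z_closed, of "(i, _)"] by (auto simp: le_fun_def cochain_def)
	moreover have "(%n. Z (i, n)) <= (%n. carrier (?G n))"
		using K.closedD(1)[OF Z_closed, of _ "(i, _)"] by (auto simp: le_fun_def cochain_def)
	ultimately have "fin_gen_family Q ?G (slice_ops (L i)) (%n. Z (i, n)) (%n. {\<zero>\<^sub>(?G n)})"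
		by (rule noetherian_familyD[OF hom_noetherian[OF L_module L_dual]])
	hence "fin_gen_family Q ?G (slice_ops (L i)) (%n. Z (i, n)) (%n. B (i, n))"
		by (rule fin_gen_family_mono_base)
			(use K.closedD(2)[OF B_closed, of "(i, _)"] in "auto simp: le_fun_def cochain_def")
	thus "fin_gen_family Q (%n. K (i, n)) (slice_ops (L i)) (%n. Z (i, n)) (%n. B (i, n))"
		by (simp add: cochain_def)
next
	fix i n assume "i ~: {0..p}"
	then consider "i < 0" | "i > p" by force
	thus "Z (i, n) <= B (i, n)"
	proof cases
		case i: 1
		show ?thesis
		proof
			fix h assume h: "h : Z (i, n)"
			have "h \<zero>\<^sub>(L i) = \<zero>\<^sub>(NN n)" by (rule linear_zero[OF L_module NN_module]) (use h Z_iff in blast)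
			thus "h : B (i, n)"
			using h L_neg[OF i] by (intro coboundaryI[where a = "%x. \<zero>\<^sub>(NN n)"]) (auto simp: Z_iff linear_const_zero[OF NN_module])
		qed
	qed (rule bound)
next
	fix i s \<psi> assume "(s, \<psi>) : slice_ops (L i)"
	then obtain \<phi> where p: "(s, \<phi>) : nops" "\<psi> = (%n h. \<lambda>x\<in>carrier (L i). \<phi> n (h x))" by (rule slice_opsE)
	have "coeff_op L (s, \<phi>) : all_ops k L T" using p by (auto simp: all_ops_def)
	thus "EX \<phi>. ((0, s), \<phi>) : all_ops k L T & (ALL n. \<phi> (i, n) = \<psi> n)"
		by (intro exI[of _ "%(i, n) h. \<lambda>x\<in>carrier (L i). \<phi> n (h x)"]) (simp add: coeff_op_def p(2))
qed simp

section \<open>Comparison with a projective resolution\<close>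

definition free_on :: "('q, 'k) ring_scheme => 'p set => ('q, 'p => 'q) module" where
	"free_on Q J = (|carrier = {u. (ALL x. u x : carrier Q) & finite {x. u x ~= \<zero>\<^sub>Q} & (ALL x. u x ~= \<zero>\<^sub>Q --> x : J)},
		monoid.mult = undefined, one = undefined, ring.zero = (%x. \<zero>\<^sub>Q), add = (%u v x. u x \<oplus>\<^sub>Q v x),
		smult = (%a u x. a \<otimes>\<^sub>Q u x)|)"

lemma free_on_module:
	fixes Q :: "('q, 'k) ring_scheme" and J :: "'p set"
	assumes "cring Q"
	shows "module Q (free_on Q J)"
proof -
	interpret cring Q by fact
	have fin: "finite {x. u x \<oplus>\<^sub>Q v x ~= \<zero>\<^sub>Q}"
		if "finite {x. u x ~= \<zero>\<^sub>Q}" "finite {x. v x ~= \<zero>\<^sub>Q}" for u v :: "'p => 'q"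
		by (rule finite_subset[OF _ finite_UnI[OF that]]) auto
	have fin': "finite {x. a \<otimes>\<^sub>Q u x ~= \<zero>\<^sub>Q}" if "finite {x. u x ~= \<zero>\<^sub>Q}" "a : carrier Q" for a and u :: "'p => 'q"
		by (rule finite_subset[OF _ that(1)]) (use that in auto)
	show ?thesis
	proof (rule moduleI)
		show "cring Q" by fact
		show "abelian_group (free_on Q J)"
		proof (rule abelian_groupI)
			fix u assume u: "u : carrier (free_on Q J)"
			show "EX v:carrier (free_on Q J). v \<oplus>\<^sub>(free_on Q J) u = \<zero>\<^sub>(free_on Q J)"
			proof (rule bexI)
			show "(%x. \<ominus>\<^sub>Q \<one>\<^sub>Q \<otimes>\<^sub>Q u x) \<oplus>\<^sub>(free_on Q J) u = \<zero>\<^sub>(free_on Q J)"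
			using u by (auto simp: free_on_def l_minus l_neg)
			show "(%x. \<ominus>\<^sub>Q \<one>\<^sub>Q \<otimes>\<^sub>Q u x) : carrier (free_on Q J)"
			using u fin'[of u "\<ominus>\<^sub>Q \<one>\<^sub>Q"] unfolding free_on_def by (simp, metis r_null add.inv_closed one_closed)
			qed
		next
			fix u v assume "u : carrier (free_on Q J)" "v : carrier (free_on Q J)"
			thus "u \<oplus>\<^sub>(free_on Q J) v : carrier (free_on Q J)"
			using fin[of u v] unfolding free_on_def by (simp, metis l_zero zero_closed)
		qed (auto simp: free_on_def a_ac fun_eq_iff)
	next
		fix a u assume "a : carrier Q" "u : carrier (free_on Q J)"
		thus "a \<odot>\<^sub>(free_on Q J) u : carrier (free_on Q J)"
			using fin'[of u a] unfolding free_on_def by (simp, metis r_null)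
	qed (auto simp: free_on_def fun_eq_iff l_distr r_distr m_assoc)
qed

text \<open>A section of the canonical surjection from the free module on the carrier gives the coordinates.\<close>

lemma projective_dual_basis:
	fixes P :: "('q, 'p) module"
	assumes "projective_module Q P"
	shows "EX lam. dual_basis Q P (carrier P) (%x. x) lam"
proof -
	have P: "module Q P" using assms by (simp add: projective_module_def)
	interpret P: module Q P by (rule P)
	let ?U = "free_on Q (carrier P)"
	interpret U: module Q ?U by (rule free_on_module[OF P.R.is_cring])
	define g where "g u = (\<Oplus>\<^sub>P x\<in>{x : carrier P. u x ~= \<zero>\<^sub>Q}. u x \<odot>\<^sub>P x)" for u
	have gl: "linear_map Q ?U P g" unfolding g_def
		by (rule coordinate_sum_linear[OF U.module_axioms P]) (auto simp: free_on_def)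
	have "g ` carrier ?U = carrier P"
	proof
		show "g ` carrier ?U <= carrier P" using linear_closed[OF gl] by auto
		show "carrier P <= g ` carrier ?U"
		proof
			fix x assume x: "x : carrier P"
			let ?u = "%y. if x = y then \<one>\<^sub>Q else \<zero>\<^sub>Q"
			have u: "?u : carrier ?U" using x by (auto simp: free_on_def)
			have "g ?u = (lincomb P {x} ?u (%y. y))" unfolding g_def
			by (rule P.finsum_support) (use x in auto)
			also have "... = x" using x by (simp add: P.M.finsum_insert)
			finally show "x : g ` carrier ?U" using u by (metis imageI)
		qed
	qed
	hence "EX k. linear_map Q P ?U k & (ALL x:carrier P. g (k x) = x)"
		using assms[unfolded projective_module_def] U.module_axioms P gl linear_id[of Q P] by blast
	then obtain k where k: "linear_map Q P ?U k" "!!x. x : carrier P ==> g (k x) = x" by blast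
	have kU: "k x : carrier ?U" if "x : carrier P" for x using linear_closed[OF k(1) that] .
	have "dual_basis Q P (carrier P) (%x. x) k"
		unfolding dual_basis_def
	proof (intro conjI ballI)
		fix x assume x: "x : carrier P"
		show "k x : carrier P \<rightarrow> carrier Q" "finite {j : carrier P. k x j ~= \<zero>\<^sub>Q}"
			using kU[OF x] by (auto simp: free_on_def)
		show "x = (\<Oplus>\<^sub>P j\<in>{j : carrier P. k x j ~= \<zero>\<^sub>Q}. k x j \<odot>\<^sub>P j)"
			using k(2)[OF x] by (simp add: g_def)
		show "k (x \<oplus>\<^sub>P y) j = k x j \<oplus>\<^sub>Q k y j" if "y : carrier P" for y j
			using linear_add[OF k(1) x that] by (simp add: free_on_def)
		show "k (a \<odot>\<^sub>P x) j = a \<otimes>\<^sub>Q k x j" if "a : carrier Q" for a j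
			using linear_smult[OF k(1) that x] by (simp add: free_on_def)
	qed simp
	thus ?thesis by blast
qed

lemma chain_map_exists:
	fixes XX :: "nat => ('q, 'x) module" and Y :: "nat => ('q, 'y) module"
	assumes XX: "!!j. module Q (XX j)" and Y: "!!j. module Q (Y j)" and M: "module Q M"
		and db: "!!j. EX (J :: 'j set) b lam. dual_basis Q (XX j) J b lam"
		and dX: "!!j. linear_map Q (XX (Suc j)) (XX j) (dX j)" and dY: "!!j. linear_map Q (Y (Suc j)) (Y j) (dY j)"
		and eX: "linear_map Q (XX 0) M eX" and eY: "linear_map Q (Y 0) M eY"
		and dX2: "!!j x. x : carrier (XX (Suc (Suc j))) ==> dX j (dX (Suc j) x) = \<zero>\<^sub>(XX j)"
		and eX2: "!!x. x : carrier (XX 1) ==> eX (dX 0 x) = \<zero>\<^sub>M"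
		and ex0: "!!y. y : carrier (Y 0) ==> eY y = \<zero>\<^sub>M ==> y : dY 0 ` carrier (Y 1)"
		and ex: "!!j y. y : carrier (Y (Suc j)) ==> dY j y = \<zero>\<^sub>(Y j) ==> y : dY (Suc j) ` carrier (Y (Suc (Suc j)))"
		and surj: "eY ` carrier (Y 0) = carrier M"
	shows "EX \<phi>. (ALL j. linear_map Q (XX j) (Y j) (\<phi> j)) & (ALL x:carrier (XX 0). eY (\<phi> 0 x) = eX x) &
		(ALL j. ALL x:carrier (XX (Suc j)). dY j (\<phi> (Suc j) x) = \<phi> j (dX j x))"
proof -
	define good where "good j \<phi> \<longleftrightarrow> linear_map Q (XX j) (Y j) \<phi> &
			(j = 0 --> (ALL x:carrier (XX 0). eY (\<phi> x) = eX x)) &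
			(ALL i. j = Suc i --> (ALL x:carrier (XX (Suc j)). dY i (\<phi> (dX j x)) = \<zero>\<^sub>(Y i)))" for j \<phi>
	have "EX \<phi>. ALL j. good j (\<phi> j) & (ALL x:carrier (XX (Suc j)). dY j (\<phi> (Suc j) x) = \<phi> j (dX j x))"
	proof (rule dependent_nat_choice)
		obtain J :: "'j set" and b lam where J: "dual_basis Q (XX 0) J b lam" using db by blast
		have "EX k. linear_map Q (XX 0) (Y 0) k & (ALL x:carrier (XX 0). eY (k x) = eX x)"
			by (rule dual_basis_lift[OF XX Y M J eY eX]) (use linear_closed[OF eX] surj in auto)
		thus "EX \<phi>. good 0 \<phi>" unfolding good_def by auto
	next
		fix \<phi> j assume p: "good j \<phi>"
		hence pl: "linear_map Q (XX j) (Y j) \<phi>" by (simp add: good_def)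
		obtain J :: "'j set" and b lam where J: "dual_basis Q (XX (Suc j)) J b lam" using db by blast
		have "EX k. linear_map Q (XX (Suc j)) (Y (Suc j)) k & (ALL x:carrier (XX (Suc j)). dY j (k x) = \<phi> (dX j x))"
		proof (rule dual_basis_lift[OF XX Y Y J dY linear_comp[OF dX pl]])
			fix x assume x: "x : carrier (XX (Suc j))"
			have c: "\<phi> (dX j x) : carrier (Y j)" by (rule linear_closed[OF pl linear_closed[OF dX x]])
			show "\<phi> (dX j x) : dY j ` carrier (Y (Suc j))"
			proof (cases j)
			case 0
			hence "eY (\<phi> (dX 0 x)) = eX (dX 0 x)" using p linear_closed[OF dX x] unfolding good_def by auto
			thus ?thesis using ex0[of "\<phi> (dX 0 x)"] c eX2[of x] x 0 by simp
			next
			case (Suc i)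
			hence "dY i (\<phi> (dX j x)) = \<zero>\<^sub>(Y i)" using p x unfolding good_def by auto
			thus ?thesis using ex[of "\<phi> (dX j x)" i] c Suc by simp
			qed
		qed
		then obtain k where k: "linear_map Q (XX (Suc j)) (Y (Suc j)) k" "!!x. x : carrier (XX (Suc j)) ==> dY j (k x) = \<phi> (dX j x)"
			by blast
		have "dY j (k (dX (Suc j) x)) = \<zero>\<^sub>(Y j)" if "x : carrier (XX (Suc (Suc j)))" for x
			using k(2)[OF linear_closed[OF dX that]] dX2[OF that] linear_zero[OF XX Y pl] by simp
		hence "good (Suc j) k" unfolding good_def using k(1) by simp
		thus "EX \<psi>. good (Suc j) \<psi> & (ALL x:carrier (XX (Suc j)). dY j (\<psi> x) = \<phi> (dX j x))" using k(2) by blast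
	qed
	then obtain \<phi> where "!!j. good j (\<phi> j)" "!!j x. x : carrier (XX (Suc j)) ==> dY j (\<phi> (Suc j) x) = \<phi> j (dX j x)" by blast
	thus ?thesis unfolding good_def by (intro exI[of _ \<phi>]) blast
qed

lemma null_homotopy_exists:
	fixes XX :: "nat => ('q, 'x) module" and Y :: "nat => ('q, 'y) module"
	assumes XX: "!!j. module Q (XX j)" and Y: "!!j. module Q (Y j)" and M: "module Q M"
		and db: "!!j. EX (J :: 'j set) b lam. dual_basis Q (XX j) J b lam"
		and dX: "!!j. linear_map Q (XX (Suc j)) (XX j) (dX j)" and dY: "!!j. linear_map Q (Y (Suc j)) (Y j) (dY j)"
		and dX2: "!!j x. x : carrier (XX (Suc (Suc j))) ==> dX j (dX (Suc j) x) = \<zero>\<^sub>(XX j)"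
		and ex0: "!!y. y : carrier (Y 0) ==> eY y = \<zero>\<^sub>M ==> y : dY 0 ` carrier (Y 1)"
		and ex: "!!j y. y : carrier (Y (Suc j)) ==> dY j y = \<zero>\<^sub>(Y j) ==> y : dY (Suc j) ` carrier (Y (Suc (Suc j)))"
		and u: "!!j. linear_map Q (XX j) (Y j) (u j)"
		and u_chain: "!!j x. x : carrier (XX (Suc j)) ==> dY j (u (Suc j) x) = u j (dX j x)"
		and u0: "!!x. x : carrier (XX 0) ==> eY (u 0 x) = \<zero>\<^sub>M"
	shows "EX \<xi>. (ALL j. linear_map Q (XX j) (Y (Suc j)) (\<xi> j)) &
		(ALL j. ALL x:carrier (XX (Suc j)). u (Suc j) x = dY (Suc j) (\<xi> (Suc j) x) \<oplus>\<^sub>(Y (Suc j)) \<xi> j (dX j x))"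
proof -
	define good where "good j \<xi> \<longleftrightarrow> linear_map Q (XX j) (Y (Suc j)) \<xi> &
			(ALL x:carrier (XX (Suc j)). dY j (\<xi> (dX j x)) = u j (dX j x))" for j \<xi>
	have "EX \<xi>. ALL j. good j (\<xi> j) & (ALL x:carrier (XX (Suc j)). u (Suc j) x = dY (Suc j) (\<xi> (Suc j) x) \<oplus>\<^sub>(Y (Suc j)) \<xi> j (dX j x))"
	proof (rule dependent_nat_choice)
		obtain J :: "'j set" and b lam where J: "dual_basis Q (XX 0) J b lam" using db by blast
		have "EX k. linear_map Q (XX 0) (Y (Suc 0)) k & (ALL x:carrier (XX 0). dY 0 (k x) = u 0 x)"
			by (rule dual_basis_lift[OF XX Y Y J dY u]) (use linear_closed[OF u] ex0 u0 in auto)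
		then obtain k where "linear_map Q (XX 0) (Y (Suc 0)) k" "!!x. x : carrier (XX 0) ==> dY 0 (k x) = u 0 x" by blast
		thus "EX \<xi>. good 0 \<xi>" unfolding good_def using linear_closed[OF dX] by blast
	next
		fix \<xi> j assume p: "good j \<xi>"
		hence pl: "linear_map Q (XX j) (Y (Suc j)) \<xi>"
			and pi: "!!x. x : carrier (XX (Suc j)) ==> dY j (\<xi> (dX j x)) = u j (dX j x)" by (auto simp: good_def)
		interpret Y1: module Q "Y (Suc j)" by (rule Y)
		interpret Yj: module Q "Y j" by (rule Y)
		obtain J :: "'j set" and b lam where J: "dual_basis Q (XX (Suc j)) J b lam" using db by blast
		let ?v = "%x. u (Suc j) x \<ominus>\<^sub>(Y (Suc j)) \<xi> (dX j x)"
		have vl: "linear_map Q (XX (Suc j)) (Y (Suc j)) ?v"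
			by (rule linear_minus_map[OF Y u linear_comp[OF dX pl]])
		have "EX k. linear_map Q (XX (Suc j)) (Y (Suc (Suc j))) k & (ALL x:carrier (XX (Suc j)). dY (Suc j) (k x) = ?v x)"
		proof (rule dual_basis_lift[OF XX Y Y J dY vl])
			fix x assume x: "x : carrier (XX (Suc j))"
			have c: "u (Suc j) x : carrier (Y (Suc j))" "\<xi> (dX j x) : carrier (Y (Suc j))"
			using linear_closed[OF u x] linear_closed[OF pl linear_closed[OF dX x]] by auto
			have "dY j (?v x) = u j (dX j x) \<ominus>\<^sub>(Y j) u j (dX j x)"
			using linear_diff[OF Y Y dY c] u_chain[OF x] pi[OF x] by simp
			also have "... = \<zero>\<^sub>(Y j)"
			unfolding a_minus_def by (rule Yj.M.r_neg) (rule linear_closed[OF u linear_closed[OF dX x]])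
			finally show "?v x : dY (Suc j) ` carrier (Y (Suc (Suc j)))"
			using ex[of "?v x" j] linear_closed[OF vl x] by simp
		qed
		then obtain k where k: "linear_map Q (XX (Suc j)) (Y (Suc (Suc j))) k"
			"!!x. x : carrier (XX (Suc j)) ==> dY (Suc j) (k x) = ?v x" by blast
		have "good (Suc j) k" unfolding good_def
		proof (intro conjI ballI)
			fix x assume x: "x : carrier (XX (Suc (Suc j)))"
			have dx: "dX (Suc j) x : carrier (XX (Suc j))" by (rule linear_closed[OF dX x])
			show "dY (Suc j) (k (dX (Suc j) x)) = u (Suc j) (dX (Suc j) x)"
			using k(2)[OF dx] dX2[OF x] linear_zero[OF XX Y pl] linear_closed[OF u dx] by (simp add: Y1.M.diff_zero)
		qed (rule k(1))
		moreover have "u (Suc j) x = dY (Suc j) (k x) \<oplus>\<^sub>(Y (Suc j)) \<xi> (dX j x)" if x: "x : carrier (XX (Suc j))" for x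
			using k(2)[OF x] linear_closed[OF u x] linear_closed[OF pl linear_closed[OF dX x]]
			by (simp add: a_minus_def Y1.M.a_assoc Y1.M.l_neg)
		ultimately show "EX \<tau>. good (Suc j) \<tau> & (ALL x:carrier (XX (Suc j)). u (Suc j) x = dY (Suc j) (\<tau> x) \<oplus>\<^sub>(Y (Suc j)) \<xi> (dX j x))"
			by blast
	qed
	then obtain \<xi> where "!!j. good j (\<xi> j)" "!!j x. x : carrier (XX (Suc j)) ==> u (Suc j) x = dY (Suc j) (\<xi> (Suc j) x) \<oplus>\<^sub>(Y (Suc j)) \<xi> j (dX j x)" by blast
	thus ?thesis unfolding good_def by (intro exI[of _ \<xi>]) blast
qed

text \<open>Comparison maps to the finite resolution and back compose to a map homotopic to the identity. Above the length of
the finite resolution the composite is zero, so a cocycle is the coboundary of its composite with the homotopy.\<close>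

lemma (in ci_cochain) bounded_cohomology:
	fixes P :: "nat => ('q, 'p) module"
	assumes k0: "k = 0" and res: "resolution Q M P d e" and proj: "!!j. projective_module Q (P j)"
		and triv: "!!j. j > p ==> carrier (P j) = {\<zero>\<^sub>(P j)}" and i: "i > int p"
	shows "Z (i, n) <= B (i, n)"
proof
	fix h assume h: "h : Z (i, n)"
	note r = res[unfolded resolution_def]
	have f0: "fspan f k P = {\<zero>\<^sub>P}" if "module Q P" for P :: "('q, nat => 'l) module"
	proof -
		interpret module Q P by fact
		show ?thesis by (auto simp: fspan_def k0)
	qed
	let ?XX = "%j. L (int j)" and ?dX = "%j. D (int (Suc j))"
	have PM: "module Q (P j)" for j using r by blast
	have dbX: "EX (J :: nat set) b lam. dual_basis Q (?XX j) J b lam" for j using L_dual[of "int j"] by (auto simp: fin_dual_basis_def)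
	have dbP: "EX (J :: 'p set) b lam. dual_basis Q (P j) J b lam" for j using projective_dual_basis[OF proj] by blast
	have dX: "linear_map Q (?XX (Suc j)) (?XX j) (?dX j)" for j by (rule D_linear') simp
	have dX2: "?dX j (?dX (Suc j) x) = \<zero>\<^sub>(?XX j)" if "x : carrier (?XX (Suc (Suc j)))" for j x
	proof -
		interpret Lj: module Q "L (int j)" by (rule L_module)
		have "int (Suc (Suc j)) - 1 = int (Suc j)" "int (Suc (Suc j)) - 2 = int j" by auto
		thus ?thesis using D_D[OF that] by (simp add: k0)
	qed
	have eX2: "aug (?dX 0 x) = \<zero>\<^sub>M" if "x : carrier (?XX 1)" for x using aug_D[of x] that by simp
	have eX: "linear_map Q (?XX 0) M aug" using aug_linear by simp
	have exX0: "y : ?dX 0 ` carrier (?XX 1)" if y: "y : carrier (?XX 0)" "aug y = \<zero>\<^sub>M" for y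
	proof -
		interpret L0: module Q "L 0" by (rule L_module)
		have y0: "y : carrier (L 0)" using y(1) by simp
		obtain z where z: "z : carrier (L 1)" "y \<ominus>\<^sub>(L 0) D 1 z : fspan f k (L 0)"
			using aug_exact[OF y0 y(2)] by blast
		hence "y = D 1 z" using L0.M.diff_eq_zero_iff[OF y0 D_closed[OF z(1), of 0]] f0[OF L_module, of 0] by simp
		thus ?thesis using z(1) by auto
	qed
	have exX: "y : ?dX (Suc j) ` carrier (?XX (Suc (Suc j)))" if y: "y : carrier (?XX (Suc j))" "?dX j y = \<zero>\<^sub>(?XX j)" for j y
	proof -
		interpret L0: module Q "L (int (Suc j))" by (rule L_module)
		have e: "int (Suc j) + 1 = int (Suc (Suc j))" "int (Suc j) - 1 = int j" "int (Suc j) > 0" by auto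
		have "D (int (Suc j)) y : fspan f k (L (int (Suc j) - 1))" unfolding e(2) f0[OF L_module] using y(2) by simp
		then obtain z where z: "z : carrier (L (int (Suc (Suc j))))" "y \<ominus>\<^sub>(L (int (Suc j))) D (int (Suc (Suc j))) z : fspan f k (L (int (Suc j)))"
			using exact[OF e(3) y(1)] unfolding e(1) by blast
		have "D (int (Suc (Suc j))) z : carrier (L (int (Suc j)))" by (rule D_closed[OF z(1)]) simp
		hence "y = D (int (Suc (Suc j))) z" using L0.M.diff_eq_zero_iff[OF y(1)] z(2) f0[OF L_module, of "int (Suc j)"] by blast
		thus ?thesis using z(1) by auto
	qed
	have exP: "y : d (Suc j) ` carrier (P (Suc (Suc j)))" if "y : carrier (P (Suc j))" "d j y = \<zero>\<^sub>(P j)" for j y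
		using r that by blast
	have exP0: "y : d 0 ` carrier (P 1)" if "y : carrier (P 0)" "e y = \<zero>\<^sub>M" for y
		using r that by blast
	have dP: "linear_map Q (P (Suc j)) (P j) (d j)" for j using r by blast
	have eP: "linear_map Q (P 0) M e" using r by blast
	have dP2: "d j (d (Suc j) x) = \<zero>\<^sub>(P j)" if "x : carrier (P (Suc (Suc j)))" for j x
		using r that by blast
	have eP2: "e (d 0 x) = \<zero>\<^sub>M" if "x : carrier (P 1)" for x using r that by blast
	have surjP: "e ` carrier (P 0) = carrier M" using r by blast
	have surjX: "aug ` carrier (?XX 0) = carrier M" using aug_surj by simp
	obtain \<phi> where phi0: "(ALL j. linear_map Q (?XX j) (P j) (\<phi> j)) & (ALL x:carrier (?XX 0). e (\<phi> 0 x) = aug x) &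
		(ALL j. ALL x:carrier (?XX (Suc j)). d j (\<phi> (Suc j) x) = \<phi> j (?dX j x))"
		using chain_map_exists[of Q ?XX P M, OF L_module PM M_module dbX dX dP eX eP dX2 eX2 exP0 exP surjP] by (rule exE)
	have phi: "!!j. linear_map Q (?XX j) (P j) (\<phi> j)" "!!x. x : carrier (?XX 0) ==> e (\<phi> 0 x) = aug x"
		"!!j x. x : carrier (?XX (Suc j)) ==> d j (\<phi> (Suc j) x) = \<phi> j (?dX j x)"
		using phi0 by blast+
	obtain \<psi> where psi0: "(ALL j. linear_map Q (P j) (?XX j) (\<psi> j)) & (ALL x:carrier (P 0). aug (\<psi> 0 x) = e x) &
		(ALL j. ALL x:carrier (P (Suc j)). ?dX j (\<psi> (Suc j) x) = \<psi> j (d j x))"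
		using chain_map_exists[of Q P ?XX M, OF PM L_module M_module dbP dP dX eP eX dP2 eP2 exX0 exX surjX] by (rule exE)
	have psi: "!!j. linear_map Q (P j) (?XX j) (\<psi> j)" "!!x. x : carrier (P 0) ==> aug (\<psi> 0 x) = e x"
		"!!j x. x : carrier (P (Suc j)) ==> ?dX j (\<psi> (Suc j) x) = \<psi> j (d j x)"
		using psi0 by blast+
	let ?u = "%j x. x \<ominus>\<^sub>(?XX j) \<psi> j (\<phi> j x)"
	have pp: "linear_map Q (?XX j) (?XX j) (%x. \<psi> j (\<phi> j x))" for j by (rule linear_comp[OF phi(1) psi(1)])
	have ul: "linear_map Q (?XX j) (?XX j) (?u j)" for j
		by (rule linear_minus_map[OF L_module linear_id pp])
	have uc: "?dX j (?u (Suc j) x) = ?u j (?dX j x)" if x: "x : carrier (?XX (Suc j))" for j x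
		using linear_diff[OF L_module L_module dX x linear_closed[OF pp x]]
			psi(3)[OF linear_closed[OF phi(1) x]] phi(3)[OF x] by simp
	have u0: "aug (?u 0 x) = \<zero>\<^sub>M" if x: "x : carrier (?XX 0)" for x
	proof -
		interpret Mm: module Q M by (rule M_module)
		have "aug (?u 0 x) = aug x \<ominus>\<^sub>M aug (\<psi> 0 (\<phi> 0 x))"
			by (rule linear_diff[OF L_module M_module eX x linear_closed[OF pp x]])
		also have "aug (\<psi> 0 (\<phi> 0 x)) = aug x" using psi(2)[OF linear_closed[OF phi(1) x]] phi(2)[OF x] by simp
		finally show ?thesis using linear_closed[OF eX x] by (simp add: a_minus_def Mm.M.r_neg)
	qed
	obtain \<xi> where sigma0: "(ALL j. linear_map Q (?XX j) (?XX (Suc j)) (\<xi> j)) & (ALL j. ALL x:carrier (?XX (Suc j)).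
			?u (Suc j) x = ?dX (Suc j) (\<xi> (Suc j) x) \<oplus>\<^sub>(?XX (Suc j)) \<xi> j (?dX j x))"
		using null_homotopy_exists[of Q ?XX ?XX M ?dX ?dX aug ?u, OF L_module L_module M_module dbX dX dX dX2 exX0 exX ul uc u0]
		by (rule exE)
	have sigma: "!!j. linear_map Q (?XX j) (?XX (Suc j)) (\<xi> j)"
		"!!j x. x : carrier (?XX (Suc j)) ==> ?u (Suc j) x = ?dX (Suc j) (\<xi> (Suc j) x) \<oplus>\<^sub>(?XX (Suc j)) \<xi> j (?dX j x)"
		using sigma0 by blast+
	obtain j where j: "i = int (Suc j)" using i by (metis Suc_pred' gr_implies_not0 less_imp_of_nat_less nat_0_le not_gr0 of_nat_0_le_iff order.strict_trans1 order_less_imp_le zero_less_nat_eq nat_int)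
	have jp: "Suc j > p" using i j by simp
	interpret Li: module Q "L i" by (rule L_module)
	interpret N: module Q "NN n" by (rule NN_module)
	note hz = h[unfolded Z_iff]
	have hl: "linear_map Q (L i) (NN n) h" and hD: "!!x. x : carrier (L (i + 1)) ==> h (D (i + 1) x) = \<zero>\<^sub>(NN n)"
		using hz by auto
	have sj: "linear_map Q (L (i - 1)) (L i) (\<xi> j)" using sigma(1)[of j] j by simp
	show "h : B (i, n)"
	proof (rule coboundaryI[where a = "%x. h (\<xi> j x)"])
		show "linear_map Q (L (i - 1)) (NN n) (%x. h (\<xi> j x))" by (rule linear_comp[OF sj hl])
		show "h : extensional (carrier (L i))" using hz by blast
		fix x assume x: "x : carrier (L i)"
		have x': "x : carrier (?XX (Suc j))" using x j by simp
		have "\<phi> (Suc j) x = \<zero>\<^sub>(P (Suc j))" using linear_closed[OF phi(1) x'] triv[OF jp] by simp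
		hence "\<psi> (Suc j) (\<phi> (Suc j) x) = \<zero>\<^sub>(L i)" using linear_zero[OF PM L_module psi(1)] j by simp
		hence ux: "x = D (i + 1) (\<xi> (Suc j) x) \<oplus>\<^sub>(L i) \<xi> j (D i x)"
		proof -
			have e: "int (Suc j) = i" "int (Suc (Suc j)) = i + 1" using j by auto
			show ?thesis
			using sigma(2)[OF x', unfolded e] \<open>\<psi> (Suc j) (\<phi> (Suc j) x) = \<zero>\<^sub>(L i)\<close> Li.M.diff_zero[OF x] by simp
		qed
		have sx: "\<xi> (Suc j) x : carrier (L (i + 1))" using linear_closed[OF sigma(1) x'] j by (simp add: add.commute)
		have Dx: "\<xi> j (D i x) : carrier (L i)" by (rule linear_closed[OF sj D_closed[OF x refl]])
		have "h x = h (D (i + 1) (\<xi> (Suc j) x) \<oplus>\<^sub>(L i) \<xi> j (D i x))" using ux by simp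
		also have "... = \<zero>\<^sub>(NN n) \<oplus>\<^sub>(NN n) h (\<xi> j (D i x))"
			using linear_add[OF hl _ Dx, of "D (i + 1) (\<xi> (Suc j) x)"] D_closed[OF sx, of i] hD[OF sx] by simp
		also have "... = h (\<xi> j (D i x))" using linear_closed[OF hl Dx] by simp
		finally show "h x = h (\<xi> j (D i x))" .
	qed
qed

text \<open>The augmented module \<open>M\<close> stays the same throughout the induction, and so does its finite projective
resolution, which is used at the bottom only.\<close>

theorem (in ci_coeff) cohomology_fin_gen:
	fixes P :: "nat => ('q, 'p) module" and M :: "('q, 'm) module" and L :: "int => ('q, nat => 'l) module"
	assumes res: "resolution Q M P d e" and proj: "!!j. projective_module Q (P j)"
		and triv: "!!j. j > p ==> carrier (P j) = {\<zero>\<^sub>(P j)}"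
		and sys: "ci_system Q f k L D T M aug" and k: "k <= c"
	shows "fin_gen_family Q (cochain L) (all_ops k L T) (cocycle L D) (coboundary L D)"
	using sys k
proof (induct k arbitrary: L D T aug)
	case 0
	interpret ci_cochain Q f c NN nops 0 L D T M aug
		by unfold_locales (use 0 in auto)
	show ?case by (rule fin_gen_bounded[OF bounded_cohomology[OF refl res proj triv]])
next
	case (Suc k)
	interpret ci_step Q f c NN nops k L D T M aug
		by unfold_locales (use Suc in auto)
	show ?case by (rule fin_gen_step[OF Suc(1)[OF cone_system]]) (use Suc in simp)
qed

section \<open>Polynomial rings over a commutative ring\<close>

text \<open>A system of orthogonal additive projections exhibits a direct decomposition.\<close>

lemma direct_decompI:
	assumes M: "abelian_group M" and sub: "!!g. additive_subgroup (Mg g) M"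
		and pr_mem: "!!g x. x : carrier M ==> pr g x : Mg g"
		and pr_add: "!!g x y. x : carrier M ==> y : carrier M ==> pr g (x \<oplus>\<^sub>M y) = pr g x \<oplus>\<^sub>M pr g y"
		and pr_same: "!!g x. x : Mg g ==> pr g x = x"
		and pr_other: "!!g h x. x : Mg h ==> h ~= g ==> pr g x = \<zero>\<^sub>M"
		and fin: "!!x. x : carrier M ==> finite {g. pr g x ~= \<zero>\<^sub>M}"
		and sep: "!!x. x : carrier M ==> (!!g. pr g x = \<zero>\<^sub>M) ==> x = \<zero>\<^sub>M"
	shows "direct_decomp M Mg"
proof -
	interpret M: abelian_group M by (rule M)
	have car: "x : carrier M" if "x : Mg g" for x g
		using additive_subgroup.a_subset[OF sub] that by blast
	have zero_mem: "\<zero>\<^sub>M : Mg g" for g by (rule additive_subgroup.zero_closed[OF sub])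
	have sums: "pr h (\<Oplus>\<^sub>M g\<in>S. c g) = (if h : S then c h else \<zero>\<^sub>M)"
		if "finite S" "!!g. c g : Mg g" for S c h
		using that
	proof (induct S rule: finite_induct)
		case empty
		have "pr h \<zero>\<^sub>M = \<zero>\<^sub>M" by (rule pr_same[OF zero_mem])
		thus ?case by simp
	next
		case (insert g S)
		have c: "c g : carrier M" for g using insert(4) car by blast
		hence s: "(\<Oplus>\<^sub>M g\<in>S. c g) : carrier M" by (intro M.finsum_closed) auto
		have "(\<Oplus>\<^sub>M g\<in>insert g S. c g) = c g \<oplus>\<^sub>M (\<Oplus>\<^sub>M g\<in>S. c g)"
			using insert c by (intro M.finsum_insert) auto
		moreover have "pr h (c g) = (if h = g then c h else \<zero>\<^sub>M)"
			using pr_same[OF insert(4)[of g]] pr_other[OF insert(4)[of g], of h] by auto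
		ultimately show ?case using insert c s by (auto simp: pr_add)
	qed
	have "EX! c. (ALL g. c g : Mg g) & finite {g. c g ~= \<zero>\<^sub>M} & x = (\<Oplus>\<^sub>M g\<in>{g. c g ~= \<zero>\<^sub>M}. c g)"
		if x: "x : carrier M" for x
	proof (rule ex1I)
		let ?S = "{g. pr g x ~= \<zero>\<^sub>M}"
		let ?y = "\<Oplus>\<^sub>M g\<in>?S. pr g x"
		have p: "pr g x : Mg g" for g by (rule pr_mem[OF x])
		have y: "?y : carrier M" using car p by (intro M.finsum_closed) auto
		have "x \<ominus>\<^sub>M ?y = \<zero>\<^sub>M"
		proof (rule sep)
			fix h
			have z: "x \<ominus>\<^sub>M ?y : carrier M" using x y by simp
			have pc: "pr h x : carrier M" "pr h (x \<ominus>\<^sub>M ?y) : carrier M" using car pr_mem x z by blast+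
			have "x = (x \<ominus>\<^sub>M ?y) \<oplus>\<^sub>M ?y" using x y by (simp add: a_minus_def M.a_assoc M.l_neg)
			hence "pr h x = pr h (x \<ominus>\<^sub>M ?y) \<oplus>\<^sub>M pr h ?y" using pr_add[OF z y, of h] by simp
			moreover have "pr h ?y = pr h x" using sums[of ?S "%g. pr g x" h] fin[OF x] p by simp
			ultimately have "\<zero>\<^sub>M \<oplus>\<^sub>M pr h x = pr h (x \<ominus>\<^sub>M ?y) \<oplus>\<^sub>M pr h x" using pc by simp
			thus "pr h (x \<ominus>\<^sub>M ?y) = \<zero>\<^sub>M" using pc M.add.r_cancel by (metis M.zero_closed)
		qed (use x y in simp)
		hence "x = ?y" using x y
			by (metis M.a_assoc M.a_inv_closed M.l_neg M.l_zero M.r_zero a_minus_def)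
		thus "(ALL g. pr g x : Mg g) & finite ?S & x = ?y" using p fin[OF x] by blast
		fix c assume c: "(ALL g. c g : Mg g) & finite {g. c g ~= \<zero>\<^sub>M} & x = (\<Oplus>\<^sub>M g\<in>{g. c g ~= \<zero>\<^sub>M}. c g)"
		show "c = (%g. pr g x)"
		proof
			fix h
			have "pr h x = (if h : {g. c g ~= \<zero>\<^sub>M} then c h else \<zero>\<^sub>M)"
			using sums[of "{g. c g ~= \<zero>\<^sub>M}" c h] c by metis
			thus "c h = pr h x" by auto
		qed
	qed
	thus ?thesis using sub by (auto simp: direct_decomp_def)
qed

lemma finite_subset_mset: "finite {\<nu>. \<nu> <=# \<mu>}"
proof (rule finite_subset)
	show "{\<nu>. \<nu> <=# \<mu>} <= mset ` {xs. set xs <= set_mset \<mu> & length xs <= size \<mu>}"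
		by (metis (mono_tags, lifting) ex_mset image_eqI mem_Collect_eq set_mset_mono set_mset_mset size_mset size_mset_mono subsetI)
qed (simp add: finite_lists_length_le)

definition mpoly_monom :: "('a, 'k) ring_scheme => 'a => 'v multiset => 'v multiset => 'a" where
	"mpoly_monom R a \<mu> = (%\<nu>. if \<nu> = \<mu> then a else \<zero>\<^sub>R)"

locale mpoly = cring R for R :: "('a, 'k) ring_scheme" (structure) + fixes V :: "'v set"
begin

abbreviation "P == mpoly_ring R V"
abbreviation "mn == mpoly_monom R"

lemma P_carrier: "p : carrier P \<longleftrightarrow> (ALL \<mu>. p \<mu> : carrier R) & finite {\<mu>. p \<mu> ~= \<zero>} & (ALL \<mu>. p \<mu> ~= \<zero> --> set_mset \<mu> <= V)"
	by (simp add: mpoly_ring_def)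

lemma P_simps: "\<zero>\<^sub>P = (%\<mu>. \<zero>)" "\<one>\<^sub>P = mn \<one> {#}" "(p \<oplus>\<^sub>P q) = (%\<mu>. p \<mu> \<oplus> q \<mu>)"
	"p \<otimes>\<^sub>P q = (%\<mu>. \<Oplus>\<nu>\<in>{\<nu>. \<nu> <=# \<mu>}. p \<nu> \<otimes> q (\<mu> - \<nu>))"
	by (simp_all add: mpoly_ring_def mpoly_monom_def)

lemma P_D: "p : carrier P ==> p \<mu> : carrier R" by (simp add: P_carrier)

lemma mon_closed [simp]: "a : carrier R ==> set_mset \<mu> <= V ==> mn a \<mu> : carrier P"
	by (auto simp: P_carrier mpoly_monom_def intro: finite_subset[of _ "{\<mu>}"])

lemma add_closed: "p : carrier P ==> q : carrier P ==> p \<oplus>\<^sub>P q : carrier P"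
proof -
	assume p: "p : carrier P" and q: "q : carrier P"
	have "{\<mu>. p \<mu> \<oplus> q \<mu> ~= \<zero>} <= {\<mu>. p \<mu> ~= \<zero>} Un {\<mu>. q \<mu> ~= \<zero>}" by auto
	hence "finite {\<mu>. p \<mu> \<oplus> q \<mu> ~= \<zero>}" using p q by (auto simp: P_carrier elim!: finite_subset)
	moreover have "set_mset \<mu> <= V" if "p \<mu> \<oplus> q \<mu> ~= \<zero>" for \<mu>
	proof -
		have "p \<mu> ~= \<zero> \<or> q \<mu> ~= \<zero>" using that by auto
		thus ?thesis using p q by (auto simp: P_carrier)
	qed
	ultimately show ?thesis using p q by (simp add: P_carrier P_simps)
qed

lemma P_abelian_group: "abelian_group P"
proof (rule abelian_groupI)
	fix p assume p: "p : carrier P"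
	show "EX q:carrier P. q \<oplus>\<^sub>P p = \<zero>\<^sub>P"
	proof (rule bexI)
		show "(%\<mu>. \<ominus> p \<mu>) \<oplus>\<^sub>P p = \<zero>\<^sub>P" using P_D[OF p] by (simp add: P_simps l_neg)
		have e: "\<ominus> p \<mu> = \<zero> \<longleftrightarrow> p \<mu> = \<zero>" for \<mu>
			by (rule add.inv_eq_1_iff[OF P_D[OF p]])
		show "(%\<mu>. \<ominus> p \<mu>) : carrier P" using p by (simp add: P_carrier e)
	qed
next
	show "\<zero>\<^sub>P : carrier P" by (simp add: P_carrier P_simps)
next
	show "!!p q. p : carrier P ==> q : carrier P ==> p \<oplus>\<^sub>P q : carrier P" by (rule add_closed)
qed (simp_all add: P_D P_simps(1,3) a_ac)

text \<open>Polynomials are sums of monomials. Since the ring laws are additive in each argument, this reduces them to monomials,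
where they are laws of the coefficient ring and of multisets.\<close>

lemma additive_induct [consumes 1, case_names zero monom add]:
	assumes p: "p : carrier P"
		and zero: "Pr \<zero>\<^sub>P"
		and monom: "!!a \<mu>. a : carrier R ==> set_mset \<mu> <= V ==> Pr (mn a \<mu>)"
		and add: "!!p q. p : carrier P ==> q : carrier P ==> Pr p ==> Pr q ==> Pr (p \<oplus>\<^sub>P q)"
	shows "Pr p"
proof -
	have "ALL p:carrier P. {\<mu>. p \<mu> ~= \<zero>} <= S --> Pr p" if "finite S" for S
		using that
	proof (induct S rule: finite_induct)
		case empty
		show ?case
		proof (intro ballI impI)
			fix p :: "'v multiset => 'a" assume "{\<mu>. p \<mu> ~= \<zero>} <= {}"
			hence "p = \<zero>\<^sub>P" by (auto simp: P_simps)
			thus "Pr p" using zero by simp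
		qed
	next
		case (insert \<mu> S)
		show ?case
		proof (intro ballI impI)
			fix p assume p: "p : carrier P" and s: "{\<mu>. p \<mu> ~= \<zero>} <= insert \<mu> S"
			show "Pr p"
			proof (cases "p \<mu> = \<zero>")
			case True
			hence "{\<mu>. p \<mu> ~= \<zero>} <= S" using s by auto
			thus ?thesis using insert p by blast
			next
			case False
			define q where "q = p(\<mu> := \<zero>)"
			have qv: "q \<nu> = (if \<nu> = \<mu> then \<zero> else p \<nu>)" for \<nu> by (simp add: q_def)
			have V: "set_mset \<mu> <= V" using p False by (auto simp: P_carrier)
			have "{\<nu>. q \<nu> ~= \<zero>} <= {\<nu>. p \<nu> ~= \<zero>}" by (auto simp: qv)
			hence "finite {\<nu>. q \<nu> ~= \<zero>}" by (rule finite_subset) (use p in "simp add: P_carrier")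
			moreover have "q \<nu> : carrier R" "q \<nu> ~= \<zero> --> set_mset \<nu> <= V" for \<nu>
			using p by (auto simp: P_carrier qv)
			ultimately have q: "q : carrier P" unfolding P_carrier by blast
			have "{\<nu>. q \<nu> ~= \<zero>} <= S" using s by (auto simp: qv)
			hence "Pr q" using insert q by blast
			moreover have "p = mn (p \<mu>) \<mu> \<oplus>\<^sub>P q" using P_D[OF p] by (auto simp: P_simps mpoly_monom_def qv)
			ultimately show ?thesis using add[OF mon_closed[OF P_D[OF p] V] q monom[OF P_D[OF p] V]] by metis
			qed
		qed
	qed
	thus ?thesis using p by (auto simp: P_carrier)
qed

lemma mult_term: "p : carrier P ==> q : carrier P ==> p \<nu> \<otimes> q \<kappa> : carrier R" by (simp add: P_D)

lemma mult_nonzero: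
	assumes p: "p : carrier P" and q: "q : carrier P" and nz: "(p \<otimes>\<^sub>P q) \<mu> ~= \<zero>"
	shows "EX \<nu>. \<nu> <=# \<mu> & p \<nu> ~= \<zero> & q (\<mu> - \<nu>) ~= \<zero>"
proof (rule ccontr)
	assume "\<not> ?thesis"
	hence "p \<nu> \<otimes> q (\<mu> - \<nu>) = \<zero>" if "\<nu> <=# \<mu>" for \<nu>
		using that P_D[OF p] P_D[OF q] by (metis l_null r_null)
	hence "(p \<otimes>\<^sub>P q) \<mu> = \<zero>" unfolding P_simps by (intro add.finprod_one_eqI) auto
	thus False using nz by simp
qed

lemma mult_closed:
	assumes p: "p : carrier P" and q: "q : carrier P"
	shows "p \<otimes>\<^sub>P q : carrier P"
proof -
	have "{\<mu>. (p \<otimes>\<^sub>P q) \<mu> ~= \<zero>} <= (%(\<nu>, \<kappa>). \<nu> + \<kappa>) ` ({\<nu>. p \<nu> ~= \<zero>} \<times> {\<kappa>. q \<kappa> ~= \<zero>})"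
		using mult_nonzero[OF p q] by (fastforce simp: image_iff)
	hence "finite {\<mu>. (p \<otimes>\<^sub>P q) \<mu> ~= \<zero>}"
		by (rule finite_subset) (use p q in "auto simp: P_carrier")
	moreover have "set_mset \<mu> <= V" if "(p \<otimes>\<^sub>P q) \<mu> ~= \<zero>" for \<mu>
	proof -
		obtain \<nu> where b: "\<nu> <=# \<mu>" "p \<nu> ~= \<zero>" "q (\<mu> - \<nu>) ~= \<zero>" using mult_nonzero[OF p q \<open>(p \<otimes>\<^sub>P q) \<mu> ~= \<zero>\<close>] by blast
		have "\<mu> = \<nu> + (\<mu> - \<nu>)" using b(1) by simp
		hence "set_mset \<mu> = set_mset \<nu> Un set_mset (\<mu> - \<nu>)" by (metis set_mset_union)
		thus ?thesis using b p q unfolding P_carrier by blast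
	qed
	moreover have "(p \<otimes>\<^sub>P q) \<mu> : carrier R" for \<mu>
		unfolding P_simps by (intro finsum_closed) (use mult_term[OF p q] in auto)
	ultimately show ?thesis by (simp add: P_carrier)
qed

lemma mult_l_distr:
	assumes "p : carrier P" "q : carrier P" "r : carrier P"
	shows "(p \<oplus>\<^sub>P q) \<otimes>\<^sub>P r = p \<otimes>\<^sub>P r \<oplus>\<^sub>P q \<otimes>\<^sub>P r"
proof
	fix \<mu>
	have "(\<Oplus>\<nu>\<in>{\<nu>. \<nu> <=# \<mu>}. (p \<nu> \<oplus> q \<nu>) \<otimes> r (\<mu> - \<nu>)) =
			(\<Oplus>\<nu>\<in>{\<nu>. \<nu> <=# \<mu>}. p \<nu> \<otimes> r (\<mu> - \<nu>) \<oplus> q \<nu> \<otimes> r (\<mu> - \<nu>))"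
		by (rule finsum_cong') (use assms in "auto simp: P_D l_distr")
	also have "... = (\<Oplus>\<nu>\<in>{\<nu>. \<nu> <=# \<mu>}. p \<nu> \<otimes> r (\<mu> - \<nu>)) \<oplus> (\<Oplus>\<nu>\<in>{\<nu>. \<nu> <=# \<mu>}. q \<nu> \<otimes> r (\<mu> - \<nu>))"
		by (rule finsum_addf) (use assms in "auto simp: P_D")
	finally show "((p \<oplus>\<^sub>P q) \<otimes>\<^sub>P r) \<mu> = (p \<otimes>\<^sub>P r \<oplus>\<^sub>P q \<otimes>\<^sub>P r) \<mu>" by (simp add: P_simps)
qed

lemma mult_r_distr:
	assumes "p : carrier P" "q : carrier P" "r : carrier P"
	shows "r \<otimes>\<^sub>P (p \<oplus>\<^sub>P q) = r \<otimes>\<^sub>P p \<oplus>\<^sub>P r \<otimes>\<^sub>P q"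
proof
	fix \<mu>
	have "(\<Oplus>\<nu>\<in>{\<nu>. \<nu> <=# \<mu>}. r \<nu> \<otimes> (p (\<mu> - \<nu>) \<oplus> q (\<mu> - \<nu>))) =
			(\<Oplus>\<nu>\<in>{\<nu>. \<nu> <=# \<mu>}. r \<nu> \<otimes> p (\<mu> - \<nu>) \<oplus> r \<nu> \<otimes> q (\<mu> - \<nu>))"
		by (rule finsum_cong') (use assms in "auto simp: P_D r_distr")
	also have "... = (\<Oplus>\<nu>\<in>{\<nu>. \<nu> <=# \<mu>}. r \<nu> \<otimes> p (\<mu> - \<nu>)) \<oplus> (\<Oplus>\<nu>\<in>{\<nu>. \<nu> <=# \<mu>}. r \<nu> \<otimes> q (\<mu> - \<nu>))"
		by (rule finsum_addf) (use assms in "auto simp: P_D")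
	finally show "(r \<otimes>\<^sub>P (p \<oplus>\<^sub>P q)) \<mu> = (r \<otimes>\<^sub>P p \<oplus>\<^sub>P r \<otimes>\<^sub>P q) \<mu>" by (simp add: P_simps)
qed

lemma mult_zero:
	assumes "p : carrier P" shows "\<zero>\<^sub>P \<otimes>\<^sub>P p = \<zero>\<^sub>P" "p \<otimes>\<^sub>P \<zero>\<^sub>P = \<zero>\<^sub>P"
	using P_D[OF assms] by (auto simp: P_simps intro!: add.finprod_one_eqI)

lemma mon_mult:
	assumes "a : carrier R" "b : carrier R"
	shows "mn a \<mu> \<otimes>\<^sub>P mn b \<nu> = mn (a \<otimes> b) (\<mu> + \<nu>)"
proof
	fix \<kappa> :: "'v multiset"
	have fin: "finite {\<delta>. \<delta> <=# \<kappa>}" by (rule finite_subset_mset)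
	show "(mn a \<mu> \<otimes>\<^sub>P mn b \<nu>) \<kappa> = mn (a \<otimes> b) (\<mu> + \<nu>) \<kappa>"
	proof (cases "\<kappa> = \<mu> + \<nu>")
		case True
		have "(\<Oplus>\<delta>\<in>{\<delta>. \<delta> <=# \<kappa>}. mn a \<mu> \<delta> \<otimes> mn b \<nu> (\<kappa> - \<delta>)) = (\<Oplus>\<delta>\<in>{\<delta>. \<delta> <=# \<kappa>}. if \<mu> = \<delta> then a \<otimes> b else \<zero>)"
			by (rule finsum_cong') (use assms True in "auto simp: mpoly_monom_def")
		also have "... = a \<otimes> b"
			by (rule finsum_singleton) (use assms True fin in auto)
		finally show ?thesis using True by (simp add: P_simps) (simp add: mpoly_monom_def)
	next
		case False
		have "mn a \<mu> \<delta> \<otimes> mn b \<nu> (\<kappa> - \<delta>) = \<zero>" if "\<delta> <=# \<kappa>" for \<delta>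
		proof (cases "\<delta> = \<mu>")
			case True
			hence "\<kappa> - \<delta> ~= \<nu>" using False that by (metis subset_mset.add_diff_inverse)
			thus ?thesis using assms by (simp add: mpoly_monom_def)
		qed (use assms in "simp add: mpoly_monom_def")
		hence "(mn a \<mu> \<otimes>\<^sub>P mn b \<nu>) \<kappa> = \<zero>" unfolding P_simps by (intro add.finprod_one_eqI) auto
		thus ?thesis using False by (simp add: mpoly_monom_def)
	qed
qed

lemma mult_comm:
	assumes p: "p : carrier P" and q: "q : carrier P"
	shows "p \<otimes>\<^sub>P q = q \<otimes>\<^sub>P p"
	using p
proof (induct p rule: additive_induct)
	case zero
	thus ?case using mult_zero[OF q] by simp
next
	case (monom a \<mu>)
	note ma = mon_closed[OF monom]
	show ?case using q
	proof (induct q rule: additive_induct)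
		case zero
		thus ?case using mult_zero[OF ma] by simp
	next
		case (monom b \<nu>)
		thus ?case using \<open>a : carrier R\<close> by (simp add: mon_mult m_comm add.commute)
	next
		case (add q r)
		thus ?case using ma by (simp add: mult_r_distr mult_l_distr)
	qed
next
	case (add p r)
	thus ?case using q by (simp add: mult_r_distr mult_l_distr)
qed

lemma mult_assoc:
	assumes p: "p : carrier P" and q: "q : carrier P" and r: "r : carrier P"
	shows "(p \<otimes>\<^sub>P q) \<otimes>\<^sub>P r = p \<otimes>\<^sub>P (q \<otimes>\<^sub>P r)"
	using p
proof (induct p rule: additive_induct)
	case zero
	thus ?case using q r by (simp add: mult_zero mult_closed)
next
	case (monom a \<mu>)
	note ma = mon_closed[OF monom] and aR = monom(1)
	show ?case using q
	proof (induct q rule: additive_induct)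
		case zero
		thus ?case using r ma by (simp add: mult_zero)
	next
		case (monom b \<nu>)
		note mb = mon_closed[OF monom] and bR = monom(1)
		show ?case using r
		proof (induct r rule: additive_induct)
			case zero
			thus ?case using ma mb by (simp add: mult_zero mult_closed)
		next
			case (monom d \<kappa>)
			thus ?case using aR bR by (simp add: mon_mult m_assoc add.assoc)
		next
			case (add r s)
			thus ?case using ma mb by (simp add: mult_r_distr mult_closed)
		qed
	next
		case (add q s)
		thus ?case using ma r by (simp add: mult_r_distr mult_l_distr mult_closed)
	qed
next
	case (add p s)
	thus ?case using q r by (simp add: mult_l_distr mult_closed)
qed

lemma P_one_closed: "\<one>\<^sub>P : carrier P" by (simp add: P_simps(2))

lemma mult_one:
	assumes p: "p : carrier P"
	shows "\<one>\<^sub>P \<otimes>\<^sub>P p = p"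
	using p
proof (induct p rule: additive_induct)
	case zero
	thus ?case by (rule mult_zero[OF P_one_closed])
next
	case (monom a \<mu>)
	thus ?case unfolding P_simps(2) by (simp add: mon_mult)
next
	case (add p q)
	thus ?case using P_one_closed by (simp add: mult_r_distr)
qed

lemma P_cring: "cring P"
proof (rule cringI)
	show "abelian_group P" by (rule P_abelian_group)
	show "comm_monoid P"
		by (rule comm_monoidI) (use mult_closed P_one_closed mult_assoc mult_one mult_comm in auto)
qed (rule mult_l_distr)

end

section \<open>The action of the Rees algebra with polynomial variables\<close>

locale rees_algebra = A: cring A for A :: "('a, 'k) ring_scheme" + fixes I :: "'a set"
	assumes graded: "graded_ring (rees A I) (rees_part A I)" and I_ideal: "ideal I A"
begin

abbreviation "R == rees A I"
abbreviation "Is == ideal_power A I"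

sublocale UP: UP_cring A "UP A" by (simp add: UP_cring_def A.is_cring)

lemma R_cring: "cring R" using graded by (simp add: graded_ring_def)

sublocale R: cring R by (rule R_cring)

lemma R_simps: "\<zero>\<^sub>R = \<zero>\<^sub>(UP A)" "\<one>\<^sub>R = \<one>\<^sub>(UP A)" "p \<oplus>\<^sub>R q = p \<oplus>\<^sub>(UP A) q" "p \<otimes>\<^sub>R q = p \<otimes>\<^sub>(UP A) q"
	by (simp_all add: rees_def)

lemma R_carrier: "p : carrier R \<longleftrightarrow> p : carrier (UP A) & (ALL n. coeff (UP A) p n : Is n)"
	by (simp add: rees_def)

lemma rees_part_subgroup: "additive_subgroup (rees_part A I n) R"
	using graded by (simp add: graded_ring_def direct_decomp_def)

lemma ideal_power_ideal: "ideal (Is n) A"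
proof (induct n)
	case 0
	show ?case using A.oneideal by simp
next
	case (Suc n)
	thus ?case using A.ideal_prod_is_ideal[OF I_ideal] by simp
qed

lemma Is_carrier: "x : Is n ==> x : carrier A"
	using ideal.Icarr[OF ideal_power_ideal] .

lemma Is_zero: "\<zero>\<^sub>A : Is n"
	using additive_subgroup.zero_closed[OF ideal.axioms(1)[OF ideal_power_ideal]] .

lemma Is_add: "x : Is n ==> y : Is n ==> x \<oplus>\<^sub>A y : Is n"
	using additive_subgroup.a_closed[OF ideal.axioms(1)[OF ideal_power_ideal]] .

lemma monom_rees: "x : Is n ==> monom (UP A) x n : carrier R"
	using Is_carrier Is_zero by (auto simp: R_carrier)

lemma monom_rees_part: "x : Is n ==> monom (UP A) x n : rees_part A I n"
	by (auto simp: rees_part_def)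

lemma Is_mult: "x : Is s ==> y : Is n ==> x \<otimes>\<^sub>A y : Is (s + n)"
proof -
	assume x: "x : Is s" and y: "y : Is n"
	have "monom (UP A) x s \<otimes>\<^sub>R monom (UP A) y n : rees_part A I (s + n)"
		using graded monom_rees_part[OF x] monom_rees_part[OF y] by (simp add: graded_ring_def)
	then obtain z where z: "z : Is (s + n)" "monom (UP A) (x \<otimes>\<^sub>A y) (s + n) = monom (UP A) z (s + n)"
		using Is_carrier[OF x] Is_carrier[OF y] by (auto simp: rees_part_def R_simps)
	have "coeff (UP A) (monom (UP A) (x \<otimes>\<^sub>A y) (s + n)) (s + n) = x \<otimes>\<^sub>A y"
		using Is_carrier[OF x] Is_carrier[OF y] by (subst UP.coeff_monom) auto
	moreover have "coeff (UP A) (monom (UP A) z (s + n)) (s + n) = z"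
		using Is_carrier[OF z(1)] by simp
	ultimately show ?thesis using z by metis
qed

lemma rees_induct [consumes 1, case_names zero monom add]:
	assumes p: "p : carrier R"
		and zero: "Pr \<zero>\<^sub>R"
		and monom: "!!x s. x : Is s ==> Pr (monom (UP A) x s)"
		and add: "!!p q. p : carrier R ==> q : carrier R ==> Pr p ==> Pr q ==> Pr (p \<oplus>\<^sub>R q)"
	shows "Pr p"
proof -
	have pU: "p : carrier (UP A)" and pc: "!!n. coeff (UP A) p n : Is n" using p by (auto simp: R_carrier)
	let ?f = "%i. monom (UP A) (coeff (UP A) p i) i"
	have f: "?f i : carrier R" "Pr (?f i)" "?f i : carrier (UP A)" for i
		using monom_rees[OF pc] monom[OF pc] Is_carrier[OF pc] by auto
	have "(\<Oplus>\<^sub>(UP A)i\<in>{..<n}. ?f i) : carrier R & Pr (\<Oplus>\<^sub>(UP A)i\<in>{..<n}. ?f i)" for n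
	proof (induct n)
		case 0
		thus ?case using zero R.zero_closed by (simp add: R_simps)
	next
		case (Suc n)
		have "(\<Oplus>\<^sub>(UP A)i\<in>{..<Suc n}. ?f i) = ?f n \<oplus>\<^sub>R (\<Oplus>\<^sub>(UP A)i\<in>{..<n}. ?f i)"
			unfolding R_simps lessThan_Suc by (rule UP.P.finsum_insert) (use f in auto)
		thus ?case using Suc f add[OF f(1)[of n] conjunct1[OF Suc] f(2)[of n] conjunct2[OF Suc]] R.a_closed by simp
	qed
	from this[of "Suc (deg A p)"] show ?thesis using UP.up_repr[OF pU] by (simp add: lessThan_Suc_atMost)
qed

lemma rees_support_finite: "p : carrier R ==> finite {s. coeff (UP A) p s ~= \<zero>\<^sub>A}"
proof -
	assume "p : carrier R"
	hence "{s. coeff (UP A) p s ~= \<zero>\<^sub>A} <= {..deg A p}"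
		using UP.deg_aboveD[of p] R_carrier by (auto simp: not_le[symmetric])
	thus ?thesis by (rule finite_subset) simp
qed

end

lemma (in abelian_monoid) finsum_extend:
	assumes "finite S" "S' <= S" "!!i. i : S ==> g i : carrier G" "!!i. i : S - S' ==> g i = \<zero>"
	shows "finsum G g S' = finsum G g S"
	by (rule add.finprod_mono_neutral_cong_left) (use assms in auto)

text \<open>Operators \<open>mu x s\<close> for homogeneous elements of the Rees algebra and \<open>tau r\<close> for the variables, all
commuting, determine an action of the polynomial ring. It is built up in two stages: \<open>rho\<close> for the Rees algebra,
\<open>act\<close> for polynomials.\<close>

locale rees_action = rees_algebra A I for A :: "('a, 'k) ring_scheme" and I +
	fixes E :: "'e ring" and c :: nat and mu :: "'a => nat => 'e => 'e" and tau :: "nat => 'e => 'e"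
	assumes E_group: "abelian_group E"
		and mu_closed: "x : Is s ==> e : carrier E ==> mu x s e : carrier E"
		and mu_add: "x : Is s ==> e : carrier E ==> e' : carrier E ==> mu x s (e \<oplus>\<^sub>E e') = mu x s e \<oplus>\<^sub>E mu x s e'"
		and mu_add_scalar: "x : Is s ==> y : Is s ==> e : carrier E ==> mu (x \<oplus>\<^sub>A y) s e = mu x s e \<oplus>\<^sub>E mu y s e"
		and mu_mult: "x : Is s ==> y : Is s' ==> e : carrier E ==> mu (x \<otimes>\<^sub>A y) (s + s') e = mu x s (mu y s' e)"
		and mu_one: "e : carrier E ==> mu \<one>\<^sub>A 0 e = e"
		and tau_closed: "r < c ==> e : carrier E ==> tau r e : carrier E"
		and tau_add: "r < c ==> e : carrier E ==> e' : carrier E ==> tau r (e \<oplus>\<^sub>E e') = tau r e \<oplus>\<^sub>E tau r e'"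
		and tau_commute: "r < c ==> r' < c ==> e : carrier E ==> tau r (tau r' e) = tau r' (tau r e)"
		and tau_mu: "r < c ==> x : Is s ==> e : carrier E ==> tau r (mu x s e) = mu x s (tau r e)"
begin

sublocale E: abelian_group E by (rule E_group)

lemma additive_zero:
	assumes "!!e. e : carrier E ==> g e : carrier E" "!!e e'. e : carrier E ==> e' : carrier E ==> g (e \<oplus>\<^sub>E e') = g e \<oplus>\<^sub>E g e'"
	shows "g \<zero>\<^sub>E = \<zero>\<^sub>E"
proof -
	have "g \<zero>\<^sub>E \<oplus>\<^sub>E g \<zero>\<^sub>E = g \<zero>\<^sub>E" using assms(2)[of "\<zero>\<^sub>E" "\<zero>\<^sub>E"] by simp
	thus ?thesis using assms(1)[OF E.zero_closed] E.add.r_cancel_one by metis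
qed

lemma mu_zero_scalar: "e : carrier E ==> mu \<zero>\<^sub>A s e = \<zero>\<^sub>E"
proof -
	assume e: "e : carrier E"
	have "mu \<zero>\<^sub>A s e \<oplus>\<^sub>E mu \<zero>\<^sub>A s e = mu \<zero>\<^sub>A s e" using mu_add_scalar[OF Is_zero Is_zero e, of s] by simp
	thus ?thesis using mu_closed[OF Is_zero e] E.add.r_cancel_one by metis
qed

text \<open>A multiset has to be listed in some order to apply its operators successively; as they commute, sorting is harmless.\<close>

definition taus :: "nat multiset => 'e => 'e" where
	"taus \<mu> e = foldr tau (sorted_list_of_multiset \<mu>) e"

lemma foldr_tau_closed: "set xs <= {..<c} ==> e : carrier E ==> foldr tau xs e : carrier E"
	by (induct xs) (auto intro: tau_closed)

lemma foldr_insort: "set xs <= {..<c} ==> r < c ==> e : carrier E ==> foldr tau (List.insort r xs) e = tau r (foldr tau xs e)"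
	by (induct xs) (auto simp: tau_commute foldr_tau_closed)

lemma taus_closed: "set_mset \<mu> <= {..<c} ==> e : carrier E ==> taus \<mu> e : carrier E"
	unfolding taus_def by (rule foldr_tau_closed) auto

lemma taus_empty [simp]: "taus {#} e = e" by (simp add: taus_def)

lemma taus_add_mset: "set_mset \<mu> <= {..<c} ==> r < c ==> e : carrier E ==> taus (add_mset r \<mu>) e = tau r (taus \<mu> e)"
	unfolding taus_def by (simp add: foldr_insort)

lemma taus_union:
	assumes "set_mset \<mu> <= {..<c}" "set_mset \<nu> <= {..<c}" "e : carrier E"
	shows "taus (\<mu> + \<nu>) e = taus \<mu> (taus \<nu> e)"
	using assms(1) by (induct \<mu>) (auto simp: taus_add_mset taus_closed assms)

lemma taus_add:
	assumes "set_mset \<mu> <= {..<c}" "e : carrier E" "e' : carrier E"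
	shows "taus \<mu> (e \<oplus>\<^sub>E e') = taus \<mu> e \<oplus>\<^sub>E taus \<mu> e'"
	using assms(1) by (induct \<mu>) (auto simp: taus_add_mset taus_closed assms tau_add)

lemma taus_mu:
	assumes "set_mset \<mu> <= {..<c}" "x : Is s" "e : carrier E"
	shows "taus \<mu> (mu x s e) = mu x s (taus \<mu> e)"
	using assms(1) by (induct \<mu>) (auto simp: taus_add_mset taus_closed assms mu_closed tau_mu)

definition rho :: "(nat => 'a) => 'e => 'e" where
	"rho p e = (\<Oplus>\<^sub>E s\<in>{s. coeff (UP A) p s ~= \<zero>\<^sub>A}. mu (coeff (UP A) p s) s e)"

lemma coeff_Is: "p : carrier R ==> coeff (UP A) p s : Is s" by (simp add: R_carrier)

lemma rho_extend:
	assumes "p : carrier R" "e : carrier E" "finite S" "{s. coeff (UP A) p s ~= \<zero>\<^sub>A} <= S"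
	shows "rho p e = (\<Oplus>\<^sub>E s\<in>S. mu (coeff (UP A) p s) s e)"
	unfolding rho_def
	by (rule E.finsum_extend) (use assms coeff_Is mu_closed mu_zero_scalar in auto)

lemma rho_closed: "p : carrier R ==> e : carrier E ==> rho p e : carrier E"
	unfolding rho_def using coeff_Is mu_closed by (intro E.finsum_closed) auto

lemma rho_add:
	assumes p: "p : carrier R" and e: "e : carrier E" "e' : carrier E"
	shows "rho p (e \<oplus>\<^sub>E e') = rho p e \<oplus>\<^sub>E rho p e'"
proof -
	have "rho p (e \<oplus>\<^sub>E e') = (\<Oplus>\<^sub>E s\<in>{s. coeff (UP A) p s ~= \<zero>\<^sub>A}. mu (coeff (UP A) p s) s e \<oplus>\<^sub>E mu (coeff (UP A) p s) s e')"
		unfolding rho_def by (rule E.finsum_cong') (use e coeff_Is[OF p] mu_closed mu_add in auto)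
	also have "... = rho p e \<oplus>\<^sub>E rho p e'"
		unfolding rho_def by (rule E.finsum_addf) (use e coeff_Is[OF p] mu_closed in auto)
	finally show ?thesis .
qed

lemma rho_add_scalar:
	assumes p: "p : carrier R" and q: "q : carrier R" and e: "e : carrier E"
	shows "rho (p \<oplus>\<^sub>R q) e = rho p e \<oplus>\<^sub>E rho q e"
proof -
	let ?S = "{s. coeff (UP A) p s ~= \<zero>\<^sub>A} Un {s. coeff (UP A) q s ~= \<zero>\<^sub>A}"
	have fin: "finite ?S" using rees_support_finite p q by auto
	have pq: "p : carrier (UP A)" "q : carrier (UP A)" using p q by (auto simp: R_carrier)
	have co: "coeff (UP A) (p \<oplus>\<^sub>R q) s = coeff (UP A) p s \<oplus>\<^sub>A coeff (UP A) q s" for s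
		using pq by (simp add: R_simps)
	have "rho (p \<oplus>\<^sub>R q) e = (\<Oplus>\<^sub>E s\<in>?S. mu (coeff (UP A) (p \<oplus>\<^sub>R q) s) s e)"
		by (rule rho_extend) (use p q e fin co in auto)
	also have "... = (\<Oplus>\<^sub>E s\<in>?S. mu (coeff (UP A) p s) s e \<oplus>\<^sub>E mu (coeff (UP A) q s) s e)"
		by (rule E.finsum_cong') (use e coeff_Is[OF p] coeff_Is[OF q] mu_closed mu_add_scalar co in auto)
	also have "... = (\<Oplus>\<^sub>E s\<in>?S. mu (coeff (UP A) p s) s e) \<oplus>\<^sub>E (\<Oplus>\<^sub>E s\<in>?S. mu (coeff (UP A) q s) s e)"
		by (rule E.finsum_addf) (use e coeff_Is[OF p] coeff_Is[OF q] mu_closed in auto)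
	also have "... = rho p e \<oplus>\<^sub>E rho q e"
		using rho_extend[OF p e fin] rho_extend[OF q e fin] by simp
	finally show ?thesis .
qed

lemma rho_zero: "e : carrier E ==> rho \<zero>\<^sub>R e = \<zero>\<^sub>E"
	unfolding rho_def R_simps by simp

lemma rho_monom:
	assumes x: "x : Is s" and e: "e : carrier E"
	shows "rho (monom (UP A) x s) e = mu x s e"
proof -
	have "rho (monom (UP A) x s) e = (\<Oplus>\<^sub>E i\<in>{s}. mu (coeff (UP A) (monom (UP A) x s) i) i e)"
		by (rule rho_extend) (use monom_rees[OF x] Is_carrier[OF x] e in auto)
	also have "... = mu x s e"
		using Is_carrier[OF x] mu_closed[OF x e] by (simp add: E.finsum_insert)
	finally show ?thesis .
qed

lemma rho_mult:
	assumes p: "p : carrier R" and q: "q : carrier R" and e: "e : carrier E"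
	shows "rho (p \<otimes>\<^sub>R q) e = rho p (rho q e)"
	using p
proof (induct p rule: rees_induct)
	case zero
	thus ?case using q e by (simp add: rho_zero rho_closed)
next
	case (monom x s)
	note mx = monom_rees[OF monom]
	show ?case using q
	proof (induct q rule: rees_induct)
		case zero
		have "rho (monom (UP A) x s) \<zero>\<^sub>E = \<zero>\<^sub>E"
			by (rule additive_zero) (use mx rho_closed rho_add in auto)
		thus ?case using mx e by (simp add: rho_zero)
	next
		case (monom y s')
		have "monom (UP A) x s \<otimes>\<^sub>R monom (UP A) y s' = monom (UP A) (x \<otimes>\<^sub>A y) (s + s')"
			using Is_carrier[OF monom] Is_carrier[OF \<open>x : Is s\<close>] by (simp add: R_simps)
		thus ?case using monom \<open>x : Is s\<close> e by (simp add: rho_monom mu_mult Is_mult mu_closed)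
	next
		case (add q q')
		thus ?case using mx e by (simp add: R.r_distr rho_add_scalar rho_add rho_closed)
	qed
next
	case (add p p')
	thus ?case using q e by (simp add: R.l_distr rho_add_scalar rho_closed)
qed

lemma taus_rho:
	assumes a: "set_mset \<mu> <= {..<c}" and p: "p : carrier R" and e: "e : carrier E"
	shows "taus \<mu> (rho p e) = rho p (taus \<mu> e)"
	using p
proof (induct p rule: rees_induct)
	case zero
	have "taus \<mu> \<zero>\<^sub>E = \<zero>\<^sub>E" by (rule additive_zero) (use a taus_closed taus_add in auto)
	thus ?case using e a by (simp add: rho_zero taus_closed)
next
	case (monom x s)
	thus ?case using e a by (simp add: rho_monom taus_closed taus_mu)
next
	case (add p q)
	thus ?case using e a by (simp add: rho_add_scalar rho_closed taus_closed taus_add)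
qed

sublocale S: mpoly R "{..<c}" ..

abbreviation "SR == mpoly_ring R {..<c}"

definition act :: "(nat multiset => nat => 'a) => 'e => 'e" where
	"act p e = (\<Oplus>\<^sub>E \<mu>\<in>{\<mu>. p \<mu> ~= \<zero>\<^sub>R}. rho (p \<mu>) (taus \<mu> e))"

lemma act_term_closed:
	assumes p: "p : carrier SR" and e: "e : carrier E"
	shows "p \<mu> ~= \<zero>\<^sub>R ==> rho (p \<mu>) (taus \<mu> e) : carrier E"
	using p e by (intro rho_closed taus_closed) (auto simp: S.P_carrier)

lemma act_extend:
	assumes "p : carrier SR" "e : carrier E" "finite S" "{\<mu>. p \<mu> ~= \<zero>\<^sub>R} <= S" "!!\<mu>. \<mu> : S ==> set_mset \<mu> <= {..<c}"
	shows "act p e = (\<Oplus>\<^sub>E \<mu>\<in>S. rho (p \<mu>) (taus \<mu> e))"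
	unfolding act_def
proof (rule E.finsum_extend)
	show "rho (p \<mu>) (taus \<mu> e) : carrier E" if "\<mu> : S" for \<mu>
		using assms that by (intro rho_closed taus_closed) (auto simp: S.P_carrier)
	fix \<mu> assume a: "\<mu> : S - {\<mu>. p \<mu> ~= \<zero>\<^sub>R}"
	thus "rho (p \<mu>) (taus \<mu> e) = \<zero>\<^sub>E" using rho_zero[OF taus_closed[OF assms(5) assms(2)]] by auto
qed (use assms in auto)

lemma act_closed: "p : carrier SR ==> e : carrier E ==> act p e : carrier E"
	unfolding act_def using act_term_closed by (intro E.finsum_closed) auto

lemma act_add:
	assumes p: "p : carrier SR" and e: "e : carrier E" "e' : carrier E"
	shows "act p (e \<oplus>\<^sub>E e') = act p e \<oplus>\<^sub>E act p e'"
proof -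
	let ?S = "{\<mu>. p \<mu> ~= \<zero>\<^sub>R}"
	have V: "set_mset \<mu> <= {..<c}" "p \<mu> : carrier R" if "\<mu> : ?S" for \<mu> using p that by (auto simp: S.P_carrier)
	have "act p (e \<oplus>\<^sub>E e') = (\<Oplus>\<^sub>E \<mu>\<in>?S. rho (p \<mu>) (taus \<mu> e) \<oplus>\<^sub>E rho (p \<mu>) (taus \<mu> e'))"
		unfolding act_def by (rule E.finsum_cong') (use V e in "auto simp: taus_add rho_add taus_closed rho_closed")
	also have "... = act p e \<oplus>\<^sub>E act p e'"
		unfolding act_def by (rule E.finsum_addf) (use V e in "auto simp: taus_closed rho_closed")
	finally show ?thesis .
qed

lemma act_add_scalar:
	assumes p: "p : carrier SR" and q: "q : carrier SR" and e: "e : carrier E"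
	shows "act (p \<oplus>\<^sub>SR q) e = act p e \<oplus>\<^sub>E act q e"
proof -
	let ?S = "{\<mu>. p \<mu> ~= \<zero>\<^sub>R} Un {\<mu>. q \<mu> ~= \<zero>\<^sub>R}"
	have fin: "finite ?S" using p q by (auto simp: S.P_carrier)
	have V: "set_mset \<mu> <= {..<c}" if "\<mu> : ?S" for \<mu> using p q that by (auto simp: S.P_carrier)
	have c: "p \<mu> : carrier R" "q \<mu> : carrier R" for \<mu> using p q by (auto simp: S.P_carrier)
	have "act (p \<oplus>\<^sub>SR q) e = (\<Oplus>\<^sub>E \<mu>\<in>?S. rho ((p \<oplus>\<^sub>SR q) \<mu>) (taus \<mu> e))"
		by (rule act_extend[OF S.add_closed[OF p q] e fin _ V]) (auto simp: S.P_simps)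
	also have "... = (\<Oplus>\<^sub>E \<mu>\<in>?S. rho (p \<mu>) (taus \<mu> e) \<oplus>\<^sub>E rho (q \<mu>) (taus \<mu> e))"
		by (rule E.finsum_cong') (use V c e in "auto simp: S.P_simps(3) rho_add_scalar taus_closed rho_closed")
	also have "... = (\<Oplus>\<^sub>E \<mu>\<in>?S. rho (p \<mu>) (taus \<mu> e)) \<oplus>\<^sub>E (\<Oplus>\<^sub>E \<mu>\<in>?S. rho (q \<mu>) (taus \<mu> e))"
		by (rule E.finsum_addf) (use V c e in "auto simp: taus_closed rho_closed")
	also have "... = act p e \<oplus>\<^sub>E act q e"
		using act_extend[OF p e fin _ V] act_extend[OF q e fin _ V] by simp
	finally show ?thesis .
qed

lemma act_zero: "e : carrier E ==> act \<zero>\<^sub>SR e = \<zero>\<^sub>E"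
	unfolding act_def by (simp add: S.P_simps(1))

lemma act_monom:
	assumes a: "a : carrier R" and al: "set_mset \<mu> <= {..<c}" and e: "e : carrier E"
	shows "act (mpoly_monom R a \<mu>) e = rho a (taus \<mu> e)"
proof -
	have "act (mpoly_monom R a \<mu>) e = (\<Oplus>\<^sub>E \<nu>\<in>{\<mu>}. rho (mpoly_monom R a \<mu> \<nu>) (taus \<nu> e))"
		by (rule act_extend) (use S.mon_closed[OF a al] e al in "auto simp: mpoly_monom_def")
	also have "... = rho a (taus \<mu> e)"
		using rho_closed[OF a taus_closed[OF al e]] by (simp add: E.finsum_insert mpoly_monom_def)
	finally show ?thesis .
qed

lemma act_mult:
	assumes p: "p : carrier SR" and q: "q : carrier SR" and e: "e : carrier E"
	shows "act (p \<otimes>\<^sub>SR q) e = act p (act q e)"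
	using p
proof (induct p rule: S.additive_induct)
	case zero
	thus ?case using q e by (simp add: act_zero act_closed S.mult_zero)
next
	case (monom a \<mu>)
	note ma = S.mon_closed[OF monom] and am = monom
	show ?case using q
	proof (induct q rule: S.additive_induct)
		case zero
		have "act (mpoly_monom R a \<mu>) \<zero>\<^sub>E = \<zero>\<^sub>E"
			by (rule additive_zero) (use ma act_closed act_add in auto)
		thus ?case using ma e by (simp add: act_zero S.mult_zero)
	next
		case (monom b \<nu>)
		thus ?case using am e
			by (simp add: S.mon_mult act_monom taus_union rho_mult taus_rho taus_closed rho_closed)
	next
		case (add q q')
		thus ?case using ma e by (simp add: S.mult_r_distr act_add_scalar act_add act_closed S.mult_closed)
	qed
next
	case (add p p')
	thus ?case using q e by (simp add: S.mult_l_distr act_add_scalar act_closed S.mult_closed)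
qed

lemma act_one: "e : carrier E ==> act \<one>\<^sub>SR e = e"
proof -
	assume e: "e : carrier E"
	have "\<one>\<^sub>A : Is 0" by simp
	hence "rho (monom (UP A) \<one>\<^sub>A 0) e = e" using rho_monom mu_one e by metis
	moreover have "monom (UP A) \<one>\<^sub>A 0 = \<one>\<^sub>R" by (simp add: R_simps)
	ultimately have "rho \<one>\<^sub>R e = e" by simp
	thus ?thesis using act_monom[of "\<one>\<^sub>R" "{#}" e] e by (simp add: S.P_simps(2))
qed

end

section \<open>Bigradings and direct sums\<close>

definition (in rees_algebra) bidegree_proj :: "nat \<times> nat => (nat multiset => nat => 'a) => nat multiset => nat => 'a" where
	"bidegree_proj = (%(i, n) p \<mu>. if 2 * size \<mu> = i then monom (UP A) (coeff (UP A) (p \<mu>) n) n else \<zero>\<^sub>R)"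

lemma (in rees_algebra) rees_poly_graded: "graded_ring (rees_poly A I c) (rees_poly_part A I c)"
proof -
	interpret S: mpoly R "{..<c}" ..
	let ?S = "mpoly_ring R {..<c}"
	interpret SR: cring ?S by (rule S.P_cring)
	have e: "rees_poly A I c = ?S" by (simp add: rees_poly_def)
	have part: "p : rees_poly_part A I c (i, n) \<longleftrightarrow> p : carrier ?S & (ALL \<mu>. p \<mu> ~= \<zero>\<^sub>R --> 2 * size \<mu> = i & p \<mu> : rees_part A I n)" for p i n
		by (simp add: rees_poly_part_def e)
	have zp: "\<zero>\<^sub>R : rees_part A I n" for n by (rule additive_subgroup.zero_closed[OF rees_part_subgroup])
	have partR: "x : rees_part A I n ==> y : rees_part A I n ==> x \<oplus>\<^sub>R y : rees_part A I n" for x y n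
		by (rule additive_subgroup.a_closed[OF rees_part_subgroup])
	have partn: "x : rees_part A I n ==> \<ominus>\<^sub>R x : rees_part A I n" for x n
		by (rule additive_subgroup.a_inv_closed[OF rees_part_subgroup])
	have part_mult: "x : rees_part A I n ==> y : rees_part A I m ==> x \<otimes>\<^sub>R y : rees_part A I (n + m)" for x y n m
		using graded by (simp add: graded_ring_def)
	have mem: "p \<mu> : rees_part A I n" if "p : rees_poly_part A I c (i, n)" for p \<mu> i n
		using that zp part by metis
	have monom_coeff: "monom (UP A) (coeff (UP A) x n) n = x" if "x : rees_part A I n" for x n
		using that Is_carrier by (auto simp: rees_part_def)
	have monom_coeff': "monom (UP A) (coeff (UP A) x m) m = \<zero>\<^sub>R" if "x : rees_part A I n" "m ~= n" for x n m
		using that Is_carrier by (auto simp: rees_part_def R_simps)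
	have sub: "additive_subgroup (rees_poly_part A I c g) ?S" for g
	proof (rule additive_subgroupI, rule SR.add.subgroupI)
		obtain i n where g: "g = (i, n)" by (cases g)
		show "rees_poly_part A I c g <= carrier ?S" unfolding g using part by blast
		have "\<zero>\<^sub>?S : rees_poly_part A I c g" unfolding g part using SR.zero_closed by (simp add: S.P_simps)
		thus "rees_poly_part A I c g ~= {}" by blast
		fix p assume p: "p : rees_poly_part A I c g"
		hence pc: "p : carrier ?S" unfolding g part by blast
		have "\<ominus>\<^sub>?S p = (%\<mu>. \<ominus>\<^sub>R p \<mu>)"
		proof (rule SR.minus_equality)
			show "(%\<mu>. \<ominus>\<^sub>R p \<mu>) \<oplus>\<^sub>?S p = \<zero>\<^sub>?S" using S.P_D[OF pc] by (simp add: S.P_simps R.l_neg)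
			show "(%\<mu>. \<ominus>\<^sub>R p \<mu>) : carrier ?S"
			using pc R.add.inv_eq_1_iff[OF S.P_D[OF pc]] by (simp add: S.P_carrier)
		qed (rule pc)
		thus "\<ominus>\<^sub>?S p : rees_poly_part A I c g"
			using p SR.a_inv_closed[OF pc] R.add.inv_eq_1_iff[OF S.P_D[OF pc]] partn unfolding g part by simp
		fix q assume q: "q : rees_poly_part A I c g"
		hence qc: "q : carrier ?S" unfolding g part by blast
		show "p \<oplus>\<^sub>?S q : rees_poly_part A I c g"
			unfolding g part
		proof (intro conjI allI impI)
			show "p \<oplus>\<^sub>?S q : carrier ?S" using pc qc by simp
			fix \<mu> assume nz: "(p \<oplus>\<^sub>?S q) \<mu> ~= \<zero>\<^sub>R"
			hence "p \<mu> ~= \<zero>\<^sub>R \<or> q \<mu> ~= \<zero>\<^sub>R" by (auto simp: S.P_simps)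
			thus "2 * size \<mu> = i" using p q unfolding g part by blast
			show "(p \<oplus>\<^sub>?S q) \<mu> : rees_part A I n"
			using partR mem p q unfolding g by (simp add: S.P_simps(3))
		qed
	qed
	have prc: "p : carrier ?S ==> bidegree_proj g p : rees_poly_part A I c g" for p and g :: "nat \<times> nat"
	proof -
		assume p: "p : carrier ?S"
		obtain i n where g: "g = (i, n)" by (cases g)
		have c: "coeff (UP A) (p \<mu>) n : Is n" for \<mu> using S.P_D[OF p, of \<mu>] by (simp add: R_carrier)
		have nz: "p \<mu> ~= \<zero>\<^sub>R" if "bidegree_proj g p \<mu> ~= \<zero>\<^sub>R" for \<mu>
			using that by (auto simp: bidegree_proj_def g R_simps)
		have "finite {\<mu>. bidegree_proj g p \<mu> ~= \<zero>\<^sub>R}"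
			by (rule finite_subset[of _ "{\<mu>. p \<mu> ~= \<zero>\<^sub>R}"]) (use nz p in "auto simp: S.P_carrier")
		moreover have "bidegree_proj g p \<mu> : carrier R" for \<mu>
			using monom_rees[OF c] by (simp add: bidegree_proj_def g)
		ultimately have "bidegree_proj g p : carrier ?S" using nz p unfolding S.P_carrier by blast
		thus ?thesis unfolding g part using monom_rees_part[OF c] by (auto simp: bidegree_proj_def g)
	qed
	have "direct_decomp ?S (rees_poly_part A I c)"
	proof (rule direct_decompI[OF SR.is_abelian_group sub prc])
		fix g :: "nat \<times> nat" and p q assume p: "p : carrier ?S" and q: "q : carrier ?S"
		obtain i n where g: "g = (i, n)" by (cases g)
		show "bidegree_proj g (p \<oplus>\<^sub>?S q) = bidegree_proj g p \<oplus>\<^sub>?S bidegree_proj g q"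
		proof
			fix \<mu>
			have "p \<mu> : carrier (UP A)" "q \<mu> : carrier (UP A)" using S.P_D[OF p, of \<mu>] S.P_D[OF q, of \<mu>] by (simp_all add: R_carrier)
			thus "bidegree_proj g (p \<oplus>\<^sub>?S q) \<mu> = (bidegree_proj g p \<oplus>\<^sub>?S bidegree_proj g q) \<mu>"
			by (auto simp: bidegree_proj_def g S.P_simps(3) R_simps)
		qed
	next
		fix g :: "nat \<times> nat" and p assume p: "p : rees_poly_part A I c g"
		obtain i n where g: "g = (i, n)" by (cases g)
		show "bidegree_proj g p = p"
		proof
			fix \<mu>
			have "p \<mu> = \<zero>\<^sub>R" if "2 * size \<mu> ~= i" using p that unfolding g part by blast
			thus "bidegree_proj g p \<mu> = p \<mu>" using monom_coeff[OF mem[OF p[unfolded g]]] by (auto simp: bidegree_proj_def g)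
		qed
	next
		fix g h :: "nat \<times> nat" and p assume p: "p : rees_poly_part A I c h" and ne: "h ~= g"
		obtain i n where g: "g = (i, n)" by (cases g)
		obtain j m where h: "h = (j, m)" by (cases h)
		show "bidegree_proj g p = \<zero>\<^sub>?S"
		proof
			fix \<mu>
			show "bidegree_proj g p \<mu> = \<zero>\<^sub>?S \<mu>"
			proof (cases "p \<mu> = \<zero>\<^sub>R")
			case True
			thus ?thesis by (simp add: bidegree_proj_def g S.P_simps(1) R_simps)
			next
			case False
			hence "2 * size \<mu> = j" using p unfolding h part by blast
			thus ?thesis using ne monom_coeff'[OF mem[OF p[unfolded h]], of n \<mu>]
			by (auto simp: bidegree_proj_def g h S.P_simps(1))
			qed
		qed
	next
		fix p assume p: "p : carrier ?S"
		have "{g. bidegree_proj g p ~= \<zero>\<^sub>?S} <= (\<Union>\<mu>\<in>{\<mu>. p \<mu> ~= \<zero>\<^sub>R}. (%n. (2 * size \<mu>, n)) ` {n. coeff (UP A) (p \<mu>) n ~= \<zero>\<^sub>A})"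
		proof
			fix g assume nz: "g : {g. bidegree_proj g p ~= \<zero>\<^sub>?S}"
			obtain i n where g: "g = (i, n)" by (cases g)
			obtain \<mu> where a: "bidegree_proj g p \<mu> ~= \<zero>\<^sub>R" using nz by (auto simp: S.P_simps(1) fun_eq_iff)
			hence "2 * size \<mu> = i" "monom (UP A) (coeff (UP A) (p \<mu>) n) n ~= \<zero>\<^sub>R"
			by (auto simp: bidegree_proj_def g split: if_splits)
			moreover from this have "coeff (UP A) (p \<mu>) n ~= \<zero>\<^sub>A" by (auto simp: R_simps)
			moreover from this have "p \<mu> ~= \<zero>\<^sub>R" by (auto simp: R_simps)
			ultimately show "g : (\<Union>\<mu>\<in>{\<mu>. p \<mu> ~= \<zero>\<^sub>R}. (%n. (2 * size \<mu>, n)) ` {n. coeff (UP A) (p \<mu>) n ~= \<zero>\<^sub>A})"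
			by (auto simp: g)
		qed
		thus "finite {g. bidegree_proj g p ~= \<zero>\<^sub>?S}"
			by (rule finite_subset) (use p rees_support_finite S.P_D in "auto simp: S.P_carrier")
	next
		fix p assume p: "p : carrier ?S" and z: "!!g. bidegree_proj g p = \<zero>\<^sub>?S"
		show "p = \<zero>\<^sub>?S"
		proof
			fix \<mu>
			have pU: "p \<mu> : carrier (UP A)" using S.P_D[OF p, of \<mu>] by (simp add: R_carrier)
			have "coeff (UP A) (p \<mu>) n = \<zero>\<^sub>A" for n
			proof -
			have "bidegree_proj (2 * size \<mu>, n) p \<mu> = \<zero>\<^sub>R" unfolding z by (simp add: S.P_simps(1))
			hence "coeff (UP A) (monom (UP A) (coeff (UP A) (p \<mu>) n) n) n = coeff (UP A) \<zero>\<^sub>(UP A) n"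
			by (simp add: bidegree_proj_def R_simps)
			thus ?thesis using UP.coeff_closed[OF pU] by simp
			qed
			hence "p \<mu> = \<zero>\<^sub>(UP A)" using pU by (intro UP.up_eqI) auto
			thus "p \<mu> = \<zero>\<^sub>?S \<mu>" by (simp add: S.P_simps(1) R_simps)
		qed
	qed
	moreover have "\<one>\<^sub>?S : rees_poly_part A I c 0"
	proof -
		have "\<one>\<^sub>R : rees_part A I 0" using graded by (simp add: graded_ring_def)
		thus ?thesis using S.P_one_closed unfolding zero_prod_def part S.P_simps(2) mpoly_monom_def by simp
	qed
	moreover have "p \<otimes>\<^sub>?S q : rees_poly_part A I c (g + h)"
		if p: "p : rees_poly_part A I c g" and q: "q : rees_poly_part A I c h" for g h p q
	proof -
		obtain i n where g: "g = (i, n)" by (cases g)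
		obtain j m where h: "h = (j, m)" by (cases h)
		have pc: "p : carrier ?S" and qc: "q : carrier ?S" using p q unfolding g h part by blast+
		show ?thesis unfolding g h add_Pair part
		proof (intro conjI allI impI)
			show "p \<otimes>\<^sub>?S q : carrier ?S" using pc qc by simp
			fix \<mu> assume nz: "(p \<otimes>\<^sub>?S q) \<mu> ~= \<zero>\<^sub>R"
			obtain \<nu> where b: "\<nu> <=# \<mu>" "p \<nu> ~= \<zero>\<^sub>R" "q (\<mu> - \<nu>) ~= \<zero>\<^sub>R" using S.mult_nonzero[OF pc qc nz] by blast
			have "2 * size \<nu> = i" "2 * size (\<mu> - \<nu>) = j" using p q b unfolding g h part by blast+
			thus "2 * size \<mu> = i + j" using b(1) by (metis add_mult_distrib2 size_union subset_mset.add_diff_inverse)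
			have "(\<Oplus>\<^sub>R \<nu>\<in>W. p \<nu> \<otimes>\<^sub>R q (\<mu> - \<nu>)) : rees_part A I (n + m)" if "finite W" for W
			using that
			proof (induct W rule: finite_induct)
			case empty
			thus ?case using zp by simp
			next
			case (insert \<nu> W)
			have "(\<Oplus>\<^sub>R \<nu>\<in>insert \<nu> W. p \<nu> \<otimes>\<^sub>R q (\<mu> - \<nu>)) = p \<nu> \<otimes>\<^sub>R q (\<mu> - \<nu>) \<oplus>\<^sub>R (\<Oplus>\<^sub>R \<nu>\<in>W. p \<nu> \<otimes>\<^sub>R q (\<mu> - \<nu>))"
			by (rule R.finsum_insert) (use insert S.mult_term[OF pc qc] in auto)
			thus ?case using insert partR part_mult[OF mem[OF p[unfolded g]] mem[OF q[unfolded h]]] by simp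
			qed
			thus "(p \<otimes>\<^sub>?S q) \<mu> : rees_part A I (n + m)" unfolding S.P_simps(4) using finite_subset_mset by blast
		qed
	qed
	ultimately show ?thesis unfolding graded_ring_def e using S.P_cring by blast
qed

definition direct_sum :: "('p => ('b, 'm) ring_scheme) => ('p => 'b) ring" where
	"direct_sum E = (|carrier = {e. (ALL p. e p : carrier (E p)) & finite {p. e p ~= \<zero>\<^sub>(E p)}},
			monoid.mult = undefined, one = undefined,
			ring.zero = (%p. \<zero>\<^sub>(E p)),
			add = (%e e' p. e p \<oplus>\<^sub>(E p) e' p)|)"

lemma direct_sum_simps:
	"e : carrier (direct_sum E) \<longleftrightarrow> (ALL p. e p : carrier (E p)) & finite {p. e p ~= \<zero>\<^sub>(E p)}"
	"\<zero>\<^sub>(direct_sum E) = (%p. \<zero>\<^sub>(E p))"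
	"e \<oplus>\<^sub>(direct_sum E) e' = (%p. e p \<oplus>\<^sub>(E p) e' p)"
	by (simp_all add: direct_sum_def)

lemma direct_sum_group:
	assumes E: "!!p. abelian_group (E p)"
		and S: "carrier S = carrier (direct_sum E)" "\<zero>\<^sub>S = \<zero>\<^sub>(direct_sum E)" "add S = add (direct_sum E)"
	shows "abelian_group S"
proof -
	have am: "abelian_monoid (E p)" for p by (rule abelian_group.axioms(1)[OF E])
	show ?thesis
	proof (rule abelian_groupI)
		fix e e' assume e: "e : carrier S" and e': "e' : carrier S"
		have "{p. e p \<oplus>\<^sub>(E p) e' p ~= \<zero>\<^sub>(E p)} <= {p. e p ~= \<zero>\<^sub>(E p)} Un {p. e' p ~= \<zero>\<^sub>(E p)}"
			using abelian_monoid.l_zero[OF am abelian_monoid.zero_closed[OF am]] by auto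
		hence "finite {p. e p \<oplus>\<^sub>(E p) e' p ~= \<zero>\<^sub>(E p)}" using e e' by (auto simp: direct_sum_simps S elim: finite_subset)
		thus "e \<oplus>\<^sub>S e' : carrier S"
			using e e' abelian_monoid.a_closed[OF am] by (simp add: direct_sum_simps S)
	next
		fix e assume e: "e : carrier S"
		have ec: "e p : carrier (E p)" for p using e by (simp add: direct_sum_simps S)
		have z: "\<ominus>\<^sub>(E p) e p = \<zero>\<^sub>(E p) \<longleftrightarrow> e p = \<zero>\<^sub>(E p)" for p
		proof -
			interpret abelian_group "E p" by (rule E)
			show ?thesis by (rule add.inv_eq_1_iff[OF ec])
		qed
		show "EX e':carrier S. e' \<oplus>\<^sub>S e = \<zero>\<^sub>S"
			by (rule bexI[of _ "%p. \<ominus>\<^sub>(E p) e p"])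
			(use e z abelian_group.a_inv_closed[OF E] abelian_group.l_neg[OF E] in "auto simp: direct_sum_simps S")
	qed (auto simp: direct_sum_simps S abelian_monoid.l_zero[OF am] abelian_monoid.r_zero[OF am] abelian_monoid.a_assoc[OF am] abelian_monoid.a_comm[OF am]
			abelian_monoid.zero_closed[OF am] fun_eq_iff)
qed

definition direct_sum_part :: "('p => ('b, 'm) ring_scheme) => 'p => ('p => 'b) set" where
	"direct_sum_part E p = {e : carrier (direct_sum E). ALL p'. p' ~= p --> e p' = \<zero>\<^sub>(direct_sum E) p'}"

definition single :: "('p => ('b, 'm) ring_scheme) => 'p => 'b => 'p => 'b" where
	"single E p x = (%p'. if p' = p then x else \<zero>\<^sub>(E p'))"

lemma single_closed:
	assumes E: "!!p. abelian_group (E p)" and "x : carrier (E p)"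
	shows "single E p x : carrier (direct_sum E)"
	using assms abelian_monoid.zero_closed[OF abelian_group.axioms(1)[OF E]]
	by (auto simp: direct_sum_simps single_def intro: finite_subset[of _ "{p}"])

lemma direct_sum_decomp:
	assumes E: "!!p. abelian_group (E p)"
		and S: "carrier S = carrier (direct_sum E)" "\<zero>\<^sub>S = \<zero>\<^sub>(direct_sum E)" "add S = add (direct_sum E)"
	shows "direct_decomp S (direct_sum_part E)"
proof -
	interpret D: abelian_group S by (rule direct_sum_group[OF E S])
	have am: "abelian_monoid (E p)" for p by (rule abelian_group.axioms(1)[OF E])
	note zc = abelian_monoid.zero_closed[OF am] and lz = abelian_monoid.l_zero[OF am]
	have sub: "additive_subgroup (direct_sum_part E p) S" for p
	proof (rule additive_subgroupI, rule D.add.subgroupI)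
		show "direct_sum_part E p <= carrier S" by (auto simp: direct_sum_part_def S)
		have "\<zero>\<^sub>S : direct_sum_part E p" using D.zero_closed by (simp add: direct_sum_part_def S)
		thus "direct_sum_part E p ~= {}" by blast
		fix e assume e: "e : direct_sum_part E p"
		hence ec: "e : carrier S" by (simp add: direct_sum_part_def S)
		have n: "\<ominus>\<^sub>S e : carrier S" using ec by simp
		have "(\<ominus>\<^sub>S e) p' = \<zero>\<^sub>(E p')" if "p' ~= p" for p'
		proof -
			have "(\<ominus>\<^sub>S e \<oplus>\<^sub>S e) p' = \<zero>\<^sub>(E p')" using D.l_neg[OF ec] by (simp add: direct_sum_simps S)
			moreover have "e p' = \<zero>\<^sub>(E p')" using e that by (simp add: direct_sum_part_def S direct_sum_simps S)
			moreover have "(\<ominus>\<^sub>S e) p' : carrier (E p')" using n by (simp add: direct_sum_simps S)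
			ultimately show ?thesis using abelian_monoid.r_zero[OF am] by (simp add: direct_sum_simps S)
		qed
		thus "\<ominus>\<^sub>S e : direct_sum_part E p" using n by (simp add: direct_sum_part_def S direct_sum_simps S)
		fix e' assume e': "e' : direct_sum_part E p"
		thus "e \<oplus>\<^sub>S e' : direct_sum_part E p"
			using e D.a_closed[OF ec, of e'] lz[OF zc] by (simp add: direct_sum_part_def S direct_sum_simps S)
	qed
	show ?thesis
	proof (rule direct_decompI[where pr = "%p e. single E p (e p)", OF D.abelian_group_axioms sub])
		show "single E p (e p) : direct_sum_part E p" if "e : carrier S" for p e
			using single_closed[where E = E and x = "e p" and p = p, OF E, folded S(1)] that by (auto simp: direct_sum_part_def S direct_sum_simps S single_def)
		show "single E p ((e \<oplus>\<^sub>S e') p) = single E p (e p) \<oplus>\<^sub>S single E p (e' p)"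
			if "e : carrier S" "e' : carrier S" for p e e'
			using lz[OF zc] by (auto simp: direct_sum_simps S single_def)
		show "single E p (e p) = e" if "e : direct_sum_part E p" for p e
			using that by (auto simp: direct_sum_part_def S direct_sum_simps S single_def)
		show "single E p (e p) = \<zero>\<^sub>S" if "e : direct_sum_part E p'" "p' ~= p" for p p' e
			using that by (auto simp: direct_sum_part_def S direct_sum_simps S single_def)
		show "finite {p. single E p (e p) ~= \<zero>\<^sub>S}" if "e : carrier S" for e
			by (rule finite_subset[of _ "{p. e p ~= \<zero>\<^sub>(E p)}"]) (use that in "auto simp: direct_sum_simps S single_def")
		show "e = \<zero>\<^sub>S" if z: "!!p. single E p (e p) = \<zero>\<^sub>S" for e
		proof
			fix p
			show "e p = \<zero>\<^sub>S p" using fun_cong[OF z[of p], of p] by (simp add: single_def)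
		qed
	qed
qed

text \<open>Elements of the subquotient are cosets of \<open>B\<close> in \<open>H\<close>, not in \<open>Z\<close>, so that a class does not mention the submodule
it is taken in.\<close>

locale subquotient = H: module A H for A :: "('a, 'k) ring_scheme" and H :: "('a, 'b) module" +
	fixes Z B :: "'b set"
	assumes Z: "submodule Z A H" and B: "submodule B A H" and B_Z: "B <= Z"
begin

definition Ex :: "('a, 'b set) module" where "Ex = quot_module (H(|carrier := Z|)) B"

definition cls :: "'b => 'b set" where "cls h = B +>\<^sub>H h"

lemma Z_carrier: "h : Z ==> h : carrier H" using H.submoduleE(1)[OF Z] by blast

sublocale HZ: module A "H(|carrier := Z|)" by (rule submodule.submodule_is_module[OF Z H.module_axioms])

lemma B_sub: "additive_subgroup B (H(|carrier := Z|))"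
proof (rule additive_subgroupI, rule HZ.M.add.subgroupI)
	show "B <= carrier (H(|carrier := Z|))" using B_Z by simp
	show "B ~= {}" using H.submoduleE(2)[OF B] .
	fix a assume a: "a : B"
	have az: "a : Z" using a B_Z by blast
	have "\<ominus>\<^sub>(H(|carrier := Z|)) a = \<ominus>\<^sub>H a"
		by (rule HZ.M.minus_equality) (use az H.submoduleE(3)[OF Z az] Z_carrier[OF az] in "simp_all add: H.M.l_neg")
	thus "\<ominus>\<^sub>(H(|carrier := Z|)) a : B" using H.submoduleE(3)[OF B a] by simp
	show "b : B ==> a \<oplus>\<^sub>(H(|carrier := Z|)) b : B" for b using H.submoduleE(5)[OF B a] by simp
qed

sublocale BZ: abelian_subgroup B "H(|carrier := Z|)"
	by (rule abelian_subgroupI3[OF B_sub HZ.M.abelian_group_axioms])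

lemma coset_eq: "B +>\<^sub>(H(|carrier := Z|)) h = cls h"
	by (simp add: cls_def a_r_coset_def r_coset_def)

lemma Ex_simps: "carrier Ex = cls ` Z" "\<zero>\<^sub>Ex = B" "add Ex = set_add (H(|carrier := Z|))"
	by (auto simp: Ex_def quot_module_def A_RCOSETS_def' coset_eq)

lemma cls_closed: "h : Z ==> cls h : carrier Ex" by (simp add: Ex_simps)

lemma cls_add: "g : Z ==> h : Z ==> cls g \<oplus>\<^sub>Ex cls h = cls (g \<oplus>\<^sub>H h)"
	using BZ.a_rcos_sum[of g h] by (simp add: Ex_simps coset_eq)

lemma cls_zero: "b : B ==> cls b = \<zero>\<^sub>Ex"
	using BZ.a_rcos_const[of b] by (simp add: Ex_simps coset_eq)

lemma Ex_group: "abelian_group Ex"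
proof (rule abelian_groupI)
	have z: "\<zero>\<^sub>H : B" using subgroup.one_closed[OF submodule.axioms(1)[OF B]] by simp
	have zZ: "\<zero>\<^sub>Ex = cls \<zero>\<^sub>H" "\<zero>\<^sub>H : Z" using cls_zero[OF z] z B_Z by auto
	note Za = H.submoduleE(5)[OF Z]
	show "\<zero>\<^sub>Ex : carrier Ex" using cls_closed zZ by simp
	fix x assume "x : carrier Ex"
	then obtain g where g: "g : Z" "x = cls g" by (auto simp: Ex_simps(1))
	show "\<zero>\<^sub>Ex \<oplus>\<^sub>Ex x = x" unfolding zZ(1) g(2) using g(1) zZ(2) Z_carrier by (simp add: cls_add)
	show "EX y:carrier Ex. y \<oplus>\<^sub>Ex x = \<zero>\<^sub>Ex"
		by (rule bexI[of _ "cls (\<ominus>\<^sub>H g)"])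
			(use g Z_carrier H.submoduleE(3)[OF Z g(1)] in "simp_all add: cls_add cls_closed zZ(1) H.M.l_neg")
	fix y assume "y : carrier Ex"
	then obtain h where h: "h : Z" "y = cls h" by (auto simp: Ex_simps(1))
	show "x \<oplus>\<^sub>Ex y : carrier Ex" unfolding g(2) h(2) using g h by (simp add: cls_add cls_closed Za)
	show "x \<oplus>\<^sub>Ex y = y \<oplus>\<^sub>Ex x" unfolding g(2) h(2) using g h Z_carrier by (simp add: cls_add H.M.a_comm)
	fix w assume "w : carrier Ex"
	then obtain k where k: "k : Z" "w = cls k" by (auto simp: Ex_simps(1))
	show "x \<oplus>\<^sub>Ex y \<oplus>\<^sub>Ex w = x \<oplus>\<^sub>Ex (y \<oplus>\<^sub>Ex w)"
		unfolding g(2) h(2) k(2) using g h k Z_carrier by (simp add: cls_add Za H.M.a_assoc)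
qed

lemma cls_eqI:
	assumes "g : Z" "h : Z" "g \<ominus>\<^sub>H h : B"
	shows "cls g = cls h"
proof -
	have c: "g : carrier H" "h : carrier H" using Z_carrier assms by auto
	have "g = (g \<ominus>\<^sub>H h) \<oplus>\<^sub>H h" using c by (simp add: a_minus_def H.M.a_assoc H.M.l_neg)
	hence "cls g = cls (g \<ominus>\<^sub>H h) \<oplus>\<^sub>Ex cls h" using cls_add[of "g \<ominus>\<^sub>H h" h] assms B_Z by auto
	also have "... = cls h"
		using cls_zero[OF assms(3)] abelian_monoid.l_zero[OF abelian_group.axioms(1)[OF Ex_group] cls_closed[OF assms(2)]] by simp
	finally show ?thesis .
qed

lemma cls_cases: "x : carrier Ex ==> EX h:Z. x = cls h" by (auto simp: Ex_simps)

lemma cls_mem: "h : Z ==> g : cls h ==> g : Z & g \<ominus>\<^sub>H h : B"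
proof -
	assume h: "h : Z" and g: "g : cls h"
	then obtain b where b: "b : B" "g = b \<oplus>\<^sub>H h" by (auto simp: cls_def a_r_coset_def')
	have c: "b : carrier H" "h : carrier H" using b B_Z h Z_carrier by auto
	have "g \<ominus>\<^sub>H h = b" unfolding b(2) using c by (simp add: a_minus_def H.M.a_assoc H.M.r_neg)
	moreover have "g : Z" unfolding b(2) using b B_Z h H.submoduleE(5)[OF Z] by blast
	ultimately show ?thesis using b by simp
qed

lemma cls_self: "h : Z ==> h : cls h"
proof -
	assume h: "h : Z"
	have "\<zero>\<^sub>H : B" using subgroup.one_closed[OF submodule.axioms(1)[OF B]] by simp
	thus ?thesis using Z_carrier[OF h] by (force simp: cls_def a_r_coset_def')
qed

end

lemma (in module) span_submodule:
	assumes "finite G0" "G0 <= carrier M"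
	defines "Y == {(lincomb M G0 a (%b. b)) | a. a : G0 \<rightarrow> carrier R}"
	shows "submodule Y R M" "G0 <= Y"
proof -
	have Yc: "Y <= carrier M" unfolding Y_def using assms(2) by (auto intro!: M.finsum_closed)
	have YI: "(lincomb M G0 a (%b. b)) : Y" if "!!b. b : G0 ==> a b : carrier R" for a
		unfolding Y_def using that by (intro CollectI exI[of _ a]) auto
	have sm: "r \<odot>\<^sub>M x : Y" if r: "r : carrier R" and x: "x : Y" for r x
	proof -
		obtain a where a: "a : G0 \<rightarrow> carrier R" "x = (lincomb M G0 a (%b. b))" using x by (auto simp: Y_def)
		have "r \<odot>\<^sub>M x = (\<Oplus>\<^sub>M b\<in>G0. r \<odot>\<^sub>M (a b \<odot>\<^sub>M b))"
			unfolding a(2) by (rule finsum_smult_ldistr) (use a r assms in auto)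
		also have "... = (lincomb M G0 (%b. (r \<otimes> a b)) (%b. b))"
			by (rule M.finsum_cong') (use a r assms(2) in "auto simp: Pi_iff smult_assoc1 subset_iff")
		finally show ?thesis using YI[of "%b. r \<otimes> a b"] a r by auto
	qed
	show "submodule Y R M"
	proof (rule submoduleI[OF Yc])
		have "(\<Oplus>\<^sub>M b\<in>G0. \<zero> \<odot>\<^sub>M b) = \<zero>\<^sub>M" by (rule M.add.finprod_one_eqI) (use assms(2) in auto)
		thus "\<zero>\<^sub>M : Y" using YI[of "%b. \<zero>"] by simp
		show "\<ominus>\<^sub>M x : Y" if "x : Y" for x
			using sm[of "\<ominus> \<one>" x] that Yc by (auto simp: smult_l_minus)
		show "x \<oplus>\<^sub>M y : Y" if "x : Y" "y : Y" for x y
		proof -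
			obtain a where a: "a : G0 \<rightarrow> carrier R" "x = (lincomb M G0 a (%b. b))" using \<open>x : Y\<close> by (auto simp: Y_def)
			obtain a' where a': "a' : G0 \<rightarrow> carrier R" "y = (lincomb M G0 a' (%b. b))" using \<open>y : Y\<close> by (auto simp: Y_def)
			have "x \<oplus>\<^sub>M y = (\<Oplus>\<^sub>M b\<in>G0. a b \<odot>\<^sub>M b \<oplus>\<^sub>M a' b \<odot>\<^sub>M b)"
			unfolding a(2) a'(2) by (rule M.finsum_addf[symmetric]) (use a a' assms(2) in auto)
			also have "... = (lincomb M G0 (%b. (a b \<oplus> a' b)) (%b. b))"
			by (rule M.finsum_cong') (use a a' assms(2) in "auto simp: Pi_iff smult_l_distr subset_iff")
			finally show ?thesis using YI[of "%b. a b \<oplus> a' b"] a a' by auto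
		qed
	qed (rule sm)
	show "G0 <= Y"
	proof
		fix g assume g: "g : G0"
		have "(lincomb M G0 (%b. (if g = b then \<one> else \<zero>)) (%b. b)) = (\<Oplus>\<^sub>M b\<in>G0. if g = b then b else \<zero>\<^sub>M)"
			by (rule M.finsum_cong') (use assms(2) in auto)
		also have "... = g" by (rule M.finsum_singleton) (use g assms in auto)
		finally show "g : Y" using YI[of "%b. if g = b then \<one> else \<zero>"] by simp
	qed
qed

section \<open>The coefficient module over the base ring\<close>

lemma restrict_scalars_simps:
	"carrier (restrict_scalars q V) = carrier V" "\<zero>\<^sub>(restrict_scalars q V) = \<zero>\<^sub>V"
	"x \<oplus>\<^sub>(restrict_scalars q V) y = x \<oplus>\<^sub>V y" "a \<odot>\<^sub>(restrict_scalars q V) x = q a \<odot>\<^sub>V x"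
	by (simp_all add: restrict_scalars_def)

lemma restrict_scalars_module:
	assumes Q: "cring Q" and q: "q : ring_hom Q A" and V: "module A V"
	shows "module Q (restrict_scalars q V)"
proof -
	interpret V: module A V by (rule V)
	note qD = ring_hom_memE[OF q]
	show ?thesis
	proof (rule moduleI[OF Q])
		show "abelian_group (restrict_scalars q V)"
			by (rule abelian_groupI)
			(auto simp: restrict_scalars_simps V.M.a_ac intro!: bexI[of _ "\<ominus>\<^sub>V x" for x] V.M.l_neg)
	qed (auto simp: restrict_scalars_simps qD V.smult_l_distr V.smult_r_distr V.smult_assoc1)
qed

locale rees_module = rees_algebra A I for A :: "('a, 'k) ring_scheme" and I +
	fixes N :: "(nat => 'a, 'n) module" and Ng :: "nat => 'n set"
	assumes N_graded: "graded_module (rees A I) (rees_part A I) N Ng"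
begin

abbreviation "NA == graded_comp A N Ng"

sublocale N: module R N using N_graded by (simp add: graded_module_def)

lemma Ng_subgroup: "additive_subgroup (Ng n) N"
	using N_graded by (simp add: graded_module_def direct_decomp_def)

lemma Ng_carrier: "y : Ng n ==> y : carrier N" using additive_subgroup.a_Hcarr[OF Ng_subgroup] .

lemmas Ng_zero = additive_subgroup.zero_closed[OF Ng_subgroup]
	and Ng_add = additive_subgroup.a_closed[OF Ng_subgroup]

lemma Ng_minus: "y : Ng n ==> \<ominus>\<^sub>N y : Ng n"
	by (rule additive_subgroup.a_inv_closed[OF Ng_subgroup])

definition nact :: "'a => nat => 'n => 'n" where "nact x s y = monom (UP A) x s \<odot>\<^sub>N y"

lemma nact_closed: "x : Is s ==> y : Ng n ==> nact x s y : Ng (n + s)"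
	using N_graded monom_rees_part[of x s] by (simp add: graded_module_def nact_def add.commute[of n s])

lemma nact_add: "x : Is s ==> y : Ng n ==> y' : Ng n ==> nact x s (y \<oplus>\<^sub>N y') = nact x s y \<oplus>\<^sub>N nact x s y'"
	using N.smult_r_distr[OF monom_rees] Ng_carrier by (simp add: nact_def)

lemma nact_add_scalar: "x : Is s ==> x' : Is s ==> y : Ng n ==> nact (x \<oplus>\<^sub>A x') s y = nact x s y \<oplus>\<^sub>N nact x' s y"
	using N.smult_l_distr[OF monom_rees monom_rees, of x s x' s y] Ng_carrier Is_carrier by (simp add: nact_def R_simps)

lemma nact_mult: "x : Is s ==> x' : Is s' ==> y : Ng n ==> nact (x \<otimes>\<^sub>A x') (s + s') y = nact x s (nact x' s' y)"
	using N.smult_assoc1[OF monom_rees monom_rees, of x s x' s' y] Ng_carrier Is_carrier by (simp add: nact_def R_simps)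

lemma nact_one: "y : Ng n ==> nact \<one>\<^sub>A 0 y = y"
	using N.smult_one Ng_carrier by (simp add: nact_def R_simps)

lemma nact_commute:
	assumes "x : Is s" "x' : Is s'" "y : Ng n"
	shows "nact x s (nact x' s' y) = nact x' s' (nact x s y)"
	using nact_mult[OF assms] nact_mult[OF assms(2,1,3)] A.m_comm[OF Is_carrier[OF assms(1)] Is_carrier[OF assms(2)]]
	by (simp add: add.commute)

lemma NA_simps: "carrier (NA n) = Ng n" "\<zero>\<^sub>(NA n) = \<zero>\<^sub>N" "y \<oplus>\<^sub>(NA n) y' = y \<oplus>\<^sub>N y'" "a \<odot>\<^sub>(NA n) y = nact a 0 y"
	by (simp_all add: graded_comp_def restrict_scalars_def nact_def)

lemma NA_module: "module A (NA n)"
proof (rule moduleI[OF A.is_cring])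
	show "abelian_group (NA n)"
	proof (rule abelian_groupI)
		fix y assume "y : carrier (NA n)"
		thus "EX x:carrier (NA n). x \<oplus>\<^sub>(NA n) y = \<zero>\<^sub>(NA n)"
			by (intro bexI[of _ "\<ominus>\<^sub>N y"]) (simp_all add: NA_simps Ng_minus Ng_carrier N.M.l_neg)
	qed (auto simp: NA_simps Ng_zero Ng_add Ng_carrier N.M.a_ac)
qed (use nact_closed[of _ 0] nact_mult[of _ 0 _ 0] in "auto simp: NA_simps nact_add nact_add_scalar nact_one")

lemma homogeneous_unique:
	assumes c: "!!n. c n : Ng n" "finite {n. c n ~= \<zero>\<^sub>N}" "y = (\<Oplus>\<^sub>N n\<in>{n. c n ~= \<zero>\<^sub>N}. c n)" and y: "y : Ng m"
	shows "c m = y"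
proof -
	let ?c = "%n. if n = m then y else \<zero>\<^sub>N"
	define P where "P k \<longleftrightarrow> (ALL n. k n : Ng n) & finite {n. k n ~= \<zero>\<^sub>N} & y = (\<Oplus>\<^sub>N n\<in>{n. k n ~= \<zero>\<^sub>N}. k n)" for k
	have ex: "EX! k. P k"
		using N_graded Ng_carrier[OF y] unfolding P_def graded_module_def direct_decomp_def by blast
	have "finite {n. ?c n ~= \<zero>\<^sub>N}" by (rule finite_subset[of _ "{m}"]) auto
	moreover have "y = (\<Oplus>\<^sub>N n\<in>{n. ?c n ~= \<zero>\<^sub>N}. ?c n)"
	proof -
		have "(\<Oplus>\<^sub>N n\<in>{n. ?c n ~= \<zero>\<^sub>N}. ?c n) = (\<Oplus>\<^sub>N n\<in>{m}. ?c n)"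
			by (rule N.finsum_extend) (use Ng_carrier[OF y] in auto)
		thus ?thesis using Ng_carrier[OF y] by (simp add: N.M.finsum_insert)
	qed
	ultimately have "P ?c" unfolding P_def using y Ng_zero by auto
	moreover have "P c" unfolding P_def using c by blast
	ultimately have "c = ?c" using ex by blast
	thus ?thesis by (simp add: fun_eq_iff)
qed

lemma homogeneous_sum_add:
	assumes c: "!!n. c n : Ng n" "finite {n. c n ~= \<zero>\<^sub>N}" and c': "!!n. c' n : Ng n" "finite {n. c' n ~= \<zero>\<^sub>N}"
	shows "finite {n. c n \<oplus>\<^sub>N c' n ~= \<zero>\<^sub>N}"
		and "(\<Oplus>\<^sub>N n\<in>{n. c n \<oplus>\<^sub>N c' n ~= \<zero>\<^sub>N}. c n \<oplus>\<^sub>N c' n)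
			= (\<Oplus>\<^sub>N n\<in>{n. c n ~= \<zero>\<^sub>N}. c n) \<oplus>\<^sub>N (\<Oplus>\<^sub>N n\<in>{n. c' n ~= \<zero>\<^sub>N}. c' n)"
proof -
	let ?K = "{n. c n ~= \<zero>\<^sub>N} Un {n. c' n ~= \<zero>\<^sub>N}"
	have K: "finite ?K" "{n. c n \<oplus>\<^sub>N c' n ~= \<zero>\<^sub>N} <= ?K" using c c' by auto
	thus "finite {n. c n \<oplus>\<^sub>N c' n ~= \<zero>\<^sub>N}" by (rule finite_subset[rotated])
	note cc = Ng_carrier[OF c(1)] Ng_carrier[OF c'(1)]
	have e: "(\<Oplus>\<^sub>N n\<in>{n. g n ~= \<zero>\<^sub>N}. g n) = (\<Oplus>\<^sub>N n\<in>?K. g n)" if "{n. g n ~= \<zero>\<^sub>N} <= ?K" "!!n. g n : carrier N" for g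
		by (rule N.finsum_extend[OF K(1)]) (use that in auto)
	show "(\<Oplus>\<^sub>N n\<in>{n. c n \<oplus>\<^sub>N c' n ~= \<zero>\<^sub>N}. c n \<oplus>\<^sub>N c' n)
			= (\<Oplus>\<^sub>N n\<in>{n. c n ~= \<zero>\<^sub>N}. c n) \<oplus>\<^sub>N (\<Oplus>\<^sub>N n\<in>{n. c' n ~= \<zero>\<^sub>N}. c' n)"
		using e[OF K(2)] e[of c] e[of c'] cc by (simp add: N.M.finsum_addf)
qed

end

locale rees_module_over = rees_module A I N Ng + Q: cring Q
	for A :: "('a, 'k) ring_scheme" and I and N :: "(nat => 'a, 'n) module" and Ng and Q :: "('q, 'j) ring_scheme" +
	fixes q :: "'q => 'a"
	assumes q_hom: "q : ring_hom Q A" and q_surj: "q ` carrier Q = carrier A"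
		and Q_noetherian: "noetherian_ring Q" and N_fin_gen: "fin_gen_module (rees A I) N"
begin

abbreviation "NQ n == restrict_scalars q (NA n)"

definition mult_op :: "'q => nat \<times> (nat => 'n => 'n)" where "mult_op w = (1, %n. nact (q w) 1)"

lemma NQ_module: "module Q (NQ n)" by (rule restrict_scalars_module[OF Q.is_cring q_hom NA_module])

lemmas NQ_simps = restrict_scalars_simps NA_simps

lemma Is_1 [simp]: "ideal_prod A I (carrier A) = I"
	by (rule A.ideal_prod_one[OF I_ideal])

lemma mult_op_linear: "q w : I ==> linear_map Q (NQ n) (NQ (n + 1)) (nact (q w) 1)"
	using nact_closed[of "q w" 1] nact_add[of "q w" 1] nact_commute[of "q w" 1 _ 0] ring_hom_closed[OF q_hom]
	by (intro linear_mapI) (auto simp: NQ_simps Is_1)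

lemma ideal_generators: "EX W. finite W & W <= carrier Q & {z : carrier Q. q z : I} = Idl\<^bsub>Q\<^esub> W"
proof -
	have "ring_hom_ring Q A q" using q_hom Q.ring_axioms A.ring_axioms by (intro ring_hom_ringI2)
	from noetherian_ring.finetely_gen[OF Q_noetherian ring_hom_ring.ideal_vimage[OF this I_ideal]]
	show ?thesis by blast
qed

text \<open>Elements of \<open>I\<^sup>s\<close> are sums of \<open>s\<close>-fold products of generators of \<open>I\<close>. Hence closure under the finitely many
operators of degree one implies closure under the whole Rees algebra.\<close>

lemma closed_family_nact:
	assumes W: "W <= carrier Q" "{z : carrier Q. q z : I} = Idl\<^bsub>Q\<^esub> W"
		and U: "closed_family Q NQ (mult_op ` W) U" and x: "x : Is s" and y: "y : U n"
	shows "nact x s y : U (n + s)"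
proof -
	note Ud = closed_familyD[OF U NQ_module, unfolded NQ_simps]
	have q_add: "q (a \<oplus>\<^sub>Q b) = q a \<oplus>\<^sub>A q b" and q_mult: "q (a \<otimes>\<^sub>Q b) = q a \<otimes>\<^sub>A q b"
		if "a : carrier Q" "b : carrier Q" for a b
		using that ring_hom_add[OF q_hom] ring_hom_mult[OF q_hom] by auto
	have scal: "nact a 0 y : U n" if a: "a : carrier A" and u: "y : U n" for a y n
	proof -
		have "a : q ` carrier Q" using a q_surj by simp
		then obtain r where "r : carrier Q" "a = q r" by (rule imageE)
		thus ?thesis using Ud(5)[of r y n] u by simp
	qed
	let ?V = "{z : carrier Q. q z : I & (ALL n. ALL y:U n. nact (q z) 1 y : U (n + 1))}"
	have IQ: "ideal {z : carrier Q. q z : I} Q" unfolding W(2) by (rule Q.genideal_ideal[OF W(1)])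
	have "ideal ?V Q"
	proof (rule idealI[OF Q.ring_axioms])
		have V_mult: "a \<otimes>\<^sub>Q z : ?V" if a: "a : carrier Q" and z: "z : ?V" for a z
		proof -
			have "a \<otimes>\<^sub>Q z : {z : carrier Q. q z : I}" using a z ideal.I_l_closed[OF IQ, of z a] by blast
			moreover have "nact (q (a \<otimes>\<^sub>Q z)) 1 y : U (n + 1)" if "y : U n" for n y
			using that a z nact_mult[of "q a" 0 "q z" 1 y n] Ud(1) scal ring_hom_closed[OF q_hom a]
			by (simp add: q_mult Is_1)
			ultimately show ?thesis by blast
		qed
		show "subgroup ?V (add_monoid Q)"
		proof (rule Q.add.subgroupI)
			have "q \<zero>\<^sub>Q = \<zero>\<^sub>A" using ring_hom_zero[OF q_hom Q.ring_axioms A.ring_axioms] .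
			moreover have "nact \<zero>\<^sub>A 1 y = \<zero>\<^sub>N" if "y : U n" for n y
			using Ng_carrier[OF Ud(1)[OF that]] by (simp add: nact_def R_simps[symmetric])
			ultimately have "\<zero>\<^sub>Q : ?V" using Ud(2) Is_zero[of 1] by auto
			thus "?V ~= {}" by blast
			fix a assume a: "a : ?V"
			thus "\<ominus>\<^sub>Q a : ?V" using V_mult[of "\<ominus>\<^sub>Q \<one>\<^sub>Q" a] by (simp add: Q.l_minus)
			fix b assume b: "b : ?V"
			have "a \<oplus>\<^sub>Q b : {z : carrier Q. q z : I}"
			using a b additive_subgroup.a_closed[OF ideal.axioms(1)[OF IQ], of a b] by blast
			moreover have "nact (q (a \<oplus>\<^sub>Q b)) 1 y : U (n + 1)" if "y : U n" for n y
			using that a b nact_add_scalar[of "q a" 1 "q b" y n] Ud(1) Ud(3) by (simp add: q_add Is_1)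
			ultimately show "a \<oplus>\<^sub>Q b : ?V" by blast
		qed blast
		show "z : ?V ==> a : carrier Q ==> a \<otimes>\<^sub>Q z : ?V" for a z by (rule V_mult)
		show "z : ?V ==> a : carrier Q ==> z \<otimes>\<^sub>Q a : ?V" for a z using V_mult[of a z] Q.m_comm[of z a] by simp
	qed
	moreover have "W <= ?V"
	proof
		fix w assume w: "w : W"
		hence "w : {z : carrier Q. q z : I}" using Q.genideal_self[OF W(1)] unfolding W(2) by blast
		thus "w : ?V" using Ud(6)[of 1 "%n. nact (q w) 1"] w by (auto simp: mult_op_def)
	qed
	ultimately have V: "{z : carrier Q. q z : I} <= ?V" unfolding W(2) by (rule Q.genideal_minimal)
	have step: "nact z 1 y : U (n + 1)" if z: "z : I" and y: "y : U n" for z y n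
	proof -
		obtain w where "w : carrier Q" "z = q w" using ideal.Icarr[OF I_ideal z] unfolding q_surj[symmetric] by (auto elim: imageE)
		thus ?thesis using V z y by blast
	qed
	show ?thesis using x
	proof (induct s arbitrary: x)
		case 0
		thus ?case using scal y by simp
	next
		case (Suc s)
		from Suc(2)[simplified] show ?case
		proof (induct x rule: ideal_prod.induct)
			case (prod i j)
			have "nact (i \<otimes>\<^sub>A j) (1 + s) y = nact i 1 (nact j s y)"
			by (rule nact_mult) (use prod Is_1 Ud(1)[OF y] in auto)
			thus ?case using step[OF prod(1) Suc(1)[OF prod(2)]] by simp
		next
			case (sum a b)
			have "a : Is (Suc s)" "b : Is (Suc s)" using sum by simp_all
			thus ?case using sum nact_add_scalar[of a "Suc s" b y n] Ud(1)[OF y] Ud(3) by simp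
		qed
	qed
qed

text \<open>The homogeneous components of generators over the Rees algebra are generators for the operators.\<close>

lemma coefficients_fin_gen:
	assumes W: "W <= carrier Q" "{z : carrier Q. q z : I} = Idl\<^bsub>Q\<^esub> W"
	shows "fin_gen_family Q NQ (mult_op ` W) (%n. carrier (NQ n)) (%n. {\<zero>\<^sub>(NQ n)})"
proof -
	obtain G0 where G0: "finite G0" "G0 <= carrier N"
		"!!y. y : carrier N ==> EX a:G0 \<rightarrow> carrier R. y = (lincomb N G0 a (%b. b))"
		using N_fin_gen unfolding fin_gen_module_def by blast
	have "ALL g:G0. EX c. (ALL n. c n : Ng n) & finite {n. c n ~= \<zero>\<^sub>N} & g = (\<Oplus>\<^sub>N n\<in>{n. c n ~= \<zero>\<^sub>N}. c n)"
		using N_graded G0(2) unfolding graded_module_def direct_decomp_def by blast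
	then obtain c where c: "!!g n. g : G0 ==> c g n : Ng n" "!!g. g : G0 ==> finite {n. c g n ~= \<zero>\<^sub>N}"
		"!!g. g : G0 ==> g = (\<Oplus>\<^sub>N n\<in>{n. c g n ~= \<zero>\<^sub>N}. c g n)" by metis
	let ?S = "\<Union>g\<in>G0. (%n. (n, c g n)) ` {n. c g n ~= \<zero>\<^sub>N}"
	show ?thesis
		unfolding fin_gen_family_def
	proof (intro exI[of _ ?S] conjI allI impI)
		show "finite ?S" using G0(1) c(2) by auto
		show "?S <= Sigma UNIV (%n. carrier (NQ n))" using c(1) by (auto simp: NQ_simps)
		fix U assume "closed_family Q NQ (mult_op ` W) U & (%n. {\<zero>\<^sub>(NQ n)}) <= U & ?S <= Sigma UNIV U"
		hence U: "closed_family Q NQ (mult_op ` W) U" and SU: "?S <= Sigma UNIV U" by auto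
		note Ud = closed_familyD[OF U NQ_module, unfolded NQ_simps]
		define Pr where "Pr y \<longleftrightarrow> (EX c. (ALL n. c n : U n) & finite {n. c n ~= \<zero>\<^sub>N} & y = (\<Oplus>\<^sub>N n\<in>{n. c n ~= \<zero>\<^sub>N}. c n))" for y
		have PrI: "Pr (\<Oplus>\<^sub>N n\<in>{n. c n ~= \<zero>\<^sub>N}. c n)" if "!!n. c n : U n" "finite {n. c n ~= \<zero>\<^sub>N}" for c
			using that unfolding Pr_def by blast
		have Pr_zero: "Pr \<zero>\<^sub>N" using PrI[of "%n. \<zero>\<^sub>N"] Ud(2) by simp
		have Pr_add: "Pr (y \<oplus>\<^sub>N y')" if y: "Pr y" "Pr y'" for y y'
		proof -
			obtain k k' where k: "!!n. k n : U n" "finite {n. k n ~= \<zero>\<^sub>N}" "y = (\<Oplus>\<^sub>N n\<in>{n. k n ~= \<zero>\<^sub>N}. k n)"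
			and k': "!!n. k' n : U n" "finite {n. k' n ~= \<zero>\<^sub>N}" "y' = (\<Oplus>\<^sub>N n\<in>{n. k' n ~= \<zero>\<^sub>N}. k' n)"
			using y unfolding Pr_def by metis
			note s = homogeneous_sum_add[OF Ud(1)[OF k(1)] k(2) Ud(1)[OF k'(1)] k'(2)]
			show ?thesis unfolding k(3) k'(3) s(2)[symmetric] by (rule PrI[OF Ud(3)[OF k(1) k'(1)] s(1)])
		qed
		have Pr_U: "Pr y" if y: "y : U m" for y m
		proof -
			let ?c = "%n. if n = m then y else \<zero>\<^sub>N"
			have "(\<Oplus>\<^sub>N n\<in>{n. ?c n ~= \<zero>\<^sub>N}. ?c n) = (\<Oplus>\<^sub>N n\<in>{m}. ?c n)"
			by (rule N.finsum_extend) (use Ng_carrier[OF Ud(1)[OF y]] in auto)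
			moreover have "Pr (\<Oplus>\<^sub>N n\<in>{n. ?c n ~= \<zero>\<^sub>N}. ?c n)"
			by (rule PrI) (use y Ud(2) in \<open>auto intro: finite_subset[of _ "{m}"]\<close>)
			ultimately show ?thesis using Ng_carrier[OF Ud(1)[OF y]] by (simp add: N.M.finsum_insert)
		qed
		have Pr_sum: "Pr (\<Oplus>\<^sub>N k\<in>K. g k)" if "finite K" "!!k. k : K ==> Pr (g k) & g k : carrier N" for K :: "'z set" and g
			using that by (induct K rule: finite_induct) (auto simp: N.M.finsum_insert Pr_zero Pr_add)
		have Pr_smult: "Pr (p \<odot>\<^sub>N u)" if p: "p : carrier R" and u: "u : U n" for p u n
			using p
		proof (induct p rule: rees_induct)
			case zero
			thus ?case using Pr_zero Ng_carrier[OF Ud(1)[OF u]] by simp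
		next
			case (monom x s)
			show ?case using Pr_U[OF closed_family_nact[OF W U monom u]] by (simp add: nact_def)
		next
			case (add p p')
			thus ?case using Pr_add Ng_carrier[OF Ud(1)[OF u]] by (simp add: N.smult_l_distr)
		qed
		have cU: "c g n : U n" if "g : G0" "c g n ~= \<zero>\<^sub>N" for g n using SU that by blast
		have "Pr y" if y: "y : carrier N" for y
		proof -
			obtain a where a: "a : G0 \<rightarrow> carrier R" "y = (lincomb N G0 a (%b. b))" using G0(3)[OF y] by blast
			have "Pr (a g \<odot>\<^sub>N g) & a g \<odot>\<^sub>N g : carrier N" if g: "g : G0" for g
			proof -
			have ag: "a g : carrier R" using a g by blast
			have "a g \<odot>\<^sub>N g = a g \<odot>\<^sub>N (\<Oplus>\<^sub>N n\<in>{n. c g n ~= \<zero>\<^sub>N}. c g n)" using c(3)[OF g] by simp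
			also have "... = (\<Oplus>\<^sub>N n\<in>{n. c g n ~= \<zero>\<^sub>N}. a g \<odot>\<^sub>N c g n)"
			by (rule N.finsum_smult_ldistr) (use ag c[OF g] Ng_carrier in auto)
			finally have "a g \<odot>\<^sub>N g = (\<Oplus>\<^sub>N n\<in>{n. c g n ~= \<zero>\<^sub>N}. a g \<odot>\<^sub>N c g n)" .
			hence "Pr (a g \<odot>\<^sub>N g)"
			using Pr_sum[OF c(2)[OF g], of "%n. a g \<odot>\<^sub>N c g n"] Pr_smult[OF ag cU[OF g]] ag Ng_carrier[OF c(1)[OF g]] by simp
			thus ?thesis using ag g G0(2) by auto
			qed
			thus ?thesis unfolding a(2) by (rule Pr_sum[OF G0(1)])
		qed
		hence "y : U n" if "y : Ng n" for y n
			using homogeneous_unique[OF Ud(1) _ _ that] Ng_carrier[OF that] unfolding Pr_def by metis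
		thus "(%n. carrier (NQ n)) <= U" by (auto simp: le_fun_def NQ_simps)
	qed
qed

lemma coefficients_noetherian:
	assumes W: "finite W" "W <= carrier Q" "{z : carrier Q. q z : I} = Idl\<^bsub>Q\<^esub> W"
	shows "noetherian_family Q NQ (mult_op ` W) (%n. carrier (NQ n)) (%n. {\<zero>\<^sub>(NQ n)})"
proof -
	interpret F: module_family Q NQ by (rule module_family.intro[OF NQ_module])
	interpret NQ: module Q "NQ n" for n by (rule NQ_module)
	have WI: "q w : I" if "w : W" for w using Q.genideal_self[OF W(2)] that unfolding W(3)[symmetric] by blast
	have lin: "linear_map Q (NQ n) (NQ (n + s)) (\<phi> n)" if "(s, \<phi>) : mult_op ` W" for s \<phi> n
		using that mult_op_linear WI by (auto simp: mult_op_def)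
	show ?thesis
	proof (rule F.fin_gen_imp_noetherian[OF Q_noetherian finite_imageI[OF W(1)] _ _ _ _ _ coefficients_fin_gen[OF W(2,3)]])
		show "ALL (s, \<phi>):mult_op ` W. ALL n. linear_map Q (NQ n) (NQ (n + s)) (\<phi> n)" using lin by blast
		show "closed_family Q NQ (mult_op ` W) (%n. carrier (NQ n))"
			by (rule F.closedI) (use linear_closed[OF lin] in auto)
		show "closed_family Q NQ (mult_op ` W) (%n. {\<zero>\<^sub>(NQ n)})"
			by (rule F.closedI) (use linear_zero[OF NQ_module NQ_module lin] in auto)
		show "(%n. {\<zero>\<^sub>(NQ n)}) <= (%n. carrier (NQ n))" by (simp add: le_fun_def)
		fix P R assume "P : mult_op ` W" "R : mult_op ` W"
		then obtain w v where wv: "w : W" "v : W" "P = mult_op w" "R = mult_op v" by blast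
		have "F.cong_mod (%n. {\<zero>\<^sub>(NQ n)}) (n + 1 + 1) (nact (q w) 1 (nact (q v) 1 y)) (nact (q v) 1 (nact (q w) 1 y))"
			if y: "y : Ng n" for n y
		proof -
			have e: "nact (q w) 1 (nact (q v) 1 y) = nact (q v) 1 (nact (q w) 1 y)"
			by (rule nact_commute) (use WI wv y Is_1 in auto)
			have "nact (q v) 1 (nact (q w) 1 y) : carrier (NQ (n + 1 + 1))"
			using nact_closed[OF _ nact_closed[OF _ y], of "q v" 1 "q w" 1] WI wv Is_1 by (simp add: NQ_simps)
			thus ?thesis unfolding e F.cong_mod_def by (simp add: a_minus_def NQ.M.r_neg)
		qed
		thus "F.commutes_mod (%n. carrier (NQ n)) (%n. {\<zero>\<^sub>(NQ n)}) P R"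
			unfolding F.commutes_mod_def wv mult_op_def by (simp add: NQ_simps)
	qed
qed

end

section \<open>Systems of Eisenbud operators on free resolutions\<close>

text \<open>The copy of a module inside the type of sequences in which cones can be formed.\<close>

definition const_module :: "('q, 'l) module => ('q, nat => 'l) module" where
	"const_module P = (|carrier = (%x _. x) ` carrier P, monoid.mult = undefined, one = undefined,
		ring.zero = (%_. \<zero>\<^sub>P), add = (%u v _. u 0 \<oplus>\<^sub>P v 0), smult = (%a u _. a \<odot>\<^sub>P u 0)|)"

lemma const_module_simps:
	"carrier (const_module P) = (%x _. x) ` carrier P" "\<zero>\<^sub>(const_module P) = (%_. \<zero>\<^sub>P)"
	"u \<oplus>\<^sub>(const_module P) v = (%_. u 0 \<oplus>\<^sub>P v 0)" "a \<odot>\<^sub>(const_module P) u = (%_. a \<odot>\<^sub>P u 0)"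
	by (simp_all add: const_module_def)

lemma const_module_module:
	assumes "module Q P"
	shows "module Q (const_module P)"
proof -
	interpret P: module Q P by fact
	show ?thesis
	proof (rule moduleI[OF P.R.is_cring])
		show "abelian_group (const_module P)"
		proof (rule abelian_groupI)
			fix u assume "u : carrier (const_module P)"
			thus "EX v:carrier (const_module P). v \<oplus>\<^sub>(const_module P) u = \<zero>\<^sub>(const_module P)"
			by (intro bexI[of _ "%_. \<ominus>\<^sub>P u 0"]) (auto simp: const_module_simps P.M.l_neg)
		qed (auto simp: const_module_simps P.M.a_ac)
	qed (auto simp: const_module_simps P.smult_l_distr P.smult_r_distr P.smult_assoc1)
qed

lemma linear_to_const:
	assumes "linear_map Q P P' h"
	shows "linear_map Q (const_module P) (const_module P') (%u _. h (u 0))"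
	using assms by (intro linear_mapI) (auto simp: const_module_simps linear_add linear_smult intro: linear_closed)

lemma const_finsum:
	assumes P: "module Q P" and "finite K" "!!k. k : K ==> g k : carrier P"
	shows "(\<Oplus>\<^sub>(const_module P)k\<in>K. (%_. g k)) = (%_. \<Oplus>\<^sub>P k\<in>K. g k)"
proof -
	have "linear_map Q P (const_module P) (%x _. x)" by (rule linear_mapI) (auto simp: const_module_simps)
	from linear_finsum[OF P const_module_module[OF P] this assms(2), of g] show ?thesis using assms by auto
qed

lemma const_fspan:
	assumes P: "module Q P" and f: "!!r. r < k ==> f r : carrier Q"
	shows "u : fspan f k (const_module P) \<longleftrightarrow> (EX x:fspan f k P. u = (%_. x))"
proof -
	interpret P: module Q P by (rule P)
	have s: "(lincomb (const_module P) {..<k} f g) = (%_. \<Oplus>\<^sub>P r\<in>{..<k}. f r \<odot>\<^sub>P g r 0)"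
		if "!!r. r < k ==> g r 0 : carrier P" for g
		unfolding const_module_simps(4) by (rule const_finsum[OF P]) (use that f in auto)
	show ?thesis
	proof
		assume "u : fspan f k (const_module P)"
		then obtain g where g: "g : {..<k} \<rightarrow> carrier (const_module P)" "u = (lincomb (const_module P) {..<k} f g)"
			unfolding fspan_def by auto
		have gc: "g r 0 : carrier P" if "r < k" for r
		proof -
			have "g r : carrier (const_module P)" using g(1) that by auto
			thus ?thesis by (auto simp: const_module_simps)
		qed
		show "EX x:fspan f k P. u = (%_. x)" unfolding g(2)
			by (rule bexI[where x = "\<Oplus>\<^sub>P r\<in>{..<k}. f r \<odot>\<^sub>P g r 0"], rule s, rule gc) (auto intro!: fspanI gc)
	next
		assume "EX x:fspan f k P. u = (%_. x)"
		then obtain g where g: "g : {..<k} \<rightarrow> carrier P" "u = (%_. \<Oplus>\<^sub>P r\<in>{..<k}. f r \<odot>\<^sub>P g r)"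
			unfolding fspan_def by auto
		have gc: "g r : carrier P" if "r < k" for r using g(1) that by auto
		have "u = (lincomb (const_module P) {..<k} f (%r. (%_. g r)))" using s[of "%r _. g r"] gc g(2) by simp
		also have "... : fspan f k (const_module P)" by (rule fspanI) (use gc in "auto simp: const_module_simps")
		finally show "u : fspan f k (const_module P)" .
	qed
qed

lemma const_diff:
	assumes "module Q P" "x : carrier P" "y : carrier P"
	shows "(%_. x) \<ominus>\<^sub>(const_module P) (%_. y) = (%_. x \<ominus>\<^sub>P y)"
proof -
	have "linear_map Q P (const_module P) (%x _. x)" by (rule linear_mapI) (auto simp: const_module_simps)
	from linear_diff[OF assms(1) const_module_module[OF assms(1)] this assms(2,3)] show ?thesis by simp
qed

lemma const_fin_dual_basis:
	assumes P: "module Q P" and "fin_dual_basis Q P"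
	shows "fin_dual_basis Q (const_module P)"
proof -
	obtain J :: "nat set" and b lam where J: "finite J" and db: "dual_basis Q P J b lam"
		using assms(2) by (auto simp: fin_dual_basis_def)
	interpret P: module Q P by (rule P)
	note d = db[unfolded dual_basis_def]
	have b: "b j : carrier P" if "j : J" for j using d that by auto
	have lam: "lam x j : carrier Q" if "x : carrier P" "j : J" for x j using d that by blast
	have lam_add: "lam (x \<oplus>\<^sub>P y) j = lam x j \<oplus>\<^sub>Q lam y j" if "x : carrier P" "y : carrier P" "j : J" for x y j using d that by blast
	have lam_smult: "lam (a \<odot>\<^sub>P x) j = a \<otimes>\<^sub>Q lam x j" if "a : carrier Q" "x : carrier P" "j : J" for a x j using d that by blast
	have "dual_basis Q (const_module P) J (%j _. b j) (%u. lam (u 0))"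
	proof (rule dual_basis_finiteI[OF const_module_module[OF P] J])
		fix u assume "u : carrier (const_module P)"
		then obtain x where x: "x : carrier P" "u = (%_. x)" by (auto simp: const_module_simps)
		show "u = (lincomb (const_module P) J (lam (u 0)) (%j. (%_. b j)))"
			unfolding const_module_simps(4) x(2)
			by (subst const_finsum[OF P J]) (use b lam x dual_basis_finite[OF P db J x(1)] in auto)
		show "lam (u 0) j : carrier Q" if "j : J" for j using lam[OF x(1) that] by (simp add: x(2))
		show "lam ((a \<odot>\<^sub>(const_module P) u) 0) j = a \<otimes>\<^sub>Q lam (u 0) j" if "a : carrier Q" "j : J" for a j
			using lam_smult[OF that(1) x(1) that(2)] by (simp add: const_module_simps x(2))
		fix v assume "v : carrier (const_module P)"
		thus "lam ((u \<oplus>\<^sub>(const_module P) v) 0) j = lam (u 0) j \<oplus>\<^sub>Q lam (v 0) j" if "j : J" for j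
			using lam_add x(1) that by (auto simp: const_module_simps x(2))
	qed (use b in "auto simp: const_module_simps")
	thus ?thesis using J by (auto simp: fin_dual_basis_def)
qed

lemma free_fin_dual_basis:
	assumes "fin_free_module Q P"
	shows "fin_dual_basis Q P"
proof -
	obtain B where P: "module Q P" and B: "finite B" "B <= carrier P"
		and ex0: "ALL x:carrier P. EX! a. a : B \<rightarrow>\<^sub>E carrier Q & x = (lincomb P B a (%b. b))"
		using assms unfolding fin_free_module_def by (elim conjE exE) (rule that, assumption+)
	interpret P: module Q P by (rule P)
	obtain g where g: "bij_betw g {0..<card B} B" using ex_bij_betw_nat_finite[OF B(1)] by blast
	define Pr where "Pr x a \<longleftrightarrow> a : B \<rightarrow>\<^sub>E carrier Q & x = (lincomb P B a (%b. b))" for x a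
	define co where "co x = (THE a. Pr x a)" for x
	have ex: "EX! a. Pr x a" if "x : carrier P" for x using ex0 that by (simp only: Pr_def)
	have Pr_co: "Pr x (co x)" if "x : carrier P" for x unfolding co_def by (rule theI'[OF ex[OF that]])
	have co: "co x : B \<rightarrow>\<^sub>E carrier Q" "(lincomb P B (co x) (%b. b)) = x" if "x : carrier P" for x
		using Pr_co[OF that] unfolding Pr_def by simp_all
	have coc: "co x b : carrier Q" if "x : carrier P" "b : B" for x b using co(1)[OF that(1)] that(2) by auto
	have Bc: "b : carrier P" if "b : B" for b using B that by blast
	have uniq: "co x b = a b"
		if "x : carrier P" "b : B" "!!b. b : B ==> a b : carrier Q" "x = (lincomb P B a (%b. b))" for x a b
	proof -
		have "(lincomb P B (restrict a B) (%b. b)) = (lincomb P B a (%b. b))"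
			by (rule P.M.finsum_cong') (use that(3) Bc in auto)
		hence "Pr x (restrict a B)" unfolding Pr_def that(4) using that(3) by simp
		hence "co x = restrict a B" using ex[OF that(1)] Pr_co[OF that(1)] by blast
		thus ?thesis using that(2) by simp
	qed
	let ?J = "{0..<card B}"
	have gB: "g j : B" if "j : ?J" for j using bij_betwE[OF g] that by blast
	have "dual_basis Q P ?J g (%x j. co x (g j))"
	proof (rule dual_basis_finiteI[OF P])
		fix x assume x: "x : carrier P"
		have "(lincomb P (g ` ?J) (co x) (%b. b)) = (lincomb P ?J (%j. co x (g j)) g)"
			by (rule P.M.finsum_reindex) (use g coc[OF x] Bc in "auto simp: bij_betw_def")
		thus "x = (lincomb P ?J (%j. co x (g j)) g)" using co(2)[OF x] bij_betw_imp_surj_on[OF g] by simp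
		fix y j assume y: "y : carrier P" and j: "j : ?J"
		have "x \<oplus>\<^sub>P y = (lincomb P B (co x) (%b. b)) \<oplus>\<^sub>P (lincomb P B (co y) (%b. b))"
			using co(2)[OF x] co(2)[OF y] by simp
		also have "... = (\<Oplus>\<^sub>P b\<in>B. co x b \<odot>\<^sub>P b \<oplus>\<^sub>P co y b \<odot>\<^sub>P b)"
			by (rule P.M.finsum_addf[symmetric]) (use coc x y Bc in auto)
		also have "... = (lincomb P B (%b. (co x b \<oplus>\<^sub>Q co y b)) (%b. b))"
			by (rule P.M.finsum_cong') (use coc x y Bc in "auto simp: P.smult_l_distr")
		finally have e: "x \<oplus>\<^sub>P y = (lincomb P B (%b. (co x b \<oplus>\<^sub>Q co y b)) (%b. b))" .
		show "co (x \<oplus>\<^sub>P y) (g j) = co x (g j) \<oplus>\<^sub>Q co y (g j)"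
			by (rule uniq[OF _ gB[OF j] _ e]) (use coc x y in auto)
	next
		fix a x j assume a: "a : carrier Q" and x: "x : carrier P" and j: "j : ?J"
		have "a \<odot>\<^sub>P x = a \<odot>\<^sub>P (lincomb P B (co x) (%b. b))" using co(2)[OF x] by simp
		also have "... = (\<Oplus>\<^sub>P b\<in>B. a \<odot>\<^sub>P (co x b \<odot>\<^sub>P b))"
			by (rule P.finsum_smult_ldistr) (use B a coc[OF x] Bc in auto)
		also have "... = (lincomb P B (%b. (a \<otimes>\<^sub>Q co x b)) (%b. b))"
			by (rule P.M.finsum_cong') (use coc x a Bc in "auto simp: P.smult_assoc1")
		finally have e: "a \<odot>\<^sub>P x = (lincomb P B (%b. (a \<otimes>\<^sub>Q co x b)) (%b. b))" .
		show "co (a \<odot>\<^sub>P x) (g j) = a \<otimes>\<^sub>Q co x (g j)"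
			by (rule uniq[OF _ gB[OF j] _ e]) (use coc x a in auto)
	qed (use gB Bc coc in auto)
	thus ?thesis unfolding fin_dual_basis_def by blast
qed

lemma (in module) zero_submodule: "module R (M(|carrier := {\<zero>\<^sub>M}|))"
	by (rule submodule.submodule_is_module[OF submoduleI module_axioms]) auto

lemma zero_fin_dual_basis:
	fixes M :: "('q, 'l) module"
	assumes "module R M"
	shows "fin_dual_basis R (M(|carrier := {\<zero>\<^sub>M}|))"
	unfolding fin_dual_basis_def
proof (intro exI conjI)
	interpret Z: module R "M(|carrier := {\<zero>\<^sub>M}|)" by (rule module.zero_submodule[OF assms])
	show "dual_basis R (M(|carrier := {\<zero>\<^sub>M}|)) {} undefined undefined"
		by (rule dual_basis_finiteI[OF Z.module_axioms]) (auto simp: Z.M.finsum_empty)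
qed simp

text \<open>The lift of a free resolution is extended by zero to negative degrees and copied into sequences, after which it is a
system with \<open>c\<close> operators.\<close>

locale eisenbud_data = Q: cring Q for Q :: "'q ring" +
	fixes fs :: "'q list" and A :: "'q set ring" and M :: "('q set, 'm) module" and F :: "nat => ('q set, 'f) module" and d aug
		and L :: "nat => ('q, 'l) module" and \<pi> :: "nat => 'l => 'f" and D T and t :: "nat => nat => 'f => 'f"
	assumes fs_regular: "regular_sequence Q fs" and A_def: "A = Q Quot (Idl\<^bsub>Q\<^esub> (set fs))"
		and F_res: "free_resolution A M F d aug" and eis: "eisenbud_operators Q fs F d L \<pi> D T t"
begin

abbreviation "c == length fs"
abbreviation "f == (!) fs"
abbreviation "q == quot_map Q fs"

sublocale J: ideal "Idl\<^bsub>Q\<^esub> (set fs)" Q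
	by (rule Q.genideal_ideal) (use fs_regular in "simp add: regular_sequence_def")

sublocale A: cring A unfolding A_def by (rule J.quotient_is_cring[OF Q.is_cring])

lemma q_hom: "q : ring_hom Q A"
	using J.rcos_ring_hom by (simp add: A_def quot_map_def[abs_def])

lemma q_surj: "q ` carrier Q = carrier A"
	by (auto simp: A_def FactRing_def A_RCOSETS_def' quot_map_def)

lemma f_closed: "r < c ==> f r : carrier Q"
	using fs_regular nth_mem by (force simp: regular_sequence_def)

lemma q_f: "r < c ==> q (f r) = \<zero>\<^sub>A"
proof -
	assume r: "r < c"
	have "f r : Idl\<^bsub>Q\<^esub> (set fs)" using Q.genideal_self[of "set fs"] fs_regular nth_mem[OF r] by (simp add: regular_sequence_def subset_iff)
	thus ?thesis using Q.a_rcos_zero[OF J.is_ideal] by (simp add: A_def FactRing_def quot_map_def)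
qed

sublocale regular_seq Q f c
proof
	have s: "set (take k fs) = f ` {..<k}" if "k <= c" for k using nth_image[OF that] by (simp add: atLeast0LessThan)
	fix k x assume "k < c" "x : carrier Q" "f k \<otimes>\<^sub>Q x : Idl\<^bsub>Q\<^esub> (f ` {..<k})"
	thus "x : Idl\<^bsub>Q\<^esub> (f ` {..<k})"
		using fs_regular unfolding regular_sequence_def s[OF less_imp_le[OF \<open>k < c\<close>], symmetric] by blast
qed (rule f_closed)

lemma restrict_module: "module A V ==> module Q (restrict_scalars q V)"
	by (rule restrict_scalars_module[OF Q.is_cring q_hom])

lemma F_module: "module A (F n)" and M_module: "module A M"
	and d_linear: "linear_map A (F (Suc n)) (F n) (d n)" and aug_linear: "linear_map A (F 0) M aug"
	and aug_surj: "aug ` carrier (F 0) = carrier M"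
	and d_exact_0: "d 0 ` carrier (F 1) = {x : carrier (F 0). aug x = \<zero>\<^sub>M}"
	and d_exact: "d (Suc n) ` carrier (F (Suc (Suc n))) = {x : carrier (F (Suc n)). d n x = \<zero>\<^sub>(F n)}"
	using F_res by (auto simp: free_resolution_def resolution_def)

lemma L_free: "fin_free_module Q (L n)" and red: "reduction Q fs (L n) (F n) (\<pi> n)"
	and lift_D_linear: "linear_map Q (L (Suc n)) (L n) (D n)"
	and \<pi>_D: "x : carrier (L (Suc n)) ==> \<pi> n (D n x) = d n (\<pi> (Suc n) x)"
	and lift_T_linear: "r < c ==> linear_map Q (L (Suc (Suc n))) (L n) (T r n)"
	and lift_D_D: "x : carrier (L (Suc (Suc n))) ==> D n (D (Suc n) x) = (lincomb (L n) {..<c} f (%r. T r n x))"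
	and t_\<pi>: "r < c ==> x : carrier (L (Suc (Suc n))) ==> t r n (\<pi> (Suc (Suc n)) x) = \<pi> n (T r n x)"
	using eis by (auto simp: eisenbud_operators_def numeral_2_eq_2)

lemma lift_L_module: "module Q (L n)" using L_free by (simp add: fin_free_module_def)

lemma \<pi>_linear: "linear_map Q (L n) (restrict_scalars q (F n)) (\<pi> n)"
	and \<pi>_surj: "\<pi> n ` carrier (L n) = carrier (F n)"
	using red by (simp_all add: reduction_def)

lemma \<pi>_kernel: "x : carrier (L n) ==> \<pi> n x = \<zero>\<^sub>(F n) \<longleftrightarrow> x : fspan f c (L n)"
	using red[of n] unfolding reduction_def fspan_def by blast

lemma \<pi>_cases: "y : carrier (F n) ==> EX x:carrier (L n). y = \<pi> n x"
	using \<pi>_surj[of n] by blast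

lemma \<pi>_closed: "x : carrier (L n) ==> \<pi> n x : carrier (F n)" using \<pi>_surj by blast

lemma \<pi>_diff: "x : carrier (L n) ==> y : carrier (L n) ==> \<pi> n (x \<ominus>\<^sub>(L n) y) = \<zero>\<^sub>(F n) \<longleftrightarrow> \<pi> n x = \<pi> n y"
proof -
	assume x: "x : carrier (L n)" and y: "y : carrier (L n)"
	interpret V: module Q "restrict_scalars q (F n)" by (rule restrict_module[OF F_module])
	show ?thesis
		using linear_diff[OF lift_L_module V.module_axioms \<pi>_linear x y] V.M.diff_eq_zero_iff[of "\<pi> n x" "\<pi> n y"] \<pi>_closed[OF x] \<pi>_closed[OF y]
		by (simp add: restrict_scalars_simps)
qed

definition Lp :: "int => ('q, 'l) module" where "Lp i = (if 0 <= i then L (nat i) else (L 0)(|carrier := {\<zero>\<^sub>(L 0)}|))"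

definition "Lz i = const_module (Lp i)"
definition Dz :: "int => (nat => 'l) => nat => 'l" where
	"Dz i = (if 1 <= i then (%u _. D (nat i - 1) (u 0)) else (%_ _. \<zero>\<^sub>(Lp (i - 1))))"
definition Tz :: "nat => int => (nat => 'l) => nat => 'l" where
	"Tz r i = (if 2 <= i then (%u _. T r (nat i - 2) (u 0)) else (%_ _. \<zero>\<^sub>(Lp (i - 2))))"

abbreviation augz :: "(nat => 'l) => 'm" where "augz u == aug (\<pi> 0 (u 0))"

lemma Lp_nat [simp]: "Lp (int n) = L n" "Lp (1 + int n) = L (Suc n)" "Lp (2 + int n) = L (Suc (Suc n))"
	"Lp 0 = L 0" "Lp 1 = L 1" "Lp 2 = L 2"
	by (simp_all add: Lp_def nat_add_distrib)

lemma Dz_nat [simp]: "Dz (1 + int n) u = (%_. D n (u 0))" and Tz_nat [simp]: "Tz r (2 + int n) u = (%_. T r n (u 0))"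
	by (simp_all add: Dz_def Tz_def nat_add_distrib)

lemma Lp_module: "module Q (Lp i)" and Lp_dual_basis: "fin_dual_basis Q (Lp i)"
	using lift_L_module free_fin_dual_basis[OF L_free] module.zero_submodule[OF lift_L_module] zero_fin_dual_basis[OF lift_L_module]
	by (auto simp: Lp_def)

lemma Lz_module: "module Q (Lz i)" unfolding Lz_def by (rule const_module_module[OF Lp_module])

lemma Lz_carrier: "u : carrier (Lz i) \<longleftrightarrow> (EX x:carrier (Lp i). u = (%_. x))" by (auto simp: Lz_def const_module_simps)

lemma ci_system: "ci_system Q f c Lz Dz Tz (restrict_scalars q M) augz"
proof -
	have q_mod: "module Q (restrict_scalars q M)" by (rule restrict_module[OF M_module])
	have zero: "linear_map Q (Lz i) (Lz j) (%_ _. \<zero>\<^sub>(Lp j))" for i j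
		using linear_const_zero[OF Lz_module, of _ j] by (simp add: Lz_def const_module_simps(2))
	have Dl: "linear_map Q (Lz i) (Lz (i - 1)) (Dz i)" for i
	proof (cases "1 <= i")
		case True
		then obtain n where "i = 1 + int n" using zle_iff_zadd by blast
		thus ?thesis using linear_to_const[OF lift_D_linear] by (simp add: Lz_def Dz_def nat_add_distrib)
	next
		case False
		thus ?thesis using zero by (simp add: Dz_def)
	qed
	have Tl: "linear_map Q (Lz i) (Lz (i - 2)) (Tz r i)" if "r < c" for r i
	proof (cases "2 <= i")
		case True
		then obtain n where "i = 2 + int n" using zle_iff_zadd by blast
		thus ?thesis using linear_to_const[OF lift_T_linear[OF that]] by (simp add: Lz_def Tz_def nat_add_distrib)
	next
		case False
		thus ?thesis using zero by (simp add: Tz_def)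
	qed
	have DD: "Dz (i - 1) (Dz i u) = (lincomb (Lz (i - 2)) {..<c} f (%r. Tz r i u))" if u: "u : carrier (Lz i)" for i u
	proof -
		have "(lincomb (Lz (i - 2)) {..<c} f (%r. Tz r i u)) = (%_. \<Oplus>\<^sub>(Lp (i - 2))r\<in>{..<c}. f r \<odot>\<^sub>(Lp (i - 2)) Tz r i u 0)"
		proof -
			interpret V: module Q "Lp (i - 2)" by (rule Lp_module)
			have "Tz r i u 0 : carrier (Lp (i - 2))" if r: "r < c" for r
			using linear_closed[OF Tl[OF r] u] by (auto simp: Lz_carrier)
			thus ?thesis unfolding Lz_def const_module_simps(4)
			by (intro const_finsum[OF Lp_module]) (auto simp: f_closed)
		qed
		moreover have "Dz (i - 1) (Dz i u) = (%_. \<Oplus>\<^sub>(Lp (i - 2))r\<in>{..<c}. f r \<odot>\<^sub>(Lp (i - 2)) Tz r i u 0)"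
		proof (cases "2 <= i")
			case True
			then obtain n where n: "i = 2 + int n" using zle_iff_zadd by blast
			have m: "Dz (1 + int n) (Dz (1 + int (Suc n)) u) = (%_. D n (D (Suc n) (u 0)))" unfolding Dz_nat by simp
			have "u 0 : carrier (L (Suc (Suc n)))" using u n by (auto simp: Lz_carrier)
			have e: "1 + int (Suc n) = 2 + int n" "i - 1 = 1 + int n" by (simp_all add: n)
			show ?thesis using m lift_D_D[OF \<open>u 0 : carrier (L (Suc (Suc n)))\<close>] unfolding e by (simp add: n)
		next
			case False
			interpret V: module Q "Lp (i - 2)" by (rule Lp_module)
			have "(\<Oplus>\<^sub>(Lp (i - 2))r\<in>{..<c}. f r \<odot>\<^sub>(Lp (i - 2)) \<zero>\<^sub>(Lp (i - 2))) = \<zero>\<^sub>(Lp (i - 2))"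
			by (rule V.M.add.finprod_one_eqI) (auto simp: f_closed)
			thus ?thesis using False by (simp add: Dz_def Tz_def)
		qed
		ultimately show ?thesis by simp
	qed
	have span: "(%_. x) : fspan f c (Lz (int n)) \<longleftrightarrow> \<pi> n x = \<zero>\<^sub>(F n)" if "x : carrier (L n)" for x n
		using \<pi>_kernel[OF that] const_fspan[OF lift_L_module, of c f "%_. x" n] f_closed unfolding Lz_def by (auto dest: fun_cong)
	have lift: "EX v:carrier (Lz (1 + int n)). u \<ominus>\<^sub>(Lz (int n)) Dz (1 + int n) v : fspan f c (Lz (int n))"
		if u: "u : carrier (Lz (int n))" and ex: "EX w:carrier (F (Suc n)). \<pi> n (u 0) = d n w" for u n
	proof -
		obtain x where x: "x : carrier (L n)" "u = (%_. x)" using u by (auto simp: Lz_carrier)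
		obtain y where y: "y : carrier (L (Suc n))" "\<pi> n x = d n (\<pi> (Suc n) y)" using ex \<pi>_cases[of _ "Suc n"] x by auto
		have Dy: "D n y : carrier (L n)" by (rule linear_closed[OF lift_D_linear y(1)])
		have "\<pi> n (x \<ominus>\<^sub>(L n) D n y) = \<zero>\<^sub>(F n)" using \<pi>_diff[OF x(1) Dy] \<pi>_D[OF y(1)] y(2) by simp
		moreover have "x \<ominus>\<^sub>(L n) D n y : carrier (L n)"
		proof -
			interpret V: module Q "L n" by (rule lift_L_module)
			show ?thesis using x Dy by simp
		qed
		ultimately have "u \<ominus>\<^sub>(Lz (int n)) Dz (1 + int n) (%_. y) : fspan f c (Lz (int n))"
			using span const_diff[OF lift_L_module x(1) Dy] by (simp add: x(2) Lz_def)
		moreover have "(%_. y) : carrier (Lz (1 + int n))" using y(1) by (auto simp: Lz_carrier)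
		ultimately show ?thesis by blast
	qed
	show ?thesis
		unfolding ci_system_def
	proof (intro conjI allI impI ballI)
		show "fin_dual_basis Q (Lz i)" for i unfolding Lz_def by (rule const_fin_dual_basis[OF Lp_module Lp_dual_basis])
		show "carrier (Lz i) = {\<zero>\<^sub>(Lz i)}" if "i < 0" for i using that by (simp add: Lz_def Lp_def const_module_simps)
		fix i u assume i: "(0::int) < i" and u: "u : carrier (Lz i)" and Du: "Dz i u : fspan f c (Lz (i - 1))"
		obtain n where n: "i = int (Suc n)" using i zero_less_imp_eq_int by (metis gr0_implies_Suc)
		obtain x where x: "x : carrier (L (Suc n))" "u = (%_. x)" using u n by (auto simp: Lz_carrier)
		have "\<pi> n (D n x) = \<zero>\<^sub>(F n)" using Du span[OF linear_closed[OF lift_D_linear x(1)]] by (simp add: n x(2))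
		hence "d n (\<pi> (Suc n) x) = \<zero>\<^sub>(F n)" using \<pi>_D[OF x(1)] by simp
		hence "\<pi> (Suc n) x : d (Suc n) ` carrier (F (Suc (Suc n)))" unfolding d_exact using \<pi>_closed[OF x(1)] by simp
		hence "EX w:carrier (F (Suc (Suc n))). \<pi> (Suc n) (u 0) = d (Suc n) w" using x(2) by blast
		from lift[OF u[unfolded n] this] show "EX v:carrier (Lz (i + 1)). u \<ominus>\<^sub>(Lz i) Dz (i + 1) v : fspan f c (Lz i)"
			by (simp add: n add.commute)
	next
		fix r y assume "r < c" and y: "y : carrier (restrict_scalars q M)"
		interpret M: module A M by (rule M_module)
		show "f r \<odot>\<^sub>(restrict_scalars q M) y = \<zero>\<^sub>(restrict_scalars q M)"
			using y q_f[OF \<open>r < c\<close>] by (simp add: restrict_scalars_simps)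
	next
		have "linear_map Q (restrict_scalars q (F 0)) (restrict_scalars q M) aug"
			using aug_linear ring_hom_closed[OF q_hom] by (auto simp: linear_map_def restrict_scalars_simps)
		from linear_comp[OF \<pi>_linear this]
		have "linear_map Q (L 0) (restrict_scalars q M) (%x. aug (\<pi> 0 x))" .
		thus "linear_map Q (Lz 0) (restrict_scalars q M) augz"
			by (auto simp: linear_map_def Lz_def const_module_simps)
		show "augz ` carrier (Lz 0) = carrier (restrict_scalars q M)"
		proof -
			have "(%x. aug (\<pi> 0 x)) ` carrier (L 0) = aug ` \<pi> 0 ` carrier (L 0)" by (simp add: image_image)
			thus ?thesis using aug_surj \<pi>_surj[of 0] by (simp add: Lz_def const_module_simps restrict_scalars_simps image_image)
		qed
		fix v assume "v : carrier (Lz 1)"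
		then obtain y where y: "y : carrier (L (Suc 0))" "v = (%_. y)" by (auto simp: Lz_carrier)
		have "d 0 (\<pi> (Suc 0) y) : d 0 ` carrier (F 1)" using \<pi>_closed[OF y(1)] by simp
		hence "aug (d 0 (\<pi> (Suc 0) y)) = \<zero>\<^sub>M" unfolding d_exact_0 by simp
		thus "augz (Dz 1 v) = \<zero>\<^sub>(restrict_scalars q M)" using \<pi>_D[OF y(1)] y(2) by (simp add: Dz_def restrict_scalars_simps)
	next
		fix u assume u: "u : carrier (Lz 0)" and z: "augz u = \<zero>\<^sub>(restrict_scalars q M)"
		then obtain x where x: "x : carrier (L 0)" "u = (%_. x)" by (auto simp: Lz_carrier)
		have "\<pi> 0 x : d 0 ` carrier (F 1)" unfolding d_exact_0 using z x \<pi>_closed by (simp add: restrict_scalars_simps)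
		hence "EX w:carrier (F (Suc 0)). \<pi> 0 (u 0) = d 0 w" using x(2) by auto
		from lift[of u 0, OF _ this] u show "EX v:carrier (Lz 1). u \<ominus>\<^sub>(Lz 0) Dz 1 v : fspan f c (Lz 0)" by simp
	qed (use Lz_module Dl Tl DD q_mod in auto)
qed

end

section \<open>Induced operators on graded subquotients\<close>

locale graded_subquotient =
	fixes A :: "('a, 'k) ring_scheme" and H :: "'p::cancel_comm_monoid_add => ('a, 'b) module" and Z B :: "'p => 'b set"
	assumes sq: "subquotient A (H p) (Z p) (B p)"
begin

sublocale sq: subquotient A "H p" "Z p" "B p" for p by (rule sq)

abbreviation "E p == quot_module ((H p)(|carrier := Z p|)) (B p)"
abbreviation "cl p h == B p +>\<^sub>(H p) h"

lemmas cl_closed = sq.cls_closed[unfolded sq.Ex_def sq.cls_def]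
	and cl_add = sq.cls_add[unfolded sq.Ex_def sq.cls_def]
	and cl_zero = sq.cls_zero[unfolded sq.Ex_def sq.cls_def]
	and cl_eqI = sq.cls_eqI[unfolded sq.cls_def]
	and cl_cases = sq.cls_cases[unfolded sq.Ex_def sq.cls_def]
	and cl_mem = sq.cls_mem[unfolded sq.cls_def]
	and cl_self = sq.cls_self[unfolded sq.cls_def]
	and E_group = sq.Ex_group[unfolded sq.Ex_def]

sublocale Ep: abelian_group "E p" for p by (rule E_group)

lemma zero_B: "\<zero>\<^sub>(H p) : B p"
	using subgroup.one_closed[OF submodule.axioms(1)[OF sq.B]] by simp

lemma zero_Z: "\<zero>\<^sub>(H p) : Z p" using zero_B sq.B_Z by blast

lemma Z_add: "g : Z p ==> h : Z p ==> g \<oplus>\<^sub>(H p) h : Z p" by (rule sq.H.submoduleE(5)[OF sq.Z])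

lemma zero_class: "\<zero>\<^sub>(E p) = cl p \<zero>\<^sub>(H p)" using cl_zero[OF zero_B] by simp

lemma refl_B: "h : Z p ==> h \<ominus>\<^sub>(H p) h : B p"
	using sq.Z_carrier zero_B by (simp add: a_minus_def sq.H.M.r_neg)

definition operator :: "'p => ('p => 'b => 'b) => bool" where
	"operator \<xi> \<phi> \<longleftrightarrow> (ALL p. ALL h:Z p. \<phi> p h : Z (p + \<xi>)) & (ALL p. ALL h:B p. \<phi> p h : B (p + \<xi>)) &
		(ALL p. ALL g:Z p. ALL h:Z p. \<phi> p (g \<oplus>\<^sub>(H p) h) = \<phi> p g \<oplus>\<^sub>(H (p + \<xi>)) \<phi> p h)"

text \<open>Components in degrees that are not of the form \<open>p' + \<xi>\<close> are zero; in the others the union over all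
representatives is a single coset.\<close>

definition induced :: "'p => ('p => 'b => 'b) => ('p => 'b set) => 'p => 'b set" where
	"induced \<xi> \<phi> e p = (if (EX p'. p = p' + \<xi>) then \<Union>h\<in>e (p - \<xi>). cl p (\<phi> (p - \<xi>) h) else \<zero>\<^sub>(E p))"

lemma operatorD:
	assumes "operator \<xi> \<phi>"
	shows "h : Z p ==> \<phi> p h : Z (p + \<xi>)" "h : B p ==> \<phi> p h : B (p + \<xi>)"
		"g : Z p ==> h : Z p ==> \<phi> p (g \<oplus>\<^sub>(H p) h) = \<phi> p g \<oplus>\<^sub>(H (p + \<xi>)) \<phi> p h"
	using assms by (auto simp: operator_def)

lemma induced_low: "\<not> (EX p'. p = p' + \<xi>) ==> induced \<xi> \<phi> e p = \<zero>\<^sub>(E p)"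
	by (auto simp: induced_def)

lemma induced_class:
	assumes \<phi>: "operator \<xi> \<phi>" and h: "h : Z p" and e: "e p = cl p h"
	shows "induced \<xi> \<phi> e (p + \<xi>) = cl (p + \<xi>) (\<phi> p h)"
proof -
	have "cl (p + \<xi>) (\<phi> p g) = cl (p + \<xi>) (\<phi> p h)" if "g : cl p h" for g
	proof (rule cl_eqI)
		have g: "g : Z p" "g \<ominus>\<^sub>(H p) h : B p" using cl_mem[OF h that] by auto
		show Zs: "\<phi> p g : Z (p + \<xi>)" "\<phi> p h : Z (p + \<xi>)" using operatorD(1)[OF \<phi>] g h by auto
		have c: "\<phi> p (g \<ominus>\<^sub>(H p) h) : carrier (H (p + \<xi>))"
			using operatorD(2)[OF \<phi> g(2)] sq.B_Z sq.Z_carrier by blast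
		have "g = (g \<ominus>\<^sub>(H p) h) \<oplus>\<^sub>(H p) h"
			using sq.Z_carrier g h by (simp add: a_minus_def sq.H.M.a_assoc sq.H.M.l_neg)
		hence "\<phi> p g = \<phi> p (g \<ominus>\<^sub>(H p) h) \<oplus>\<^sub>(H (p + \<xi>)) \<phi> p h"
			using operatorD(3)[OF \<phi> subsetD[OF sq.B_Z g(2)] h] by simp
		hence "\<phi> p g \<ominus>\<^sub>(H (p + \<xi>)) \<phi> p h = \<phi> p (g \<ominus>\<^sub>(H p) h)"
			using c sq.Z_carrier[OF Zs(2)] by (simp add: a_minus_def sq.H.M.a_assoc sq.H.M.r_neg)
		thus "\<phi> p g \<ominus>\<^sub>(H (p + \<xi>)) \<phi> p h : B (p + \<xi>)" using operatorD(2)[OF \<phi> g(2)] by simp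
	qed
	moreover have "h : cl p h" by (rule cl_self[OF h])
	ultimately have "(\<Union>g\<in>cl p h. cl (p + \<xi>) (\<phi> p g)) = cl (p + \<xi>) (\<phi> p h)" by blast
	thus ?thesis by (simp add: induced_def e)
qed

lemma component_cases: "e : carrier (direct_sum E) ==> EX h:Z p. e p = cl p h"
	by (rule cl_cases) (simp add: direct_sum_simps)

lemma induced_eqI:
	assumes "!!p. induced \<xi> \<phi> e (p + \<xi>) = e' (p + \<xi>)"
		and "!!p. \<not> (EX p'. p = p' + \<xi>) ==> e' p = \<zero>\<^sub>(E p)"
	shows "induced \<xi> \<phi> e = e'"
proof
	fix p
	show "induced \<xi> \<phi> e p = e' p" using assms induced_low[of p \<xi> \<phi> e] by (cases "EX p'. p = p' + \<xi>") auto
qed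

lemma induced_zero:
	assumes "operator \<xi> \<phi>" "e p = \<zero>\<^sub>(E p)"
	shows "induced \<xi> \<phi> e (p + \<xi>) = \<zero>\<^sub>(E (p + \<xi>))"
	using induced_class[where e = e, OF assms(1) zero_Z] assms(2) cl_zero[OF operatorD(2)[OF assms(1) zero_B]] by (simp add: zero_class)

lemma induced_closed:
	assumes \<phi>: "operator \<xi> \<phi>" and e: "e : carrier (direct_sum E)"
	shows "induced \<xi> \<phi> e : carrier (direct_sum E)"
proof -
	have "induced \<xi> \<phi> e p : carrier (E p)" for p
	proof (cases "EX p'. p = p' + \<xi>")
		case True
		then obtain p' where p: "p = p' + \<xi>" by blast
		obtain h where h: "h : Z p'" "e p' = cl p' h" using component_cases[OF e] by blast
		show ?thesis unfolding p induced_class[where e = e, OF \<phi> h] by (rule cl_closed[OF operatorD(1)[OF \<phi> h(1)]])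
	qed (simp add: induced_low)
	moreover have "{p. induced \<xi> \<phi> e p ~= \<zero>\<^sub>(E p)} <= (%p. p + \<xi>) ` {p. e p ~= \<zero>\<^sub>(E p)}"
	proof
		fix p assume p: "p : {p. induced \<xi> \<phi> e p ~= \<zero>\<^sub>(E p)}"
		then obtain p' where "p = p' + \<xi>" using induced_low by blast
		thus "p : (%p. p + \<xi>) ` {p. e p ~= \<zero>\<^sub>(E p)}" using p induced_zero[where e = e, OF \<phi>] by blast
	qed
	hence "finite {p. induced \<xi> \<phi> e p ~= \<zero>\<^sub>(E p)}" by (rule finite_subset) (use e in "simp add: direct_sum_simps")
	ultimately show ?thesis by (simp add: direct_sum_simps)
qed

lemma induced_add:
	assumes \<phi>: "operator \<xi> \<phi>" and e: "e : carrier (direct_sum E)" "e' : carrier (direct_sum E)"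
	shows "induced \<xi> \<phi> (e \<oplus>\<^sub>(direct_sum E) e') = induced \<xi> \<phi> e \<oplus>\<^sub>(direct_sum E) induced \<xi> \<phi> e'"
proof (rule induced_eqI)
	fix p
	obtain h where h: "h : Z p" "e p = cl p h" using component_cases[OF e(1)] by blast
	obtain h' where h': "h' : Z p" "e' p = cl p h'" using component_cases[OF e(2)] by blast
	have "(e \<oplus>\<^sub>(direct_sum E) e') p = cl p (h \<oplus>\<^sub>(H p) h')" using h h' by (simp add: direct_sum_simps cl_add)
	from induced_class[where e = "e \<oplus>\<^sub>(direct_sum E) e'", OF \<phi> Z_add[OF h(1) h'(1)] this]
	show "induced \<xi> \<phi> (e \<oplus>\<^sub>(direct_sum E) e') (p + \<xi>) = (induced \<xi> \<phi> e \<oplus>\<^sub>(direct_sum E) induced \<xi> \<phi> e') (p + \<xi>)"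
		using h h' operatorD[OF \<phi>] by (simp add: direct_sum_simps induced_class[where e = e, OF \<phi> h] induced_class[where e = e', OF \<phi> h'] cl_add)
qed (simp add: direct_sum_simps induced_low)

lemma induced_add_operator:
	assumes op: "operator \<xi> \<phi>" "operator \<xi> \<psi>" "operator \<xi> \<chi>" and e: "e : carrier (direct_sum E)"
		and s: "!!p h. h : Z p ==> \<chi> p h = \<phi> p h \<oplus>\<^sub>(H (p + \<xi>)) \<psi> p h"
	shows "induced \<xi> \<chi> e = induced \<xi> \<phi> e \<oplus>\<^sub>(direct_sum E) induced \<xi> \<psi> e"
proof (rule induced_eqI)
	fix p
	obtain h where h: "h : Z p" "e p = cl p h" using component_cases[OF e] by blast
	show "induced \<xi> \<chi> e (p + \<xi>) = (induced \<xi> \<phi> e \<oplus>\<^sub>(direct_sum E) induced \<xi> \<psi> e) (p + \<xi>)"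
		using operatorD(1)[OF op(1) h(1)] operatorD(1)[OF op(2) h(1)]
		by (simp add: direct_sum_simps induced_class[where e = e, OF op(1) h] induced_class[where e = e, OF op(2) h] induced_class[where e = e, OF op(3) h] s[OF h(1)] cl_add)
qed (simp add: direct_sum_simps induced_low)

lemma induced_comp:
	assumes op: "operator \<xi> \<phi>" "operator \<xi>' \<psi>" "operator \<rho> \<chi>" and \<rho>: "\<rho> = \<xi> + \<xi>'" and e: "e : carrier (direct_sum E)"
		and c: "!!p h. h : Z p ==> \<chi> p h \<ominus>\<^sub>(H (p + \<rho>)) \<phi> (p + \<xi>') (\<psi> p h) : B (p + \<rho>)"
	shows "induced \<rho> \<chi> e = induced \<xi> \<phi> (induced \<xi>' \<psi> e)"
proof (rule induced_eqI)
	fix p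
	obtain h where h: "h : Z p" "e p = cl p h" using component_cases[OF e] by blast
	have s: "p + \<xi>' + \<xi> = p + \<rho>" by (simp add: \<rho> ac_simps)
	have "induced \<xi> \<phi> (induced \<xi>' \<psi> e) (p + \<xi>' + \<xi>) = cl (p + \<xi>' + \<xi>) (\<phi> (p + \<xi>') (\<psi> p h))"
		by (rule induced_class[where e = "induced \<xi>' \<psi> e", OF op(1) operatorD(1)[OF op(2) h(1)] induced_class[where e = e, OF op(2) h]])
	moreover have "cl (p + \<rho>) (\<chi> p h) = cl (p + \<rho>) (\<phi> (p + \<xi>') (\<psi> p h))"
		by (rule cl_eqI[OF operatorD(1)[OF op(3) h(1)] _ c[OF h(1)]])
			(use operatorD(1)[OF op(1) operatorD(1)[OF op(2) h(1)]] s in simp)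
	ultimately show "induced \<rho> \<chi> e (p + \<rho>) = induced \<xi> \<phi> (induced \<xi>' \<psi> e) (p + \<rho>)"
		unfolding s by (simp add: induced_class[where e = e, OF op(3) h])
next
	fix p assume low: "\<not> (EX p'. p = p' + \<rho>)"
	show "induced \<xi> \<phi> (induced \<xi>' \<psi> e) p = \<zero>\<^sub>(E p)"
	proof (cases "EX p'. p = p' + \<xi>")
		case True
		then obtain p' where p: "p = p' + \<xi>" by blast
		have "\<not> (EX p''. p' = p'' + \<xi>')" using low by (auto simp: \<rho> p add.assoc add.commute[of \<xi>])
		thus ?thesis unfolding p by (intro induced_zero[OF op(1)] induced_low)
	qed (simp add: induced_low)
qed

lemma induced_id:
	assumes "operator 0 \<phi>" "e : carrier (direct_sum E)" "!!p h. h : Z p ==> \<phi> p h = h"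
	shows "induced 0 \<phi> e = e"
proof (rule induced_eqI)
	fix p
	obtain h where h: "h : Z p" "e p = cl p h" using component_cases[OF assms(2)] by blast
	show "induced 0 \<phi> e (p + 0) = e (p + 0)" unfolding induced_class[where e = e, OF assms(1) h] using h assms(3) by simp
qed simp

lemma induced_single:
	assumes \<phi>: "operator \<xi> \<phi>" and h: "h : Z p"
	shows "induced \<xi> \<phi> (single E p (cl p h)) = single E (p + \<xi>) (cl (p + \<xi>) (\<phi> p h))"
proof (rule induced_eqI)
	fix p'
	show "induced \<xi> \<phi> (single E p (cl p h)) (p' + \<xi>) = single E (p + \<xi>) (cl (p + \<xi>) (\<phi> p h)) (p' + \<xi>)"
	proof (cases "p' = p")
		case True
		show ?thesis unfolding True by (subst induced_class[where e = "single E p (cl p h)", OF \<phi> h]) (simp_all add: single_def)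
	next
		case False
		thus ?thesis using induced_zero[OF \<phi>, of "single E p (cl p h)" p'] by (simp add: single_def)
	qed
next
	fix p' assume "\<not> (EX p''. p' = p'' + \<xi>)"
	hence "p' ~= p + \<xi>" by auto
	thus "single E (p + \<xi>) (cl (p + \<xi>) (\<phi> p h)) p' = \<zero>\<^sub>(E p')" by (simp add: single_def)
qed

lemma direct_sum_spanned:
	assumes Y: "additive_subgroup Y S" and S: "carrier S = carrier (direct_sum E)" "\<zero>\<^sub>S = \<zero>\<^sub>(direct_sum E)" "add S = add (direct_sum E)"
		and single: "!!p h. h : Z p ==> single E p (cl p h) : Y" and e: "e : carrier (direct_sum E)"
	shows "e : Y"
proof -
	have "e : Y" if "finite K" "e : carrier (direct_sum E)" "{p. e p ~= \<zero>\<^sub>(E p)} <= K" for K e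
		using that
	proof (induct K arbitrary: e rule: finite_induct)
		case empty
		hence "e = \<zero>\<^sub>S" by (auto simp: S direct_sum_simps)
		thus ?case using additive_subgroup.zero_closed[OF Y] by simp
	next
		case (insert p K)
		let ?e = "e(p := \<zero>\<^sub>(E p))"
		have ec: "e p' : carrier (E p')" for p' using insert(4) by (simp add: direct_sum_simps)
		have "{p'. ?e p' ~= \<zero>\<^sub>(E p')} <= K" using insert(5) by (auto split: if_splits)
		moreover from this have "?e : carrier (direct_sum E)"
			using ec finite_subset[OF _ insert(1)] by (simp add: direct_sum_simps)
		ultimately have "?e : Y" by (rule insert(3)[rotated])
		obtain h where h: "h : Z p" "e p = cl p h" using component_cases[OF insert(4)] by blast
		have "e = single E p (cl p h) \<oplus>\<^sub>S ?e"
		proof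
			fix p'
			show "e p' = (single E p (cl p h) \<oplus>\<^sub>S ?e) p'"
			using ec h(2) cl_closed[OF h(1)] by (cases "p' = p") (simp_all add: S direct_sum_simps single_def Ep.r_zero Ep.l_zero)
		qed
		thus ?case using additive_subgroup.a_closed[OF Y single[OF h(1)] \<open>?e : Y\<close>] by simp
	qed
	from this[OF _ e order_refl] show ?thesis using e by (simp add: direct_sum_simps)
qed

end

section \<open>Ext over the quotient ring as cohomology over the base ring\<close>

locale eisenbud_ext = eisenbud_data Q fs A M F d aug L \<pi> D T t + rees_module_over A I N Ng Q "quot_map Q fs"
	for Q :: "'q ring" and fs and A :: "'q set ring" and M :: "('q set, 'm) module" and F :: "nat => ('q set, 'f) module" and d aug
		and L :: "nat => ('q, 'l) module" and \<pi> D T t and I and N :: "(nat => 'q set, 'n) module" and Ng +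
	fixes W :: "'q set"
	assumes W_finite: "finite W" and W_carrier: "W <= carrier Q" and W_generates: "{z : carrier Q. q z : I} = Idl\<^bsub>Q\<^esub> W"
begin

lemma W_I: "w : W ==> q w : I"
	using Q.genideal_self[OF W_carrier] W_generates by blast

sublocale ci_coeff Q f c NQ "mult_op ` W"
proof (intro ci_coeff.intro ci_coeff_axioms.intro)
	fix r y n assume "r < c" "y : carrier (NQ n)"
	thus "f r \<odot>\<^sub>(NQ n) y = \<zero>\<^sub>(NQ n)"
		using Ng_carrier[of y n] by (simp add: NQ_simps q_f nact_def R_simps[symmetric])
next
	fix s \<phi> n assume "(s, \<phi>) : mult_op ` W"
	thus "linear_map Q (NQ n) (NQ (n + s)) (\<phi> n)" using mult_op_linear W_I by (auto simp: mult_op_def)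
next
	fix s \<phi> r \<psi> y n assume "(s, \<phi>) : mult_op ` W" "(r, \<psi>) : mult_op ` W" "y : carrier (NQ n)"
	thus "\<phi> (n + r) (\<psi> n y) = \<psi> (n + s) (\<phi> n y)"
		using W_I by (auto simp: mult_op_def NQ_simps intro!: nact_commute)
qed (use regular_seq_axioms Q_noetherian NQ_module W_finite coefficients_noetherian[OF W_finite W_carrier W_generates] in simp_all)

sublocale ci_cochain Q f c NQ "mult_op ` W" c Lz Dz Tz "restrict_scalars q M" augz
	by unfold_locales (use ci_system in auto)

abbreviation "H i n == hom_module A (F i) (NA n)"
abbreviation "ZF i n == cocycles A F d (NA n) i"
abbreviation "BF i n == coboundaries A F d (NA n) i"

lemma H_carrier: "h : carrier (H i n) \<longleftrightarrow> h : extensional (carrier (F i)) & linear_map A (F i) (NA n) h"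
	by (simp add: hom_module_simps)

lemma H_module: "module A (H i n)" by (rule hom_module_is_module[OF F_module NA_module])

lemma ZF_iff: "h : ZF i n \<longleftrightarrow> h : carrier (H i n) & (ALL x:carrier (F (Suc i)). h (d i x) = \<zero>\<^sub>N)"
	by (simp add: cocycles_def NA_simps)

lemma H_linear: "h : carrier (H i n) ==> linear_map A (F i) (NA n) h" by (simp add: H_carrier)

lemma H_closed: "h : carrier (H i n) ==> x : carrier (F i) ==> h x : Ng n"
	using linear_closed[OF H_linear] by (simp add: NA_simps)

lemma d_closed: "x : carrier (F (Suc i)) ==> d i x : carrier (F i)" by (rule linear_closed[OF d_linear])

text \<open>Composition with the reduction identifies cochains over \<open>A\<close> with cochains over \<open>Q\<close>. It is onto because a map
into a module annihilated by the sequence factors through the reduction.\<close>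

definition \<Xi> :: "nat => ('f => 'n) => (nat => 'l) => 'n" where
	"\<Xi> i h = (\<lambda>u\<in>carrier (Lz (int i)). h (\<pi> i (u 0)))"

lemma Lz_elem: "u : carrier (Lz (int i)) \<longleftrightarrow> (EX x:carrier (L i). u = (%_. x))"
	by (simp add: Lz_carrier)

lemma \<Xi>_app: "x : carrier (L i) ==> \<Xi> i h (%_. x) = h (\<pi> i x)"
	unfolding \<Xi>_def by (subst restrict_apply') (auto simp: Lz_elem)

lemma \<Xi>_closed: "h : carrier (H i n) ==> \<Xi> i h : carrier (K (int i, n))"
proof -
	assume h: "h : carrier (H i n)"
	have "linear_map Q (restrict_scalars q (F i)) (NQ n) h"
		using H_linear[OF h] ring_hom_closed[OF q_hom] by (auto simp: linear_map_def restrict_scalars_simps)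
	from linear_comp[OF \<pi>_linear this] have "linear_map Q (L i) (NQ n) (%x. h (\<pi> i x))" .
	hence "linear_map Q (Lz (int i)) (NQ n) (%u. h (\<pi> i (u 0)))"
		by (auto simp: linear_map_def Lz_def const_module_simps)
	thus ?thesis unfolding cochain_carrier \<Xi>_def using linear_restrict[OF Lz_module] by simp
qed

lemma \<Xi>_inj:
	assumes "g : carrier (H i n)" "h : carrier (H i n)" "\<Xi> i g = \<Xi> i h"
	shows "g = h"
proof (rule extensionalityI)
	show "g : extensional (carrier (F i))" "h : extensional (carrier (F i))" using assms by (auto simp: H_carrier)
	fix y assume "y : carrier (F i)"
	then obtain x where x: "x : carrier (L i)" "y = \<pi> i x" using \<pi>_cases by blast
	show "g y = h y" using fun_cong[OF assms(3), of "%_. x"] \<Xi>_app[OF x(1)] x(2) by simp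
qed

lemma \<Xi>_surj:
	assumes g: "g : carrier (K (int i, n))"
	obtains h where "h : carrier (H i n)" "g = \<Xi> i h"
proof -
	have gl: "linear_map Q (Lz (int i)) (NQ n) g" and ge: "g : extensional (carrier (Lz (int i)))"
		using g by (auto simp: cochain_carrier)
	have c_L: "linear_map Q (L i) (Lz (int i)) (%x _. x)" by (rule linear_mapI) (auto simp: Lz_def const_module_simps)
	define g' where "g' x = g (%_. x)" for x
	have g': "linear_map Q (L i) (NQ n) g'" unfolding g'_def by (rule linear_comp[OF c_L gl])
	interpret Li: module Q "L i" by (rule lift_L_module)
	interpret Nn: module Q "NQ n" by (rule NQ_module)
	have factor: "g' x = g' x'" if x: "x : carrier (L i)" "x' : carrier (L i)" "\<pi> i x = \<pi> i x'" for x x'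
	proof -
		have "x \<ominus>\<^sub>(L i) x' : fspan f c (L i)" using \<pi>_diff[OF x(1,2)] x \<pi>_kernel by simp
		from linear_kills_fspan[OF lift_L_module g' order_refl this]
		have "g' x \<ominus>\<^sub>(NQ n) g' x' = \<zero>\<^sub>(NQ n)" using linear_diff[OF lift_L_module NQ_module g' x(1,2)] by simp
		thus ?thesis
			using Nn.M.diff_eq_zero_iff[OF linear_closed[OF g' x(1)] linear_closed[OF g' x(2)]] by simp
	qed
	define s where "s y = (SOME x. x : carrier (L i) & \<pi> i x = y)" for y
	have s: "s y : carrier (L i)" "\<pi> i (s y) = y" if "y : carrier (F i)" for y
		using someI_ex[of "%x. x : carrier (L i) & \<pi> i x = y"] \<pi>_cases[OF that] unfolding s_def by auto
	define h where "h = (\<lambda>y\<in>carrier (F i). g' (s y))"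
	have h_\<pi>: "h (\<pi> i x) = g' x" if x: "x : carrier (L i)" for x
		using factor[OF s(1) x s(2)] \<pi>_closed[OF x] by (simp add: h_def)
	interpret Fi: module Q "restrict_scalars q (F i)" by (rule restrict_module[OF F_module])
	have hl: "linear_map A (F i) (NA n) h"
	proof (rule linear_mapI)
		fix y assume "y : carrier (F i)"
		then obtain x where x: "x : carrier (L i)" "y = \<pi> i x" using \<pi>_cases by blast
		show "h y : carrier (NA n)" using linear_closed[OF g' x(1)] by (simp add: x(2) h_\<pi>[OF x(1)] NQ_simps)
		{ fix y' assume "y' : carrier (F i)"
			then obtain x' where x': "x' : carrier (L i)" "y' = \<pi> i x'" using \<pi>_cases by blast
			show "h (y \<oplus>\<^sub>(F i) y') = h y \<oplus>\<^sub>(NA n) h y'"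
			using linear_add[OF \<pi>_linear x(1) x'(1)] linear_add[OF g' x(1) x'(1)] h_\<pi>[of "x \<oplus>\<^sub>(L i) x'"] x x'
			by (simp add: h_\<pi> restrict_scalars_simps) }
		fix a assume "a : carrier A"
		hence "a : q ` carrier Q" using q_surj by simp
		then obtain r where r: "r : carrier Q" "a = q r" by blast
		show "h (a \<odot>\<^sub>(F i) y) = a \<odot>\<^sub>(NA n) h y"
			using linear_smult[OF \<pi>_linear r(1) x(1)] linear_smult[OF g' r(1) x(1)] h_\<pi>[of "r \<odot>\<^sub>(L i) x"] x r
			by (simp add: h_\<pi> restrict_scalars_simps)
	qed
	have "g = \<Xi> i h"
	proof (rule extensionalityI[OF ge])
		show "\<Xi> i h : extensional (carrier (Lz (int i)))" by (simp add: \<Xi>_def)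
		fix u assume "u : carrier (Lz (int i))"
		then obtain x where x: "x : carrier (L i)" "u = (%_. x)" by (auto simp: Lz_elem)
		show "g u = \<Xi> i h u" using h_\<pi>[OF x(1)] \<Xi>_app[OF x(1)] by (simp add: x(2) g'_def)
	qed
	moreover have "h : carrier (H i n)" unfolding H_carrier using hl by (simp add: h_def)
	ultimately show ?thesis using that by blast
qed

lemma K_eqI:
	assumes "g : extensional (carrier (Lz (int i)))" "h : extensional (carrier (Lz (int i)))"
		"!!x. x : carrier (L i) ==> g (%_. x) = h (%_. x)"
	shows "g = h"
	by (rule extensionalityI[OF assms(1,2)]) (auto simp: Lz_elem assms(3))

lemma \<Xi>_ext: "\<Xi> i h : extensional (carrier (Lz (int i)))" by (simp add: \<Xi>_def)

lemma \<Xi>_add: "g : carrier (H i n) ==> h : carrier (H i n) ==> \<Xi> i (g \<oplus>\<^sub>(H i n) h) = \<Xi> i g \<oplus>\<^sub>(K (int i, n)) \<Xi> i h"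
	by (rule K_eqI[OF \<Xi>_ext]) (auto simp: cochain_simps \<Xi>_app hom_module_simps \<pi>_closed Lz_elem NQ_simps)

lemma \<Xi>_smult: "r : carrier Q ==> h : carrier (H i n) ==> \<Xi> i (\<lambda>x\<in>carrier (F i). nact (q r) 0 (h x)) = r \<odot>\<^sub>(K (int i, n)) \<Xi> i h"
	by (rule K_eqI[OF \<Xi>_ext]) (auto simp: cochain_simps \<Xi>_app \<pi>_closed Lz_elem NQ_simps)

lemma \<Xi>_zero: "\<Xi> i \<zero>\<^sub>(H i n) = \<zero>\<^sub>(K (int i, n))"
	by (rule K_eqI[OF \<Xi>_ext]) (auto simp: cochain_simps \<Xi>_app hom_module_simps \<pi>_closed Lz_elem NQ_simps)

lemma \<Xi>_diff:
	assumes "g : carrier (H i n)" "h : carrier (H i n)"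
	shows "\<Xi> i (g \<ominus>\<^sub>(H i n) h) = \<Xi> i g \<ominus>\<^sub>(K (int i, n)) \<Xi> i h"
proof -
	interpret H: module A "H i n" by (rule H_module)
	interpret Kn: module Q "K (int i, n)" by (rule K.G_module)
	have "\<Xi> i g = \<Xi> i ((g \<ominus>\<^sub>(H i n) h) \<oplus>\<^sub>(H i n) h)" using assms by (simp add: a_minus_def H.M.a_assoc H.M.l_neg)
	also have "... = \<Xi> i (g \<ominus>\<^sub>(H i n) h) \<oplus>\<^sub>(K (int i, n)) \<Xi> i h" using assms by (intro \<Xi>_add) auto
	finally show ?thesis
		using \<Xi>_closed[OF assms(2)] \<Xi>_closed[of "g \<ominus>\<^sub>(H i n) h" i n] assms by (simp add: a_minus_def Kn.M.a_assoc Kn.M.r_neg)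
qed

lemma \<Xi>_cocycle: "h : carrier (H i n) ==> \<Xi> i h : Z (int i, n) \<longleftrightarrow> h : ZF i n"
proof -
	assume h: "h : carrier (H i n)"
	have e: "u : carrier (Lz (int i + 1)) \<longleftrightarrow> (EX x:carrier (L (Suc i)). u = (%_. x))" "Dz (int i + 1) (%_. x) = (%_. D i x)" for u x
		using Dz_nat[of i] by (simp_all add: Lz_carrier add.commute[of _ 1])
	have ball: "(ALL u:carrier (Lz (int i + 1)). Pr u) \<longleftrightarrow> (ALL x:carrier (L (Suc i)). Pr (%_. x))" for Pr
		unfolding Ball_def e(1) by auto
	have "\<Xi> i h : Z (int i, n) \<longleftrightarrow> (ALL x:carrier (L (Suc i)). h (d i (\<pi> (Suc i) x)) = \<zero>\<^sub>N)"
		using \<Xi>_closed[OF h] by (simp add: cocycle_def ball e(2) \<Xi>_app linear_closed[OF lift_D_linear] \<pi>_D NQ_simps)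
	also have "... \<longleftrightarrow> h : ZF i n" unfolding ZF_iff using h \<pi>_cases \<pi>_closed by (metis (no_types, lifting))
	finally show ?thesis .
qed

text \<open>In degree zero both sides say that the cochain vanishes; there the lifted differential is zero.\<close>

lemma \<Xi>_coboundary: "h : carrier (H i n) ==> \<Xi> i h : B (int i, n) \<longleftrightarrow> h : BF i n"
proof (cases i)
	case 0
	assume h: "h : carrier (H i n)"
	have z: "g = \<zero>\<^sub>(K (int i, n))" if g: "g : B (int i, n)" for g
	proof -
		obtain a where a: "linear_map Q (Lz (int i - 1)) (NQ n) a" "g = (\<lambda>x\<in>carrier (Lz (int i)). a (Dz (int i) x))"
			using g by (auto simp: coboundary_def)
		have "a (Dz (int i) u) = \<zero>\<^sub>(NQ n)" for u
			using linear_zero[OF Lz_module NQ_module a(1)] 0 by (simp add: Dz_def Lz_def const_module_simps)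
		thus ?thesis by (simp add: a(2) cochain_simps)
	qed
	have "\<Xi> i h : B (int i, n) \<longleftrightarrow> \<Xi> i h = \<zero>\<^sub>(K (int i, n))"
		by (rule iffI, erule z, simp only: K.closedD(2)[OF B_closed])
	also have "... \<longleftrightarrow> h = \<zero>\<^sub>(H i n)"
	proof -
		interpret H: module A "H i n" by (rule H_module)
		show ?thesis using \<Xi>_inj[OF h H.M.zero_closed] \<Xi>_zero by metis
	qed
	finally show ?thesis using 0 by simp
next
	case (Suc j)
	assume h: "h : carrier (H i n)"
	have e: "int i - 1 = int j" "Dz (int i) (%_. x) = (%_. D j x)" for x using Dz_nat[of j] Suc by simp_all
	have pull: "\<Xi> i (\<lambda>x\<in>carrier (F i). k (d j x)) = (\<lambda>u\<in>carrier (Lz (int i)). \<Xi> j k (Dz (int i) u))" for k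
		by (rule K_eqI[OF \<Xi>_ext]) (auto simp: Suc \<Xi>_app e(2)[unfolded Suc] \<pi>_closed \<pi>_D linear_closed[OF lift_D_linear] Lz_carrier)
	show ?thesis
	proof
		assume "\<Xi> i h : B (int i, n)"
		then obtain a where a: "linear_map Q (Lz (int j)) (NQ n) a" "\<Xi> i h = (\<lambda>u\<in>carrier (Lz (int i)). a (Dz (int i) u))"
			by (auto simp: coboundary_def e(1))
		have "(\<lambda>u\<in>carrier (Lz (int j)). a u) : carrier (K (int j, n))"
			using linear_restrict[OF Lz_module a(1)] by (simp add: cochain_carrier)
		then obtain k where k: "k : carrier (H j n)" "(\<lambda>u\<in>carrier (Lz (int j)). a u) = \<Xi> j k" by (rule \<Xi>_surj)
		have "\<Xi> i h = \<Xi> i (\<lambda>x\<in>carrier (F i). k (d j x))"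
			unfolding pull a(2) k(2)[symmetric]
			using linear_closed[OF D_linear[of "int i"]] by (auto simp: e(1) intro!: restrict_ext)
		moreover have "(\<lambda>x\<in>carrier (F i). k (d j x)) : carrier (H i n)"
			unfolding H_carrier Suc using linear_restrict[OF F_module linear_comp[OF d_linear H_linear[OF k(1)]]] by simp
		ultimately have "h = (\<lambda>x\<in>carrier (F i). k (d j x))" by (rule \<Xi>_inj[OF h, rotated])
		thus "h : BF i n" using k(1) by (simp add: Suc)
	next
		assume "h : BF i n"
		then obtain k where k: "k : carrier (H j n)" "h = (\<lambda>x\<in>carrier (F i). k (d j x))" by (auto simp: Suc)
		have "linear_map Q (Lz (int j)) (NQ n) (\<Xi> j k)" using \<Xi>_closed[OF k(1)] by (simp add: cochain_carrier)
		thus "\<Xi> i h : B (int i, n)" unfolding k(2) pull by (auto simp: coboundary_def e(1))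
	qed
qed

definition tpull :: "nat => nat \<times> nat => ('f => 'n) => 'f => 'n" where
	"tpull r = (%(i, n) h. \<lambda>x\<in>carrier (F (i + 2)). h (t r i x))"

definition mact :: "'q set => nat => nat \<times> nat => ('f => 'n) => 'f => 'n" where
	"mact x s = (%(i, n) h. \<lambda>y\<in>carrier (F i). nact x s (h y))"

lemma t_linear:
	assumes r: "r < c"
	shows "linear_map A (F (Suc (Suc i))) (F i) (t r i)"
proof (rule linear_mapI)
	fix y assume "y : carrier (F (Suc (Suc i)))"
	then obtain x where x: "x : carrier (L (Suc (Suc i)))" "y = \<pi> (Suc (Suc i)) x" using \<pi>_cases by blast
	interpret L2: module Q "L (Suc (Suc i))" by (rule lift_L_module)
	note Tl = lift_T_linear[OF r, of i]
	show "t r i y : carrier (F i)" using t_\<pi>[OF r x(1)] linear_closed[OF Tl x(1)] \<pi>_closed by (simp add: x(2))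
	{ fix y' assume "y' : carrier (F (Suc (Suc i)))"
		then obtain x' where x': "x' : carrier (L (Suc (Suc i)))" "y' = \<pi> (Suc (Suc i)) x'" using \<pi>_cases by blast
		show "t r i (y \<oplus>\<^sub>(F (Suc (Suc i))) y') = t r i y \<oplus>\<^sub>(F i) t r i y'"
			using linear_add[OF \<pi>_linear x(1) x'(1)] linear_add[OF Tl x(1) x'(1)] t_\<pi>[OF r, of "x \<oplus>\<^sub>(L (Suc (Suc i))) x'" i]
			linear_add[OF \<pi>_linear linear_closed[OF Tl x(1)] linear_closed[OF Tl x'(1)]] x x'
			by (simp add: t_\<pi>[OF r] restrict_scalars_simps) }
	fix a assume "a : carrier A"
	hence "a : q ` carrier Q" using q_surj by simp
	then obtain z where z: "z : carrier Q" "a = q z" by blast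
	show "t r i (a \<odot>\<^sub>(F (Suc (Suc i))) y) = a \<odot>\<^sub>(F i) t r i y"
		using linear_smult[OF \<pi>_linear z(1) x(1)] linear_smult[OF Tl z(1) x(1)] t_\<pi>[OF r, of "z \<odot>\<^sub>(L (Suc (Suc i))) x" i]
			linear_smult[OF \<pi>_linear z(1) linear_closed[OF Tl x(1)]] x z
		by (simp add: t_\<pi>[OF r] restrict_scalars_simps)
qed

lemma tpull_closed: "r < c ==> h : carrier (H i n) ==> tpull r (i, n) h : carrier (H (i + 2) n)"
	using linear_restrict[OF F_module linear_comp[OF t_linear H_linear]] by (simp add: H_carrier tpull_def)

lemma \<Xi>_tpull:
	assumes "r < c"
	shows "\<Xi> (i + 2) (tpull r (i, n) h) = (\<lambda>u\<in>carrier (Lz (int i + 2)). \<Xi> i h (Tz r (int i + 2) u))"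
proof (rule K_eqI[OF \<Xi>_ext])
	show "(\<lambda>u\<in>carrier (Lz (int i + 2)). \<Xi> i h (Tz r (int i + 2) u)) : extensional (carrier (Lz (int (i + 2))))"
		by (simp only: of_nat_add of_nat_numeral restrict_extensional)
	fix x assume x: "x : carrier (L (i + 2))"
	have "(%_. x) : carrier (Lz (int i + 2))" using x by (auto simp: Lz_carrier add.commute[of _ 2])
	thus "\<Xi> (i + 2) (tpull r (i, n) h) (%_. x) = (\<lambda>u\<in>carrier (Lz (int i + 2)). \<Xi> i h (Tz r (int i + 2) u)) (%_. x)"
		using Tz_nat[of r i "%_. x"] assms x
		by (simp add: \<Xi>_app tpull_def \<pi>_closed t_\<pi> linear_closed[OF lift_T_linear] add.commute[of 2])
qed

lemma mact_closed: "x : Is s ==> h : carrier (H i n) ==> mact x s (i, n) h : carrier (H i (n + s))"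
proof -
	assume x: "x : Is s" and h: "h : carrier (H i n)"
	have "linear_map A (NA n) (NA (n + s)) (nact x s)"
		by (rule linear_mapI) (use x nact_commute[OF x, of _ 0] in "auto simp: NA_simps nact_closed nact_add")
	from linear_restrict[OF F_module linear_comp[OF H_linear[OF h] this]]
	show ?thesis by (simp add: H_carrier mact_def)
qed

lemma \<Xi>_mact: "\<Xi> i (mact x s (i, n) h) = (\<lambda>u\<in>carrier (Lz (int i)). nact x s (\<Xi> i h u))"
	by (rule K_eqI[OF \<Xi>_ext]) (auto simp: \<Xi>_app mact_def \<pi>_closed Lz_elem)

lemma pullback_submodule:
	assumes U: "closed_family Q K ops U"
	shows "submodule {h : carrier (H i n). \<Xi> i h : U (int i, n)} A (H i n)"
proof -
	interpret H: module A "H i n" by (rule H_module)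
	note Ud = K.closedD[OF U]
	have sm: "a \<odot>\<^sub>(H i n) h : carrier (H i n) & \<Xi> i (a \<odot>\<^sub>(H i n) h) : U (int i, n)"
		if a: "a : carrier A" and h: "h : carrier (H i n)" "\<Xi> i h : U (int i, n)" for a h
	proof -
		have "a : q ` carrier Q" using a q_surj by simp
		then obtain r where r: "r : carrier Q" "a = q r" by blast
		have "a \<odot>\<^sub>(H i n) h = (\<lambda>x\<in>carrier (F i). nact (q r) 0 (h x))" by (simp add: hom_module_simps NA_simps r)
		thus ?thesis using \<Xi>_smult[OF r(1) h(1)] Ud(5)[OF r(1) h(2)] H.smult_closed[OF a h(1)] by simp
	qed
	show ?thesis
	proof (rule H.submoduleI)
		show "\<zero>\<^sub>(H i n) : {h : carrier (H i n). \<Xi> i h : U (int i, n)}" using Ud(2) by (simp add: \<Xi>_zero)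
		show "\<ominus>\<^sub>(H i n) h : {h : carrier (H i n). \<Xi> i h : U (int i, n)}" if "h : {h : carrier (H i n). \<Xi> i h : U (int i, n)}" for h
			using sm[of "\<ominus>\<^sub>A \<one>\<^sub>A" h] that by (simp add: H.smult_l_minus)
	qed (use sm Ud(3) in "auto simp: \<Xi>_add")
qed

lemma nact_zero: "x : Is s ==> nact x s \<zero>\<^sub>N = \<zero>\<^sub>N"
	using N.smult_r_null[OF monom_rees] by (simp add: nact_def)

end

context graded_subquotient
begin

lemma operator_comp:
	assumes \<phi>: "operator \<xi> \<phi>" and \<psi>: "operator \<xi>' \<psi>"
	shows "operator (\<xi> + \<xi>') (%p h. \<phi> (p + \<xi>') (\<psi> p h))"
proof -
	have s: "p + (\<xi> + \<xi>') = p + \<xi>' + \<xi>" for p by (simp add: ac_simps)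
	show ?thesis unfolding operator_def s
		by (intro conjI allI ballI) (simp_all add: operatorD[OF \<phi>] operatorD[OF \<psi>])
qed

lemma induced_commute:
	assumes \<phi>: "operator \<xi> \<phi>" and \<psi>: "operator \<xi>' \<psi>" and e: "e : carrier (direct_sum E)"
		and c: "!!p h. h : Z p ==> \<phi> (p + \<xi>') (\<psi> p h) \<ominus>\<^sub>(H (p + (\<xi> + \<xi>'))) \<psi> (p + \<xi>) (\<phi> p h) : B (p + (\<xi> + \<xi>'))"
	shows "induced \<xi> \<phi> (induced \<xi>' \<psi> e) = induced \<xi>' \<psi> (induced \<xi> \<phi> e)"
proof -
	note o = operator_comp[OF \<phi> \<psi>]
	have "induced (\<xi> + \<xi>') (%p h. \<phi> (p + \<xi>') (\<psi> p h)) e = induced \<xi> \<phi> (induced \<xi>' \<psi> e)"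
		by (rule induced_comp[OF \<phi> \<psi> o refl e]) (rule refl_B[OF operatorD(1)[OF o]])
	moreover have "induced (\<xi> + \<xi>') (%p h. \<phi> (p + \<xi>') (\<psi> p h)) e = induced \<xi>' \<psi> (induced \<xi> \<phi> e)"
		by (rule induced_comp[OF \<psi> \<phi> o add.commute e c])
	ultimately show ?thesis by simp
qed

lemma single_part: "h : Z p ==> single E p (cl p h) : direct_sum_part E p"
	using single_closed[where E = E, OF E_group cl_closed] by (simp add: direct_sum_part_def direct_sum_simps(2) single_def)

lemma part_single:
	assumes "e : direct_sum_part E p"
	obtains h where "h : Z p" "e = single E p (cl p h)"
proof -
	obtain h where h: "h : Z p" "e p = cl p h" using component_cases[of e p] assms by (auto simp: direct_sum_part_def)
	have "e = single E p (cl p h)" using assms h(2) by (simp add: fun_eq_iff direct_sum_part_def single_def direct_sum_simps(2))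
	thus ?thesis using that h by blast
qed

lemma induced_part: "operator \<xi> \<phi> ==> e : direct_sum_part E p ==> induced \<xi> \<phi> e : direct_sum_part E (p + \<xi>)"
	by (erule part_single) (simp add: induced_single single_part operatorD(1))

lemma single_add: "g : Z p ==> h : Z p ==> single E p (cl p (g \<oplus>\<^sub>(H p) h)) = single E p (cl p g) \<oplus>\<^sub>(direct_sum E) single E p (cl p h)"
	by (auto simp: single_def direct_sum_simps(3) cl_add intro!: ext)

lemma single_zero: "h : B p ==> single E p (cl p h) = \<zero>\<^sub>(direct_sum E)"
	by (simp add: fun_eq_iff single_def direct_sum_simps(2) cl_zero)

end

context eisenbud_ext
begin

lemma BF_H: "h : BF i n ==> h : carrier (H i n)"
proof (cases i)
	case 0
	interpret H: module A "H i n" by (rule H_module)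
	show "h : BF i n ==> h : carrier (H i n)" using H.M.zero_closed 0 by simp
next
	case (Suc j)
	thus "h : BF i n ==> h : carrier (H i n)"
		using linear_restrict[OF F_module linear_comp[OF d_linear H_linear]] by (auto simp: H_carrier)
qed

lemma ZF_eq: "ZF i n = {h : carrier (H i n). \<Xi> i h : Z (int i, n)}"
	using \<Xi>_cocycle ZF_iff by blast

lemma BF_eq: "BF i n = {h : carrier (H i n). \<Xi> i h : B (int i, n)}"
	using \<Xi>_coboundary BF_H by blast

lemma BF_ZF: "BF i n <= ZF i n" unfolding BF_eq ZF_eq using B_le_Z by (auto simp: le_fun_def)

sublocale gs: graded_subquotient A "%(i, n). H i n" "%(i, n). ZF i n" "%(i, n). BF i n"
proof (rule graded_subquotient.intro)
	fix p :: "nat \<times> nat"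
	obtain i n where p: "p = (i, n)" by (cases p)
	have "subquotient A (H i n) (ZF i n) (BF i n)"
		by (intro subquotient.intro subquotient_axioms.intro H_module BF_ZF)
			(simp_all only: ZF_eq BF_eq pullback_submodule[OF Z_closed] pullback_submodule[OF B_closed])
	thus "subquotient A (case p of (i, n) => H i n) (case p of (i, n) => ZF i n) (case p of (i, n) => BF i n)"
		by (simp add: p)
qed

lemma gs_operatorI:
	assumes "!!i n h. h : carrier (H i n) ==> \<phi> (i, n) h : carrier (H (i + a) (n + b))"
		and "!!i n h. h : ZF i n ==> \<phi> (i, n) h : ZF (i + a) (n + b)"
		and "!!i n h. h : BF i n ==> \<phi> (i, n) h : BF (i + a) (n + b)"
		and "!!i n g h. g : carrier (H i n) ==> h : carrier (H i n) ==> \<phi> (i, n) (g \<oplus>\<^sub>(H i n) h) = \<phi> (i, n) g \<oplus>\<^sub>(H (i + a) (n + b)) \<phi> (i, n) h"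
	shows "gs.operator (a, b) \<phi>"
	using assms by (auto simp: gs.operator_def ZF_iff)

lemma shift_mem: "r < c ==> ((2, 0), %(i, n) h. \<lambda>x\<in>carrier (Lz (i + 2)). h (Tz r (i + 2) x)) : all_ops c Lz Tz"
	by (auto simp: all_ops_def shift_op_def)

lemma tpull_operator:
	assumes r: "r < c"
	shows "gs.operator (2, 0) (tpull r)"
proof (rule gs_operatorI)
	have U: "tpull r (i, n) h : carrier (H (i + 2) n) & \<Xi> (i + 2) (tpull r (i, n) h) : U (int (i + 2), n)"
		if "closed_family Q K (all_ops c Lz Tz) U" "h : carrier (H i n)" "\<Xi> i h : U (int i, n)" for U i n h
		using tpull_closed[OF r that(2)] K.closedD(6)[OF that(1) shift_mem[OF r] that(3)]
		unfolding \<Xi>_tpull[OF r] of_nat_add of_nat_numeral by simp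
	show "tpull r (i, n) h : ZF (i + 2) (n + 0)" if "h : ZF i n" for i n h using U[OF Z_closed] that unfolding ZF_eq by simp
	show "tpull r (i, n) h : BF (i + 2) (n + 0)" if "h : BF i n" for i n h using U[OF B_closed] that unfolding BF_eq by simp
qed (use r tpull_closed linear_closed[OF t_linear[OF r]] in "auto simp: tpull_def hom_module_simps")

lemma mact_operator:
	assumes x: "x : Is s"
	shows "gs.operator (0, s) (mact x s)"
proof (rule gs_operatorI)
	show "mact x s (i, n) h : ZF (i + 0) (n + s)" if "h : ZF i n" for i n h
		using that mact_closed[OF x] by (simp add: ZF_iff) (simp add: mact_def d_closed nact_zero[OF x])
	show "mact x s (i, n) h : BF (i + 0) (n + s)" if h: "h : BF i n" for i n h
	proof (cases i)
		case 0
		thus ?thesis using h nact_zero[OF x] by (auto simp: mact_def hom_module_simps NA_simps)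
	next
		case (Suc j)
		then obtain k where k: "k : carrier (H j n)" "h = (\<lambda>x\<in>carrier (F (Suc j)). k (d j x))" using h by auto
		have "mact x s (i, n) h = (\<lambda>y\<in>carrier (F (Suc j)). mact x s (j, n) k (d j y))"
			by (auto simp: mact_def Suc k(2) d_closed)
		thus ?thesis using mact_closed[OF x k(1)] by (simp add: Suc)
	qed
qed (use mact_closed[OF x] nact_add[OF x H_closed H_closed] in "auto simp: mact_def hom_module_simps NA_simps")

abbreviation "mu x s == gs.induced (0, s) (mact x s)"
abbreviation "tau r == gs.induced (2, 0) (tpull r)"

lemma rees_monom_act_eq: "rees_monom_act A F d N Ng x s = mu x s"
proof (intro ext)
	fix e :: "nat \<times> nat => ('f => 'n) set" and p :: "nat \<times> nat"
	obtain i n where p: "p = (i, n)" by (cases p)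
	have "(EX p'. (i, n) = p' + (0, s)) \<longleftrightarrow> s <= n" by (auto simp: le_iff_add add.commute)
	thus "rees_monom_act A F d N Ng x s e p = mu x s e p"
		by (simp add: p rees_monom_act_def gs.induced_def Ext_induced_def mact_def nact_def Ext_module_def)
qed

lemma eisenbud_act_eq: "eisenbud_act A F d t N Ng r = tau r"
proof (intro ext)
	fix e :: "nat \<times> nat => ('f => 'n) set" and p :: "nat \<times> nat"
	obtain i n where p: "p = (i, n)" by (cases p)
	have "(EX p'. (i, n) = p' + (2, 0)) \<longleftrightarrow> 2 <= i" by (auto simp: le_iff_add)
	moreover have "i - 2 + 2 = i" if "2 <= i" using that by simp
	ultimately show "eisenbud_act A F d t N Ng r e p = tau r e p"
		by (simp add: p eisenbud_act_def gs.induced_def Ext_induced_def tpull_def Ext_module_def del: add_2_eq_Suc')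
qed

lemma total_Ext_group_eq: "total_Ext_group A F d N Ng = direct_sum gs.E"
proof -
	have "(%(i, n). Ext_module A F d (NA n) i) = gs.E" by (auto simp: Ext_module_def)
	thus ?thesis by (simp add: total_Ext_group_def direct_sum_def)
qed

text \<open>Commutation on cohomology is inherited from the lifted system.\<close>

lemma tpull_commute:
	assumes r: "r < c" "r' < c" and h: "h : ZF i n"
	shows "tpull r (i + 2, n) (tpull r' (i, n) h) \<ominus>\<^sub>(H (i + 4) n) tpull r' (i + 2, n) (tpull r (i, n) h) : BF (i + 4) n"
proof -
	have hc: "h : carrier (H i n)" using h by (simp add: ZF_iff)
	have e: "i + 4 = i + 2 + 2" "int i + 2 + 2 = int (i + 2 + 2)" by simp_all
	interpret H: module A "H (i + 2 + 2) n" by (rule H_module)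
	note cl = tpull_closed[OF r(1) tpull_closed[OF r(2) hc]] tpull_closed[OF r(2) tpull_closed[OF r(1) hc]]
	have "K.commutes_mod Z B (shift_op Lz (Tz r)) (shift_op Lz (Tz r'))"
		by (rule operators_commute) (use r in "auto simp: all_ops_def")
	hence "K.cong_mod B ((int i, n) + (2, 0) + (2, 0))
		(\<lambda>u\<in>carrier (Lz (int i + 2 + 2)). (\<lambda>v\<in>carrier (Lz (int i + 2)). \<Xi> i h (Tz r' (int i + 2) v)) (Tz r (int i + 2 + 2) u))
		(\<lambda>u\<in>carrier (Lz (int i + 2 + 2)). (\<lambda>v\<in>carrier (Lz (int i + 2)). \<Xi> i h (Tz r (int i + 2) v)) (Tz r' (int i + 2 + 2) u))"
		using h unfolding ZF_eq K.commutes_mod_def shift_op_def by fastforce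
	moreover have "(\<lambda>u\<in>carrier (Lz (int i + 2 + 2)). (\<lambda>v\<in>carrier (Lz (int i + 2)). \<Xi> i h (Tz a (int i + 2) v)) (Tz b (int i + 2 + 2) u))
			= \<Xi> (i + 2 + 2) (tpull b (i + 2, n) (tpull a (i, n) h))" if "a < c" "b < c" for a b
		using \<Xi>_tpull[OF that(2), of "i + 2" n] \<Xi>_tpull[OF that(1), of i n h] by (simp add: add.commute[of 2])
	ultimately have "\<Xi> (i + 2 + 2) (tpull r (i + 2, n) (tpull r' (i, n) h)) \<ominus>\<^sub>(K (int (i + 2 + 2), n))
			\<Xi> (i + 2 + 2) (tpull r' (i + 2, n) (tpull r (i, n) h)) : B (int (i + 2 + 2), n)"
		using r unfolding K.cong_mod_def e(2) by (simp add: add.commute[of 4] add.commute[of 2])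
	thus ?thesis unfolding e(1) BF_eq using \<Xi>_diff[OF cl] H.M.minus_closed[OF cl] by simp
qed

sublocale act: rees_action A I "direct_sum gs.E" c mu tau
proof (intro rees_action.intro rees_action_axioms.intro)
	show "rees_algebra A I" by (rule rees_algebra_axioms)
	show "abelian_group (direct_sum gs.E)" by (rule direct_sum_group[OF gs.E_group refl refl refl])
	fix x s e assume x: "x : Is s" and e: "e : carrier (direct_sum gs.E)"
	note ox = mact_operator[OF x]
	show "mu x s e : carrier (direct_sum gs.E)" by (rule gs.induced_closed[OF ox e])
	show "mu x s (e \<oplus>\<^sub>(direct_sum gs.E) e') = mu x s e \<oplus>\<^sub>(direct_sum gs.E) mu x s e'" if "e' : carrier (direct_sum gs.E)" for e'
		by (rule gs.induced_add[OF ox e that])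
	show "mu (x \<oplus>\<^sub>A y) s e = mu x s e \<oplus>\<^sub>(direct_sum gs.E) mu y s e" if y: "y : Is s" for y
	proof (rule gs.induced_add_operator[OF ox mact_operator[OF y] mact_operator[OF Is_add[OF x y]] e])
		fix p h assume h: "h : (case p of (i, n) => ZF i n)"
		obtain i n where p: "p = (i, n)" by (cases p)
		hence hc: "h : carrier (H i n)" using h by (simp add: ZF_iff)
		show "mact (x \<oplus>\<^sub>A y) s p h = mact x s p h \<oplus>\<^sub>(case p + (0, s) of (i, n) => H i n) mact y s p h"
			by (auto simp: p mact_def hom_module_simps NA_simps nact_add_scalar[OF x y H_closed[OF hc]] intro!: restrict_ext)
	qed
	show "mu (x \<otimes>\<^sub>A y) (s + s') e = mu x s (mu y s' e)" if y: "y : Is s'" for y s'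
	proof (rule gs.induced_comp[OF ox mact_operator[OF y] mact_operator[OF Is_mult[OF x y]] _ e])
		fix p h assume h: "h : (case p of (i, n) => ZF i n)"
		obtain i n where p: "p = (i, n)" by (cases p)
		hence hc: "h : carrier (H i n)" using h by (simp add: ZF_iff)
		have "mact x s (p + (0, s')) (mact y s' p h) = mact (x \<otimes>\<^sub>A y) (s + s') p h"
			by (auto simp: p mact_def nact_mult[OF x y H_closed[OF hc]] intro!: restrict_ext)
		thus "mact (x \<otimes>\<^sub>A y) (s + s') p h \<ominus>\<^sub>(case p + (0, s + s') of (i, n) => H i n) mact x s (p + (0, s')) (mact y s' p h)
			: (case p + (0, s + s') of (i, n) => BF i n)"
			using gs.refl_B[OF gs.operatorD(1)[OF mact_operator[OF Is_mult[OF x y]] h]] by simp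
	qed simp
	show "tau r (mu x s e) = mu x s (tau r e)" if r: "r < c" for r
	proof (rule gs.induced_commute[OF tpull_operator[OF r] ox e])
		fix p h assume h: "h : (case p of (i, n) => ZF i n)"
		have "tpull r (p + (0, s)) (mact x s p h) = mact x s (p + (2, 0)) (tpull r p h)"
			using linear_closed[OF t_linear[OF r]] by (cases p) (auto simp: mact_def tpull_def intro!: restrict_ext)
		thus "tpull r (p + (0, s)) (mact x s p h) \<ominus>\<^sub>(case p + ((2, 0) + (0, s)) of (i, n) => H i n) mact x s (p + (2, 0)) (tpull r p h)
			: (case p + ((2, 0) + (0, s)) of (i, n) => BF i n)"
			using gs.refl_B[OF gs.operatorD(1)[OF gs.operator_comp[OF tpull_operator[OF r] ox] h]] by simp
	qed
next
	fix e assume e: "e : carrier (direct_sum gs.E)"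
	have one: "\<one>\<^sub>A : Is 0" by simp
	show "mu \<one>\<^sub>A 0 e = e"
	proof (rule gs.induced_id[OF _ e, unfolded zero_prod_def])
		show "gs.operator (0, 0) (mact \<one>\<^sub>A 0)" by (rule mact_operator[OF one])
		fix p h assume h: "h : (case p of (i, n) => ZF i n)"
		obtain i n where p: "p = (i, n)" by (cases p)
		hence hc: "h : carrier (H i n)" using h by (simp add: ZF_iff)
		show "mact \<one>\<^sub>A 0 p h = h"
			by (rule extensionalityI[of _ "carrier (F i)"]) (use hc in "auto simp: p mact_def nact_one[OF H_closed[OF hc]] H_carrier")
	qed
	fix r assume r: "r < c"
	show "tau r e : carrier (direct_sum gs.E)" by (rule gs.induced_closed[OF tpull_operator[OF r] e])
	show "tau r (e \<oplus>\<^sub>(direct_sum gs.E) e') = tau r e \<oplus>\<^sub>(direct_sum gs.E) tau r e'" if "e' : carrier (direct_sum gs.E)" for e'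
		by (rule gs.induced_add[OF tpull_operator[OF r] e that])
	show "tau r (tau r' e) = tau r' (tau r e)" if r': "r' < c" for r'
	proof (rule gs.induced_commute[OF tpull_operator[OF r] tpull_operator[OF r'] e])
		fix p h assume h: "h : (case p of (i, n) => ZF i n)"
		thus "tpull r (p + (2, 0)) (tpull r' p h) \<ominus>\<^sub>(case p + ((2, 0) + (2, 0)) of (i, n) => H i n) tpull r' (p + (2, 0)) (tpull r p h)
			: (case p + ((2, 0) + (2, 0)) of (i, n) => BF i n)"
			using tpull_commute[OF r r'] by (cases p) simp
	qed
qed

end

section \<open>Finite generation of the total Ext module\<close>

lemma (in abelian_group) finsum_subgroup:
	assumes "additive_subgroup S G" "finite K" "!!k. k : K ==> g k : S"
	shows "(\<Oplus>k\<in>K. g k) : S"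
	using assms(2,3)
proof (induct K rule: finite_induct)
	case empty
	thus ?case using additive_subgroup.zero_closed[OF assms(1)] by simp
next
	case (insert k K)
	have "g i : carrier G" if "i : insert k K" for i using additive_subgroup.a_Hcarr[OF assms(1) insert(4)[OF that]] .
	thus ?case using insert additive_subgroup.a_closed[OF assms(1)] by (subst finsum_insert) auto
qed

context eisenbud_ext
begin

abbreviation "TE == total_Ext A F d t N Ng"
abbreviation "DS == direct_sum gs.E"
abbreviation "SR == mpoly_ring R {..<c}"

lemma TE_simps: "carrier TE = carrier DS" "\<zero>\<^sub>TE = \<zero>\<^sub>DS" "add TE = add DS" "p \<odot>\<^sub>TE e = act.act p e"
	by (simp_all add: total_Ext_def total_Ext_group_eq rees_monom_act_eq eisenbud_act_eq[abs_def] act.act_def act.rho_def act.taus_def R_simps Let_def)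

lemma TE_part: "total_Ext_part A F d N Ng = direct_sum_part gs.E"
	by (simp add: fun_eq_iff total_Ext_part_def direct_sum_part_def total_Ext_group_eq)

lemma TE_group: "abelian_group TE"
	by (rule direct_sum_group[where E = gs.E, OF gs.E_group TE_simps(1-3)])

lemma TE_module: "module SR TE"
proof (rule moduleI[OF act.S.P_cring TE_group])
qed (simp_all add: TE_simps act.act_closed act.act_add act.act_add_scalar act.act_mult act.act_one)

lemma taus_part:
	assumes "set_mset \<mu> <= {..<c}" "e : direct_sum_part gs.E (i, n)"
	shows "act.taus \<mu> e : direct_sum_part gs.E (2 * size \<mu> + i, n)"
	using assms(1)
proof (induct \<mu>)
	case (add r \<mu>)
	have "act.taus (add_mset r \<mu>) e = tau r (act.taus \<mu> e)"
		using add assms(2) by (intro act.taus_add_mset) (auto simp: direct_sum_part_def)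
	thus ?case using gs.induced_part[OF tpull_operator, of r "act.taus \<mu> e" "(2 * size \<mu> + i, n)"] add by simp
qed (simp add: assms)

lemma TE_graded: "graded_module (rees_poly A I c) (rees_poly_part A I c) TE (total_Ext_part A F d N Ng)"
proof -
	have "a \<odot>\<^sub>TE e : direct_sum_part gs.E (g + h)"
		if a: "a : rees_poly_part A I c g" and e: "e : direct_sum_part gs.E h" for a e g h
	proof -
		obtain j m where g: "g = (j, m)" by (cases g)
		obtain i n where h: "h = (i, n)" by (cases h)
		have aS: "a : carrier SR" and ap: "!!\<mu>. a \<mu> ~= \<zero>\<^sub>R ==> 2 * size \<mu> = j & a \<mu> : rees_part A I m"
			using a by (auto simp: g rees_poly_part_def rees_poly_def)
		have sub: "additive_subgroup (direct_sum_part gs.E (g + h)) DS"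
			using direct_sum_decomp[where E = gs.E and S = DS, OF gs.E_group refl refl refl] unfolding direct_decomp_def by blast
		have ec: "e : carrier DS" using e by (simp add: direct_sum_part_def)
		have "act.rho (a \<mu>) (act.taus \<mu> e) : direct_sum_part gs.E (g + h)" if \<mu>: "\<mu> : {\<mu>. a \<mu> ~= \<zero>\<^sub>R}" for \<mu>
		proof -
			have nz: "a \<mu> ~= \<zero>\<^sub>R" using \<mu> by simp
			have V: "set_mset \<mu> <= {..<c}" using aS nz by (simp add: act.S.P_carrier)
			obtain x where x: "x : Is m" "a \<mu> = monom (UP A) x m" using ap[OF nz] by (auto simp: rees_part_def)
			have p: "act.taus \<mu> e : direct_sum_part gs.E (j + i, n)" using taus_part[OF V e[unfolded h]] ap[OF nz] by simp
			hence "act.rho (a \<mu>) (act.taus \<mu> e) = mu x m (act.taus \<mu> e)"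
			unfolding x(2) by (intro act.rho_monom[OF x(1)]) (simp add: direct_sum_part_def)
			thus ?thesis using gs.induced_part[OF mact_operator[OF x(1)] p] by (simp add: g h add.commute)
		qed
		hence "act.act a e : direct_sum_part gs.E (g + h)"
			unfolding act.act_def by (intro act.E.finsum_subgroup[OF sub]) (use aS in "auto simp: act.S.P_carrier")
		thus ?thesis by (simp add: TE_simps)
	qed
	thus ?thesis
		using rees_poly_graded[of c] TE_module direct_sum_decomp[where E = gs.E and S = TE, OF gs.E_group TE_simps(1-3)]
		by (simp add: graded_module_def TE_part rees_poly_def)
qed

text \<open>Generators for the operators over \<open>Q\<close> become module generators. If \<open>Y\<close> is the submodule spanned by their classes, the
cocycles with class in \<open>Y\<close> form a closed family \<open>U\<close> containing the coboundaries and the generators, hence all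
cocycles. In negative degrees the condition defining \<open>U\<close> is void.\<close>

lemma TE_fin_gen:
	assumes "fin_gen_family Q K (all_ops c Lz Tz) Z B"
	shows "fin_gen_module (rees_poly A I c) TE"
proof -
	obtain S where S: "finite S" "S <= Sigma UNIV Z"
		"!!U. closed_family Q K (all_ops c Lz Tz) U ==> B <= U ==> S <= Sigma UNIV U ==> Z <= U"
		using assms unfolding fin_gen_family_def by blast
	interpret TE: module SR TE by (rule TE_module)
	define sg where "sg = (%i n h. single gs.E (i, n) (BF i n +>\<^sub>(H i n) h))"
	have sg_closed: "sg i n h : carrier DS" if "h : ZF i n" for i n h
		using gs.single_part[of h "(i, n)"] that by (simp add: sg_def direct_sum_part_def)
	have sg_add: "sg i n (g \<oplus>\<^sub>(H i n) h) = sg i n g \<oplus>\<^sub>DS sg i n h" if "g : ZF i n" "h : ZF i n" for i n g h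
		using gs.single_add[of g "(i, n)" h] that by (simp add: sg_def)
	have sg_zero: "sg i n h = \<zero>\<^sub>DS" if "h : BF i n" for i n h
		using gs.single_zero[of h "(i, n)"] that by (simp add: sg_def)
	have sg_mu: "mu x s (sg i n h) = sg i (n + s) (mact x s (i, n) h)" if "x : Is s" "h : ZF i n" for x s i n h
		using gs.induced_single[OF mact_operator[OF that(1)], of h "(i, n)"] that(2) by (simp add: sg_def)
	have sg_tau: "tau r (sg i n h) = sg (i + 2) n (tpull r (i, n) h)" if "r < c" "h : ZF i n" for r i n h
		using gs.induced_single[OF tpull_operator[OF that(1)], of h "(i, n)"] that(2) by (simp add: sg_def)
	\<comment> \<open>the classes of the cocycles over \<open>A\<close> that correspond to the generating cocycles over \<open>Q\<close>\<close>
	let ?G = "{sg i n h | i n h. h : ZF i n & ((int i, n), \<Xi> i h) : S}"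
	have "?G <= (%((i, n), g). sg (nat i) n (SOME h. h : ZF (nat i) n & \<Xi> (nat i) h = g)) ` S"
	proof
		fix y assume "y : ?G"
		then obtain i n h where h: "y = sg i n h" "h : ZF i n" "((int i, n), \<Xi> i h) : S" by blast
		have "(SOME h'. h' : ZF i n & \<Xi> i h' = \<Xi> i h) = h"
			using h(2) \<Xi>_inj[of _ i n h] by (intro some_equality) (auto simp: ZF_iff)
		thus "y : (%((i, n), g). sg (nat i) n (SOME h. h : ZF (nat i) n & \<Xi> (nat i) h = g)) ` S"
			using h(1) by (intro image_eqI[OF _ h(3)]) simp
	qed
	hence G: "finite ?G" "?G <= carrier TE" using S(1) finite_surj sg_closed by (blast, auto simp: TE_simps)
	define Y where "Y = {(lincomb TE ?G a (%b. b)) | a. a : ?G \<rightarrow> carrier SR}"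
	have Y: "submodule Y SR TE" and GY: "?G <= Y" using TE.span_submodule[OF G] unfolding Y_def by auto
	note Ysm = TE.submoduleE[OF Y]
	have Y_sub: "additive_subgroup Y TE" by (rule additive_subgroupI[OF submodule.axioms(1)[OF Y]])
	have Y_zero: "\<zero>\<^sub>DS : Y" using additive_subgroup.zero_closed[OF Y_sub] by (simp add: TE_simps)
	have Y_DS: "y : carrier DS" if "y : Y" for y using Ysm(1) that by (auto simp: TE_simps)
	have Y_mu: "mu x s y : Y" if x: "x : Is s" and y: "y : Y" for x s y
	proof -
		have m: "monom (UP A) x s : carrier R" by (rule monom_rees[OF x])
		have "act.act (mpoly_monom R (monom (UP A) x s) {#}) y = mu x s y"
			using act.act_monom[OF m, of "{#}" y] act.rho_monom[OF x Y_DS[OF y]] Y_DS[OF y] by simp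
		thus ?thesis using Ysm(4)[OF act.S.mon_closed[OF m, of "{#}"] y] by (simp add: TE_simps)
	qed
	have Y_tau: "tau r y : Y" if r: "r < c" and y: "y : Y" for r y
	proof -
		have one: "\<one>\<^sub>A : Is 0" by simp
		have m: "monom (UP A) \<one>\<^sub>A 0 : carrier R" by (rule monom_rees[OF one])
		have ty: "tau r y : carrier DS" by (rule act.tau_closed[OF r Y_DS[OF y]])
		have "act.act (mpoly_monom R (monom (UP A) \<one>\<^sub>A 0) {#r#}) y = act.rho (monom (UP A) \<one>\<^sub>A 0) (tau r y)"
			using act.act_monom[OF m, of "{#r#}" y] act.taus_add_mset[of "{#}" r y] Y_DS[OF y] r by simp
		also have "... = tau r y" using act.rho_monom[OF one ty] act.mu_one[OF ty] by simp
		finally show ?thesis using Ysm(4)[OF act.S.mon_closed[OF m, of "{#r#}"] y] r by (simp add: TE_simps)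
	qed
	define U where "U = (%(i', n). {g : Z (i', n). ALL i. i' = int i --> (EX h:ZF i n. g = \<Xi> i h & sg i n h : Y)})"
	have U_iff: "g : U (i', n) \<longleftrightarrow> g : Z (i', n) & (ALL i. i' = int i --> (EX h:ZF i n. g = \<Xi> i h & sg i n h : Y))" for g i' n
		by (simp add: U_def)
	have inj: "g = h" if "g : ZF i n" "h : ZF i n" "\<Xi> i g = \<Xi> i h" for g h i n
		using \<Xi>_inj[of g i n h] that by (simp add: ZF_iff)
	have B_U: "g : U (i', n)" if g: "g : B (i', n)" for g i' n
		unfolding U_iff
	proof (intro conjI allI impI)
		show "g : Z (i', n)" using g B_le_Z by (auto simp: le_fun_def)
		fix i assume i: "i' = int i"
		have "g : carrier (K (int i, n))" using K.closedD(1)[OF B_closed g] i by simp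
		then obtain h where h: "h : carrier (H i n)" "g = \<Xi> i h" by (rule \<Xi>_surj)
		hence "h : BF i n" using g i by (simp add: BF_eq)
		thus "EX h:ZF i n. g = \<Xi> i h & sg i n h : Y" using h(2) BF_ZF sg_zero Y_zero by (intro bexI[of _ h]) auto
	qed
	note Zd = K.closedD[OF Z_closed]
	have cl: "closed_family Q K (all_ops c Lz Tz) U"
	proof (rule K.closedI)
		fix p :: "int \<times> nat" and g
		obtain i' n where p: "p = (i', n)" by (cases p)
		show "\<zero>\<^sub>(K p) : U p" unfolding p by (rule B_U[OF K.closedD(2)[OF B_closed]])
		assume g: "g : U p"
		hence gU: "EX h:ZF i n. g = \<Xi> i h & sg i n h : Y" if "i' = int i" for i
			using that by (auto simp: p U_iff)
		have gZ: "g : Z p" using g by (simp add: p U_iff)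
		show "g : carrier (K p)" by (rule Zd(1)[OF gZ])
		have mactU: "EX h:ZF i (n + s). \<Xi> i (mact x s (i, n) h1) = \<Xi> i h & sg i (n + s) h : Y"
			if x: "x : Is s" and h1: "h1 : ZF i n" "sg i n h1 : Y" for x s i h1
			using gs.operatorD(1)[OF mact_operator[OF x], of h1 "(i, n)"] h1 Y_mu[OF x h1(2)] sg_mu[OF x h1(1)]
			by (intro bexI[of _ "mact x s (i, n) h1"]) auto
		show "r \<odot>\<^sub>(K p) g : U p" if r: "r : carrier Q" for r
			unfolding p U_iff
		proof (intro conjI allI impI)
			show "r \<odot>\<^sub>(K (i', n)) g : Z (i', n)" using Zd(5)[OF r gZ] by (simp add: p)
			fix i assume i: "i' = int i"
			then obtain h where h: "h : ZF i n" "g = \<Xi> i h" "sg i n h : Y" using gU by blast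
			have "r \<odot>\<^sub>(K (i', n)) g = \<Xi> i (mact (q r) 0 (i, n) h)"
			using \<Xi>_smult[OF r, of h i n] h i by (simp add: mact_def ZF_iff)
			thus "EX h:ZF i n. r \<odot>\<^sub>(K (i', n)) g = \<Xi> i h & sg i n h : Y"
			using mactU[of "q r" 0 h i] h ring_hom_closed[OF q_hom r] by simp
		qed
		show "g \<oplus>\<^sub>(K p) g' : U p" if g': "g' : U p" for g'
			unfolding p U_iff
		proof (intro conjI allI impI)
			show "g \<oplus>\<^sub>(K (i', n)) g' : Z (i', n)" using Zd(3)[OF gZ] g' by (simp add: p U_iff)
			fix i assume i: "i' = int i"
			obtain h where h: "h : ZF i n" "g = \<Xi> i h" "sg i n h : Y" using gU[OF i] by blast
			obtain h' where h': "h' : ZF i n" "g' = \<Xi> i h'" "sg i n h' : Y" using g' i by (auto simp: p U_iff)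
			show "EX h:ZF i n. g \<oplus>\<^sub>(K (i', n)) g' = \<Xi> i h & sg i n h : Y"
			using \<Xi>_add[of h i n h'] gs.Z_add[of h "(i, n)" h'] sg_add[OF h(1) h'(1)] Ysm(5)[OF h(3) h'(3)] h h' i
			by (intro bexI[of _ "h \<oplus>\<^sub>(H i n) h'"]) (auto simp: ZF_iff TE_simps(3))
		qed
		fix s \<phi> assume op: "(s, \<phi>) : all_ops c Lz Tz"
		have opZ: "\<phi> p g : Z (p + s)" by (rule Zd(6)[OF op gZ])
		show "\<phi> p g : U (p + s)"
			using op
		proof (cases rule: all_ops_cases)
			case (coeff s0 \<phi>0)
			then obtain w where w: "w : W" "s0 = 1" "\<phi>0 = (%n. nact (q w) 1)" by (auto simp: mult_op_def)
			have eq: "\<phi> p g = (\<lambda>u\<in>carrier (Lz i'). nact (q w) 1 (g u))" "p + s = (i', n + 1)" by (simp_all add: p coeff w)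
			have "EX h:ZF i (n + 1). \<phi> p g = \<Xi> i h & sg i (n + 1) h : Y" if i: "i' = int i" for i
			proof -
			obtain h where h: "h : ZF i n" "g = \<Xi> i h" "sg i n h : Y" using gU[OF i] by blast
			have "\<phi> p g = \<Xi> i (mact (q w) 1 (i, n) h)" using \<Xi>_mact[of i "q w" 1 n h] h(2) eq(1) i by simp
			thus ?thesis using mactU[of "q w" 1 h i] h W_I[OF w(1)] by simp
			qed
			thus ?thesis unfolding eq(2) U_iff using opZ eq(2) by simp
		next
			case (shift r)
			have eq: "\<phi> p g = (\<lambda>u\<in>carrier (Lz (i' + 2)). g (Tz r (i' + 2) u))" "p + s = (i' + 2, n)" by (simp_all add: p shift)
			show ?thesis
			proof (cases "0 <= i'")
			case True
			then obtain j where j: "i' = int j" using nonneg_int_cases by blast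
			obtain h where h: "h : ZF j n" "g = \<Xi> j h" "sg j n h : Y" using gU[OF j] by blast
			have "\<phi> p g = \<Xi> (j + 2) (tpull r (j, n) h)" unfolding \<Xi>_tpull[OF shift(1)] eq(1) by (simp only: h(2) j)
			moreover have "tpull r (j, n) h : ZF (j + 2) n" using gs.operatorD(1)[OF tpull_operator[OF shift(1)], of h "(j, n)"] h by simp
			moreover have "sg (j + 2) n (tpull r (j, n) h) : Y" using Y_tau[OF shift(1) h(3)] sg_tau[OF shift(1) h(1)] by simp
			moreover have "i = j + 2" if "i' + 2 = int i" for i using that j by simp
			ultimately show ?thesis unfolding eq(2) U_iff using opZ eq(2) by auto
			next
			case False
			hence "g : B p" using Z_neg[of i' n] gZ p by auto
			hence "\<phi> p g : B (p + s)" by (rule K.closedD(6)[OF B_closed op])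
			thus ?thesis unfolding eq(2) by (rule B_U)
			qed
		qed
	qed
	have "B <= U" using B_U by (auto simp: le_fun_def)
	moreover have "S <= Sigma UNIV U"
	proof
		fix x assume x: "x : S"
		obtain i' n g where xe: "x = ((i', n), g)" by (cases x) auto
		have gZ: "g : Z (i', n)" using x xe S(2) by blast
		moreover have "EX h:ZF i n. g = \<Xi> i h & sg i n h : Y" if i: "i' = int i" for i
		proof -
			have "g : carrier (K (int i, n))" using Zd(1)[OF gZ] i by simp
			then obtain h where h: "h : carrier (H i n)" "g = \<Xi> i h" by (rule \<Xi>_surj)
			hence "h : ZF i n" using gZ i by (simp add: ZF_eq)
			thus ?thesis using GY x h(2) xe i by blast
		qed
		ultimately have "g : U (i', n)" unfolding U_iff by blast
		thus "x : Sigma UNIV U" by (simp add: xe)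
	qed
	ultimately have "Z <= U" by (rule S(3)[OF cl])
	hence "sg i n h : Y" if "h : ZF i n" for i n h
	proof -
		have "\<Xi> i h : U (int i, n)" using \<open>Z <= U\<close> that by (auto simp: le_fun_def ZF_eq)
		thus ?thesis using inj[OF that] by (auto simp: U_iff)
	qed
	hence "single gs.E p ((case p of (i, n) => BF i n) +>\<^sub>(case p of (i, n) => H i n) h) : Y" if "h : (case p of (i, n) => ZF i n)" for p h
		using that by (cases p) (simp add: sg_def)
	hence all: "e : Y" if "e : carrier DS" for e
		by (rule gs.direct_sum_spanned[OF Y_sub TE_simps(1-3) _ that])
	show ?thesis unfolding fin_gen_module_def rees_poly_def
	proof (intro exI[of _ ?G] conjI ballI)
		fix e assume "e : carrier TE"
		hence "e : Y" using all by (simp add: TE_simps)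
		thus "EX a:?G \<rightarrow> carrier SR. e = (lincomb TE ?G a (%b. b))"
			unfolding Y_def by (elim CollectE exE conjE) (rule bexI)
	qed (use G in auto)
qed

end

theorem theorem1:
  fixes Q :: "'q ring" and fs :: "'q list" and A :: "'q set ring"
    and M :: "('q set, 'm) module" and I :: "'q set set"
    and N :: "(nat \<Rightarrow> 'q set, 'n) module" and Ng :: "nat \<Rightarrow> 'n set"
    and F :: "nat \<Rightarrow> ('q set, 'f) module" and d :: "nat \<Rightarrow> 'f \<Rightarrow> 'f" and \<epsilon> :: "'f \<Rightarrow> 'm"
    and L :: "nat \<Rightarrow> ('q, 'l) module" and \<pi> :: "nat \<Rightarrow> 'l \<Rightarrow> 'f" and D :: "nat \<Rightarrow> 'l \<Rightarrow> 'l"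
    and T :: "nat \<Rightarrow> nat \<Rightarrow> 'l \<Rightarrow> 'l" and t :: "nat \<Rightarrow> nat \<Rightarrow> 'f \<Rightarrow> 'f"
  assumes "cring Q" and "noetherian_ring Q" and "krull_dim Q < \<infinity>"
    and "regular_sequence Q fs"
    and "A = Q Quot (Idl\<^bsub>Q\<^esub> (set fs))"
    and "module A M" and "fin_gen_module A M"
    and "proj_dim TYPE('p) Q (restrict_scalars (quot_map Q fs) M) < \<infinity>"
    and "ideal I A"
    and "graded_module (rees A I) (rees_part A I) N Ng" and "fin_gen_module (rees A I) N"
    and "free_resolution A M F d \<epsilon>"
    and "eisenbud_operators Q fs F d L \<pi> D T t"
  shows "graded_module (rees_poly A I (length fs)) (rees_poly_part A I (length fs))
           (total_Ext A F d t N Ng) (total_Ext_part A F d N Ng) \<and>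
         fin_gen_module (rees_poly A I (length fs)) (total_Ext A F d t N Ng)"
proof -
	interpret eisenbud_data Q fs A M F d \<epsilon> L \<pi> D T t
		by (intro eisenbud_data.intro eisenbud_data_axioms.intro assms)
	have graded_R: "graded_ring (rees A I) (rees_part A I)" using assms(10) by (simp add: graded_module_def)
	interpret rees_module_over A I N Ng Q "quot_map Q fs"
		by (intro rees_module_over.intro rees_module_over_axioms.intro rees_module.intro rees_module_axioms.intro
			rees_algebra.intro rees_algebra_axioms.intro A.is_cring graded_R assms q_hom q_surj)
	obtain W where W: "finite W" "W <= carrier Q" "{z : carrier Q. quot_map Q fs z : I} = Idl\<^bsub>Q\<^esub> W"
		using ideal_generators by blast
	interpret E: eisenbud_ext Q fs A M F d \<epsilon> L \<pi> D T t I N Ng W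
		by (intro eisenbud_ext.intro eisenbud_ext_axioms.intro eisenbud_data_axioms rees_module_over_axioms W)
	let ?M = "restrict_scalars (quot_map Q fs) M"
	let ?S = "{enat n | n. EX (P :: nat => ('q, 'p) module) d \<epsilon>. resolution Q ?M P d \<epsilon> &
			(ALL i. projective_module Q (P i)) & (ALL i>n. carrier (P i) = {\<zero>\<^sub>(P i)})}"
	have "Inf ?S < \<infinity>" using assms(8) by (simp only: proj_dim_def)
	hence "?S ~= {}" by (metis Inf_empty top_enat_def less_irrefl)
	then obtain n and P :: "nat => ('q, 'p) module" and \<delta> \<eta> where P: "resolution Q ?M P \<delta> \<eta>"
		"!!i. projective_module Q (P i)" "!!i. i > n ==> carrier (P i) = {\<zero>\<^sub>(P i)}"
		by blast
	show ?thesis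
		using E.TE_graded E.TE_fin_gen[OF E.cohomology_fin_gen[OF P ci_system order_refl]] by blast
qed

end
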